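(* Let $N\ge 1$, $a,b\in\mathbb{R}$, $\lambda\ge 0$, and let $\lambda^*$ and $u^*$ be the extremal parameter and extremal solution of the problem $\Delta^2 u=\lambda e^u$ in $B$, $u=a$ and $\frac{\partial u}{\partial n}=b$ on $\partial B$. Assume that $u\in H^2(B)$ is an unbounded weak solution of this problem with parameter $\lambda$ satisfying the stability condition $$\lambda\int_B e^u\varphi^2\le\int_B(\Delta\varphi)^2\qquad\text{for all }\varphi\in C_0^\infty(B).$$ Then $\lambda=\lambda^*$ and $u=u^*$.
   Context: $B$ is the open unit ball of $\mathbb{R}^N$ and $n$ is the exterior unit normal vector. For $a,b\in\mathbb{R}$ and $\lambda\ge 0$ consider the problem $(P_\lambda)$: $\Delta^2u=\lambda e^u$ in $B$, $u=a$ on $\partial B$, $\frac{\partial u}{\partial n}=b$ on $\partial B$. A weak solution of $(P_\lambda)$ is a function $u\in H^2(B)$ with $e^u\in L^1(B)$, $u=a$ and $\frac{\partial u}{\partial n}=b$ on $\partial B$ (in the sense of traces), and $\int_B\Delta u\,\Delta\varphi=\lambda\int_B e^u\varphi$ for all $\varphi\in C_0^\infty(B)$. It is known that there is $\lambda^*\in(0,\infty)$, called the extremal parameter, such that for $0\le\lambda<\lambda^*$ problem $(P_\lambda)$ has a smooth minimal solution $u_\lambda$ (minimal: $u_\lambda\le u$ for every weak solution $u$ of $(P_\lambda)$), and for $\lambda>\lambda^*$ it has no weak solution. The pointwise limit $u^*=\lim_{\lambda\nearrow\lambda^*}u_\lambda$ exists, belongs to $H^2(B)$, and is a weak solution of $(P_{\lambda^*})$;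 it is called the extremal solution. The functions $u_\lambda$ and $u^*$ are radially symmetric. *)

theory Defs
  imports "HOL-Analysis.Analysis"
begin

abbreviation unit_ball :: "'a::euclidean_space set" where
  "unit_ball \<equiv> ball 0 1"

definition partial_deriv :: "'a \<Rightarrow> ('a::euclidean_space \<Rightarrow> real) \<Rightarrow> 'a \<Rightarrow> real" where
  "partial_deriv i f x = frechet_derivative f (at x) i"

primrec C_k :: "nat \<Rightarrow> ('a::euclidean_space \<Rightarrow> real) \<Rightarrow> bool" where
  "C_k 0 f \<longleftrightarrow> continuous_on UNIV f"
| "C_k (Suc k) f \<longleftrightarrow> f differentiable_on UNIV \<and> (\<forall>i\<in>Basis. C_k k (partial_deriv i f))"

definition smooth :: "('a::euclidean_space \<Rightarrow> real) \<Rightarrow> bool" where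
  "smooth f \<longleftrightarrow> (\<forall>k. C_k k f)"

definition smooth_up_to_boundary :: "('a::euclidean_space \<Rightarrow> real) \<Rightarrow> bool" where
  "smooth_up_to_boundary f \<longleftrightarrow> (\<exists>g. smooth g \<and> (\<forall>x\<in>closure unit_ball. f x = g x))"

definition test_function :: "('a::euclidean_space \<Rightarrow> real) \<Rightarrow> bool" where
  "test_function \<phi> \<longleftrightarrow> smooth \<phi> \<and>
     compact (closure {x. \<phi> x \<noteq> 0}) \<and> closure {x. \<phi> x \<noteq> 0} \<subseteq> unit_ball"

definition laplacian :: "('a::euclidean_space \<Rightarrow> real) \<Rightarrow> 'a \<Rightarrow> real" where
  "laplacian \<phi> x = (\<Sum>i\<in>Basis. partial_deriv i (partial_deriv i \<phi>) x)"

definition L2 :: "'b measure \<Rightarrow> ('b \<Rightarrow> real) set" where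
  "L2 M = {f \<in> borel_measurable M. integrable M (\<lambda>x. (f x)\<^sup>2)}"

definition locally_integrable :: "('a::euclidean_space \<Rightarrow> real) \<Rightarrow> bool" where
  "locally_integrable u \<longleftrightarrow>
     (\<forall>K. compact K \<and> K \<subseteq> unit_ball \<longrightarrow> integrable (lebesgue_on K) u)"

definition has_weak_pderiv ::
    "'a \<Rightarrow> ('a::euclidean_space \<Rightarrow> real) \<Rightarrow> ('a \<Rightarrow> real) \<Rightarrow> bool" where
  "has_weak_pderiv i u v \<longleftrightarrow> locally_integrable u \<and> locally_integrable v \<and>
     (\<forall>\<phi>. test_function \<phi> \<longrightarrow>
        (\<integral>x. u x * partial_deriv i \<phi> x \<partial>lebesgue_on unit_ball) =
        - (\<integral>x. v x * \<phi> x \<partial>lebesgue_on unit_ball))"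

text \<open>A weak derivative is only unique almost everywhere; \<^term>\<open>weak_pderiv i u\<close> is some
  representative, and is meaningful only if a weak derivative exists.\<close>

definition weak_pderiv :: "'a \<Rightarrow> ('a::euclidean_space \<Rightarrow> real) \<Rightarrow> 'a \<Rightarrow> real" where
  "weak_pderiv i u = (SOME v. has_weak_pderiv i u v)"

definition H1 :: "('a::euclidean_space \<Rightarrow> real) set" where
  "H1 = {u \<in> L2 (lebesgue_on unit_ball).
     \<forall>i\<in>Basis. (\<exists>v. has_weak_pderiv i u v) \<and> weak_pderiv i u \<in> L2 (lebesgue_on unit_ball)}"

definition H2 :: "('a::euclidean_space \<Rightarrow> real) set" where
  "H2 = {u \<in> H1. \<forall>i\<in>Basis. weak_pderiv i u \<in> H1}"

definition H1_norm :: "('a::euclidean_space \<Rightarrow> real) \<Rightarrow> real" where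
  "H1_norm u = sqrt ((\<integral>x. (u x)\<^sup>2 \<partial>lebesgue_on unit_ball) +
     (\<Sum>i\<in>Basis. \<integral>x. (weak_pderiv i u x)\<^sup>2 \<partial>lebesgue_on unit_ball))"

definition weak_laplacian :: "('a::euclidean_space \<Rightarrow> real) \<Rightarrow> 'a \<Rightarrow> real" where
  "weak_laplacian u x = (\<Sum>i\<in>Basis. weak_pderiv i (weak_pderiv i u) x)"

text \<open>Surface measure of the unit sphere through polar coordinates: for a Borel set \<open>A\<close> of the
  sphere in dimension \<open>N\<close> it is \<open>N\<close> times the volume of the cone
  \<open>{t *\<^sub>R x | t x. 0 < t \<and> t < 1 \<and> x \<in> A}\<close>, and the complement of the sphere is a null set.
  (Here \<^term>\<open>sgn x\<close> is the radial projection \<open>x /\<^sub>R norm x\<close>.)  In dimension one this is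
  the counting measure on the two end points.\<close>

definition sphere_measure :: "'a::euclidean_space measure" where
  "sphere_measure = scale_measure (ennreal (real DIM('a)))
     (distr (restrict_space lborel unit_ball) borel sgn)"

text \<open>\<open>h\<close> is the trace of \<open>u\<close>: the trace operator from \<open>H\<^sup>1\<close> of the ball to \<open>L\<^sup>2\<close> of the sphere is
  the continuous extension of the restriction of functions smooth up to the boundary, which are
  dense in \<open>H\<^sup>1\<close>.\<close>

definition has_trace :: "('a::euclidean_space \<Rightarrow> real) \<Rightarrow> ('a \<Rightarrow> real) \<Rightarrow> bool" where
  "has_trace u h \<longleftrightarrow> u \<in> H1 \<and> h \<in> L2 sphere_measure \<and>
     (\<exists>V. (\<forall>k. smooth (V k)) \<and>
        (\<lambda>k. H1_norm (\<lambda>x. V k x - u x)) \<longlonglongrightarrow> 0 \<and>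
        (\<lambda>k. \<integral>x. (V k x - h x)\<^sup>2 \<partial>sphere_measure) \<longlonglongrightarrow> 0)"

text \<open>The normal derivative of \<open>u \<in> H\<^sup>2\<close> is the scalar product of the trace of its gradient with
  the exterior unit normal, which at a point \<open>x\<close> of the unit sphere is \<open>x\<close> itself.\<close>

definition has_normal_deriv_trace :: "('a::euclidean_space \<Rightarrow> real) \<Rightarrow> ('a \<Rightarrow> real) \<Rightarrow> bool" where
  "has_normal_deriv_trace u g \<longleftrightarrow>
     (\<exists>h. (\<forall>i\<in>Basis. has_trace (weak_pderiv i u) (h i)) \<and>
          (AE x in sphere_measure. (\<Sum>i\<in>Basis. h i x * (x \<bullet> i)) = g x))"

definition weak_solution :: "real \<Rightarrow> real \<Rightarrow> real \<Rightarrow> ('a::euclidean_space \<Rightarrow> real) \<Rightarrow> bool" where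
  "weak_solution a b lam u \<longleftrightarrow>
     u \<in> H2 \<and>
     integrable (lebesgue_on unit_ball) (\<lambda>x. exp (u x)) \<and>
     has_trace u (\<lambda>_. a) \<and>
     has_normal_deriv_trace u (\<lambda>_. b) \<and>
     (\<forall>\<phi>. test_function \<phi> \<longrightarrow>
        (\<integral>x. weak_laplacian u x * laplacian \<phi> x \<partial>lebesgue_on unit_ball) =
        lam * (\<integral>x. exp (u x) * \<phi> x \<partial>lebesgue_on unit_ball))"

definition stable_solution :: "real \<Rightarrow> ('a::euclidean_space \<Rightarrow> real) \<Rightarrow> bool" where
  "stable_solution lam u \<longleftrightarrow> (\<forall>\<phi>. test_function \<phi> \<longrightarrow>
     lam * (\<integral>x. exp (u x) * (\<phi> x)\<^sup>2 \<partial>lebesgue_on unit_ball)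
       \<le> (\<integral>x. (laplacian \<phi> x)\<^sup>2 \<partial>lebesgue_on unit_ball))"

definition essentially_bounded :: "('a::euclidean_space \<Rightarrow> real) \<Rightarrow> bool" where
  "essentially_bounded u \<longleftrightarrow> (\<exists>C. AE x in lebesgue_on unit_ball. \<bar>u x\<bar> \<le> C)"

definition smooth_minimal_solution ::
    "real \<Rightarrow> real \<Rightarrow> real \<Rightarrow> ('a::euclidean_space \<Rightarrow> real) \<Rightarrow> bool" where
  "smooth_minimal_solution a b lam u \<longleftrightarrow>
     weak_solution a b lam u \<and> smooth_up_to_boundary u \<and>
     (\<forall>v. weak_solution a b lam v \<longrightarrow> (AE x in lebesgue_on unit_ball. u x \<le> v x))"

text \<open>The extremal parameter is determined by the following property; the type argument fixes the
  ambient space, whose dimension the parameter depends on.\<close>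

definition extremal_parameter :: "'a::euclidean_space itself \<Rightarrow> real \<Rightarrow> real \<Rightarrow> real \<Rightarrow> bool" where
  "extremal_parameter _ a b \<Lambda> \<longleftrightarrow> 0 < \<Lambda> \<and>
     (\<forall>lam. 0 \<le> lam \<and> lam < \<Lambda> \<longrightarrow> (\<exists>u::'a \<Rightarrow> real. smooth_minimal_solution a b lam u)) \<and>
     (\<forall>lam>\<Lambda>. \<nexists>u::'a \<Rightarrow> real. weak_solution a b lam u)"

text \<open>The pointwise limit may be infinite at the centre of the ball, so it is taken almost
  everywhere.  That this limit lies in \<open>H\<^sup>2\<close> and is a weak solution at the extremal
  parameter is a known theorem which is included in the notion.\<close>

definition extremal_solution ::
    "real \<Rightarrow> real \<Rightarrow> real \<Rightarrow> ('a::euclidean_space \<Rightarrow> real) \<Rightarrow> bool" where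
  "extremal_solution a b \<Lambda> w \<longleftrightarrow> weak_solution a b \<Lambda> w \<and>
     (\<exists>U. (\<forall>lam. 0 \<le> lam \<and> lam < \<Lambda> \<longrightarrow> smooth_minimal_solution a b lam (U lam)) \<and>
          (AE x in lebesgue_on unit_ball. ((\<lambda>lam. U lam x) \<longlongrightarrow> w x) (at_left \<Lambda>)))"

end

theory Submission
  imports Defs
begin

text \<open>Let \<open>0 \<le> l < \<lambda>\<close>.  By stability of \<open>u\<close> the problem
  \<open>\<Delta>\<^sup>2 \<phi> = e\<^sup>u (\<lambda> - l exp (- max 0 \<phi>))\<close>, \<open>\<phi> \<in> H\<^sub>0\<^sup>2\<close>, is the Euler equation of a strongly convex
  functional and hence solvable.  Its right-hand side is nonnegative, so \<open>\<phi> \<ge> 0\<close> by Boggio's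
  principle, and \<open>u - \<phi> \<le> u\<close> is a weak solution with parameter \<open>l\<close>.  Therefore the minimal solutions
  at all \<open>l < \<lambda>\<close> lie below \<open>u\<close>.  Any weak solution \<open>s \<le> u\<close> at \<open>\<lambda>\<close> itself coincides with \<open>u\<close>,
  by testing the difference of the equations with \<open>u - s\<close> in the stability inequality.  With the
  bounded minimal solution as \<open>s\<close> this excludes \<open>\<lambda> < \<lambda>\<^sup>*\<close>; with \<open>s = u\<^sup>*\<close> it gives \<open>u = u\<^sup>*\<close>.

  Boggio's principle is proved without Green's representation: the bilaplacian of a smoothed Green
  function with pole \<open>x\<close> is an approximate identity at \<open>x\<close>, up to a remainder which tends to zero.\<close>

section \<open>Functions of class \<open>C\<^sup>k\<close>\<close>

text \<open>Stability speaks of test functions, but it has to be applied to differences of weak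
  solutions and to limits of minimising sequences. Such a function is carried as a pair: an L2 limit
  of test functions together with the limit of their Laplacians. Since the Laplacian controls all
  derivatives of a test function up to order two, inequalities and equations pass to these limits.
  Two solutions with the same boundary data have the same boundary terms in Green's identity, and
  these cancel in the difference. The strict inequality l < \<lambda> gives strong convexity with a
  constant proportional to 1 - l/\<lambda>, so a minimising sequence is Cauchy and no weak
  compactness is invoked. The truncation is forced by the order of the argument: the sign of \<phi>
  is known only after \<phi> has been found, and at negative arguments exp (-\<phi>) and its
  derivative are out of control. The extremal solution is accessible only as a limit of minimal
  solutions, which is why the comparison is made at every l < \<lambda>. At \<lambda> = 0 stability
  is void, and uniqueness comes from the linear equation instead.\<close>

lemma partial_deriv_eqI:
  assumes "(f has_derivative f') (at x)"
  shows "partial_deriv i f x = f' i"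
  using frechet_derivative_at[OF assms] by (simp add: partial_deriv_def)

lemma has_derivative_partial_deriv:
  assumes "f differentiable (at x)"
  shows "(f has_derivative (\<lambda>v. \<Sum>i\<in>Basis. (v \<bullet> i) * partial_deriv i f x)) (at x)"
proof -
  have D: "(f has_derivative frechet_derivative f (at x)) (at x)"
    using assms by (simp add: frechet_derivative_works)
  interpret bounded_linear "frechet_derivative f (at x)"
    using D by (rule has_derivative_bounded_linear)
  have "frechet_derivative f (at x) v = (\<Sum>i\<in>Basis. (v \<bullet> i) * partial_deriv i f x)" for v
    by (subst euclidean_representation[of v, symmetric]) (simp add: sum scale partial_deriv_def)
  with D show ?thesis by (metis (no_types, lifting) ext)
qed

text \<open>A derivative known in closed form determines every \<open>partial_deriv\<close>, so
  regularity need only be checked for its values at the basis vectors.\<close>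

lemma C_k_SucI:
  assumes "\<And>x. (f has_derivative f' x) (at x)"
    and "\<And>i. i \<in> Basis \<Longrightarrow> C_k k (\<lambda>x. f' x i)"
  shows "C_k (Suc k) f"
proof -
  have "partial_deriv i f = (\<lambda>x. f' x i)" for i
    by (rule ext) (rule partial_deriv_eqI[OF assms(1)])
  moreover have "f differentiable_on UNIV"
    using assms(1) unfolding differentiable_on_def differentiable_def by auto
  ultimately show ?thesis using assms(2) by simp
qed

lemma C_k_Suc_has_derivative:
  assumes "C_k (Suc k) f"
  shows "(f has_derivative (\<lambda>v. \<Sum>i\<in>Basis. (v \<bullet> i) * partial_deriv i f x)) (at x)"
  using assms by (intro has_derivative_partial_deriv) (auto simp: differentiable_on_def)

lemma C_k_continuous: "C_k k f \<Longrightarrow> continuous_on UNIV f"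
  by (cases k) (auto intro: differentiable_imp_continuous_on)

lemma C_k_Suc_imp: "C_k (Suc k) f \<Longrightarrow> C_k k f"
proof (induction k arbitrary: f)
  case 0 then show ?case using C_k_continuous[of "Suc 0" f] by simp
next
  case (Suc k) then show ?case by simp
qed

lemma C_k_const: "C_k k (\<lambda>x. c)"
proof (induction k arbitrary: c)
  case (Suc k)
  then show ?case by (intro C_k_SucI[where f' = "\<lambda>x v. 0"]) auto
qed simp

lemma C_k_inner: "C_k k (\<lambda>x. x \<bullet> v)"
proof (cases k)
  case (Suc m)
  show ?thesis unfolding Suc
    by (rule C_k_SucI[where f' = "\<lambda>x w. w \<bullet> v"]) (auto intro!: derivative_eq_intros C_k_const)
qed (auto intro!: continuous_intros)

lemma sum_Basis_inner_mult:
  fixes i :: "'a::euclidean_space" and c :: "'a \<Rightarrow> real"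
  assumes "i \<in> Basis" shows "(\<Sum>j\<in>Basis. (i \<bullet> j) * c j) = c i"
proof -
  have "(\<Sum>j\<in>Basis. (i \<bullet> j) * c j) = (\<Sum>j\<in>Basis. if i = j then c j else 0)"
    using assms by (intro sum.cong) (auto simp: inner_Basis)
  also have "\<dots> = c i" using assms by simp
  finally show ?thesis .
qed

lemma C_k_add:
  assumes "C_k k f" "C_k k g" shows "C_k k (\<lambda>x. f x + g x)"
  using assms
proof (induction k arbitrary: f g)
  case (Suc k)
  show ?case
  proof (rule C_k_SucI)
    show "((\<lambda>x. f x + g x) has_derivative (\<lambda>v. (\<Sum>i\<in>Basis. (v \<bullet> i) * partial_deriv i f x)
        + (\<Sum>i\<in>Basis. (v \<bullet> i) * partial_deriv i g x))) (at x)" for x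
      by (intro has_derivative_add C_k_Suc_has_derivative[OF Suc.prems(1)]
          C_k_Suc_has_derivative[OF Suc.prems(2)])
    fix i :: 'a assume "i \<in> Basis"
    then show "C_k k (\<lambda>x. (\<Sum>j\<in>Basis. (i \<bullet> j) * partial_deriv j f x)
        + (\<Sum>j\<in>Basis. (i \<bullet> j) * partial_deriv j g x))"
      using Suc by (simp add: sum_Basis_inner_mult)
  qed
qed (simp add: continuous_on_add)

lemma C_k_mult:
  assumes "C_k k f" "C_k k g" shows "C_k k (\<lambda>x. f x * g x)"
  using assms
proof (induction k arbitrary: f g)
  case (Suc k)
  show ?case
  proof (rule C_k_SucI)
    show "((\<lambda>x. f x * g x) has_derivative (\<lambda>v. f x * (\<Sum>i\<in>Basis. (v \<bullet> i) * partial_deriv i g x)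
        + (\<Sum>i\<in>Basis. (v \<bullet> i) * partial_deriv i f x) * g x)) (at x)" for x
      by (rule has_derivative_mult[OF C_k_Suc_has_derivative[OF Suc.prems(1)]
          C_k_Suc_has_derivative[OF Suc.prems(2)]])
    fix i :: 'a assume i: "i \<in> Basis"
    have pd: "C_k k (partial_deriv i f)" "C_k k (partial_deriv i g)"
      using Suc.prems i by simp_all
    show "C_k k (\<lambda>x. f x * (\<Sum>j\<in>Basis. (i \<bullet> j) * partial_deriv j g x)
        + (\<Sum>j\<in>Basis. (i \<bullet> j) * partial_deriv j f x) * g x)"
      unfolding sum_Basis_inner_mult[OF i]
      by (rule C_k_add[OF Suc.IH[OF C_k_Suc_imp[OF Suc.prems(1)] pd(2)] Suc.IH[OF pd(1) C_k_Suc_imp[OF Suc.prems(2)]]])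
  qed
qed (simp add: continuous_on_mult)

lemma C_k_sum:
  assumes "\<And>i. i \<in> I \<Longrightarrow> C_k k (f i)" shows "C_k k (\<lambda>x. \<Sum>i\<in>I. f i x)"
  using assms
proof (induction I rule: infinite_finite_induct)
  case (insert j I)
  then show ?case using C_k_add[of k "f j" "\<lambda>x. \<Sum>i\<in>I. f i x"] by simp
qed (simp_all add: C_k_const)

lemma partial_deriv_add:
  assumes "C_k (Suc 0) f" "C_k (Suc 0) g"
  shows "partial_deriv i (\<lambda>x. f x + g x) x = partial_deriv i f x + partial_deriv i g x"
  using partial_deriv_eqI[OF has_derivative_add[OF C_k_Suc_has_derivative[OF assms(1)] C_k_Suc_has_derivative[OF assms(2)]]]
  by (simp only: partial_deriv_eqI[OF C_k_Suc_has_derivative[OF assms(1)], symmetric]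
    partial_deriv_eqI[OF C_k_Suc_has_derivative[OF assms(2)], symmetric])

lemma partial_deriv_diff:
  assumes "C_k (Suc 0) f" "C_k (Suc 0) g"
  shows "partial_deriv i (\<lambda>x. f x - g x) x = partial_deriv i f x - partial_deriv i g x"
  using partial_deriv_eqI[OF has_derivative_diff[OF C_k_Suc_has_derivative[OF assms(1)] C_k_Suc_has_derivative[OF assms(2)]]]
  by (simp only: partial_deriv_eqI[OF C_k_Suc_has_derivative[OF assms(1)], symmetric]
    partial_deriv_eqI[OF C_k_Suc_has_derivative[OF assms(2)], symmetric])

lemma partial_deriv_mult:
  assumes "C_k (Suc 0) f" "C_k (Suc 0) g"
  shows "partial_deriv i (\<lambda>x. f x * g x) x = f x * partial_deriv i g x + partial_deriv i f x * g x"
  using partial_deriv_eqI[OF has_derivative_mult[OF C_k_Suc_has_derivative[OF assms(1)] C_k_Suc_has_derivative[OF assms(2)]]]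
  by (simp only: partial_deriv_eqI[OF C_k_Suc_has_derivative[OF assms(1)], symmetric]
    partial_deriv_eqI[OF C_k_Suc_has_derivative[OF assms(2)], symmetric])

lemma partial_deriv_cmult:
  "C_k (Suc 0) f \<Longrightarrow> partial_deriv i (\<lambda>x. c * f x) x = c * partial_deriv i f x"
  using partial_deriv_mult[OF C_k_const, of f i c x] 
    partial_deriv_eqI[of "\<lambda>x. c" "\<lambda>_. 0" x i] by simp

lemma partial_deriv_affine:
  fixes f :: "'a::euclidean_space \<Rightarrow> real"
  assumes "C_k (Suc 0) f"
  shows "partial_deriv i (\<lambda>x. f (c *\<^sub>R x + d)) x = c * partial_deriv i f (c *\<^sub>R x + d)"
proof -
  have "((\<lambda>x. f (c *\<^sub>R x + d)) has_derivative
      (\<lambda>v. \<Sum>j\<in>Basis. ((c *\<^sub>R v) \<bullet> j) * partial_deriv j f (c *\<^sub>R x + d))) (at x)"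
    by (rule has_derivative_compose[OF _ C_k_Suc_has_derivative[OF assms]])
       (auto intro!: derivative_eq_intros)
  from partial_deriv_eqI[OF this, of i]
  have "partial_deriv i (\<lambda>x. f (c *\<^sub>R x + d)) x = c * (\<Sum>j\<in>Basis. (i \<bullet> j) * partial_deriv j f (c *\<^sub>R x + d))"
    by (simp add: sum_distrib_left mult.assoc)
  also have "(\<Sum>j\<in>Basis. (i \<bullet> j) * partial_deriv j f (c *\<^sub>R x + d)) = partial_deriv i f (c *\<^sub>R x + d)"
    by (rule partial_deriv_eqI[OF C_k_Suc_has_derivative[OF assms], symmetric])
  finally show ?thesis .
qed

lemma C_k_affine:
  assumes "C_k k f" shows "C_k k (\<lambda>x. f (c *\<^sub>R x + d))"
  using assms
proof (induction k arbitrary: f)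
  case 0
  have "continuous_on UNIV (\<lambda>x. c *\<^sub>R x + d)" by (intro continuous_intros)
  from continuous_on_compose2[of UNIV f UNIV, OF _ this] 0 show ?case by simp
next
  case (Suc k)
  have "C_k (Suc 0) f" using Suc.prems C_k_continuous by auto
  note pd = partial_deriv_affine[OF this, of _ c d]
  have "(\<lambda>x. f (c *\<^sub>R x + d)) differentiable_on UNIV"
    unfolding differentiable_on_def
  proof safe
    fix x show "(\<lambda>x. f (c *\<^sub>R x + d)) differentiable at x"
      by (rule differentiableI, rule has_derivative_compose[OF _ C_k_Suc_has_derivative[OF \<open>C_k (Suc 0) f\<close>]])
         (rule has_derivative_add_const, rule has_derivative_scaleR_right, rule has_derivative_ident)
  qed
  moreover have "C_k k (partial_deriv i (\<lambda>x. f (c *\<^sub>R x + d)))" if "i \<in> Basis" for i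
  proof -
    have "C_k k (\<lambda>x. c * partial_deriv i f (c *\<^sub>R x + d))"
      using Suc.prems that by (intro C_k_mult C_k_const Suc.IH) auto
    moreover have "partial_deriv i (\<lambda>x. f (c *\<^sub>R x + d)) = (\<lambda>x. c * partial_deriv i f (c *\<^sub>R x + d))"
      by (rule ext) (rule pd)
    ultimately show ?thesis by simp
  qed
  ultimately show ?case by simp
qed

text \<open>\<open>frechet_derivative\<close> is chosen by a description operator, so local
  agreement is transferred through the equivalence of all \<open>has_derivative\<close> statements;
  this works whether or not the functions are differentiable.\<close>

lemma partial_deriv_cong_open:
  assumes "open S" "x \<in> S" "\<And>y. y \<in> S \<Longrightarrow> f y = g y"
  shows "partial_deriv i f x = partial_deriv i g x"
proof -
  have "(f has_derivative D) (at x) = (g has_derivative D) (at x)" for D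
    using assms has_derivative_transform_within_open[of f D x UNIV S g]
      has_derivative_transform_within_open[of g D x UNIV S f] by auto
  then show ?thesis unfolding partial_deriv_def frechet_derivative_def by simp
qed

lemma smooth_C_k: "smooth f \<Longrightarrow> C_k k f"
  by (simp add: smooth_def)

lemma smooth_partial_deriv: "smooth f \<Longrightarrow> i \<in> Basis \<Longrightarrow> smooth (partial_deriv i f)"
  unfolding smooth_def by (metis C_k.simps(2))

lemma smooth_const: "smooth (\<lambda>x. c)" and smooth_inner: "smooth (\<lambda>x. x \<bullet> v)"
  by (simp_all add: smooth_def C_k_const C_k_inner)

lemma smooth_add: "smooth f \<Longrightarrow> smooth g \<Longrightarrow> smooth (\<lambda>x. f x + g x)"
  and smooth_mult: "smooth f \<Longrightarrow> smooth g \<Longrightarrow> smooth (\<lambda>x. f x * g x)"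
  and smooth_affine: "smooth f \<Longrightarrow> smooth (\<lambda>x. f (c *\<^sub>R x + d))"
  by (simp_all add: smooth_def C_k_add C_k_mult C_k_affine)

lemma smooth_sum: "(\<And>i. i \<in> I \<Longrightarrow> smooth (f i)) \<Longrightarrow> smooth (\<lambda>x. \<Sum>i\<in>I. f i x)"
  by (simp add: smooth_def C_k_sum)

lemma smooth_diff: "smooth f \<Longrightarrow> smooth g \<Longrightarrow> smooth (\<lambda>x. f x - g x)"
  using smooth_add[OF _ smooth_mult[OF smooth_const[of "-1"]], of f g] by simp

lemma smooth_continuous: "smooth f \<Longrightarrow> continuous_on S f"
  using C_k_continuous[of 0 f] continuous_on_subset[of UNIV f S] by (simp add: smooth_def)

lemma smooth_laplacian: "smooth f \<Longrightarrow> smooth (laplacian f)"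
  unfolding laplacian_def[abs_def] by (intro smooth_sum smooth_partial_deriv)

text \<open>Derivatives of \<open>t \<mapsto> t\<^sup>-\<^sup>m exp (-1/t)\<close> stay in the span of functions of this form.\<close>

definition flat :: "nat \<Rightarrow> real \<Rightarrow> real" where
  "flat m t = (if t > 0 then inverse t ^ m * exp (- inverse t) else 0)"

lemma flat_nonneg: "flat m t \<ge> 0"
  by (simp add: flat_def)

text \<open>The substitution s = 1/t turns this into the decay of s^m exp (-s) at infinity.\<close>

lemma flat_tendsto_0: "(flat m \<longlongrightarrow> 0) (at_right 0)"
proof -
  have "((\<lambda>s::real. s ^ m / exp s) \<longlongrightarrow> 0) at_top"
    by (rule tendsto_power_div_exp_0)
  then have "((\<lambda>t. inverse t ^ m / exp (inverse t)) \<longlongrightarrow> 0) (at_right (0::real))"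
    by (rule filterlim_compose[OF _ filterlim_inverse_at_top_right])
  then show ?thesis
    by (rule Lim_transform_eventually)
       (auto simp: eventually_at_right_less flat_def exp_minus divide_inverse
         intro!: eventually_at_rightI[of 0 1])
qed

lemma flat_has_derivative:
  "(flat m has_real_derivative flat (m + 2) t - real m * flat (m + 1) t) (at t)"
proof (cases "t > 0 \<or> t < 0")
  case True
  then show ?thesis
  proof
    assume t: "t > 0"
    define u where "u = inverse t"
    have 1: "(inverse has_real_derivative - (u ^ 2)) (at t)"
      using DERIV_inverse[of t UNIV] t by (simp add: u_def power2_eq_square)
    \<comment> \<open>For \<open>m = 0\<close> the exponent \<open>m - 1\<close> truncates to 0,
      which the factor \<open>real m\<close> makes harmless; hence the case split on
      \<open>m\<close> below.\<close>
    have 2: "((\<lambda>u. u ^ m * exp (- u)) has_real_derivative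
        real m * u ^ (m - 1) * exp (-u) - u ^ m * exp (- u)) (at u)"
      by (auto intro!: derivative_eq_intros)
    have 3: "(real m * u ^ (m - 1) * exp (-u) - u ^ m * exp (- u)) * (- (u ^ 2))
        = flat (m + 2) t - real m * flat (m + 1) t"
    proof -
      have "flat k t = u ^ k * exp (- u)" for k using t by (simp add: flat_def u_def)
      then show ?thesis
        by (cases m) (simp_all only: power_add power_Suc power2_eq_square, simp_all add: algebra_simps)
    qed
    have "((\<lambda>t. inverse t ^ m * exp (- inverse t)) has_real_derivative
        flat (m + 2) t - real m * flat (m + 1) t) (at t)"
      using DERIV_chain2[OF 2[unfolded u_def] 1] 3 by (simp only: u_def)
    then show ?thesis
      by (rule has_field_derivative_transform_within_open[where S = "{0<..}"])
         (use t in \<open>simp_all add: flat_def\<close>)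
  next
    assume t: "t < 0"
    have "((\<lambda>t. 0) has_real_derivative 0) (at t)" by simp
    then have "(flat m has_real_derivative 0) (at t)"
      by (rule has_field_derivative_transform_within_open[where S = "{..<0}"])
         (use t in \<open>simp_all add: flat_def\<close>)
    then show ?thesis using t by (simp add: flat_def)
  qed
next
  case False
  then have t: "t = 0" by simp
  \<comment> \<open>The derivative claimed at 0 is 0. To the right of 0 the difference quotient is
    \<open>flat (Suc m) h\<close>, to the left it vanishes.\<close>
  have "((\<lambda>h. (flat m (0 + h) - flat m 0) / h) \<longlongrightarrow> 0) (at 0)"
  proof (rule filterlim_split_at)
    show "((\<lambda>h. (flat m (0 + h) - flat m 0) / h) \<longlongrightarrow> 0) (at_left 0)"
      by (rule tendsto_eventually) (auto simp: flat_def intro!: eventually_at_leftI[of "-1"])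
    show "((\<lambda>h. (flat m (0 + h) - flat m 0) / h) \<longlongrightarrow> 0) (at_right 0)"
      by (rule Lim_transform_eventually[OF flat_tendsto_0[of "Suc m"]])
         (auto simp: flat_def divide_inverse intro!: eventually_at_rightI[of 0 1])
  qed
  then show ?thesis unfolding t DERIV_def by (simp add: flat_def)
qed

lemma C_k_flat:
  fixes s :: "'a::euclidean_space \<Rightarrow> real"
  assumes "\<And>k. C_k k s"
  shows "C_k k (\<lambda>x. flat m (s x))"
proof (induction k arbitrary: m)
  case 0
  have "continuous_on UNIV (flat m)"
    by (meson DERIV_isCont flat_has_derivative continuous_at_imp_continuous_on)
  then show ?case
    using C_k_continuous[OF assms[of 0]] by (auto intro: continuous_on_compose2)
next
  case (Suc k)
  show ?case
  proof (rule C_k_SucI)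
    show "((\<lambda>x. flat m (s x)) has_derivative (\<lambda>v. (flat (m + 2) (s x) - real m * flat (m + 1) (s x)) *
        (\<Sum>i\<in>Basis. (v \<bullet> i) * partial_deriv i s x))) (at x)" for x
      using has_derivative_compose[OF C_k_Suc_has_derivative[OF assms[of "Suc 0"]] 
          flat_has_derivative[unfolded has_field_derivative_def]] by simp
    fix i :: 'a assume i: "i \<in> Basis"
    have "(\<Sum>j\<in>Basis. (i \<bullet> j) * partial_deriv j s x) = partial_deriv i s x" for x
      by (rule partial_deriv_eqI[OF C_k_Suc_has_derivative[OF assms[of "Suc 0"]], symmetric])
    then show "C_k k (\<lambda>x. (flat (m + 2) (s x) - real m * flat (m + 1) (s x)) *
        (\<Sum>j\<in>Basis. (i \<bullet> j) * partial_deriv j s x))"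
      using Suc.IH[of "m + 2"] Suc.IH[of "m + 1"] assms[of "Suc k"] i
        C_k_add[OF _ C_k_mult[OF C_k_const[of k "-real m"]]]
      by (intro C_k_mult) auto
  qed
qed

text \<open>The standard bump exp (-1 / (1 - |x|^2)), written with \<open>x \<bullet> x\<close>
  because a polynomial argument is smooth at the origin as well.\<close>

definition bump :: "'a::euclidean_space \<Rightarrow> real" where
  "bump x = flat 0 (1 - x \<bullet> x)"

lemma bump_smooth: "smooth bump"
proof -
  have "smooth (\<lambda>x::'a. 1 + (-1) * (\<Sum>i\<in>Basis. (x \<bullet> i) * (x \<bullet> i)))"
    by (intro smooth_add smooth_mult smooth_const smooth_sum smooth_inner)
  then have "smooth (\<lambda>x::'a. 1 - x \<bullet> x)" by (simp add: euclidean_inner[symmetric])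
  then show ?thesis unfolding smooth_def bump_def[abs_def] using C_k_flat by blast
qed

lemma bump_nonneg: "bump x \<ge> 0"
  by (simp add: bump_def flat_nonneg)

lemma bump_pos_iff: "bump x > 0 \<longleftrightarrow> norm x < 1"
proof -
  have "x \<bullet> x < 1 \<longleftrightarrow> norm x < 1"
    by (simp add: norm_eq_sqrt_inner)
  then show ?thesis by (simp add: bump_def flat_def)
qed

lemma bump_eq_0: "norm x \<ge> 1 \<Longrightarrow> bump x = 0"
  using bump_pos_iff[of x] bump_nonneg[of x] by auto

section \<open>Square-integrable functions\<close>

lemma L2_measurable: "f \<in> L2 M \<Longrightarrow> f \<in> borel_measurable M"
  and L2_integrable: "f \<in> L2 M \<Longrightarrow> integrable M (\<lambda>x. (f x)\<^sup>2)"
  by (auto simp: L2_def)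

lemma L2_mult:
  assumes "f \<in> L2 M" "g \<in> L2 M" shows "integrable M (\<lambda>x. f x * g x)"
proof (rule Bochner_Integration.integrable_bound)
  show "integrable M (\<lambda>x. (f x)\<^sup>2 + (g x)\<^sup>2)"
    using assms by (intro Bochner_Integration.integrable_add L2_integrable)
  show "(\<lambda>x. f x * g x) \<in> borel_measurable M"
    using assms by (intro borel_measurable_times L2_measurable)
  have "\<bar>a * b\<bar> \<le> a\<^sup>2 + b\<^sup>2" for a b :: real
  proof -
    have "0 \<le> (\<bar>a\<bar> - \<bar>b\<bar>)\<^sup>2" by simp
    then have "2 * (\<bar>a\<bar> * \<bar>b\<bar>) \<le> a\<^sup>2 + b\<^sup>2" by (simp add: power2_diff)
    moreover have "0 \<le> \<bar>a\<bar> * \<bar>b\<bar>" by simp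
    ultimately show ?thesis unfolding abs_mult by linarith
  qed
  then show "AE x in M. norm (f x * g x) \<le> norm ((f x)\<^sup>2 + (g x)\<^sup>2)" by simp
qed

lemma L2_lincomb:
  assumes "f \<in> L2 M" "g \<in> L2 M" shows "(\<lambda>x. a * f x + b * g x) \<in> L2 M"
proof -
  have "(\<lambda>x. (a * f x + b * g x)\<^sup>2) = (\<lambda>x. a\<^sup>2 * (f x)\<^sup>2 + 2 * a * b * (f x * g x) + b\<^sup>2 * (g x)\<^sup>2)"
    by (simp add: power2_sum power_mult_distrib algebra_simps)
  moreover have "integrable M (\<lambda>x. a\<^sup>2 * (f x)\<^sup>2 + 2 * a * b * (f x * g x) + b\<^sup>2 * (g x)\<^sup>2)"
    using L2_mult[OF assms] L2_integrable[OF assms(1)] L2_integrable[OF assms(2)] by simp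
  ultimately show ?thesis
    using L2_measurable[OF assms(1)] L2_measurable[OF assms(2)] by (simp add: L2_def)
qed

lemma L2_add: "f \<in> L2 M \<Longrightarrow> g \<in> L2 M \<Longrightarrow> (\<lambda>x. f x + g x) \<in> L2 M"
  and L2_diff: "f \<in> L2 M \<Longrightarrow> g \<in> L2 M \<Longrightarrow> (\<lambda>x. f x - g x) \<in> L2 M"
  and L2_cmult: "f \<in> L2 M \<Longrightarrow> (\<lambda>x. c * f x) \<in> L2 M"
  using L2_lincomb[of f M g 1 1] L2_lincomb[of f M g 1 "-1"] L2_lincomb[of f M f c 0] by simp_all

lemma L2_zero: "(\<lambda>x. 0) \<in> L2 M"
  by (simp add: L2_def)

lemma L2_sum: "(\<And>i. i \<in> I \<Longrightarrow> f i \<in> L2 M) \<Longrightarrow> (\<lambda>x. \<Sum>i\<in>I. f i x) \<in> L2 M"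
  by (induction I rule: infinite_finite_induct) (simp_all add: L2_zero L2_add)

lemma L2_cong_AE:
  assumes "f \<in> L2 M" "g \<in> borel_measurable M" "AE x in M. f x = g x"
  shows "g \<in> L2 M"
proof -
  have "integrable M (\<lambda>x. (g x)\<^sup>2)"
    by (rule integrable_cong_AE_imp[OF L2_integrable[OF assms(1)]]) (use assms in auto)
  then show ?thesis using assms(2) by (simp add: L2_def)
qed

lemma L2_bounded:
  assumes "f \<in> L2 M" "g \<in> borel_measurable M" "AE x in M. \<bar>g x\<bar> \<le> C * \<bar>f x\<bar>"
  shows "g \<in> L2 M"
proof -
  have "integrable M (\<lambda>x. (g x)\<^sup>2)"
  proof (rule Bochner_Integration.integrable_bound)
    show "integrable M (\<lambda>x. C\<^sup>2 * (f x)\<^sup>2)" using L2_integrable[OF assms(1)] by simp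
    have "y\<^sup>2 \<le> C\<^sup>2 * z\<^sup>2" if "\<bar>y\<bar> \<le> C * \<bar>z\<bar>" for y z
      using power_mono[OF that, of 2] by (simp add: power_mult_distrib)
    then show "AE x in M. norm ((g x)\<^sup>2) \<le> norm (C\<^sup>2 * (f x)\<^sup>2)"
      using assms(3) by auto
  qed (use assms in simp)
  then show ?thesis using assms(2) by (simp add: L2_def)
qed

lemma L2_sq_add:
  assumes "f \<in> L2 M" "g \<in> L2 M"
  shows "(\<integral>x. (f x + t * g x)\<^sup>2 \<partial>M) = (\<integral>x. (f x)\<^sup>2 \<partial>M) + 2 * t * (\<integral>x. f x * g x \<partial>M) + t\<^sup>2 * (\<integral>x. (g x)\<^sup>2 \<partial>M)"
proof -
  have "(\<lambda>x. (f x + t * g x)\<^sup>2) = (\<lambda>x. (f x)\<^sup>2 + (2 * t) * (f x * g x) + t\<^sup>2 * (g x)\<^sup>2)"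
    by (simp add: power2_sum power_mult_distrib algebra_simps)
  then show ?thesis
    using L2_mult[OF assms] L2_integrable[OF assms(1)] L2_integrable[OF assms(2)] by simp
qed

text \<open>Discriminant criterion for a polynomial in \<open>t\<close>. Besides the Cauchy-Schwarz
  inequality it later yields the bound for the first variation of the energy at an almost minimal
  test function.\<close>

lemma quadratic_nonneg_imp:
  fixes a b c :: real
  assumes "\<And>t. 0 \<le> a + 2 * t * b + t\<^sup>2 * c" "0 \<le> c"
  shows "b\<^sup>2 \<le> a * c"
proof (cases "c = 0")
  case True
  have "b = 0"
  proof (rule ccontr)
    assume "b \<noteq> 0"
    \<comment> \<open>At this \<open>t\<close> the remaining linear polynomial takes the value
      -1.\<close>
    then show False using assms(1)[of "- (a + 1) / (2 * b)"] True by (simp add: field_simps)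
  qed
  then show ?thesis using True by simp
next
  case False
  then have "c > 0" using assms(2) by simp
  \<comment> \<open>The minimum point of the parabola.\<close>
  then show ?thesis using assms(1)[of "- b / c"] 
    by (simp add: field_simps power2_eq_square)
qed

lemma L2_cauchy_schwarz:
  assumes "f \<in> L2 M" "g \<in> L2 M"
  shows "(\<integral>x. f x * g x \<partial>M)\<^sup>2 \<le> (\<integral>x. (f x)\<^sup>2 \<partial>M) * (\<integral>x. (g x)\<^sup>2 \<partial>M)"
proof (rule quadratic_nonneg_imp)
  fix t :: real
  have "0 \<le> (\<integral>x. (f x + t * g x)\<^sup>2 \<partial>M)" by simp
  then show "0 \<le> (\<integral>x. (f x)\<^sup>2 \<partial>M) + 2 * t * (\<integral>x. f x * g x \<partial>M) + t\<^sup>2 * (\<integral>x. (g x)\<^sup>2 \<partial>M)"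
    unfolding L2_sq_add[OF assms] .
qed simp

lemma L2_cauchy_schwarz_abs:
  assumes "f \<in> L2 M" "g \<in> L2 M"
  shows "\<bar>\<integral>x. f x * g x \<partial>M\<bar> \<le> sqrt (\<integral>x. (f x)\<^sup>2 \<partial>M) * sqrt (\<integral>x. (g x)\<^sup>2 \<partial>M)"
  using real_sqrt_le_mono[OF L2_cauchy_schwarz[OF assms]] by (simp add: real_sqrt_mult)

text \<open>The parallelogram law with one square dropped; at the price of a factor 2 it lets error
  estimates stay with squared distances.\<close>

lemma L2_triangle_sq:
  assumes "f \<in> L2 M" "g \<in> L2 M"
  shows "(\<integral>x. (f x - g x)\<^sup>2 \<partial>M) \<le> 2 * (\<integral>x. (f x)\<^sup>2 \<partial>M) + 2 * (\<integral>x. (g x)\<^sup>2 \<partial>M)"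
proof -
  have "(\<integral>x. (f x - g x)\<^sup>2 \<partial>M) + (\<integral>x. (f x + g x)\<^sup>2 \<partial>M) = 2 * (\<integral>x. (f x)\<^sup>2 \<partial>M) + 2 * (\<integral>x. (g x)\<^sup>2 \<partial>M)"
    using L2_sq_add[OF assms, of 1] L2_sq_add[OF assms, of "-1"] by simp
  moreover have "0 \<le> (\<integral>x. (f x + g x)\<^sup>2 \<partial>M)" by simp
  ultimately show ?thesis by linarith
qed

text \<open>Membership in \<open>L2\<close> is part of the notion because a non-integrable function
  has integral 0 by convention, so that convergence of the integrals alone would say
  nothing.\<close>

definition L2_conv :: "'b measure \<Rightarrow> (nat \<Rightarrow> 'b \<Rightarrow> real) \<Rightarrow> ('b \<Rightarrow> real) \<Rightarrow> bool" where
  "L2_conv M F f \<longleftrightarrow> (\<forall>k. F k \<in> L2 M) \<and> f \<in> L2 M \<and> (\<lambda>k. \<integral>x. (F k x - f x)\<^sup>2 \<partial>M) \<longlonglongrightarrow> 0"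

lemma L2_convD:
  assumes "L2_conv M F f"
  shows "F k \<in> L2 M" "f \<in> L2 M" "(\<lambda>k. \<integral>x. (F k x - f x)\<^sup>2 \<partial>M) \<longlonglongrightarrow> 0"
  using assms by (auto simp: L2_conv_def)

lemma L2_conv_const: "f \<in> L2 M \<Longrightarrow> L2_conv M (\<lambda>k. f) f"
  by (simp add: L2_conv_def)

lemma L2_conv_bound:
  assumes "\<And>k. F k \<in> L2 M" "f \<in> L2 M" "\<And>k. (\<integral>x. (F k x - f x)\<^sup>2 \<partial>M) \<le> e k" "e \<longlonglongrightarrow> 0"
  shows "L2_conv M F f"
  unfolding L2_conv_def
proof (intro conjI allI assms(1,2))
  show "(\<lambda>k. \<integral>x. (F k x - f x)\<^sup>2 \<partial>M) \<longlonglongrightarrow> 0"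
    by (rule tendsto_sandwich[OF always_eventually always_eventually tendsto_const assms(4)]) (use assms(3) in simp_all)
qed

lemma L2_conv_lincomb:
  assumes "L2_conv M F f" "L2_conv M G g"
  shows "L2_conv M (\<lambda>k x. a * F k x + b * G k x) (\<lambda>x. a * f x + b * g x)"
proof (rule L2_conv_bound)
  note 1 = L2_convD[OF assms(1)] note 2 = L2_convD[OF assms(2)]
  show "(\<lambda>x. a * F k x + b * G k x) \<in> L2 M" for k by (intro L2_lincomb 1 2)
  show "(\<lambda>x. a * f x + b * g x) \<in> L2 M" by (intro L2_lincomb 1 2)
  show "(\<integral>x. (a * F k x + b * G k x - (a * f x + b * g x))\<^sup>2 \<partial>M)
      \<le> 2 * (a\<^sup>2 * (\<integral>x. (F k x - f x)\<^sup>2 \<partial>M)) + 2 * (b\<^sup>2 * (\<integral>x. (G k x - g x)\<^sup>2 \<partial>M))" for k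
  proof -
    have "(\<integral>x. (a * F k x + b * G k x - (a * f x + b * g x))\<^sup>2 \<partial>M) =
        (\<integral>x. (a * (F k x - f x) - (- b) * (G k x - g x))\<^sup>2 \<partial>M)"
      by (intro Bochner_Integration.integral_cong refl) (simp add: algebra_simps)
    also have "\<dots> \<le> 2 * (\<integral>x. (a * (F k x - f x))\<^sup>2 \<partial>M) + 2 * (\<integral>x. (- b * (G k x - g x))\<^sup>2 \<partial>M)"
      by (intro L2_triangle_sq L2_cmult L2_diff 1 2)
    finally show ?thesis by (simp add: power_mult_distrib)
  qed
  have "(\<lambda>k. 2 * (a\<^sup>2 * (\<integral>x. (F k x - f x)\<^sup>2 \<partial>M)) + 2 * (b\<^sup>2 * (\<integral>x. (G k x - g x)\<^sup>2 \<partial>M)))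
      \<longlonglongrightarrow> 2 * (a\<^sup>2 * 0) + 2 * (b\<^sup>2 * 0)"
    by (intro tendsto_intros 1 2)
  then show "(\<lambda>k. 2 * (a\<^sup>2 * (\<integral>x. (F k x - f x)\<^sup>2 \<partial>M)) + 2 * (b\<^sup>2 * (\<integral>x. (G k x - g x)\<^sup>2 \<partial>M))) \<longlonglongrightarrow> 0"
    by simp
qed

lemma L2_conv_diff:
  "L2_conv M F f \<Longrightarrow> L2_conv M G g \<Longrightarrow> L2_conv M (\<lambda>k x. F k x - G k x) (\<lambda>x. f x - g x)"
  using L2_conv_lincomb[of M F f G g 1 "-1"] by simp

lemma L2_conv_inner_const:
  assumes "L2_conv M F f" "g \<in> L2 M"
  shows "(\<lambda>k. \<integral>x. F k x * g x \<partial>M) \<longlonglongrightarrow> (\<integral>x. f x * g x \<partial>M)"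
proof -
  note 1 = L2_convD[OF assms(1)]
  have lim: "(\<lambda>k. sqrt (\<integral>x. (F k x - f x)\<^sup>2 \<partial>M) * sqrt (\<integral>x. (g x)\<^sup>2 \<partial>M)) \<longlonglongrightarrow> sqrt 0 * sqrt (\<integral>x. (g x)\<^sup>2 \<partial>M)"
    by (intro tendsto_intros 1)
  have le: "norm ((\<integral>x. F k x * g x \<partial>M) - (\<integral>x. f x * g x \<partial>M))
      \<le> sqrt (\<integral>x. (F k x - f x)\<^sup>2 \<partial>M) * sqrt (\<integral>x. (g x)\<^sup>2 \<partial>M)" for k
  proof -
    have "(\<integral>x. F k x * g x \<partial>M) - (\<integral>x. f x * g x \<partial>M) = (\<integral>x. (F k x - f x) * g x \<partial>M)"
      unfolding left_diff_distrib using 1 assms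
      by (subst Bochner_Integration.integral_diff) (auto intro: L2_mult)
    then show ?thesis using L2_cauchy_schwarz_abs[OF L2_diff[OF 1(1) 1(2)] assms(2)] by simp
  qed
  have "(\<lambda>k. (\<integral>x. F k x * g x \<partial>M) - (\<integral>x. f x * g x \<partial>M)) \<longlonglongrightarrow> 0"
    by (rule Lim_null_comparison[OF always_eventually[OF allI[OF le]]]) (use lim in simp)
  then show ?thesis by (rule LIM_zero_cancel)
qed

lemma L2_conv_sq:
  assumes "L2_conv M F f"
  shows "(\<lambda>k. \<integral>x. (F k x)\<^sup>2 \<partial>M) \<longlonglongrightarrow> (\<integral>x. (f x)\<^sup>2 \<partial>M)"
proof -
  note 1 = L2_convD[OF assms]
  have "(\<integral>x. (F k x)\<^sup>2 \<partial>M) = (\<integral>x. (F k x - f x)\<^sup>2 \<partial>M) + 2 * (\<integral>x. F k x * f x \<partial>M) - (\<integral>x. (f x)\<^sup>2 \<partial>M)" for k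
    using L2_sq_add[OF 1(1)[of k] 1(2), of "-1"] by simp
  moreover have "(\<lambda>k. (\<integral>x. (F k x - f x)\<^sup>2 \<partial>M) + 2 * (\<integral>x. F k x * f x \<partial>M) - (\<integral>x. (f x)\<^sup>2 \<partial>M))
      \<longlonglongrightarrow> 0 + 2 * (\<integral>x. f x * f x \<partial>M) - (\<integral>x. (f x)\<^sup>2 \<partial>M)"
    by (intro tendsto_intros 1 L2_conv_inner_const[OF assms])
  ultimately show ?thesis by (simp add: power2_eq_square)
qed

lemma L2_conv_subseq:
  assumes "L2_conv M F f" "strict_mono r"
  shows "L2_conv M (\<lambda>k. F (r k)) f"
  using assms LIMSEQ_subseq_LIMSEQ[OF L2_convD(3)[OF assms(1)] assms(2)]
  by (simp add: L2_conv_def o_def)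

lemma L2_conv_AE_subseq:
  assumes "L2_conv M F f"
  obtains r where "strict_mono r" "AE x in M. (\<lambda>k. F (r k) x) \<longlonglongrightarrow> f x"
proof -
  note 1 = L2_convD[OF assms]
  have "\<exists>r. strict_mono r \<and> (AE x in M. (\<lambda>n. (F (r n) x - f x)\<^sup>2) \<longlonglongrightarrow> 0)"
    using 1(3) by (intro tendsto_L1_AE_subseq[of M "\<lambda>k x. (F k x - f x)\<^sup>2"] L2_integrable L2_diff 1) simp
  then obtain r where r: "strict_mono r" "AE x in M. (\<lambda>n. (F (r n) x - f x)\<^sup>2) \<longlonglongrightarrow> 0" by auto
  have sq: "(\<lambda>k. g k) \<longlonglongrightarrow> l" if "(\<lambda>k. (g k - l)\<^sup>2) \<longlonglongrightarrow> 0" for g :: "nat \<Rightarrow> real" and l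
    using tendsto_real_sqrt[OF that] by (simp add: tendsto_rabs_zero_iff LIM_zero_iff)
  have "AE x in M. (\<lambda>k. F (r k) x) \<longlonglongrightarrow> f x"
    using r(2) by eventually_elim (rule sq)
  with r(1) show ?thesis by (rule that)
qed

text \<open>Fatou's lemma for the squares. The bound is asked only eventually, as in the
  completeness proof, where only late differences are small.\<close>

lemma L2_fatou:
  assumes "\<And>n. G n \<in> L2 M" "g \<in> borel_measurable M"
    and "AE x in M. (\<lambda>n. G n x) \<longlonglongrightarrow> g x" "\<forall>\<^sub>F n in sequentially. (\<integral>x. (G n x)\<^sup>2 \<partial>M) \<le> C"
  shows "g \<in> L2 M" "(\<integral>x. (g x)\<^sup>2 \<partial>M) \<le> C"
proof -
  obtain n where "(\<integral>x. (G n x)\<^sup>2 \<partial>M) \<le> C" using assms(4) unfolding eventually_sequentially by blast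
  then have C: "0 \<le> C" by (rule order_trans[rotated]) simp
  have "(\<integral>\<^sup>+x. ennreal ((g x)\<^sup>2) \<partial>M) = (\<integral>\<^sup>+x. liminf (\<lambda>n. ennreal ((G n x)\<^sup>2)) \<partial>M)"
  proof (rule nn_integral_cong_AE, use assms(3) in eventually_elim)
    case (elim x)
    then have "(\<lambda>n. ennreal ((G n x)\<^sup>2)) \<longlonglongrightarrow> ennreal ((g x)\<^sup>2)" by (intro tendsto_intros)
    then show ?case by (rule lim_imp_Liminf[OF trivial_limit_sequentially, symmetric])
  qed
  also have "\<dots> \<le> liminf (\<lambda>n. \<integral>\<^sup>+x. ennreal ((G n x)\<^sup>2) \<partial>M)"
    using assms(1) by (intro nn_integral_liminf) (auto simp: L2_def)
  also have "\<dots> = liminf (\<lambda>n. ennreal (\<integral>x. (G n x)\<^sup>2 \<partial>M))"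
    using assms(1) by (subst nn_integral_eq_integral) (auto simp: L2_def)
  also have "\<dots> \<le> limsup (\<lambda>n. ennreal (\<integral>x. (G n x)\<^sup>2 \<partial>M))"
    by (rule Liminf_le_Limsup) simp
  also have "\<dots> \<le> ennreal C"
    by (rule Limsup_bounded) (use assms(4) in \<open>auto elim!: eventually_mono intro: ennreal_leI\<close>)
  finally have le: "(\<integral>\<^sup>+x. ennreal ((g x)\<^sup>2) \<partial>M) \<le> ennreal C" .
  have "integrable M (\<lambda>x. (g x)\<^sup>2)"
    using assms(2) le by (intro integrableI_bounded) (auto simp: top_unique intro: le_less_trans)
  then show "g \<in> L2 M" using assms(2) by (simp add: L2_def)
  show "(\<integral>x. (g x)\<^sup>2 \<partial>M) \<le> C"
    using le C nn_integral_eq_integral[OF \<open>integrable M (\<lambda>x. (g x)\<^sup>2)\<close>] by simp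
qed

text \<open>Riesz-Fischer. Along a subsequence the squared distances of neighbours lie below 4^(-n).
  The weight 2^n keeps the integrals summable, and where the sum of 2^n d_n^2 is a finite number S
  one has |d_n| \<le> sqrt S * 2^(-n/2), so the telescoping series converges. Fatou's lemma, with
  one index fixed and the other sent to infinity along the subsequence, turns the pointwise limit
  into an L2 limit of the whole sequence.\<close>

lemma L2_complete:
  assumes F: "\<And>k. F k \<in> L2 M"
    and Cau: "\<And>e. e > 0 \<Longrightarrow> \<exists>N. \<forall>m\<ge>N. \<forall>n\<ge>N. (\<integral>x. (F m x - F n x)\<^sup>2 \<partial>M) < e"
  shows "\<exists>f. L2_conv M F f"
proof -
  have "\<exists>r. \<forall>n. (\<forall>i\<ge>r n. \<forall>j\<ge>r n. (\<integral>x. (F i x - F j x)\<^sup>2 \<partial>M) < (1/4) ^ n) \<and> r n < r (Suc n)"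
  proof (rule dependent_nat_choice)
    show "\<exists>x. \<forall>i\<ge>x. \<forall>j\<ge>x. (\<integral>y. (F i y - F j y)\<^sup>2 \<partial>M) < (1/4) ^ 0" using Cau[of 1] by simp
    fix x n
    obtain N where N: "\<forall>m\<ge>N. \<forall>n'\<ge>N. (\<integral>x. (F m x - F n' x)\<^sup>2 \<partial>M) < (1/4) ^ Suc n"
      using Cau[of "(1/4) ^ Suc n"] by auto
    show "\<exists>y. (\<forall>i\<ge>y. \<forall>j\<ge>y. (\<integral>x. (F i x - F j x)\<^sup>2 \<partial>M) < (1/4) ^ Suc n) \<and> x < y"
      by (rule exI[of _ "max N (Suc x)"]) (use N in auto)
  qed
  then obtain r where r: "\<And>n i j. i \<ge> r n \<Longrightarrow> j \<ge> r n \<Longrightarrow> (\<integral>x. (F i x - F j x)\<^sup>2 \<partial>M) < (1/4) ^ n"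
    "\<And>n. r n < r (Suc n)" by auto
  have rm: "strict_mono r" using r(2) by (simp add: strict_mono_Suc_iff)
  define d where "d n x = F (r (Suc n)) x - F (r n) x" for n x
  have dL2: "d n \<in> L2 M" for n unfolding d_def by (intro L2_diff F)
  have [measurable]: "d n \<in> borel_measurable M" "F n \<in> borel_measurable M" for n
    using dL2 F by (auto simp: L2_def)
  have dint: "(\<integral>\<^sup>+x. ennreal (2 ^ n * (d n x)\<^sup>2) \<partial>M) \<le> ennreal ((1/2) ^ n)" for n
  proof -
    have "(\<integral>\<^sup>+x. ennreal (2 ^ n * (d n x)\<^sup>2) \<partial>M) = ennreal (\<integral>x. 2 ^ n * (d n x)\<^sup>2 \<partial>M)"
      using dL2 by (intro nn_integral_eq_integral) (auto simp: L2_def)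
    also have "\<dots> = ennreal (2 ^ n * (\<integral>x. (d n x)\<^sup>2 \<partial>M))" by simp
    also have "\<dots> \<le> ennreal (2 ^ n * (1/4) ^ n)"
      using r(1)[of n "r (Suc n)" "r n"] r(2)[of n]
      by (intro ennreal_leI mult_left_mono) (auto simp: d_def)
    also have "2 ^ n * (1/4) ^ n = ((1/2) ^ n :: real)"
      by (simp flip: power_mult_distrib)
    finally show ?thesis .
  qed
  have "(\<integral>\<^sup>+x. (\<Sum>n. ennreal (2 ^ n * (d n x)\<^sup>2)) \<partial>M) = (\<Sum>n. \<integral>\<^sup>+x. ennreal (2 ^ n * (d n x)\<^sup>2) \<partial>M)"
    by (rule nn_integral_suminf) measurable
  also have "\<dots> \<le> (\<Sum>n. ennreal ((1/2) ^ n))"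
    by (intro suminf_le dint) auto
  also have "\<dots> < \<infinity>"
    by (simp add: suminf_ennreal_eq[OF _ geometric_sums] less_top)
  finally have "AE x in M. (\<Sum>n. ennreal (2 ^ n * (d n x)\<^sup>2)) \<noteq> \<infinity>"
    by (intro nn_integral_noteq_infinite) (auto simp: less_top)
  then have conv: "AE x in M. convergent (\<lambda>n. F (r n) x)"
  proof eventually_elim
    case (elim x)
    define S where "S = enn2real (\<Sum>n. ennreal (2 ^ n * (d n x)\<^sup>2))"
    have S: "(\<Sum>n. ennreal (2 ^ n * (d n x)\<^sup>2)) = ennreal S" "S \<ge> 0"
      using elim by (auto simp: S_def less_top)
    have b: "\<bar>d n x\<bar> \<le> sqrt S * (sqrt (1/2)) ^ n" for n
    proof -
      have "(\<Sum>i\<in>{n}. ennreal (2 ^ i * (d i x)\<^sup>2)) \<le> (\<Sum>i. ennreal (2 ^ i * (d i x)\<^sup>2))"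
        by (rule sum_le_suminf) (rule summableI, rule finite.insertI, rule finite.emptyI, rule zero_le)
      then have "ennreal (2 ^ n * (d n x)\<^sup>2) \<le> ennreal S"
        unfolding S(1) by (simp only: sum.insert_remove sum.empty finite.emptyI Diff_empty empty_Diff add_0_right)
      then have "2 ^ n * (d n x)\<^sup>2 \<le> S" using S(2) by (simp only: ennreal_le_iff)
      then have "(d n x)\<^sup>2 \<le> S * (1/2) ^ n" by (simp add: power_divide pos_le_divide_eq mult.commute)
      from real_sqrt_le_mono[OF this] show ?thesis
        unfolding real_sqrt_abs by (simp only: real_sqrt_mult real_sqrt_power)
    qed
    have "summable (\<lambda>n. d n x)"
      by (rule summable_comparison_test'[of "\<lambda>n. sqrt S * (sqrt (1/2)) ^ n"])
         (use b in \<open>auto intro!: summable_mult summable_geometric\<close>)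
    then have "convergent (\<lambda>n. \<Sum>i<n. d i x)" by (simp add: summable_iff_convergent)
    moreover have "(\<Sum>i<n. d i x) = F (r n) x - F (r 0) x" for n
      unfolding d_def by (rule sum_lessThan_telescope)
    ultimately have "convergent (\<lambda>n. F (r n) x - F (r 0) x)" by simp
    then have "convergent (\<lambda>n. (F (r n) x - F (r 0) x) + F (r 0) x)"
      by (intro convergent_add convergent_const)
    then show ?case by simp
  qed
  define f where "f x = lim (\<lambda>n. F (r n) x)" for x
  have fm[measurable]: "f \<in> borel_measurable M" unfolding f_def by measurable
  have lim: "AE x in M. (\<lambda>n. F (r n) x) \<longlonglongrightarrow> f x"
    using conv by eventually_elim (simp add: f_def convergent_LIMSEQ_iff)
  have le: "(\<lambda>x. F k x - f x) \<in> L2 M \<and> (\<integral>x. (F k x - f x)\<^sup>2 \<partial>M) \<le> (1/4) ^ m" if "k \<ge> r m" for k m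
  proof -
    have ev: "\<forall>\<^sub>F n in sequentially. (\<integral>x. (F k x - F (r n) x)\<^sup>2 \<partial>M) \<le> (1/4) ^ m"
      using eventually_ge_at_top[of m]
    proof eventually_elim
      case (elim n)
      then have "r m \<le> r n" using rm by (simp add: strict_mono_less_eq)
      then show ?case using r(1)[OF that] by (simp add: less_imp_le)
    qed
    have "AE x in M. (\<lambda>n. F k x - F (r n) x) \<longlonglongrightarrow> F k x - f x"
      using lim by eventually_elim (intro tendsto_intros)
    from L2_fatou[OF _ _ this ev] show ?thesis using F by (auto intro: L2_diff)
  qed
  have fL2: "f \<in> L2 M"
    using L2_diff[OF F[of "r 0"] conjunct1[OF le[of 0 "r 0"]]] by simp
  have "(\<lambda>k. \<integral>x. (F k x - f x)\<^sup>2 \<partial>M) \<longlonglongrightarrow> 0"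
  proof (rule LIMSEQ_I)
    fix e :: real assume "e > 0"
    then obtain m where m: "(1/4) ^ m < e" using real_arch_pow_inv[of e "1/4"] by auto
    then show "\<exists>no. \<forall>n\<ge>no. norm ((\<integral>x. (F n x - f x)\<^sup>2 \<partial>M) - 0) < e"
      using le by (intro exI[of _ "r m"]) (force intro: le_less_trans)
  qed
  then show ?thesis using F fL2 unfolding L2_conv_def by blast
qed

lemma L2_conv_unique:
  assumes "L2_conv M F f" "L2_conv M F g"
  shows "AE x in M. f x = g x"
proof -
  have "(\<integral>x. (f x - g x)\<^sup>2 \<partial>M) = 0"
    using L2_conv_sq[OF L2_conv_diff[OF assms]] by (simp add: LIMSEQ_const_iff)
  then have "AE x in M. (f x - g x)\<^sup>2 = 0"
    using integral_nonneg_eq_0_iff_AE[OF L2_integrable[OF L2_diff[OF L2_convD(2)[OF assms(1)] L2_convD(2)[OF assms(2)]]]]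
    by simp
  then show ?thesis by simp
qed

section \<open>The divergence theorem on the ball\<close>

lemma integral_lebesgue_on_borel:
  fixes f :: "'a::euclidean_space \<Rightarrow> real"
  assumes "f \<in> borel_measurable borel" "S \<in> sets borel"
  shows "(\<integral>x. f x \<partial>lebesgue_on S) = (\<integral>x. indicator S x * f x \<partial>lborel)"
  using assms by (subst integral_restrict_space) (simp_all add: integral_completion)

lemma integrable_lebesgue_on_borel:
  fixes f :: "'a::euclidean_space \<Rightarrow> real"
  assumes "f \<in> borel_measurable borel" "S \<in> sets borel"
  shows "integrable (lebesgue_on S) f \<longleftrightarrow> integrable lborel (\<lambda>x. indicator S x * f x)"
  using assms by (subst integrable_restrict_space) (simp_all add: integrable_completion)

lemma lborel_integral_translate:
  fixes f :: "'a::euclidean_space \<Rightarrow> real"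
  assumes [measurable]: "f \<in> borel_measurable borel"
  shows "(\<integral>x. f (c + x) \<partial>lborel) = (\<integral>x. f x \<partial>lborel)"
  by (subst (2) lborel_distr_plus[of c, symmetric]) (simp add: integral_distr)

lemma lborel_integrable_translate:
  fixes f :: "'a::euclidean_space \<Rightarrow> real"
  assumes [measurable]: "f \<in> borel_measurable borel"
  shows "integrable lborel (\<lambda>x. f (c + x)) \<longleftrightarrow> integrable lborel f"
  by (subst (2) lborel_distr_plus[of c, symmetric]) (simp add: integrable_distr_eq)

lemma lborel_integral_scale:
  fixes f :: "'a::euclidean_space \<Rightarrow> real"
  assumes [measurable]: "f \<in> borel_measurable borel" and c: "c \<noteq> 0"
  shows "(\<integral>x. f x \<partial>lborel) = \<bar>c\<bar> ^ DIM('a) * (\<integral>x. f (c *\<^sub>R x) \<partial>lborel)"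
  by (subst lborel_affine[OF c, of 0]) (simp add: integral_density integral_distr)

text \<open>The integral of \<open>g (x + t i) - g x\<close> vanishes by translation invariance; divide by \<open>t\<close>.\<close>

lemma lipschitz_integral_deriv_eq_0:
  fixes g :: "'a::euclidean_space \<Rightarrow> real"
  assumes [measurable]: "g \<in> borel_measurable borel" "g' \<in> borel_measurable borel"
    and i: "i \<in> Basis"
    and lip: "\<And>x t. 0 < t \<Longrightarrow> t \<le> 1 \<Longrightarrow> \<bar>g (x + t *\<^sub>R i) - g x\<bar> \<le> C * t * indicator (cball 0 2) x"
    and int: "integrable lborel g"
    and der: "AE x in lborel. \<exists>D. (g has_derivative D) (at x) \<and> D i = g' x"
  shows "(\<integral>x. g' x \<partial>lborel) = 0"
proof -
  define t :: "nat \<Rightarrow> real" where "t n = 1 / (real n + 1)" for n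
  have t: "0 < t n" "t n \<le> 1" for n by (auto simp: t_def)
  have t0: "filterlim t (at 0) sequentially"
  proof (rule filterlim_atI)
    show "t \<longlonglongrightarrow> 0" unfolding t_def[abs_def] by real_asymp
    show "\<forall>\<^sub>F n in sequentially. t n \<noteq> 0" using t(1) by (intro always_eventually) (metis less_irrefl)
  qed
  define q where "q n x = (g (x + t n *\<^sub>R i) - g x) / t n" for n x
  have [measurable]: "q n \<in> borel_measurable borel" for n unfolding q_def by measurable
  have q0: "(\<integral>x. q n x \<partial>lborel) = 0" for n
  proof -
    have "integrable lborel (\<lambda>x. g (x + t n *\<^sub>R i))"
      using int lborel_integrable_translate[of g "t n *\<^sub>R i"] by (simp add: add.commute)
    moreover have "(\<integral>x. g (x + t n *\<^sub>R i) \<partial>lborel) = (\<integral>x. g x \<partial>lborel)"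
      using lborel_integral_translate[of g "t n *\<^sub>R i"] by (simp add: add.commute)
    ultimately show ?thesis using int by (simp add: q_def)
  qed
  have "(\<lambda>n. \<integral>x. q n x \<partial>lborel) \<longlonglongrightarrow> (\<integral>x. g' x \<partial>lborel)"
  proof (rule integral_dominated_convergence[where w = "\<lambda>x. C * indicator (cball 0 2) x"])
    show "integrable lborel (\<lambda>x::'a. C * indicator (cball 0 2) x)"
      using emeasure_lborel_cball_finite[of "0::'a" 2]
      by (intro integrable_mult_right integrable_real_indicator) auto
    show "AE x in lborel. (\<lambda>n. q n x) \<longlonglongrightarrow> g' x"
      using der
    proof eventually_elim
      case (elim x)
      then obtain D where D: "(g has_derivative D) (at x)" "D i = g' x" by blast
      have lin: "D (h *\<^sub>R i) = h * g' x" for h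
        using D by (metis has_derivative_bounded_linear linear_simps(5) real_scaleR_def)
      have "((\<lambda>h. g (x + h *\<^sub>R i)) has_derivative (\<lambda>h. D (h *\<^sub>R i))) (at 0)"
        by (rule has_derivative_compose[where f = "\<lambda>h. x + h *\<^sub>R i" and g = g]) 
           (use D in \<open>auto intro!: derivative_eq_intros\<close>)
      then have "((\<lambda>h. g (x + h *\<^sub>R i)) has_real_derivative g' x) (at 0)"
        unfolding lin has_field_derivative_def by (simp add: mult.commute[of _ "g' x"])
      then have "((\<lambda>h. (g (x + h *\<^sub>R i) - g x) / h) \<longlongrightarrow> g' x) (at 0)"
        by (simp add: DERIV_def)
      from filterlim_compose[OF this t0] show ?case by (simp add: q_def)
    qed
    show "AE x in lborel. norm (q n x) \<le> C * indicator (cball 0 2) x" for n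
    proof (rule AE_I2)
      fix x
      have "\<bar>g (x + t n *\<^sub>R i) - g x\<bar> / t n \<le> C * indicator (cball 0 2) x"
        using lip[OF t(1) t(2), of x n] t(1)[of n] by (simp add: pos_divide_le_eq mult.commute mult.left_commute)
      then show "norm (q n x) \<le> C * indicator (cball 0 2) x"
        using t(1)[of n] by (simp add: q_def)
    qed
  qed measurable
  then show ?thesis unfolding q0 by (simp add: LIMSEQ_const_iff)
qed

lemma C_k_borel: "C_k k f \<Longrightarrow> f \<in> borel_measurable borel"
  by (intro borel_measurable_continuous_onI C_k_continuous)

lemma continuous_bounded_cball:
  fixes f :: "'a::euclidean_space \<Rightarrow> real"
  assumes "continuous_on UNIV f"
  obtains B where "B \<ge> 0" "\<And>x. norm x \<le> r \<Longrightarrow> \<bar>f x\<bar> \<le> B"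
proof -
  have "compact (f ` cball 0 r)"
    using assms by (intro compact_continuous_image continuous_on_subset[OF assms]) auto
  then obtain B where "\<forall>y\<in>f ` cball 0 r. norm y \<le> B" using compact_imp_bounded bounded_iff by blast
  then show ?thesis by (intro that[of "\<bar>B\<bar>"]) force+
qed

lemma C_1_lipschitz_cball:
  fixes F :: "'a::euclidean_space \<Rightarrow> real"
  assumes F: "C_k (Suc 0) F"
  obtains L where "L \<ge> 0" "\<And>x y. norm x \<le> r \<Longrightarrow> norm y \<le> r \<Longrightarrow> \<bar>F x - F y\<bar> \<le> L * norm (x - y)"
    "\<And>x i. i \<in> Basis \<Longrightarrow> norm x \<le> r \<Longrightarrow> \<bar>partial_deriv i F x\<bar> \<le> L"
proof -
  have "\<exists>B. \<forall>i\<in>Basis. B i \<ge> 0 \<and> (\<forall>x. norm x \<le> r \<longrightarrow> \<bar>partial_deriv i F x\<bar> \<le> B i)"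
  proof (rule bchoice, rule ballI)
    fix i :: 'a assume "i \<in> Basis"
    then have "continuous_on UNIV (partial_deriv i F)" using F by simp
    from continuous_bounded_cball[OF this, of r]
    show "\<exists>B\<ge>0. \<forall>x. norm x \<le> r \<longrightarrow> \<bar>partial_deriv i F x\<bar> \<le> B" by metis
  qed
  then obtain B where B: "\<And>i. i \<in> Basis \<Longrightarrow> B i \<ge> 0"
    "\<And>i x. i \<in> Basis \<Longrightarrow> norm x \<le> r \<Longrightarrow> \<bar>partial_deriv i F x\<bar> \<le> B i" by metis
  show thesis
  proof (rule that[of "\<Sum>i\<in>Basis. B i"])
    show "0 \<le> (\<Sum>i\<in>Basis. B i)" using B by (intro sum_nonneg)
    show "\<bar>partial_deriv i F x\<bar> \<le> (\<Sum>i\<in>Basis. B i)" if "i \<in> Basis" "norm x \<le> r" for x i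
      using B(2)[OF that] member_le_sum[of i Basis B] B(1) that by force
    fix x y :: 'a assume xy: "norm x \<le> r" "norm y \<le> r"
    have "norm (F x - F y) \<le> (\<Sum>i\<in>Basis. B i) * norm (x - y)"
    proof (rule differentiable_bound[where S = "cball 0 r"])
      fix z :: 'a assume z: "z \<in> cball 0 r"
      show "(F has_derivative (\<lambda>v. \<Sum>i\<in>Basis. (v \<bullet> i) * partial_deriv i F z)) (at z within cball 0 r)"
        by (rule has_derivative_at_withinI[OF C_k_Suc_has_derivative[OF F]])
      show "onorm (\<lambda>v. \<Sum>i\<in>Basis. (v \<bullet> i) * partial_deriv i F z) \<le> (\<Sum>i\<in>Basis. B i)"
      proof (rule onorm_le)
        fix v :: 'a
        have "norm (\<Sum>i\<in>Basis. (v \<bullet> i) * partial_deriv i F z) \<le> (\<Sum>i\<in>Basis. norm v * B i)"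
          by (intro order_trans[OF norm_sum] sum_mono)
             (use z B in \<open>auto simp: abs_mult Basis_le_norm intro!: mult_mono\<close>)
        then show "norm (\<Sum>i\<in>Basis. (v \<bullet> i) * partial_deriv i F z) \<le> (\<Sum>i\<in>Basis. B i) * norm v"
          by (simp add: sum_distrib_left mult.commute)
      qed
    qed (use xy in auto)
    then show "\<bar>F x - F y\<bar> \<le> (\<Sum>i\<in>Basis. B i) * norm (x - y)" by simp
  qed
qed

lemma AE_lborel_norm_neq: "AE x in lborel. norm (x :: 'a::euclidean_space) \<noteq> r"
proof -
  have "sphere (0::'a) r \<in> null_sets lborel"
    using negligible_sphere[of "0::'a" r]
    by (auto simp: negligible_iff_null_sets null_sets_completion_iff)
  from AE_not_in[OF this] show ?thesis by simp
qed

text \<open>The cutoff has gradient - sgn x / e on the annulus and 0 elsewhere. Its product with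
  \<open>F\<close> is Lipschitz with compact support and differentiable off two spheres, which are
  null sets, so its directional derivative has integral 0.\<close>

lemma C_1_cutoff_ibp:
  fixes F :: "'a::euclidean_space \<Rightarrow> real"
  assumes F: "C_k (Suc 0) F" and i: "i \<in> Basis" and e: "0 < e" "e < 1"
  shows "(\<integral>x. partial_deriv i F x * min 1 (max 0 ((1 - norm x) / e)) \<partial>lborel)
       = (\<integral>x. indicator {x. 1 - e \<le> norm x \<and> norm x < 1} x * (F x * (sgn x \<bullet> i)) / e \<partial>lborel)"
proof -
  define c :: "'a \<Rightarrow> real" where "c x = min 1 (max 0 ((1 - norm x) / e))" for x
  define A :: "'a set" where "A = {x. 1 - e \<le> norm x \<and> norm x < 1}"
  note Fd = C_k_Suc_has_derivative[OF F]
  have [measurable]: "F \<in> borel_measurable borel" "partial_deriv i F \<in> borel_measurable borel"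
    "c \<in> borel_measurable borel" "A \<in> sets borel"
    using F i C_k_borel[of 0 "partial_deriv i F"] C_k_borel[OF F] by (auto simp: c_def[abs_def] A_def)
  obtain B where B: "B \<ge> 0" "\<And>x. norm x \<le> 3 \<Longrightarrow> \<bar>F x\<bar> \<le> B"
    using continuous_bounded_cball[OF C_k_continuous[OF F], of 3] by metis
  obtain L where L: "L \<ge> 0" "\<And>x y. norm x \<le> 3 \<Longrightarrow> norm y \<le> 3 \<Longrightarrow> \<bar>F x - F y\<bar> \<le> L * norm (x - y)"
    "\<And>x. norm x \<le> 3 \<Longrightarrow> \<bar>partial_deriv i F x\<bar> \<le> L"
    using C_1_lipschitz_cball[OF F, of 3] i by metis
  have c01: "0 \<le> c x" "c x \<le> 1" for x by (auto simp: c_def)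
  have c0: "norm x \<ge> 1 \<Longrightarrow> c x = 0" for x using e by (simp add: c_def divide_nonpos_pos)
  have clip: "\<bar>c x - c y\<bar> \<le> norm (x - y) / e" for x y
  proof -
    have "\<bar>min 1 (max 0 a) - min 1 (max 0 b)\<bar> \<le> \<bar>a - b\<bar>" for a b :: real by linarith
    then have "\<bar>c x - c y\<bar> \<le> \<bar>(1 - norm x) / e - (1 - norm y) / e\<bar>" unfolding c_def .
    also have "\<dots> = \<bar>norm y - norm x\<bar> / e" using e by (simp add: diff_divide_distrib[symmetric])
    also have "\<dots> \<le> norm (x - y) / e"
      using norm_triangle_ineq3[of y x] e by (simp add: divide_right_mono norm_minus_commute)
    finally show ?thesis .
  qed
  define g where "g x = F x * c x" for x
  define g' where "g' x = partial_deriv i F x * c x - indicator A x * (F x * (sgn x \<bullet> i)) / e" for x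
  have gm[measurable]: "g \<in> borel_measurable borel" "g' \<in> borel_measurable borel"
    unfolding g_def g'_def by measurable
  have fin: "integrable lborel (\<lambda>x::'a. C * indicator (cball 0 2) x)" for C :: real
    using emeasure_lborel_cball_finite[of "0::'a" 2]
    by (intro integrable_mult_right integrable_real_indicator) auto
  have gint: "integrable lborel g"
    by (rule Bochner_Integration.integrable_bound[OF fin[of B]])
       (use B c01 c0 in \<open>auto simp: g_def abs_mult indicator_def intro!: mult_le_one mult_left_le[THEN order_trans]\<close>)
  have I: "integrable lborel (\<lambda>x. partial_deriv i F x * c x)"
  proof (rule Bochner_Integration.integrable_bound[OF fin[of L]], simp, rule AE_I2)
    fix x :: 'a
    have "\<bar>partial_deriv i F x\<bar> * \<bar>c x\<bar> \<le> L * 1" if "norm x \<le> 2"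
      by (rule mult_mono) (use L(3)[of x] c01[of x] that L(1) in auto)
    then show "norm (partial_deriv i F x * c x) \<le> norm (L * indicator (cball 0 2) x)"
      using c0[of x] L(1) by (auto simp: abs_mult indicator_def)
  qed
  have II: "integrable lborel (\<lambda>x. indicator A x * (F x * (sgn x \<bullet> i)) / e)"
  proof (rule Bochner_Integration.integrable_bound[OF fin[of "B / e"]], measurable, rule AE_I2)
    fix x :: 'a
    have "\<bar>sgn x \<bullet> i\<bar> \<le> 1" using Basis_le_norm[OF i, of "sgn x"] by (simp add: norm_sgn split: if_splits)
    then have "\<bar>F x\<bar> * \<bar>sgn x \<bullet> i\<bar> \<le> B * 1" if "norm x < 1"
      by (intro mult_mono) (use B(2)[of x] that B(1) in auto)
    then show "norm (indicator A x * (F x * (sgn x \<bullet> i)) / e) \<le> norm (B / e * indicator (cball 0 2) x)"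
      using B(1) e by (auto simp: abs_mult indicator_def A_def divide_right_mono)
  qed
  have "(\<integral>x. g' x \<partial>lborel) = 0"
  proof (rule lipschitz_integral_deriv_eq_0[OF gm i _ gint])
    fix x :: 'a and t :: real assume t: "0 < t" "t \<le> 1"
    define y where "y = x + t *\<^sub>R i"
    have yx: "norm (y - x) = t" using i t by (simp add: y_def)
    \<comment> \<open>A step of length at most 1 from outside \<open>cball 0 2\<close> does not
      enter the open unit ball, outside of which the cutoff vanishes; from inside it stays within
      radius 3, where \<open>B\<close> and \<open>L\<close> are valid.\<close>
    show "\<bar>g (x + t *\<^sub>R i) - g x\<bar> \<le> (B / e + L) * t * indicator (cball 0 2) x"
    proof (cases "norm x \<le> 2")
      case True
      then have y3: "norm y \<le> 3" using norm_triangle_ineq[of x "y - x"] yx t by simp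
      have "\<bar>g y - g x\<bar> = \<bar>F y * (c y - c x) + c x * (F y - F x)\<bar>" by (simp add: g_def algebra_simps)
      also have "\<dots> \<le> \<bar>F y\<bar> * \<bar>c y - c x\<bar> + \<bar>c x\<bar> * \<bar>F y - F x\<bar>"
        by (metis abs_mult abs_triangle_ineq)
      also have "\<dots> \<le> B * (t / e) + 1 * (L * t)"
        using B(1) B(2)[OF y3] clip[of y x] c01[of x] L(2)[of y x] y3 True yx L(1)
        by (intro add_mono mult_mono) auto
      finally show ?thesis using True by (simp add: y_def algebra_simps)
    next
      case False
      then have "norm y \<ge> 1" using norm_triangle_ineq2[of x "x - y"] yx t by (simp add: norm_minus_commute)
      then have "c y = 0" "c x = 0" using False c0 by auto
      then show ?thesis using False by (simp add: g_def y_def)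
    qed
  next
    show "AE x in lborel. \<exists>D. (g has_derivative D) (at x) \<and> D i = g' x"
      using AE_lborel_norm_neq[of 1] AE_lborel_norm_neq[of "1 - e"]
    proof eventually_elim
      case (elim x)
      consider "norm x < 1 - e" | "1 - e < norm x" "norm x < 1" | "norm x > 1" using elim by linarith
      then show ?case
      proof cases
        case 1
        have "(g has_derivative (\<lambda>v. \<Sum>j\<in>Basis. (v \<bullet> j) * partial_deriv j F x)) (at x)"
        proof (rule has_derivative_transform_within_open[OF Fd])
          show "open {x::'a. norm x < 1 - e}" by (intro open_Collect_less continuous_intros)
          show "F y = g y" if "y \<in> {x. norm x < 1 - e}" for y
            using that e by (simp add: g_def c_def min_def max_def le_divide_eq)
        qed (use 1 in simp)
        moreover have "c x = 1" using 1 e by (simp add: c_def min_def max_def le_divide_eq)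
        ultimately show ?thesis
          using 1 i by (intro exI conjI) (assumption, simp add: g'_def A_def sum_Basis_inner_mult)
      next
        case 2
        have x0: "x \<noteq> 0" using 2 e by auto
        have "((\<lambda>y. F y * ((1 - norm y) / e)) has_derivative
            (\<lambda>v. F x * (- (v \<bullet> sgn x) / e) + (\<Sum>j\<in>Basis. (v \<bullet> j) * partial_deriv j F x) * ((1 - norm x) / e))) (at x)"
        proof (rule has_derivative_mult[OF Fd])
          have "(norm has_derivative (\<lambda>v. v \<bullet> sgn x)) (at x)"
            using has_derivative_norm[OF x0] by (simp add: inner_commute)
          from has_derivative_diff[OF has_derivative_const[of 1] this]
          have "((\<lambda>y. (1 - norm y) * inverse e) has_derivative (\<lambda>v. (0 - v \<bullet> sgn x) * inverse e)) (at x)"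
            by (rule has_derivative_mult_left)
          then show "((\<lambda>y. (1 - norm y) / e) has_derivative (\<lambda>v. - (v \<bullet> sgn x) / e)) (at x)"
            by (simp add: divide_inverse)
        qed
        then have "(g has_derivative
            (\<lambda>v. F x * (- (v \<bullet> sgn x) / e) + (\<Sum>j\<in>Basis. (v \<bullet> j) * partial_deriv j F x) * ((1 - norm x) / e))) (at x)"
        proof (rule has_derivative_transform_within_open)
          show "open {x::'a. 1 - e < norm x \<and> norm x < 1}"
            by (intro open_Collect_conj open_Collect_less continuous_intros)
          show "F y * ((1 - norm y) / e) = g y" if "y \<in> {x. 1 - e < norm x \<and> norm x < 1}" for y
            using that e by (simp add: g_def c_def min_def max_def le_divide_eq divide_le_0_iff)
        qed (use 2 in simp)
        moreover have "c x = (1 - norm x) / e" using 2 e by (simp add: c_def min_def max_def le_divide_eq divide_le_0_iff)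
        ultimately show ?thesis using 2 i
          by (intro exI conjI) (assumption, simp add: g'_def A_def sum_Basis_inner_mult inner_commute)
      next
        case 3
        have "(g has_derivative (\<lambda>v. 0)) (at x)"
        proof (rule has_derivative_transform_within_open[OF has_derivative_const])
          show "open {x::'a. 1 < norm x}" by (intro open_Collect_less continuous_intros)
          show "0 = g y" if "y \<in> {x. 1 < norm x}" for y
            using that c0[of y] by (simp add: g_def)
        qed (use 3 in simp)
        moreover have "c x = 0" using 3 c0 by simp
        ultimately show ?thesis using 3 by (intro exI conjI) (assumption, simp add: g'_def A_def)
      qed
    qed
  qed
  moreover have "(\<integral>x. g' x \<partial>lborel) = (\<integral>x. partial_deriv i F x * c x \<partial>lborel) - (\<integral>x. indicator A x * (F x * (sgn x \<bullet> i)) / e \<partial>lborel)"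
    unfolding g'_def by (rule Bochner_Integration.integral_diff[OF I II])
  ultimately show ?thesis by (simp add: c_def A_def)
qed

section \<open>Polar coordinates and the surface measure of the sphere\<close>

lemma integral_homogeneous_ball:
  fixes h :: "'a::euclidean_space \<Rightarrow> real"
  assumes [measurable]: "h \<in> borel_measurable borel" and t: "0 < t"
  shows "(\<integral>x. indicator (ball 0 t) x * h (sgn x) \<partial>lborel) = t ^ DIM('a) * (\<integral>x. indicator (ball 0 1) x * h (sgn x) \<partial>lborel)"
proof -
  have m: "(\<lambda>x. h (sgn x)) \<in> borel_measurable borel"
    by (rule measurable_compose[OF borel_measurable_sgn assms(1)])
  have "(\<integral>x. indicator (ball 0 t) x * h (sgn x) \<partial>lborel)
      = \<bar>t\<bar> ^ DIM('a) * (\<integral>x. indicator (ball 0 t) (t *\<^sub>R x) * h (sgn (t *\<^sub>R x :: 'a)) \<partial>lborel)"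
    by (rule lborel_integral_scale[OF _ less_imp_neq[OF t, symmetric]]) (intro borel_measurable_times borel_measurable_indicator m, simp)
  moreover have "indicator (ball 0 t) (t *\<^sub>R x) * h (sgn (t *\<^sub>R x)) = indicator (ball 0 1) x * h (sgn x)" for x :: 'a
    using t by (simp add: indicator_def sgn_scaleR)
  ultimately show ?thesis using t by simp
qed

text \<open>As a density of an image measure the surface measure has transfer rules for integrals
  and null sets.\<close>

lemma sphere_measure_density:
  "(sphere_measure :: 'a::euclidean_space measure) =
    density (distr (restrict_space lborel (ball 0 1)) borel sgn) (\<lambda>_. ennreal (real DIM('a)))"
  unfolding sphere_measure_def by (rule measure_eqI) (simp_all add: emeasure_density_const)

lemma sgn_measurable_ball [measurable]:
  "sgn \<in> restrict_space lborel (ball 0 1) \<rightarrow>\<^sub>M (borel :: 'a::euclidean_space measure)"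
  by (rule measurable_restrict_space1) simp

lemma sets_sphere_measure [simp, measurable_cong]: "sets sphere_measure = sets borel"
  by (simp add: sphere_measure_def)

lemma integral_sphere_measure:
  fixes h :: "'a::euclidean_space \<Rightarrow> real"
  assumes [measurable]: "h \<in> borel_measurable borel"
  shows "(\<integral>x. h x \<partial>sphere_measure) = real DIM('a) * (\<integral>x. indicator (ball 0 1) x * h (sgn x) \<partial>lborel)"
  unfolding sphere_measure_density
  by (simp add: integral_density integral_distr integral_restrict_space)

lemma finite_sphere_measure: "finite_measure (sphere_measure :: 'a::euclidean_space measure)"
proof
  have "emeasure (sphere_measure :: 'a measure) UNIV
      = ennreal (real DIM('a)) * emeasure (restrict_space lborel (ball (0::'a) 1)) (sgn -` UNIV \<inter> space (restrict_space lborel (ball (0::'a) 1)))"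
    unfolding sphere_measure_def by (simp add: emeasure_distr)
  also have "\<dots> < \<infinity>"
    using emeasure_lborel_ball_finite[of "0::'a" 1]
    by (simp add: space_restrict_space emeasure_restrict_space ennreal_mult_less_top)
  finally have "emeasure (sphere_measure :: 'a measure) UNIV \<noteq> \<infinity>" by simp
  moreover have "space (sphere_measure :: 'a measure) = UNIV"
    by (simp add: sphere_measure_def space_scale_measure)
  ultimately show "emeasure (sphere_measure :: 'a measure) (space sphere_measure) \<noteq> \<infinity>"
    by simp
qed

text \<open>\<open>sgn\<close> sends the centre of the ball to 0 and not to the sphere; that single
  point is a null set.\<close>

lemma AE_sphere_measure: "AE x in (sphere_measure :: 'a::euclidean_space measure). norm x = 1"
proof -
  have "AE x in lborel. norm x \<noteq> 0 \<longrightarrow> norm (sgn x :: 'a) = 1" by (simp add: norm_sgn)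
  then have "AE x in lborel. norm (sgn x :: 'a) = 1"
    using AE_lborel_norm_neq[of 0] by eventually_elim auto
  then have "AE x in restrict_space lborel (ball 0 1). norm (sgn x :: 'a) = 1"
    by (subst AE_restrict_space_iff) auto
  then have "AE x in distr (restrict_space lborel (ball 0 1)) borel sgn. norm (x::'a) = 1"
    by (subst AE_distr_iff) auto
  then show ?thesis unfolding sphere_measure_density by (subst AE_density) auto
qed

lemma integrable_sphere_measure:
  fixes h :: "'a::euclidean_space \<Rightarrow> real"
  assumes "continuous_on UNIV h"
  shows "integrable sphere_measure h"
proof -
  interpret finite_measure "sphere_measure :: 'a measure" by (rule finite_sphere_measure)
  obtain B where B: "\<And>x. norm x \<le> 1 \<Longrightarrow> \<bar>h x\<bar> \<le> B"
    using continuous_bounded_cball[OF assms, of 1] by metis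
  have "AE x in sphere_measure. norm (h x) \<le> B"
    using AE_sphere_measure by eventually_elim (use B in auto)
  then show ?thesis
    using borel_measurable_continuous_onI[OF assms] by (intro integrable_const_bound) auto
qed

lemma integrable_bounded_ball:
  fixes f :: "'a::euclidean_space \<Rightarrow> real"
  assumes "f \<in> borel_measurable borel" "\<And>x. norm x < r \<Longrightarrow> \<bar>f x\<bar> \<le> B"
  shows "integrable lborel (\<lambda>x. indicator (ball 0 r) x * f x)"
proof (rule Bochner_Integration.integrable_bound)
  show "integrable lborel (\<lambda>x::'a. B * indicator (ball 0 r) x)"
    using emeasure_lborel_ball_finite[of "0::'a" r]
    by (intro integrable_mult_right integrable_real_indicator) auto
  show "AE x in lborel. norm (indicator (ball 0 r) x * f x) \<le> norm (B * indicator (ball 0 r) x)"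
  proof (rule AE_I2)
    fix x :: 'a
    show "norm (indicator (ball 0 r) x * f x) \<le> norm (B * indicator (ball 0 r) x)"
    proof (cases "norm x < r")
      case True
      then have "\<bar>f x\<bar> \<le> \<bar>B\<bar>" using assms(2)[of x] by linarith
      then show ?thesis using True by (simp add: abs_mult)
    qed simp
  qed
qed (use assms(1) in \<open>intro borel_measurable_times borel_measurable_indicator, simp_all\<close>)

lemma integral_homogeneous_annulus:
  fixes h :: "'a::euclidean_space \<Rightarrow> real"
  assumes m: "h \<in> borel_measurable borel" and b: "\<And>x. norm x \<le> 1 \<Longrightarrow> \<bar>h x\<bar> \<le> B" and t: "0 < t" "t < 1"
  shows "integrable lborel (\<lambda>x. indicator {x. t \<le> norm x \<and> norm x < 1} x * h (sgn x))"
    and "(\<integral>x. indicator {x. t \<le> norm x \<and> norm x < 1} x * h (sgn x) \<partial>lborel)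
      = (1 - t ^ DIM('a)) * (\<integral>x. indicator (ball 0 1) x * h (sgn x) \<partial>lborel)"
proof -
  have eq: "indicator {x. t \<le> norm x \<and> norm x < 1} x * h (sgn x)
      = indicator (ball 0 1) x * h (sgn x) - indicator (ball 0 t) x * h (sgn x)" for x :: 'a
    using t by (simp add: indicator_def)
  have sgn1: "norm (sgn x) \<le> 1" for x :: 'a by (simp add: norm_sgn)
  have i: "integrable lborel (\<lambda>x. indicator (ball 0 r) x * h (sgn x))" for r
    by (rule integrable_bounded_ball[where B = B]) (use b sgn1 measurable_compose[OF borel_measurable_sgn m] in auto)
  show "integrable lborel (\<lambda>x. indicator {x. t \<le> norm x \<and> norm x < 1} x * h (sgn x))"
    unfolding eq by (rule Bochner_Integration.integrable_diff[OF i i])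
  show "(\<integral>x. indicator {x. t \<le> norm x \<and> norm x < 1} x * h (sgn x) \<partial>lborel)
      = (1 - t ^ DIM('a)) * (\<integral>x. indicator (ball 0 1) x * h (sgn x) \<partial>lborel)"
    unfolding eq Bochner_Integration.integral_diff[OF i i] integral_homogeneous_ball[OF m t(1)]
    by (simp add: algebra_simps)
qed

text \<open>Integrate by parts against the cutoff \<open>min 1 ((1 - \<bar>x\<bar>) / e)\<close> and let \<open>e \<rightarrow> 0\<close>.\<close>

theorem divergence_ball:
  fixes F :: "'a::euclidean_space \<Rightarrow> real"
  assumes F: "C_k (Suc 0) F" and i: "i \<in> Basis"
  shows "(\<integral>x. partial_deriv i F x \<partial>lebesgue_on unit_ball) = (\<integral>x. F x * (x \<bullet> i) \<partial>sphere_measure)"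
proof -
  define e :: "nat \<Rightarrow> real" where "e n = inverse (real (Suc (Suc n)))" for n
  have e: "0 < e n" "e n < 1" for n by (auto simp: e_def inverse_less_1_iff)
  have e0: "e \<longlonglongrightarrow> 0" unfolding e_def[abs_def] using LIMSEQ_Suc[OF LIMSEQ_inverse_real_of_nat] by simp
  have [measurable]: "F \<in> borel_measurable borel" "partial_deriv i F \<in> borel_measurable borel"
    using F i C_k_borel[of 0 "partial_deriv i F"] C_k_borel[OF F] by auto
  obtain B where B: "B \<ge> 0" "\<And>x. norm x \<le> 1 \<Longrightarrow> \<bar>F x\<bar> \<le> B"
    using continuous_bounded_cball[OF C_k_continuous[OF F], of 1] by metis
  obtain L where L: "L \<ge> 0" "\<And>x y. norm x \<le> 1 \<Longrightarrow> norm y \<le> 1 \<Longrightarrow> \<bar>F x - F y\<bar> \<le> L * norm (x - y)"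
    "\<And>x. norm x \<le> 1 \<Longrightarrow> \<bar>partial_deriv i F x\<bar> \<le> L"
    using C_1_lipschitz_cball[OF F, of 1] i by metis
  define h where "h x = F x * (x \<bullet> i)" for x
  have hm[measurable]: "h \<in> borel_measurable borel" unfolding h_def by measurable
  have xi: "norm x \<le> 1 \<Longrightarrow> \<bar>x \<bullet> i\<bar> \<le> 1" for x using Basis_le_norm[OF i, of x] by simp
  have hB: "\<bar>h x\<bar> \<le> B" if "norm x \<le> 1" for x
    using mult_mono[OF B(2)[OF that] xi[OF that]] B(1) by (simp add: h_def abs_mult)
  define I where "I = (\<integral>x. indicator (ball 0 1) x * h (sgn x) \<partial>lborel)"
  define V :: real where "V = (\<integral>x. indicator (ball (0::'a) 1) x * (1::real) \<partial>lborel)"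
  define A :: "nat \<Rightarrow> 'a set" where "A n = {x. 1 - e n \<le> norm x \<and> norm x < 1}" for n
  have [measurable]: "A n \<in> sets borel" for n unfolding A_def by measurable
  define R where "R n = (\<integral>x. indicator (A n) x * (F x * (sgn x \<bullet> i)) / e n \<partial>lborel)" for n
  define J where "J n = (\<integral>x. indicator (A n) x * h (sgn x) / e n \<partial>lborel)" for n
  have sgn1: "norm (sgn x) \<le> 1" for x :: 'a by (simp add: norm_sgn)
  have J: "J n = (1 - (1 - e n) ^ DIM('a)) / e n * I" for n
    unfolding J_def I_def using integral_homogeneous_annulus(2)[OF hm hB, of "1 - e n"] e[of n]
    by (simp add: A_def)
  have intA: "integrable lborel (\<lambda>x. indicator (A n) x * (1::real))" for n
    using integral_homogeneous_annulus(1)[of "\<lambda>_::'a. 1" 1 "1 - e n"] e[of n] by (simp add: A_def)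
  have VA: "(\<integral>x. indicator (A n) x * (1::real) \<partial>lborel) = (1 - (1 - e n) ^ DIM('a)) * V" for n
    using integral_homogeneous_annulus(2)[of "\<lambda>_::'a. 1" 1 "1 - e n"] e[of n] by (simp add: A_def V_def)
  \<comment> \<open>Freezing \<open>F\<close> at the radial projection changes the integrand by at
    most \<open>L * e n / e n = L\<close>, on an annulus whose volume tends to 0.\<close>
  have RJ: "\<bar>R n - J n\<bar> \<le> L * ((1 - (1 - e n) ^ DIM('a)) * V)" for n
  proof -
    have J': "integrable lborel (\<lambda>x. indicator (A n) x * h (sgn x) / e n)"
      using integral_homogeneous_annulus(1)[OF hm hB, of "1 - e n"] e[of n] by (simp add: A_def)
    have "integrable lborel (\<lambda>x. indicator (A n) x * (F x * (sgn x \<bullet> i)))"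
    proof (rule Bochner_Integration.integrable_bound[OF integrable_mult_right[OF intA, of B]])
      show "AE x in lborel. norm (indicator (A n) x * (F x * (sgn x \<bullet> i))) \<le> norm (B * (indicator (A n) x * 1))"
      proof (rule AE_I2)
        fix x :: 'a
        have "\<bar>F x\<bar> * \<bar>sgn x \<bullet> i\<bar> \<le> B * 1" if "norm x < 1"
          by (rule mult_mono) (use B B(2)[of x] xi[OF sgn1] that in auto)
        then show "norm (indicator (A n) x * (F x * (sgn x \<bullet> i))) \<le> norm (B * (indicator (A n) x * 1))"
          using B(1) by (auto simp: A_def abs_mult indicator_def)
      qed
    qed measurable
    then have R': "integrable lborel (\<lambda>x. indicator (A n) x * (F x * (sgn x \<bullet> i)) / e n)" by simp
    have "\<bar>R n - J n\<bar> = \<bar>\<integral>x. indicator (A n) x * (F x * (sgn x \<bullet> i)) / e n - indicator (A n) x * h (sgn x) / e n \<partial>lborel\<bar>"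
      unfolding R_def J_def by (simp add: Bochner_Integration.integral_diff[OF R' J'])
    also have "\<dots> \<le> (\<integral>x. L * (indicator (A n) x * 1) \<partial>lborel)"
    proof (rule integral_abs_bound_integral)
      fix x :: 'a
      show "\<bar>indicator (A n) x * (F x * (sgn x \<bullet> i)) / e n - indicator (A n) x * h (sgn x) / e n\<bar>
          \<le> L * (indicator (A n) x * 1)"
      proof (cases "x \<in> A n")
        case True
        then have x: "1 - e n \<le> norm x" "norm x < 1" "x \<noteq> 0" using e[of n] by (auto simp: A_def)
        have "x - sgn x = (norm x - 1) *\<^sub>R sgn x"
          using x(3) by (simp add: sgn_div_norm algebra_simps)
        then have "norm (x - sgn x) = 1 - norm x" using x by (simp add: norm_sgn)
        then have "\<bar>F x - F (sgn x)\<bar> \<le> L * e n"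
          using L(2)[of x "sgn x"] x sgn1[of x] mult_left_mono[of "1 - norm x" "e n" L] L(1) by simp
        from mult_mono[OF this xi[OF sgn1[of x]]]
        have "\<bar>F x - F (sgn x)\<bar> * \<bar>sgn x \<bullet> i\<bar> \<le> L * e n" using L(1) e[of n] by simp
        then have "\<bar>F x - F (sgn x)\<bar> * \<bar>sgn x \<bullet> i\<bar> / e n \<le> L"
          using e[of n] by (simp add: pos_divide_le_eq)
        moreover have "indicator (A n) x * (F x * (sgn x \<bullet> i)) / e n - indicator (A n) x * h (sgn x) / e n
          = (F x - F (sgn x)) * (sgn x \<bullet> i) / e n"
          using True by (simp add: h_def diff_divide_distrib left_diff_distrib)
        ultimately show ?thesis using True e[of n] by (simp add: abs_mult)
      qed simp
    qed (use R' J' integrable_mult_right[OF intA] in auto)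
    also have "\<dots> = L * ((1 - (1 - e n) ^ DIM('a)) * V)" using VA[of n] by simp
    finally show ?thesis .
  qed
  \<comment> \<open>The relative volume of the annulus divided by \<open>e n\<close> is a difference
    quotient of the power function at 1; its limit is the factor \<open>DIM('a)\<close> in
    \<open>sphere_measure\<close>.\<close>
  have "((\<lambda>x. x ^ DIM('a)) has_real_derivative real DIM('a) * 1 ^ (DIM('a) - 1)) (at (1::real))"
    using DERIV_pow[of "DIM('a)" "1::real" UNIV] by simp
  then have "((\<lambda>h. ((1 + h) ^ DIM('a) - 1) / h) \<longlongrightarrow> real DIM('a)) (at (0::real))"
    by (simp add: DERIV_def)
  moreover have "filterlim (\<lambda>n. - e n) (at 0) sequentially"
  proof (rule filterlim_atI)
    show "(\<lambda>n. - e n) \<longlonglongrightarrow> 0" using tendsto_minus[OF e0] by simp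
    show "\<forall>\<^sub>F n in sequentially. - e n \<noteq> 0" using e(1) by (intro always_eventually) (metis less_irrefl neg_equal_0_iff_equal)
  qed
  ultimately have "(\<lambda>n. ((1 + - e n) ^ DIM('a) - 1) / (- e n)) \<longlonglongrightarrow> real DIM('a)"
    by (rule filterlim_compose)
  then have quot: "(\<lambda>n. (1 - (1 - e n) ^ DIM('a)) / e n) \<longlonglongrightarrow> real DIM('a)"
    by (simp add: minus_divide_left[symmetric] minus_divide_right diff_divide_distrib)
  have "(\<lambda>n. J n) \<longlonglongrightarrow> real DIM('a) * I" unfolding J by (intro tendsto_mult quot tendsto_const)
  moreover have "(\<lambda>n. R n - J n) \<longlonglongrightarrow> 0"
  proof (rule Lim_null_comparison[OF always_eventually])
    show "\<forall>n. norm (R n - J n) \<le> L * ((1 - (1 - e n) ^ DIM('a)) * V)" using RJ by simp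
    have "(\<lambda>n. L * ((1 - (1 - e n) ^ DIM('a)) * V)) \<longlonglongrightarrow> L * ((1 - (1 - 0) ^ DIM('a)) * V)"
      by (intro tendsto_intros e0)
    then show "(\<lambda>n. L * ((1 - (1 - e n) ^ DIM('a)) * V)) \<longlonglongrightarrow> 0" by simp
  qed
  ultimately have "(\<lambda>n. J n + (R n - J n)) \<longlonglongrightarrow> real DIM('a) * I + 0" by (rule tendsto_add)
  then have R: "R \<longlonglongrightarrow> real DIM('a) * I" by simp
  have "(\<lambda>n. \<integral>x. partial_deriv i F x * min 1 (max 0 ((1 - norm x) / e n)) \<partial>lborel)
      \<longlonglongrightarrow> (\<integral>x. indicator (ball 0 1) x * partial_deriv i F x \<partial>lborel)"
  proof (rule integral_dominated_convergence)
    show "integrable lborel (\<lambda>x. indicator (ball 0 1) x * L)"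
      by (rule integrable_bounded_ball[where B = L]) (use L in auto)
    show "AE x in lborel. (\<lambda>n. partial_deriv i F x * min 1 (max 0 ((1 - norm x) / e n)))
        \<longlonglongrightarrow> indicator (ball 0 1) x * partial_deriv i F x"
    proof (rule AE_I2)
      fix x :: 'a
      show "(\<lambda>n. partial_deriv i F x * min 1 (max 0 ((1 - norm x) / e n)))
        \<longlonglongrightarrow> indicator (ball 0 1) x * partial_deriv i F x"
      proof (cases "norm x < 1")
        case True
        then have "\<forall>\<^sub>F n in sequentially. e n < 1 - norm x" using order_tendstoD(2)[OF e0, of "1 - norm x"] by simp
        then have "\<forall>\<^sub>F n in sequentially. partial_deriv i F x * min 1 (max 0 ((1 - norm x) / e n))
            = indicator (ball 0 1) x * partial_deriv i F x"
        proof eventually_elim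
          case (elim n)
          then have "(1 - norm x) / e n \<ge> 1" using e(1)[of n] by (simp add: le_divide_eq)
          then show ?case using True by simp
        qed
        then show ?thesis by (rule tendsto_eventually)
      next
        case False
        then have "(1 - norm x) / e n \<le> 0" for n using e(1)[of n] by (simp add: divide_nonpos_pos)
        then have "max 0 ((1 - norm x) / e n) = 0" for n by (rule max_absorb1)
        then show ?thesis using False by simp
      qed
    qed
    show "AE x in lborel. norm (partial_deriv i F x * min 1 (max 0 ((1 - norm x) / e n))) \<le> indicator (ball 0 1) x * L" for n
    proof (rule AE_I2)
      fix x :: 'a
      show "norm (partial_deriv i F x * min 1 (max 0 ((1 - norm x) / e n))) \<le> indicator (ball 0 1) x * L"
      proof (cases "norm x < 1")
        case True
        have "\<bar>partial_deriv i F x\<bar> * \<bar>min 1 (max 0 ((1 - norm x) / e n))\<bar> \<le> L * 1"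
          by (rule mult_mono) (use L(1) L(3)[of x] True in auto)
        then show ?thesis using True by (simp add: abs_mult)
      next
        case False
        then have "(1 - norm x) / e n \<le> 0" using e(1)[of n] by (simp add: divide_nonpos_pos)
        then have "max 0 ((1 - norm x) / e n) = 0" by (rule max_absorb1)
        then show ?thesis using False by simp
      qed
    qed
  next
    have p: "partial_deriv i F \<in> borel_measurable lborel" by simp
    then show "(\<lambda>x. indicator (ball 0 1) x * partial_deriv i F x) \<in> borel_measurable lborel"
      by (intro borel_measurable_times borel_measurable_indicator) simp_all
    have c: "(\<lambda>x::'a. min 1 (max 0 ((1 - norm x) / e n))) \<in> borel_measurable lborel" for n by measurable
    show "(\<lambda>x. partial_deriv i F x * min 1 (max 0 ((1 - norm x) / e n))) \<in> borel_measurable lborel" for n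
      by (intro borel_measurable_times p c)
  qed
  moreover have "(\<integral>x. partial_deriv i F x * min 1 (max 0 ((1 - norm x) / e n)) \<partial>lborel) = R n" for n
    using C_1_cutoff_ibp[OF F i e] by (simp add: R_def A_def)
  ultimately have "R \<longlonglongrightarrow> (\<integral>x. indicator (ball 0 1) x * partial_deriv i F x \<partial>lborel)" by simp
  then have "(\<integral>x. indicator (ball 0 1) x * partial_deriv i F x \<partial>lborel) = real DIM('a) * I"
    using R LIMSEQ_unique by blast
  then show ?thesis
    using integral_sphere_measure[OF hm] integral_lebesgue_on_borel[of "partial_deriv i F" "ball 0 1"]
    by (simp add: I_def h_def)
qed

section \<open>Mollification\<close>

lemma lborel_integral_affine:
  fixes f :: "'a::euclidean_space \<Rightarrow> real"
  assumes [measurable]: "f \<in> borel_measurable borel" and c: "c \<noteq> 0"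
  shows "(\<integral>x. f x \<partial>lborel) = \<bar>c\<bar> ^ DIM('a) * (\<integral>x. f (t + c *\<^sub>R x) \<partial>lborel)"
  by (subst lborel_affine[OF c, of t]) (simp add: integral_density integral_distr)

lemma lborel_integrable_affine:
  fixes f :: "'a::euclidean_space \<Rightarrow> real"
  assumes [measurable]: "f \<in> borel_measurable borel" and c: "c \<noteq> 0"
  shows "integrable lborel (\<lambda>x. f (t + c *\<^sub>R x)) \<longleftrightarrow> integrable lborel f"
  using c by (subst (2) lborel_affine[OF c, of t]) (simp add: integrable_density integrable_distr_eq integrable_mult_left_iff)

lemma borel_affine_compose:
  fixes f :: "'a::euclidean_space \<Rightarrow> real"
  assumes "f \<in> borel_measurable borel"
  shows "(\<lambda>x. f (t + c *\<^sub>R x)) \<in> borel_measurable borel" "(\<lambda>x. f (c *\<^sub>R x - t)) \<in> borel_measurable borel"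
  using assms by measurable

lemma L2_lborel_affine:
  fixes g :: "'a::euclidean_space \<Rightarrow> real"
  assumes "g \<in> L2 lborel" "c \<noteq> 0"
  shows "(\<lambda>x. g (c *\<^sub>R x - v)) \<in> L2 lborel"
    and "(\<integral>x. (g (c *\<^sub>R x - v))\<^sup>2 \<partial>lborel) = (\<integral>x. (g x)\<^sup>2 \<partial>lborel) / \<bar>c\<bar> ^ DIM('a)"
proof -
  have [measurable]: "g \<in> borel_measurable borel" using L2_measurable[OF assms(1)] by simp
  have "integrable lborel (\<lambda>x. (g (c *\<^sub>R x - v))\<^sup>2)"
    using lborel_integrable_affine[of "\<lambda>x. (g x)\<^sup>2" c "- v"] assms L2_integrable[OF assms(1)] by simp
  then show "(\<lambda>x. g (c *\<^sub>R x - v)) \<in> L2 lborel"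
    using borel_affine_compose(2)[of g c v] by (simp add: L2_def)
  show "(\<integral>x. (g (c *\<^sub>R x - v))\<^sup>2 \<partial>lborel) = (\<integral>x. (g x)\<^sup>2 \<partial>lborel) / \<bar>c\<bar> ^ DIM('a)"
    using lborel_integral_affine[of "\<lambda>x. (g x)\<^sup>2" c "- v"] assms(2) by simp
qed

lemma L2_lborel_affine_le:
  fixes g :: "'a::euclidean_space \<Rightarrow> real"
  assumes "g \<in> L2 lborel" "c \<ge> 1"
  shows "(\<integral>x. (g (c *\<^sub>R x - v))\<^sup>2 \<partial>lborel) \<le> (\<integral>x. (g x)\<^sup>2 \<partial>lborel)"
proof -
  have p: "1 \<le> \<bar>c\<bar> ^ DIM('a)" using assms(2) by (intro one_le_power) simp
  then have "(\<integral>x. (g x)\<^sup>2 \<partial>lborel) * 1 \<le> (\<integral>x. (g x)\<^sup>2 \<partial>lborel) * \<bar>c\<bar> ^ DIM('a)"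
    by (intro mult_left_mono) simp_all
  with p show ?thesis
    using L2_lborel_affine(2)[OF assms(1), of c v] assms(2) by (simp add: pos_divide_le_eq)
qed

lemma power2_le_indicator:
  "\<bar>a\<bar> \<le> B * indicator S x \<Longrightarrow> norm (a\<^sup>2) \<le> B\<^sup>2 * indicator S x" for a B :: real
  by (cases "x \<in> S") (auto dest: power_mono[of "\<bar>a\<bar>" B 2])

lemma integral_tendsto_0_cball:
  fixes F :: "nat \<Rightarrow> 'a::euclidean_space \<Rightarrow> real"
  assumes "\<And>k. F k \<in> borel_measurable borel" "\<And>k x. \<bar>F k x\<bar> \<le> B * indicator (cball 0 r) x"
    and "AE x in lborel. (\<lambda>k. F k x) \<longlonglongrightarrow> 0"
  shows "(\<lambda>k. \<integral>x. (F k x)\<^sup>2 \<partial>lborel) \<longlonglongrightarrow> 0"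
proof -
  have "(\<lambda>k. \<integral>x. (F k x)\<^sup>2 \<partial>lborel) \<longlonglongrightarrow> (\<integral>x. (0::real) \<partial>(lborel :: 'a measure))"
  proof (rule integral_dominated_convergence)
    show "integrable lborel (\<lambda>x::'a. B\<^sup>2 * indicator (cball 0 r) x)"
      using emeasure_lborel_cball_finite[of "0::'a" r]
      by (intro integrable_mult_right integrable_real_indicator) auto
    show "AE x in lborel. (\<lambda>k. (F k x)\<^sup>2) \<longlonglongrightarrow> 0"
      using assms(3)
    proof eventually_elim
      case (elim x)
      from tendsto_power[OF elim, of 2] show ?case by simp
    qed
    show "AE x in lborel. norm ((F k x)\<^sup>2) \<le> B\<^sup>2 * indicator (cball 0 r) x" for k
      by (intro AE_I2 power2_le_indicator assms(2))
    show "(\<lambda>x. (F k x)\<^sup>2) \<in> borel_measurable lborel" for k using assms(1)[of k] by simp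
  qed simp
  then show ?thesis by simp
qed

text \<open>Clipping to [-M, M] costs little by dominated convergence. The clipped function is an
  almost everywhere limit of continuous functions; clipping these too and multiplying by a cutoff
  that is 1 on the unit ball and 0 beyond radius 2 makes dominated convergence applicable again. The
  two errors e/4 add up to e through the factor 2 of \<open>L2_triangle_sq\<close>.\<close>

lemma continuous_approx_L2:
  fixes g :: "'a::euclidean_space \<Rightarrow> real"
  assumes g: "g \<in> L2 lborel" and supp: "\<And>x. norm x > 1 \<Longrightarrow> g x = 0" and e: "e > 0"
  obtains h B where "continuous_on UNIV h" "\<And>x. \<bar>h x\<bar> \<le> B * indicator (cball 0 2) x" "B \<ge> 0"
    "h \<in> L2 lborel" "(\<integral>x. (g x - h x)\<^sup>2 \<partial>lborel) < e"
proof -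
  have gm[measurable]: "g \<in> borel_measurable borel" using L2_measurable[OF g] by simp
  define cl where "cl M t = max (- M) (min M t)" for M t :: real
  have "(\<lambda>n. \<integral>x. (g x - cl (real n) (g x))\<^sup>2 \<partial>lborel) \<longlonglongrightarrow> (\<integral>x. (0::real) \<partial>(lborel :: 'a measure))"
  proof (rule integral_dominated_convergence[OF _ _ L2_integrable[OF g]])
    show "AE x in lborel. (\<lambda>n. (g x - cl (real n) (g x))\<^sup>2) \<longlonglongrightarrow> 0"
    proof (rule AE_I2, rule tendsto_eventually)
      fix x
      have "\<forall>\<^sub>F n in sequentially. \<bar>g x\<bar> \<le> real n"
        by (meson eventually_sequentiallyI order_trans of_nat_le_iff real_arch_simple)
      then show "\<forall>\<^sub>F n in sequentially. (g x - cl (real n) (g x))\<^sup>2 = 0"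
        by eventually_elim (auto simp: cl_def)
    qed
    show "AE x in lborel. norm ((g x - cl (real n) (g x))\<^sup>2) \<le> (g x)\<^sup>2" for n
    proof (rule AE_I2)
      fix x
      have "\<bar>g x - cl (real n) (g x)\<bar> \<le> \<bar>g x\<bar>" by (auto simp: cl_def)
      then show "norm ((g x - cl (real n) (g x))\<^sup>2) \<le> (g x)\<^sup>2"
        using abs_le_square_iff[of "g x - cl (real n) (g x)" "g x"] by simp
    qed
  qed (simp_all add: cl_def)
  then have "\<forall>\<^sub>F n in sequentially. (\<integral>x. (g x - cl (real n) (g x))\<^sup>2 \<partial>lborel) < e / 4"
    using e by (intro order_tendstoD(2)[where y = 0]) simp_all
  then obtain n :: nat where n: "(\<integral>x. (g x - cl (real n) (g x))\<^sup>2 \<partial>lborel) < e / 4"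
    by (auto simp: eventually_sequentially)
  define M where "M = real n"
  have M: "M \<ge> 0" by (simp add: M_def)
  define g1 where "g1 x = cl M (g x)" for x
  have g1m[measurable]: "g1 \<in> borel_measurable borel" unfolding g1_def cl_def by measurable
  have g1L: "g1 \<in> L2 lborel"
    by (rule L2_bounded[OF g, where C = 1]) (use M in \<open>auto simp: g1_def cl_def\<close>)
  have "g1 measurable_on UNIV"
    by (rule lebesgue_measurable_imp_measurable_on_real) (simp_all add: measurable_completion)
  then obtain S hh where S: "negligible S" "\<And>n. continuous_on UNIV (hh n)"
    "\<And>x. x \<notin> S \<Longrightarrow> (\<lambda>n. hh n x) \<longlonglongrightarrow> g1 x"
    unfolding measurable_on_def by auto
  define \<theta> where "\<theta> x = max 0 (min 1 (2 - norm x))" for x :: 'a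
  define H where "H k x = cl M (hh k x) * \<theta> x" for k x
  have \<theta>: "0 \<le> \<theta> x" "\<theta> x \<le> 1" for x by (auto simp: \<theta>_def)
  have Hc: "continuous_on UNIV (H k)" for k
    unfolding H_def cl_def \<theta>_def by (intro continuous_intros S)
  have Hb: "\<bar>H k x\<bar> \<le> M * indicator (cball 0 2) x" for k x
  proof (cases "norm x \<le> 2")
    case True
    have "\<bar>cl M (hh k x)\<bar> * \<bar>\<theta> x\<bar> \<le> M * 1"
      by (rule mult_mono) (use M \<theta>[of x] in \<open>auto simp: cl_def\<close>)
    then show ?thesis using True by (simp add: H_def abs_mult)
  qed (simp add: H_def \<theta>_def)
  have Hm[measurable]: "H k \<in> borel_measurable borel" for k
    by (rule borel_measurable_continuous_onI[OF Hc])
  have HL: "H k \<in> L2 lborel" for k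
  proof -
    have "integrable lborel (\<lambda>x. (H k x)\<^sup>2)"
    proof (rule Bochner_Integration.integrable_bound)
      show "integrable lborel (\<lambda>x::'a. M\<^sup>2 * indicator (cball 0 2) x)"
        using emeasure_lborel_cball_finite[of "0::'a" 2]
        by (intro integrable_mult_right integrable_real_indicator) auto
      show "AE x in lborel. norm ((H k x)\<^sup>2) \<le> norm (M\<^sup>2 * indicator (cball 0 2) x)"
      proof (rule AE_I2)
        fix x
        show "norm ((H k x)\<^sup>2) \<le> norm (M\<^sup>2 * indicator (cball 0 2) x)"
          using power2_le_indicator[OF Hb[of k x]] by simp
      qed
    qed simp
    then show ?thesis by (simp add: L2_def)
  qed
  have "S \<in> null_sets lebesgue" using S(1) by (simp add: negligible_iff_null_sets)
  then have "AE x in lebesgue. x \<notin> S" by (rule AE_not_in)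
  then have AES: "AE x in lborel. x \<notin> S" by (simp add: AE_completion_iff)
  have "(\<lambda>k. \<integral>x. (H k x - g1 x)\<^sup>2 \<partial>lborel) \<longlonglongrightarrow> 0"
  proof (rule integral_tendsto_0_cball[where B = "2 * M" and r = 2])
    have g1b: "\<bar>g1 x\<bar> \<le> M * indicator (cball 0 2) x" for x
      using supp[of x] M by (auto simp: g1_def cl_def indicator_def)
    show "\<bar>H k x - g1 x\<bar> \<le> 2 * M * indicator (cball 0 2) x" for k x
      using Hb[of k x] g1b[of x] by linarith
    show "AE x in lborel. (\<lambda>k. H k x - g1 x) \<longlonglongrightarrow> 0"
      using AES
    proof eventually_elim
      case (elim x)
      have "(\<lambda>k. H k x - g1 x) \<longlonglongrightarrow> cl M (g1 x) * \<theta> x - g1 x"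
        unfolding H_def cl_def by (intro tendsto_intros S(3) elim)
      also have "cl M (g1 x) * \<theta> x - g1 x = 0"
        using supp[of x] M by (cases "norm x > 1") (auto simp: g1_def cl_def \<theta>_def)
      finally show ?case .
    qed
  qed measurable
  then have "\<forall>\<^sub>F k in sequentially. (\<integral>x. (H k x - g1 x)\<^sup>2 \<partial>lborel) < e / 4"
    using e by (intro order_tendstoD(2)[where y = 0]) simp_all
  then obtain k where k: "(\<integral>x. (H k x - g1 x)\<^sup>2 \<partial>lborel) < e / 4"
    by (auto simp: eventually_sequentially)
  have "(\<integral>x. (g x - H k x)\<^sup>2 \<partial>lborel) = (\<integral>x. ((g x - g1 x) - (H k x - g1 x))\<^sup>2 \<partial>lborel)" by simp
  also have "\<dots> \<le> 2 * (\<integral>x. (g x - g1 x)\<^sup>2 \<partial>lborel) + 2 * (\<integral>x. (H k x - g1 x)\<^sup>2 \<partial>lborel)"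
    by (intro L2_triangle_sq L2_diff g g1L HL)
  also have "\<dots> < e" using n k by (simp add: g1_def M_def)
  finally show ?thesis using that[OF Hc Hb M HL] by blast
qed

text \<open>Dilations by \<open>c k \<ge> 1\<close> and translations do not increase the L2 norm, so
  the error of a continuous approximation is controlled uniformly in \<open>k\<close>, and for
  continuous functions of compact support the claim is dominated convergence.\<close>

lemma L2_affine_continuity:
  fixes g :: "'a::euclidean_space \<Rightarrow> real"
  assumes g: "g \<in> L2 lborel" and supp: "\<And>x. norm x > 1 \<Longrightarrow> g x = 0"
    and c: "c \<longlonglongrightarrow> 1" "\<And>k. c k \<ge> 1" and v: "v \<longlonglongrightarrow> 0"
  shows "(\<lambda>k. \<integral>x. (g (c k *\<^sub>R x - v k) - g x)\<^sup>2 \<partial>lborel) \<longlonglongrightarrow> 0"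
proof (rule LIMSEQ_I)
  fix e :: real assume e: "e > 0"
  \<comment> \<open>Two applications of the triangle inequality with factor 2 give at most (4 + 4 +
    2) * e/16 < e.\<close>
  then have e8: "e / 16 > 0" by simp
  obtain h B where h: "continuous_on UNIV h" "\<And>x. \<bar>h x\<bar> \<le> B * indicator (cball 0 2) x" "B \<ge> 0"
    "h \<in> L2 lborel" "(\<integral>x. (g x - h x)\<^sup>2 \<partial>lborel) < e / 16"
    using continuous_approx_L2[OF g supp e8] by blast
  have [measurable]: "h \<in> borel_measurable borel" by (rule borel_measurable_continuous_onI[OF h(1)])
  obtain V where V: "V > 0" "\<And>k. norm (v k) \<le> V" using convergent_imp_Bseq[OF convergentI[OF v]] by (auto simp: Bseq_def)
  have ck: "c k \<noteq> 0" for k using c(2)[of k] by auto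
  have "(\<lambda>k. \<integral>x. (h (c k *\<^sub>R x - v k) - h x)\<^sup>2 \<partial>lborel) \<longlonglongrightarrow> 0"
  proof (rule integral_tendsto_0_cball[where B = "2 * B" and r = "2 + V"])
    show "\<bar>h (c k *\<^sub>R x - v k) - h x\<bar> \<le> 2 * B * indicator (cball 0 (2 + V)) x" for k x
    proof (cases "norm x \<le> 2 + V")
      case True
      have "\<bar>h y\<bar> \<le> B" for y
        by (rule order_trans[OF h(2)[of y]]) (use h(3) in \<open>auto simp: indicator_def\<close>)
      from this[of x] this[of "c k *\<^sub>R x - v k"] show ?thesis using True by simp
    next
      case False
      have "norm x \<le> norm (c k *\<^sub>R x)" using c(2)[of k] mult_right_mono[of 1 "c k" "norm x"] by simp
      also have "\<dots> \<le> norm (c k *\<^sub>R x - v k) + V" using norm_triangle_sub[of "c k *\<^sub>R x" "v k"] V(2)[of k] by simp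
      finally have "norm (c k *\<^sub>R x - v k) > 2" using False by simp
      moreover have "norm x > 2" using False V(1) by simp
      moreover have "h y = 0" if "norm y > 2" for y using h(2)[of y] that by simp
      ultimately show ?thesis using h(3) by simp
    qed
    show "AE x in lborel. (\<lambda>k. h (c k *\<^sub>R x - v k) - h x) \<longlonglongrightarrow> 0"
    proof (rule AE_I2)
      fix x :: 'a
      have "(\<lambda>k. c k *\<^sub>R x - v k) \<longlonglongrightarrow> 1 *\<^sub>R x - 0" by (intro tendsto_intros c v)
      then have "(\<lambda>k. h (c k *\<^sub>R x - v k)) \<longlonglongrightarrow> h x"
        by (intro continuous_on_tendsto_compose[OF h(1)]) simp_all
      then show "(\<lambda>k. h (c k *\<^sub>R x - v k) - h x) \<longlonglongrightarrow> 0" by (simp add: LIM_zero)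
    qed
  qed measurable
  then have "\<forall>\<^sub>F k in sequentially. (\<integral>x. (h (c k *\<^sub>R x - v k) - h x)\<^sup>2 \<partial>lborel) < e / 16"
    using e by (intro order_tendstoD(2)[where y = 0]) simp_all
  then obtain K where K: "\<And>k. k \<ge> K \<Longrightarrow> (\<integral>x. (h (c k *\<^sub>R x - v k) - h x)\<^sup>2 \<partial>lborel) < e / 16"
    by (auto simp: eventually_sequentially)
  show "\<exists>no. \<forall>n\<ge>no. norm ((\<integral>x. (g (c n *\<^sub>R x - v n) - g x)\<^sup>2 \<partial>lborel) - 0) < e"
  proof (intro exI allI impI)
    fix k assume k: "k \<ge> K"
    define d where "d x = g x - h x" for x
    have dL: "d \<in> L2 lborel" unfolding d_def by (intro L2_diff g h)
    have d: "(\<integral>x. (d x)\<^sup>2 \<partial>lborel) < e / 16" using h(5) by (simp add: d_def)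
    have "(\<integral>x. (d (c k *\<^sub>R x - v k))\<^sup>2 \<partial>lborel) \<le> (\<integral>x. (d x)\<^sup>2 \<partial>lborel)"
      by (rule L2_lborel_affine_le[OF dL c(2)])
    then have d2: "(\<integral>x. (d (c k *\<^sub>R x - v k))\<^sup>2 \<partial>lborel) < e / 16" using d by linarith
    have "(\<integral>x. (g (c k *\<^sub>R x - v k) - g x)\<^sup>2 \<partial>lborel)
        = (\<integral>x. ((d (c k *\<^sub>R x - v k) - d x) - (h x - h (c k *\<^sub>R x - v k)))\<^sup>2 \<partial>lborel)"
      by (simp add: d_def)
    also have "\<dots> \<le> 2 * (\<integral>x. (d (c k *\<^sub>R x - v k) - d x)\<^sup>2 \<partial>lborel) + 2 * (\<integral>x. (h x - h (c k *\<^sub>R x - v k))\<^sup>2 \<partial>lborel)"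
      by (intro L2_triangle_sq L2_diff L2_lborel_affine dL h ck)
    finally have le1: "(\<integral>x. (g (c k *\<^sub>R x - v k) - g x)\<^sup>2 \<partial>lborel) \<le> \<dots>" .
    have le2: "(\<integral>x. (d (c k *\<^sub>R x - v k) - d x)\<^sup>2 \<partial>lborel)
        \<le> 2 * (\<integral>x. (d (c k *\<^sub>R x - v k))\<^sup>2 \<partial>lborel) + 2 * (\<integral>x. (d x)\<^sup>2 \<partial>lborel)"
      by (intro L2_triangle_sq L2_diff L2_lborel_affine dL ck)
    have H: "(\<integral>x. (h x - h (c k *\<^sub>R x - v k))\<^sup>2 \<partial>lborel) = (\<integral>x. (h (c k *\<^sub>R x - v k) - h x)\<^sup>2 \<partial>lborel)"
      by (simp add: power2_commute)
    have aux: "A < e" if "A \<le> 2 * D + 2 * H" "D \<le> 2 * a + 2 * b" "a < e / 16" "b < e / 16" "H < e / 16"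
      for A D H a b :: real
      using that e by linarith
    have "(\<integral>x. (g (c k *\<^sub>R x - v k) - g x)\<^sup>2 \<partial>lborel) < e"
      by (rule aux[OF le1[unfolded H] le2 d2 d K[OF k]])
    then show "norm ((\<integral>x. (g (c k *\<^sub>R x - v k) - g x)\<^sup>2 \<partial>lborel) - 0) < e" by simp
  qed
qed

text \<open>By Cauchy-Schwarz with respect to the finite measure with density \<kappa>, the squared
  error at \<open>x\<close> is at most \<open>m\<close> times the \<kappa>-average of the squared
  differences \<open>D k z x\<close>. Tonelli's theorem exchanges the integrals, and dominated
  convergence in \<open>z\<close> applies because each \<open>W k z\<close> is at most four times
  the squared norm of \<open>g\<close>. Neither compact support nor unit mass is asked of \<kappa>,
  since both \<open>bump\<close> and \<open>bubble\<close> are to be inserted.\<close>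

lemma approximate_identity_L2:
  fixes g \<kappa> :: "'a::euclidean_space \<Rightarrow> real"
  assumes g: "g \<in> L2 lborel" and supp: "\<And>x. norm x > 1 \<Longrightarrow> g x = 0"
    and \<kappa>: "integrable lborel \<kappa>" "\<And>z. \<kappa> z \<ge> 0"
    and c: "c \<longlonglongrightarrow> 1" "\<And>k. c k \<ge> 1" and e: "e \<longlonglongrightarrow> 0"
  shows "L2_conv lborel (\<lambda>k x. \<integral>z. \<kappa> z * g (c k *\<^sub>R x - e k *\<^sub>R z) \<partial>lborel) (\<lambda>x. (\<integral>z. \<kappa> z \<partial>lborel) * g x)"
proof -
  define m where "m = (\<integral>z. \<kappa> z \<partial>lborel)"
  have m0: "m \<ge> 0" unfolding m_def using \<kappa> by simp
  have gm[measurable]: "g \<in> borel_measurable borel" using L2_measurable[OF g] by simp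
  have \<kappa>m[measurable]: "\<kappa> \<in> borel_measurable borel" using borel_measurable_integrable[OF \<kappa>(1)] by simp
  have ck: "c k \<noteq> 0" for k using c(2)[of k] by auto
  define D where "D k z x = g (c k *\<^sub>R x - e k *\<^sub>R z) - g x" for k z x
  have DL: "D k z \<in> L2 lborel" for k z unfolding D_def by (intro L2_diff L2_lborel_affine g ck)
  have Dm[measurable]: "(\<lambda>p. D k (fst p) (snd p)) \<in> borel_measurable (borel \<Otimes>\<^sub>M borel)" for k
    unfolding D_def by measurable
  define W where "W k z = (\<integral>x. (D k z x)\<^sup>2 \<partial>lborel)" for k z
  have Wm[measurable]: "W k \<in> borel_measurable borel" for k
    unfolding W_def by (rule lborel.borel_measurable_lebesgue_integral) measurable
  have W0: "0 \<le> W k z" for k z by (simp add: W_def)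
  define B where "B = 4 * (\<integral>x. (g x)\<^sup>2 \<partial>lborel)"
  have B: "W k z \<le> B" for k z
  proof -
    have "W k z \<le> 2 * (\<integral>x. (g (c k *\<^sub>R x - e k *\<^sub>R z))\<^sup>2 \<partial>lborel) + 2 * (\<integral>x. (g x)\<^sup>2 \<partial>lborel)"
      unfolding W_def D_def by (intro L2_triangle_sq L2_lborel_affine g ck)
    moreover have "(\<integral>x. (g (c k *\<^sub>R x - e k *\<^sub>R z))\<^sup>2 \<partial>lborel) \<le> (\<integral>x. (g x)\<^sup>2 \<partial>lborel)"
      by (rule L2_lborel_affine_le[OF g c(2)])
    ultimately show ?thesis by (simp add: B_def)
  qed
  have \<kappa>W: "integrable lborel (\<lambda>z. \<kappa> z * W k z)" for k
    by (rule Bochner_Integration.integrable_bound[OF integrable_mult_left[OF \<kappa>(1), of B]])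
       (use \<kappa>(2) W0 B in \<open>auto simp: abs_mult intro!: mult_left_mono AE_I2 order_trans[OF B abs_ge_self]\<close>)
  have lim: "(\<lambda>k. \<integral>z. \<kappa> z * W k z \<partial>lborel) \<longlonglongrightarrow> (\<integral>z. 0 \<partial>(lborel :: 'a measure))"
  proof (rule integral_dominated_convergence[OF _ _ integrable_mult_left[OF \<kappa>(1), of B]])
    show "AE z in lborel. (\<lambda>k. \<kappa> z * W k z) \<longlonglongrightarrow> 0"
    proof (rule AE_I2)
      fix z :: 'a
      have "(\<lambda>k. e k *\<^sub>R z) \<longlonglongrightarrow> 0 *\<^sub>R z" by (intro tendsto_intros e)
      then have "(\<lambda>k. W k z) \<longlonglongrightarrow> 0"
        unfolding W_def D_def by (intro L2_affine_continuity g supp c) simp_all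
      from tendsto_mult_right_zero[OF this, of "\<kappa> z"] show "(\<lambda>k. \<kappa> z * W k z) \<longlonglongrightarrow> 0" .
    qed
    show "AE z in lborel. norm (\<kappa> z * W k z) \<le> \<kappa> z * B" for k
      using \<kappa>(2) W0 B by (auto simp: abs_mult intro!: mult_left_mono AE_I2)
  qed measurable
  define T where "T k x = (\<integral>z. \<kappa> z * g (c k *\<^sub>R x - e k *\<^sub>R z) \<partial>lborel)" for k x
  have Tm[measurable]: "T k \<in> borel_measurable borel" for k
    unfolding T_def by (rule lborel.borel_measurable_lebesgue_integral) measurable
  have key: "(\<lambda>x. T k x - m * g x) \<in> L2 lborel \<and> (\<integral>x. (T k x - m * g x)\<^sup>2 \<partial>lborel) \<le> m * (\<integral>z. \<kappa> z * W k z \<partial>lborel)" for k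
  proof -
    define P where "P x = (\<integral>\<^sup>+z. ennreal (\<kappa> z * (D k z x)\<^sup>2) \<partial>lborel)" for x
    have Pm[measurable]: "P \<in> borel_measurable borel"
      unfolding P_def by (rule lborel.borel_measurable_nn_integral) (unfold D_def, measurable)
    have "(\<integral>\<^sup>+x. P x \<partial>lborel) = (\<integral>\<^sup>+z. (\<integral>\<^sup>+x. ennreal (\<kappa> z * (D k z x)\<^sup>2) \<partial>lborel) \<partial>lborel)"
      unfolding P_def by (rule lborel_pair.Fubini') (unfold D_def, measurable)
    also have "\<dots> = (\<integral>\<^sup>+z. ennreal (\<kappa> z * W k z) \<partial>lborel)"
    proof (rule nn_integral_cong)
      fix z
      show "(\<integral>\<^sup>+x. ennreal (\<kappa> z * (D k z x)\<^sup>2) \<partial>lborel) = ennreal (\<kappa> z * W k z)"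
        using \<kappa>(2)[of z] L2_integrable[OF DL[of k z]]
        by (subst nn_integral_eq_integral) (simp_all add: W_def)
    qed
    also have "\<dots> = ennreal (\<integral>z. \<kappa> z * W k z \<partial>lborel)"
      using \<kappa>W[of k] \<kappa>(2) W0 by (subst nn_integral_eq_integral) simp_all
    finally have PI: "(\<integral>\<^sup>+x. P x \<partial>lborel) = ennreal (\<integral>z. \<kappa> z * W k z \<partial>lborel)" .
    have "AE x in lborel. P x \<noteq> \<infinity>"
      by (rule nn_integral_noteq_infinite) (simp_all add: PI)
    then have le: "AE x in lborel. ennreal ((T k x - m * g x)\<^sup>2) \<le> ennreal m * P x"
    proof eventually_elim
      case (elim x)
      have [measurable]: "(\<lambda>z. D k z x) \<in> borel_measurable borel" unfolding D_def by measurable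
      define \<mu> where "\<mu> = density lborel (\<lambda>z. ennreal (\<kappa> z))"
      have i2: "integrable lborel (\<lambda>z. \<kappa> z * (D k z x)\<^sup>2)"
        using elim \<kappa>(2) by (intro integrableI_bounded) (simp_all add: P_def less_top)
      have "integrable \<mu> (\<lambda>z. (D k z x)\<^sup>2)"
        unfolding \<mu>_def using i2 \<kappa>(2) by (subst integrable_density) simp_all
      then have 1: "(\<lambda>z. D k z x) \<in> L2 \<mu>" by (simp add: L2_def \<mu>_def)
      have 2: "(\<lambda>z. 1) \<in> L2 \<mu>"
        unfolding L2_def \<mu>_def using \<kappa> by (simp add: integrable_density)
      have "(\<integral>z. D k z x * 1 \<partial>\<mu>)\<^sup>2 \<le> (\<integral>z. (D k z x)\<^sup>2 \<partial>\<mu>) * (\<integral>z. 1\<^sup>2 \<partial>\<mu>)"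
        by (rule L2_cauchy_schwarz[OF 1 2])
      moreover have "(\<integral>z. (1::real)\<^sup>2 \<partial>\<mu>) = m"
        unfolding \<mu>_def by (subst integral_density) (use \<kappa> in \<open>simp_all add: m_def\<close>)
      ultimately have cs: "(\<integral>z. \<kappa> z * D k z x \<partial>lborel)\<^sup>2 \<le> (\<integral>z. \<kappa> z * (D k z x)\<^sup>2 \<partial>lborel) * m"
        unfolding \<mu>_def using \<kappa> by (simp add: integral_density)
      have "integrable \<mu> (\<lambda>z. D k z x * 1)" by (rule L2_mult[OF 1 2])
      then have i1: "integrable lborel (\<lambda>z. \<kappa> z * D k z x)"
        unfolding \<mu>_def using \<kappa>(2) by (subst (asm) integrable_density) simp_all
      have "T k x = (\<integral>z. \<kappa> z * D k z x + \<kappa> z * g x \<partial>lborel)"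
        unfolding T_def D_def by (simp add: algebra_simps)
      also have "\<dots> = (\<integral>z. \<kappa> z * D k z x \<partial>lborel) + m * g x"
        using i1 \<kappa>(1) by (simp add: m_def)
      finally have "(T k x - m * g x)\<^sup>2 \<le> m * (\<integral>z. \<kappa> z * (D k z x)\<^sup>2 \<partial>lborel)"
        using cs by (simp add: mult.commute)
      then have "ennreal ((T k x - m * g x)\<^sup>2) \<le> ennreal m * ennreal (\<integral>z. \<kappa> z * (D k z x)\<^sup>2 \<partial>lborel)"
        using m0 by (simp add: ennreal_mult'[symmetric] ennreal_leI)
      then show ?case
        unfolding P_def using i2 \<kappa>(2) by (subst nn_integral_eq_integral) simp_all
    qed
    have "(\<integral>\<^sup>+x. ennreal ((T k x - m * g x)\<^sup>2) \<partial>lborel) \<le> (\<integral>\<^sup>+x. ennreal m * P x \<partial>lborel)"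
      by (rule nn_integral_mono_AE[OF le])
    also have "\<dots> = ennreal (m * (\<integral>z. \<kappa> z * W k z \<partial>lborel))"
      using m0 by (simp add: nn_integral_cmult PI ennreal_mult')
    finally have fin: "(\<integral>\<^sup>+x. ennreal ((T k x - m * g x)\<^sup>2) \<partial>lborel) \<le> ennreal (m * (\<integral>z. \<kappa> z * W k z \<partial>lborel))" .
    have int: "integrable lborel (\<lambda>x. (T k x - m * g x)\<^sup>2)"
      using le_less_trans[OF fin ennreal_less_top] by (intro integrableI_bounded) simp_all
    have "0 \<le> m * (\<integral>z. \<kappa> z * W k z \<partial>lborel)" using m0 \<kappa>(2) W0 by simp
    then have "(\<integral>x. (T k x - m * g x)\<^sup>2 \<partial>lborel) \<le> m * (\<integral>z. \<kappa> z * W k z \<partial>lborel)"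
      using fin nn_integral_eq_integral[OF int] by simp
    with int show ?thesis by (simp add: L2_def)
  qed
  show ?thesis
    unfolding m_def[symmetric] T_def[symmetric]
  proof (rule L2_conv_bound)
    show mg: "(\<lambda>x. m * g x) \<in> L2 lborel" by (intro L2_cmult g)
    show "T k \<in> L2 lborel" for k
      using L2_add[OF conjunct1[OF key[of k]] mg] by simp
    show "(\<integral>x. (T k x - m * g x)\<^sup>2 \<partial>lborel) \<le> m * (\<integral>z. \<kappa> z * W k z \<partial>lborel)" for k
      using key by blast
    show "(\<lambda>k. m * (\<integral>z. \<kappa> z * W k z \<partial>lborel)) \<longlonglongrightarrow> 0"
      using tendsto_mult_left[OF lim, of m] by simp
  qed
qed

text \<open>A quadratic remainder for all increments is a form of differentiability that survives
  integration against a weight; it also settles the gluing point of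
  \<open>trunc_prim\<close>.\<close>

lemma has_derivative_quadratic_bound:
  fixes f :: "'a::real_normed_vector \<Rightarrow> real"
  assumes D: "bounded_linear D" and b: "\<And>v. \<bar>f (x + v) - f x - D v\<bar> \<le> C * (norm v)\<^sup>2"
  shows "(f has_derivative D) (at x)"
  unfolding has_derivative_at
proof (intro conjI D)
  show "(\<lambda>h. norm (f (x + h) - f x - D h) / norm h) \<midarrow>0\<rightarrow> 0"
  proof (rule Lim_null_comparison)
    have "norm (norm (f (x + h) - f x - D h) / norm h) \<le> C * norm h" for h
      using b[of h] by (cases "h = 0") (simp_all add: divide_le_eq power2_eq_square mult.assoc)
    then show "\<forall>\<^sub>F h in at 0. norm (norm (f (x + h) - f x - D h) / norm h) \<le> C * norm h"
      by (rule always_eventually[OF allI])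
    have "((\<lambda>h::'a. C * norm h) \<longlongrightarrow> C * norm (0::'a)) (at 0)" by (intro tendsto_intros)
    then show "((\<lambda>h::'a. C * norm h) \<longlongrightarrow> 0) (at 0)" by simp
  qed
qed

section \<open>Convolution with smooth kernels of bounded support\<close>

definition supported :: "real \<Rightarrow> ('a::euclidean_space \<Rightarrow> real) \<Rightarrow> bool" where
  "supported r f \<longleftrightarrow> (\<forall>x. norm x > r \<longrightarrow> f x = 0)"

lemma supported_bounded:
  assumes "continuous_on UNIV K" "supported r K"
  obtains B where "B \<ge> 0" "\<And>x. \<bar>K x\<bar> \<le> B"
proof -
  obtain B where "B \<ge> 0" "\<And>x. norm x \<le> r \<Longrightarrow> \<bar>K x\<bar> \<le> B"
    using continuous_bounded_cball[OF assms(1), of r] by metis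
  then show ?thesis using assms(2) unfolding supported_def
    by (intro that[of B]) (auto simp: not_le[symmetric], metis abs_zero not_le)
qed

lemma partial_deriv_const [simp]: "partial_deriv i (\<lambda>x. c) x = 0"
  by (rule partial_deriv_eqI[of _ "\<lambda>_. 0"]) simp

lemma supported_partial_deriv:
  assumes "supported r K" shows "supported r (partial_deriv i K)"
  unfolding supported_def
proof (intro allI impI)
  fix x :: 'a assume "norm x > r"
  then have "partial_deriv i K x = partial_deriv i (\<lambda>x. 0) x"
    using assms unfolding supported_def
    by (intro partial_deriv_cong_open[of "{x. norm x > r}"]) (auto intro!: open_Collect_less continuous_intros)
  then show "partial_deriv i K x = 0" by simp
qed

lemma C_1_lipschitz_UNIV:
  fixes F :: "'a::euclidean_space \<Rightarrow> real"
  assumes F: "C_k (Suc 0) F" and B: "\<And>i x. i \<in> Basis \<Longrightarrow> \<bar>partial_deriv i F x\<bar> \<le> B i"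
  shows "\<bar>F x - F y\<bar> \<le> (\<Sum>i\<in>Basis. B i) * norm (x - y)"
proof -
  have "norm (F x - F y) \<le> (\<Sum>i\<in>Basis. B i) * norm (x - y)"
  proof (rule differentiable_bound[where S = UNIV])
    fix z :: 'a
    show "(F has_derivative (\<lambda>v. \<Sum>i\<in>Basis. (v \<bullet> i) * partial_deriv i F z)) (at z within UNIV)"
      by (rule has_derivative_at_withinI[OF C_k_Suc_has_derivative[OF F]])
    show "onorm (\<lambda>v. \<Sum>i\<in>Basis. (v \<bullet> i) * partial_deriv i F z) \<le> (\<Sum>i\<in>Basis. B i)"
    proof (rule onorm_le)
      fix v :: 'a
      have "norm (\<Sum>i\<in>Basis. (v \<bullet> i) * partial_deriv i F z) \<le> (\<Sum>i\<in>Basis. norm v * B i)"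
        by (intro order_trans[OF norm_sum] sum_mono)
           (use B in \<open>auto simp: abs_mult Basis_le_norm intro!: mult_mono\<close>)
      then show "norm (\<Sum>i\<in>Basis. (v \<bullet> i) * partial_deriv i F z) \<le> (\<Sum>i\<in>Basis. B i) * norm v"
        by (simp add: sum_distrib_left mult.commute)
    qed
  qed auto
  then show ?thesis by simp
qed

text \<open>The second derivatives are bounded, being continuous with bounded support. Hence the
  gradient is Lipschitz, and the linearisation error along the segment from \<open>p\<close> to
  \<open>p + w\<close> is quadratic, uniformly in \<open>p\<close>.\<close>

lemma smooth_supported_taylor:
  fixes K :: "'a::euclidean_space \<Rightarrow> real"
  assumes K: "smooth K" "supported r K"
  obtains C where "C \<ge> 0"
    "\<And>p w. \<bar>K (p + w) - K p - (\<Sum>i\<in>Basis. (w \<bullet> i) * partial_deriv i K p)\<bar> \<le> C * (norm w)\<^sup>2"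
proof -
  have "\<exists>L. \<forall>i\<in>Basis. L i \<ge> 0 \<and> (\<forall>x y. \<bar>partial_deriv i K x - partial_deriv i K y\<bar> \<le> L i * norm (x - y))"
  proof (rule bchoice, rule ballI)
    fix i :: 'a assume i: "i \<in> Basis"
    note si = smooth_partial_deriv[OF K(1) i]
    have "\<exists>B. \<forall>j\<in>Basis. B j \<ge> 0 \<and> (\<forall>x. \<bar>partial_deriv j (partial_deriv i K) x\<bar> \<le> B j)"
    proof (rule bchoice, rule ballI)
      fix j :: 'a assume j: "j \<in> Basis"
      show "\<exists>B\<ge>0. \<forall>x. \<bar>partial_deriv j (partial_deriv i K) x\<bar> \<le> B"
        using supported_bounded[OF smooth_continuous[OF smooth_partial_deriv[OF si j]]
            supported_partial_deriv[OF supported_partial_deriv[OF K(2)]]] by metis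
    qed
    then obtain B where B: "\<And>j. j \<in> Basis \<Longrightarrow> B j \<ge> 0"
      "\<And>j x. j \<in> Basis \<Longrightarrow> \<bar>partial_deriv j (partial_deriv i K) x\<bar> \<le> B j" by metis
    show "\<exists>L\<ge>0. \<forall>x y. \<bar>partial_deriv i K x - partial_deriv i K y\<bar> \<le> L * norm (x - y)"
      using C_1_lipschitz_UNIV[OF smooth_C_k[OF si] B(2)] B(1)
      by (intro exI[of _ "\<Sum>j\<in>Basis. B j"]) (auto intro: sum_nonneg)
  qed
  then obtain L where L: "\<And>i. i \<in> Basis \<Longrightarrow> L i \<ge> 0"
    "\<And>i x y. i \<in> Basis \<Longrightarrow> \<bar>partial_deriv i K x - partial_deriv i K y\<bar> \<le> L i * norm (x - y)" by metis
  show thesis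
  proof (rule that)
    show L0: "0 \<le> (\<Sum>i\<in>Basis. L i)" using L by (intro sum_nonneg)
    fix p w :: 'a
    define S where "S = (\<lambda>t. p + t *\<^sub>R w) ` {0..1}"
    have "norm (K (p + w) - K p - (\<Sum>i\<in>Basis. ((p + w - p) \<bullet> i) * partial_deriv i K p))
        \<le> norm (p + w - p) * ((\<Sum>i\<in>Basis. L i) * norm w)"
    proof (rule differentiable_bound_linearization[where S = S])
      show "p + t *\<^sub>R (p + w - p) \<in> S" if "t \<in> {0..1}" for t using that by (auto simp: S_def)
      show "p \<in> S" by (auto simp: S_def intro!: image_eqI[of _ _ 0])
      show "(K has_derivative (\<lambda>v. \<Sum>i\<in>Basis. (v \<bullet> i) * partial_deriv i K z)) (at z within S)" for z
        by (rule has_derivative_at_withinI[OF C_k_Suc_has_derivative[OF smooth_C_k[OF K(1)]]])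
      fix z assume "z \<in> S"
      then obtain t where t: "z = p + t *\<^sub>R w" "t \<in> {0..1}" unfolding S_def by (rule imageE)
      then have zp: "norm (z - p) \<le> norm w" by (simp add: mult_left_le_one_le)
      show "onorm ((\<lambda>v. \<Sum>i\<in>Basis. (v \<bullet> i) * partial_deriv i K z) - (\<lambda>v. \<Sum>i\<in>Basis. (v \<bullet> i) * partial_deriv i K p))
          \<le> (\<Sum>i\<in>Basis. L i) * norm w"
        unfolding fun_diff_def
      proof (rule onorm_le)
        fix v :: 'a
        have "norm ((\<Sum>i\<in>Basis. (v \<bullet> i) * partial_deriv i K z) - (\<Sum>i\<in>Basis. (v \<bullet> i) * partial_deriv i K p))
            = norm (\<Sum>i\<in>Basis. (v \<bullet> i) * (partial_deriv i K z - partial_deriv i K p))"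
          by (simp add: sum_subtractf right_diff_distrib)
        also have "\<dots> \<le> (\<Sum>i\<in>Basis. norm v * (L i * norm w))"
        proof (intro order_trans[OF norm_sum] sum_mono)
          fix i :: 'a assume i: "i \<in> Basis"
          have "\<bar>partial_deriv i K z - partial_deriv i K p\<bar> \<le> L i * norm w"
            using L(2)[OF i, of z p] mult_left_mono[OF zp L(1)[OF i]] by linarith
          then show "norm ((v \<bullet> i) * (partial_deriv i K z - partial_deriv i K p)) \<le> norm v * (L i * norm w)"
            using Basis_le_norm[OF i, of v] by (simp add: abs_mult mult_mono)
        qed
        finally show "norm ((\<Sum>i\<in>Basis. (v \<bullet> i) * partial_deriv i K z) - (\<Sum>i\<in>Basis. (v \<bullet> i) * partial_deriv i K p))
            \<le> (\<Sum>i\<in>Basis. L i) * norm w * norm v"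
          by (simp add: sum_distrib_left sum_distrib_right mult_ac)
      qed
    qed
    then show "\<bar>K (p + w) - K p - (\<Sum>i\<in>Basis. (w \<bullet> i) * partial_deriv i K p)\<bar> \<le> (\<Sum>i\<in>Basis. L i) * (norm w)\<^sup>2"
      by (simp add: power2_eq_square mult_ac)
  qed
qed

text \<open>The convolution of \<open>g\<close> and \<open>K\<close> read off at
  \<open>c *\<^sub>R x\<close>: a factor \<open>c > 1\<close> pulls its support towards the origin,
  and each derivative costs one factor \<open>c\<close>.\<close>

definition dilated_conv :: "('a::euclidean_space \<Rightarrow> real) \<Rightarrow> ('a \<Rightarrow> real) \<Rightarrow> real \<Rightarrow> 'a \<Rightarrow> real" where
  "dilated_conv g K c x = (\<integral>y. g y * K (c *\<^sub>R x - y) \<partial>lborel)"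

lemma dilated_conv_integrable:
  fixes g K :: "'a::euclidean_space \<Rightarrow> real"
  assumes g: "integrable lborel g" and K: "continuous_on UNIV K" "supported r K"
  shows "integrable lborel (\<lambda>y. g y * K (p - y))"
proof -
  obtain B where B: "B \<ge> 0" "\<And>x. \<bar>K x\<bar> \<le> B" using supported_bounded[OF K] by metis
  have [measurable]: "K \<in> borel_measurable borel" by (rule borel_measurable_continuous_onI[OF K(1)])
  have "g \<in> borel_measurable lborel" using g by (rule borel_measurable_integrable)
  then have m: "g \<in> borel_measurable borel" by simp
  show ?thesis
  proof (rule Bochner_Integration.integrable_bound[OF integrable_mult_left[OF g, of B]])
    have "(\<lambda>y. K (p - y)) \<in> borel_measurable borel" by measurable
    with m show "(\<lambda>y. g y * K (p - y)) \<in> borel_measurable lborel" by simp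
    have "\<bar>g y\<bar> * \<bar>K (p - y)\<bar> \<le> \<bar>g y\<bar> * \<bar>B\<bar>" for y
      using B(2)[of "p - y"] by (intro mult_left_mono) auto
    then show "AE y in lborel. norm (g y * K (p - y)) \<le> norm (g y * B)" by (simp add: abs_mult)
  qed
qed

text \<open>Differentiation under the integral: the Taylor remainder of \<open>K\<close> is
  quadratic uniformly in the base point, and stays so after integration against the integrable
  \<open>g\<close>.\<close>

lemma dilated_conv_has_derivative:
  fixes g K :: "'a::euclidean_space \<Rightarrow> real"
  assumes g: "integrable lborel g" and K: "smooth K" "supported r K"
  shows "(dilated_conv g K c has_derivative
    (\<lambda>v. \<Sum>i\<in>Basis. (v \<bullet> i) * (c * dilated_conv g (partial_deriv i K) c x))) (at x)"
proof -
  obtain C where C: "C \<ge> 0"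
    "\<And>p w. \<bar>K (p + w) - K p - (\<Sum>i\<in>Basis. (w \<bullet> i) * partial_deriv i K p)\<bar> \<le> C * (norm w)\<^sup>2"
    using smooth_supported_taylor[OF K] by metis
  note iK = dilated_conv_integrable[OF g smooth_continuous[OF K(1)] K(2)]
  have iD: "integrable lborel (\<lambda>y. g y * partial_deriv i K (p - y))" if "i \<in> Basis" for i p
    by (rule dilated_conv_integrable[OF g smooth_continuous[OF smooth_partial_deriv[OF K(1) that]]
          supported_partial_deriv[OF K(2)]])
  show ?thesis
  proof (rule has_derivative_quadratic_bound[where C = "(\<integral>y. \<bar>g y\<bar> \<partial>lborel) * C * c\<^sup>2"])
    show "bounded_linear (\<lambda>v. \<Sum>i\<in>Basis. (v \<bullet> i) * (c * dilated_conv g (partial_deriv i K) c x))"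
      by (intro bounded_linear_sum bounded_linear_mult_const bounded_linear_inner_left)
    fix v :: 'a
    let ?R = "\<lambda>y. K (c *\<^sub>R x - y + c *\<^sub>R v) - K (c *\<^sub>R x - y) - (\<Sum>i\<in>Basis. ((c *\<^sub>R v) \<bullet> i) * partial_deriv i K (c *\<^sub>R x - y))"
    have eq1: "K (c *\<^sub>R (x + v) - y) = K (c *\<^sub>R x - y + c *\<^sub>R v)" for y
      by (simp add: algebra_simps)
    have i1: "integrable lborel (\<lambda>y. g y * K (c *\<^sub>R x - y + c *\<^sub>R v))"
      using iK[of "c *\<^sub>R (x + v)"] unfolding eq1 .
    have i3: "integrable lborel (\<lambda>y. \<Sum>i\<in>Basis. (c * (v \<bullet> i)) * (g y * partial_deriv i K (c *\<^sub>R x - y)))"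
      by (intro Bochner_Integration.integrable_sum integrable_mult_right iD)
    have eq2: "g y * ?R y = g y * K (c *\<^sub>R x - y + c *\<^sub>R v) - g y * K (c *\<^sub>R x - y)
        - (\<Sum>i\<in>Basis. (c * (v \<bullet> i)) * (g y * partial_deriv i K (c *\<^sub>R x - y)))" for y
      by (simp add: right_diff_distrib sum_distrib_left mult_ac)
    have iR: "integrable lborel (\<lambda>y. g y * ?R y)"
      unfolding eq2 by (intro Bochner_Integration.integrable_diff i1 iK i3)
    have "(\<integral>y. g y * ?R y \<partial>lborel) = (\<integral>y. g y * K (c *\<^sub>R x - y + c *\<^sub>R v) \<partial>lborel) - (\<integral>y. g y * K (c *\<^sub>R x - y) \<partial>lborel)
        - (\<Sum>i\<in>Basis. (c * (v \<bullet> i)) * (\<integral>y. g y * partial_deriv i K (c *\<^sub>R x - y) \<partial>lborel))"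
      unfolding eq2 by (simp add: i1 iK i3 iD Bochner_Integration.integral_diff Bochner_Integration.integrable_diff Bochner_Integration.integral_sum)
    also have "\<dots> = dilated_conv g K c (x + v) - dilated_conv g K c x
        - (\<Sum>i\<in>Basis. (v \<bullet> i) * (c * dilated_conv g (partial_deriv i K) c x))"
      unfolding dilated_conv_def eq1 by (simp add: mult_ac)
    finally have "\<bar>dilated_conv g K c (x + v) - dilated_conv g K c x
        - (\<Sum>i\<in>Basis. (v \<bullet> i) * (c * dilated_conv g (partial_deriv i K) c x))\<bar> = \<bar>\<integral>y. g y * ?R y \<partial>lborel\<bar>" by simp
    also have "\<dots> \<le> (\<integral>y. \<bar>g y\<bar> * (C * (norm (c *\<^sub>R v))\<^sup>2) \<partial>lborel)"
    proof (rule integral_abs_bound_integral[OF iR])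
      show "integrable lborel (\<lambda>y. \<bar>g y\<bar> * (C * (norm (c *\<^sub>R v))\<^sup>2))" using g by simp
      show "\<bar>g y * ?R y\<bar> \<le> \<bar>g y\<bar> * (C * (norm (c *\<^sub>R v))\<^sup>2)" for y
        unfolding abs_mult by (intro mult_left_mono C(2)) simp
    qed
    also have "\<dots> = (\<integral>y. \<bar>g y\<bar> \<partial>lborel) * C * c\<^sup>2 * (norm v)\<^sup>2"
      by (simp add: power_mult_distrib)
    finally show "\<bar>dilated_conv g K c (x + v) - dilated_conv g K c x
        - (\<Sum>i\<in>Basis. (v \<bullet> i) * (c * dilated_conv g (partial_deriv i K) c x))\<bar>
        \<le> (\<integral>y. \<bar>g y\<bar> \<partial>lborel) * C * c\<^sup>2 * (norm v)\<^sup>2" .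
  qed
qed

lemma partial_deriv_dilated_conv:
  fixes g K :: "'a::euclidean_space \<Rightarrow> real"
  assumes "integrable lborel g" "smooth K" "supported r K" "i \<in> Basis"
  shows "partial_deriv i (dilated_conv g K c) = (\<lambda>x. c * dilated_conv g (partial_deriv i K) c x)"
proof
  fix x
  show "partial_deriv i (dilated_conv g K c) x = c * dilated_conv g (partial_deriv i K) c x"
    using partial_deriv_eqI[OF dilated_conv_has_derivative[OF assms(1-3)], of i c x]
    by (simp only: sum_Basis_inner_mult[OF assms(4)])
qed

lemma dilated_conv_smooth:
  fixes g K :: "'a::euclidean_space \<Rightarrow> real"
  assumes g: "integrable lborel g" and "smooth K" "supported r K"
  shows "smooth (dilated_conv g K c)"
proof -
  have "C_k k (dilated_conv g K c)" for k
    using assms(2,3)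
  proof (induction k arbitrary: K)
    case 0
    show ?case
      using has_derivative_continuous[OF dilated_conv_has_derivative[OF g 0]]
      by (simp add: continuous_on_eq_continuous_at)
  next
    case (Suc k)
    show ?case
    proof (rule C_k_SucI[OF dilated_conv_has_derivative[OF g Suc.prems]])
      fix i :: 'a assume i: "i \<in> Basis"
      show "C_k k (\<lambda>x. \<Sum>j\<in>Basis. (i \<bullet> j) * (c * dilated_conv g (partial_deriv j K) c x))"
        unfolding sum_Basis_inner_mult[OF i]
        by (intro C_k_mult C_k_const Suc.IH smooth_partial_deriv Suc.prems i supported_partial_deriv)
    qed
  qed
  then show ?thesis by (simp add: smooth_def)
qed

lemma laplacian_dilated_conv:
  fixes g K :: "'a::euclidean_space \<Rightarrow> real"
  assumes g: "integrable lborel g" and K: "smooth K" "supported r K"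
  shows "laplacian (dilated_conv g K c) x = c\<^sup>2 * dilated_conv g (laplacian K) c x"
proof -
  have "partial_deriv i (partial_deriv i (dilated_conv g K c)) x
      = c\<^sup>2 * dilated_conv g (partial_deriv i (partial_deriv i K)) c x" if i: "i \<in> Basis" for i
  proof -
    note s = smooth_partial_deriv[OF K(1) i] and p = supported_partial_deriv[OF K(2), of i]
    show ?thesis
      unfolding partial_deriv_dilated_conv[OF g K i]
      by (subst partial_deriv_cmult[OF smooth_C_k[OF dilated_conv_smooth[OF g s p]]])
         (simp add: partial_deriv_dilated_conv[OF g s p i] power2_eq_square)
  qed
  moreover have "dilated_conv g (laplacian K) c x = (\<Sum>i\<in>Basis. dilated_conv g (partial_deriv i (partial_deriv i K)) c x)"
  proof -
    have "integrable lborel (\<lambda>y. g y * partial_deriv i (partial_deriv i K) (c *\<^sub>R x - y))" if i: "i \<in> Basis" for i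
      by (rule dilated_conv_integrable[OF g smooth_continuous[OF smooth_partial_deriv[OF smooth_partial_deriv[OF K(1) i] i]]
          supported_partial_deriv[OF supported_partial_deriv[OF K(2)]]])
    then show ?thesis
      unfolding dilated_conv_def laplacian_def sum_distrib_left by (rule Bochner_Integration.integral_sum)
  qed
  ultimately show ?thesis unfolding laplacian_def[of "dilated_conv g K c"] by (simp add: sum_distrib_left)
qed

definition bump_mass :: "'a::euclidean_space itself \<Rightarrow> real" where
  "bump_mass _ = (\<integral>x. bump (x::'a) \<partial>lborel)"

lemma bump_continuous: "continuous_on UNIV bump"
  by (rule smooth_continuous[OF bump_smooth])

lemma bump_borel [measurable]: "bump \<in> borel_measurable borel"
  by (rule borel_measurable_continuous_onI[OF bump_continuous])

lemma bump_le_1: "bump x \<le> 1"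
  by (simp add: bump_def flat_def)

lemma bump_integrable: "integrable lborel (bump :: 'a::euclidean_space \<Rightarrow> real)"
proof -
  have "integrable lborel (\<lambda>x. indicator (ball 0 1) x * bump (x::'a))"
    by (rule integrable_bounded_ball[where B = 1]) (simp_all add: bump_le_1 abs_of_nonneg[OF bump_nonneg])
  moreover have "indicator (ball 0 1) x * bump x = bump x" for x :: 'a
    using bump_eq_0[of x] by (cases "norm x < 1") simp_all
  ultimately show ?thesis by simp
qed

lemma bump_mass_pos: "bump_mass TYPE('a::euclidean_space) > 0"
proof -
  have "bump_mass TYPE('a) \<noteq> 0"
  proof
    assume "bump_mass TYPE('a) = 0"
    then have "AE x in lborel. bump (x::'a) = 0"
      using integral_nonneg_eq_0_iff_AE[OF bump_integrable[where 'a = 'a] AE_I2[OF bump_nonneg]]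
      by (simp add: bump_mass_def)
    then have "AE x in lborel. x \<notin> ball (0::'a) 1"
    proof eventually_elim
      case (elim x)
      then show ?case using bump_pos_iff[of x] by simp
    qed
    then have "ball (0::'a) 1 \<in> null_sets lborel" using AE_iff_null_sets[of "ball (0::'a) 1" lborel] by simp
    then have "emeasure lborel (ball (0::'a) 1) = 0" by blast
    then show False using content_ball_pos[of 1 "0::'a"] by (simp add: measure_def)
  qed
  moreover have "bump_mass TYPE('a) \<ge> 0" by (simp add: bump_mass_def bump_nonneg)
  ultimately show ?thesis by simp
qed

definition mollifier :: "real \<Rightarrow> 'a::euclidean_space \<Rightarrow> real" where
  "mollifier e y = inverse (e ^ DIM('a) * bump_mass TYPE('a)) * bump (y /\<^sub>R e)"

lemma mollifier_smooth: "smooth (mollifier e)"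
proof -
  have "smooth (\<lambda>y::'a. inverse (e ^ DIM('a) * bump_mass TYPE('a)) * bump (inverse e *\<^sub>R y + 0))"
    by (intro smooth_mult smooth_const smooth_affine bump_smooth)
  then show ?thesis by (simp add: mollifier_def[abs_def])
qed

lemma mollifier_supported:
  assumes "e > 0" shows "supported e (mollifier e :: 'a::euclidean_space \<Rightarrow> real)"
  unfolding supported_def
proof (intro allI impI)
  fix x :: 'a assume "norm x > e"
  then have "norm (x /\<^sub>R e) \<ge> 1" using assms by (simp add: field_simps)
  then show "mollifier e x = 0" by (simp add: mollifier_def bump_eq_0)
qed

lemma dilated_conv_mollifier:
  fixes g :: "'a::euclidean_space \<Rightarrow> real"
  assumes [measurable]: "g \<in> borel_measurable borel" and e: "e > 0"
  shows "dilated_conv g (mollifier e) c x = (\<integral>z. (bump z / bump_mass TYPE('a)) * g (c *\<^sub>R x - e *\<^sub>R z) \<partial>lborel)"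
proof -
  have [measurable]: "mollifier e \<in> borel_measurable (borel :: 'a measure)"
    by (rule borel_measurable_continuous_onI[OF smooth_continuous[OF mollifier_smooth]])
  have "dilated_conv g (mollifier e) c x
      = \<bar>- e\<bar> ^ DIM('a) * (\<integral>z. g (c *\<^sub>R x + (- e) *\<^sub>R z) * mollifier e (c *\<^sub>R x - (c *\<^sub>R x + (- e) *\<^sub>R z)) \<partial>lborel)"
    unfolding dilated_conv_def
    by (rule lborel_integral_affine) (use e in \<open>measurable, simp\<close>)
  also have "\<dots> = (\<integral>z. e ^ DIM('a) * (g (c *\<^sub>R x + (- e) *\<^sub>R z) * mollifier e (c *\<^sub>R x - (c *\<^sub>R x + (- e) *\<^sub>R z))) \<partial>lborel)"
    using e by simp
  also have "\<dots> = (\<integral>z. (bump z / bump_mass TYPE('a)) * g (c *\<^sub>R x - e *\<^sub>R z) \<partial>lborel)"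
    using e by (intro Bochner_Integration.integral_cong refl) (simp add: mollifier_def field_simps)
  finally show ?thesis .
qed

text \<open>With e = 1 / (k + 1) the kernel has radius e and the dilation factor is 1 + 2 e. A
  function that vanishes outside the closed unit ball is thereby carried to one supported in radius
  (1 + e) / (1 + 2 e) < 1, that is, to a test function.\<close>

definition mollify :: "nat \<Rightarrow> ('a::euclidean_space \<Rightarrow> real) \<Rightarrow> 'a \<Rightarrow> real" where
  "mollify k g = dilated_conv g (mollifier (1 / real (Suc k))) (1 + 2 / real (Suc k))"

lemma mollify_eq:
  fixes g :: "'a::euclidean_space \<Rightarrow> real"
  assumes "g \<in> borel_measurable borel"
  shows "mollify k g x = (\<integral>z. (bump z / bump_mass TYPE('a)) * g ((1 + 2 / real (Suc k)) *\<^sub>R x - (1 / real (Suc k)) *\<^sub>R z) \<partial>lborel)"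
  unfolding mollify_def by (rule dilated_conv_mollifier[OF assms]) simp

lemma mollify_L2_conv:
  fixes g :: "'a::euclidean_space \<Rightarrow> real"
  assumes g: "g \<in> L2 lborel" "supported 1 g"
  shows "L2_conv lborel (\<lambda>k. mollify k g) g"
proof -
  have gm: "g \<in> borel_measurable borel" using L2_measurable[OF g(1)] by simp
  have e: "(\<lambda>k. 1 / real (Suc k)) \<longlonglongrightarrow> 0"
    using LIMSEQ_inverse_real_of_nat by (simp add: inverse_eq_divide)
  have c: "(\<lambda>k. 1 + 2 / real (Suc k)) \<longlonglongrightarrow> 1"
    using tendsto_add[OF tendsto_const tendsto_mult_left[OF e, of 2], of 1] by simp
  have "L2_conv lborel (\<lambda>k x. \<integral>z. (bump z / bump_mass TYPE('a)) * g ((1 + 2 / real (Suc k)) *\<^sub>R x - (1 / real (Suc k)) *\<^sub>R z) \<partial>lborel)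
      (\<lambda>x. (\<integral>z. bump (z::'a) / bump_mass TYPE('a) \<partial>lborel) * g x)"
    by (rule approximate_identity_L2[OF g(1) _ _ _ c _ e])
       (use g(2) bump_integrable divide_nonneg_pos[OF bump_nonneg bump_mass_pos[where 'a = 'a]]
         in \<open>auto simp: supported_def\<close>)
  moreover have "(\<integral>z. bump (z::'a) / bump_mass TYPE('a) \<partial>lborel) = 1"
    using bump_mass_pos[where 'a = 'a] by (simp add: bump_mass_def)
  ultimately show ?thesis by (simp add: mollify_eq[OF gm, abs_def])
qed

lemma mollify_nonneg:
  fixes g :: "'a::euclidean_space \<Rightarrow> real"
  assumes "g \<in> borel_measurable borel" "\<And>x. g x \<ge> 0"
  shows "mollify k g x \<ge> 0"
  unfolding mollify_eq[OF assms(1)]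
  by (intro Bochner_Integration.integral_nonneg mult_nonneg_nonneg divide_nonneg_pos
      assms(2) bump_nonneg bump_mass_pos)

lemma mollify_bounded:
  fixes g :: "'a::euclidean_space \<Rightarrow> real"
  assumes m[measurable]: "g \<in> borel_measurable borel" and b: "\<And>x. \<bar>g x\<bar> \<le> B"
  shows "\<bar>mollify k g x\<bar> \<le> B"
proof -
  have I: "integrable lborel (\<lambda>z::'a. (bump z / bump_mass TYPE('a)) * B)"
    using bump_integrable[where 'a = 'a] by simp
  have B: "B \<ge> 0" using b[of 0] by linarith
  have le: "\<bar>(bump z / bump_mass TYPE('a)) * g y\<bar> \<le> (bump z / bump_mass TYPE('a)) * B" for z y :: 'a
    using b[of y] bump_nonneg[of z] bump_mass_pos[where 'a = 'a]
    by (simp add: abs_mult mult_left_mono divide_right_mono)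
  have "\<bar>mollify k g x\<bar> \<le> (\<integral>z. (bump (z::'a) / bump_mass TYPE('a)) * B \<partial>lborel)"
    unfolding mollify_eq[OF m]
  proof (rule integral_abs_bound_integral[OF _ I le])
    show "integrable lborel (\<lambda>z. bump z / bump_mass TYPE('a) * g ((1 + 2 / real (Suc k)) *\<^sub>R x - (1 / real (Suc k)) *\<^sub>R z))"
    proof (rule Bochner_Integration.integrable_bound[OF I])
      show "AE z in lborel. norm (bump z / bump_mass TYPE('a) * g ((1 + 2 / real (Suc k)) *\<^sub>R x - (1 / real (Suc k)) *\<^sub>R z))
          \<le> norm (bump z / bump_mass TYPE('a) * B)"
        unfolding real_norm_def by (intro AE_I2 order_trans[OF le abs_ge_self])
    qed measurable
  qed
  also have "\<dots> = B" using bump_mass_pos[where 'a = 'a] by (simp add: bump_mass_def)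
  finally show ?thesis .
qed

lemma L2_supported_integrable:
  fixes g :: "'a::euclidean_space \<Rightarrow> real"
  assumes "g \<in> L2 lborel" "supported r g"
  shows "integrable lborel g"
proof -
  have "(indicator (cball 0 r) :: 'a \<Rightarrow> real) \<in> L2 lborel"
  proof -
    have "(\<lambda>x::'a. (indicator (cball 0 r) x :: real)\<^sup>2) = indicator (cball 0 r)"
      by (auto simp: indicator_def)
    then show ?thesis
      using emeasure_lborel_cball_finite[of "0::'a" r] by (simp add: L2_def integrable_real_indicator borel_measurable_indicator)
  qed
  from L2_mult[OF assms(1) this] have "integrable lborel (\<lambda>x. g x * indicator (cball 0 r) x)" .
  moreover have "g x * indicator (cball 0 r) x = g x" for x
    using assms(2) by (auto simp: supported_def indicator_def)
  ultimately show ?thesis by simp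
qed

lemma mollify_smooth:
  assumes "g \<in> L2 lborel" "supported r g" shows "smooth (mollify k g)"
  unfolding mollify_def
  by (rule dilated_conv_smooth[OF L2_supported_integrable[OF assms] mollifier_smooth mollifier_supported]) simp

lemma mollify_supported:
  fixes g :: "'a::euclidean_space \<Rightarrow> real"
  assumes "supported r g" "r \<ge> 0"
  shows "supported ((r + 1 / real (Suc k)) / (1 + 2 / real (Suc k))) (mollify k g)"
  unfolding supported_def
proof (intro allI impI)
  fix x :: 'a
  define e where "e = 1 / real (Suc k)"
  have e: "e > 0" by (simp add: e_def)
  assume "norm x > (r + 1 / real (Suc k)) / (1 + 2 / real (Suc k))"
  then have x: "norm x > (r + e) / (1 + 2 * e)" by (simp add: e_def)
  then have x': "norm ((1 + 2 * e) *\<^sub>R x) > r + e" using e by (simp add: pos_divide_less_eq mult.commute)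
  have "g y * mollifier e ((1 + 2 * e) *\<^sub>R x - y) = 0" for y
  proof (cases "norm y > r")
    case False
    then have "norm ((1 + 2 * e) *\<^sub>R x - y) > e" using x' norm_triangle_ineq2[of "(1 + 2 * e) *\<^sub>R x" y] by linarith
    then have "mollifier e ((1 + 2 * e) *\<^sub>R x - y) = 0"
      using mollifier_supported[OF e] unfolding supported_def by blast
    then show ?thesis by simp
  qed (use assms(1) in \<open>simp add: supported_def\<close>)
  then have "dilated_conv g (mollifier e) (1 + 2 * e) x = (\<integral>y. 0 \<partial>(lborel :: 'a measure))"
    unfolding dilated_conv_def by (intro Bochner_Integration.integral_cong refl)
  then show "mollify k g x = 0" by (simp add: mollify_def e_def)
qed

lemma test_functionI:
  fixes f :: "'a::euclidean_space \<Rightarrow> real"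
  assumes "smooth f" "supported r f" "r < 1"
  shows "test_function f"
proof -
  have "closure {x. f x \<noteq> 0} \<subseteq> cball 0 r"
    by (rule closure_minimal) (use assms(2) in \<open>auto simp: supported_def\<close>, metis not_le)
  moreover have "cball 0 r \<subseteq> (ball 0 1 :: 'a set)" using assms(3) by auto
  ultimately show ?thesis
    using assms(1) bounded_subset[OF bounded_cball] unfolding test_function_def compact_eq_bounded_closed by auto
qed

lemma mollify_test_function:
  assumes "g \<in> L2 lborel" "supported 1 g" shows "test_function (mollify k g)"
proof (rule test_functionI[OF mollify_smooth[OF assms] mollify_supported[OF assms(2)]])
  show "(1 + 1 / real (Suc k)) / (1 + 2 / real (Suc k)) < 1" by (simp add: divide_less_eq add_pos_pos)
qed simp

section \<open>Passage between the ball with Lebesgue measure and the whole space with Borel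
  measure\<close>

lemma borel_measurable_lebesgue_on_ball:
  fixes f :: "'a::euclidean_space \<Rightarrow> real"
  shows "f \<in> borel_measurable borel \<Longrightarrow> f \<in> borel_measurable (lebesgue_on unit_ball)"
  by (rule measurable_restrict_space1) (simp add: measurable_completion)

lemma AE_lebesgue_on_iff:
  assumes "S \<in> sets borel"
  shows "(AE x in lebesgue_on S. P x) \<longleftrightarrow> (AE x in lborel. x \<in> S \<longrightarrow> P x)"
  using assms by (subst AE_restrict_space_iff) (simp_all add: AE_completion_iff)

text \<open>Functions on the ball are only Lebesgue measurable; convolution and Tonelli's theorem
  are applied to a Borel representative extended by 0.\<close>

lemma borel_version:
  fixes f :: "'a::euclidean_space \<Rightarrow> real"
  assumes "f \<in> borel_measurable (lebesgue_on unit_ball)"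
  obtains g where "g \<in> borel_measurable borel" "\<And>x. norm x \<ge> 1 \<Longrightarrow> g x = 0"
    "AE x in lebesgue_on unit_ball. f x = g x"
proof -
  have "(\<lambda>x. indicator unit_ball x *\<^sub>R f x) \<in> borel_measurable lebesgue"
    using assms by (subst (asm) borel_measurable_restrict_space_iff) auto
  from completion_ex_borel_measurable_real[OF this] obtain g where g: "g \<in> borel_measurable lborel"
    "AE x in lborel. indicator unit_ball x *\<^sub>R f x = g x" by blast
  show thesis
  proof (rule that[of "\<lambda>x. indicator unit_ball x * g x"])
    show "(\<lambda>x. indicator unit_ball x * g x) \<in> borel_measurable borel"
      using g(1) by (intro borel_measurable_times borel_measurable_indicator) simp_all
    show "AE x in lebesgue_on unit_ball. f x = indicator unit_ball x * g x"
      unfolding AE_lebesgue_on_iff[OF borel_open[OF open_ball]]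
      using g(2) by eventually_elim auto
  qed simp
qed

lemma integral_ball_eq_lborel:
  fixes f g h :: "'a::euclidean_space \<Rightarrow> real"
  assumes f: "f \<in> borel_measurable (lebesgue_on unit_ball)"
    and g: "g \<in> borel_measurable borel" "\<And>x. norm x \<ge> 1 \<Longrightarrow> g x = 0"
      "AE x in lebesgue_on unit_ball. f x = g x"
    and h: "h \<in> borel_measurable borel"
  shows "(\<integral>x. f x * h x \<partial>lebesgue_on unit_ball) = (\<integral>x. g x * h x \<partial>lborel)"
proof -
  have gh: "(\<lambda>x. g x * h x) \<in> borel_measurable borel" using g h by simp
  have "(\<integral>x. f x * h x \<partial>lebesgue_on unit_ball) = (\<integral>x. g x * h x \<partial>lebesgue_on unit_ball)"
  proof (rule integral_cong_AE)
    show "AE x in lebesgue_on unit_ball. f x * h x = g x * h x" using g(3) by eventually_elim simp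
  qed (use f gh borel_measurable_lebesgue_on_ball[OF h] borel_measurable_lebesgue_on_ball[OF gh] in simp_all)
  also have "\<dots> = (\<integral>x. indicator unit_ball x * (g x * h x) \<partial>lborel)"
    by (rule integral_lebesgue_on_borel[OF gh]) simp
  also have "\<dots> = (\<integral>x. g x * h x \<partial>lborel)"
  proof (rule Bochner_Integration.integral_cong[OF refl])
    fix x :: 'a
    show "indicator unit_ball x * (g x * h x) = g x * h x"
      by (cases "norm x < 1") (simp_all add: g(2))
  qed
  finally show ?thesis .
qed

lemma L2_ball_imp_lborel:
  fixes g :: "'a::euclidean_space \<Rightarrow> real"
  assumes f: "f \<in> L2 (lebesgue_on unit_ball)"
    and g: "g \<in> borel_measurable borel" "\<And>x. norm x \<ge> 1 \<Longrightarrow> g x = 0"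
      "AE x in lebesgue_on unit_ball. f x = g x"
  shows "g \<in> L2 lborel"
proof -
  have "g \<in> L2 (lebesgue_on unit_ball)"
    by (rule L2_cong_AE[OF f borel_measurable_lebesgue_on_ball[OF g(1)] g(3)])
  then have "integrable lborel (\<lambda>x. indicator unit_ball x * (g x)\<^sup>2)"
    using integrable_lebesgue_on_borel[of "\<lambda>x. (g x)\<^sup>2" unit_ball] g(1) by (simp add: L2_def)
  moreover have "indicator unit_ball x * (g x)\<^sup>2 = (g x)\<^sup>2" for x
    by (cases "norm x < 1") (simp_all add: g(2))
  ultimately show ?thesis using g(1) by (simp add: L2_def)
qed

lemma L2_lborel_imp_ball:
  fixes F :: "'a::euclidean_space \<Rightarrow> real"
  assumes F: "F \<in> L2 lborel"
  shows "F \<in> L2 (lebesgue_on unit_ball)"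
    and "(\<integral>x. (F x)\<^sup>2 \<partial>lebesgue_on unit_ball) \<le> (\<integral>x. (F x)\<^sup>2 \<partial>lborel)"
proof -
  have m: "F \<in> borel_measurable borel" using L2_measurable[OF F] by simp
  then have m2: "(\<lambda>x. (F x)\<^sup>2) \<in> borel_measurable borel" by simp
  have i: "integrable lborel (\<lambda>x. indicator unit_ball x * (F x)\<^sup>2)"
    using integrable_mult_indicator[OF _ L2_integrable[OF F], of unit_ball] by simp
  then have "integrable (lebesgue_on unit_ball) (\<lambda>x. (F x)\<^sup>2)"
    by (subst integrable_lebesgue_on_borel[OF m2]) simp_all
  then show "F \<in> L2 (lebesgue_on unit_ball)"
    using borel_measurable_lebesgue_on_ball[OF m] by (simp add: L2_def)
  have "(\<integral>x. (F x)\<^sup>2 \<partial>lebesgue_on unit_ball) = (\<integral>x. indicator unit_ball x * (F x)\<^sup>2 \<partial>lborel)"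
    by (rule integral_lebesgue_on_borel[OF m2]) simp
  also have "\<dots> \<le> (\<integral>x. (F x)\<^sup>2 \<partial>lborel)"
    by (rule integral_mono[OF i L2_integrable[OF F]]) (simp add: indicator_def)
  finally show "(\<integral>x. (F x)\<^sup>2 \<partial>lebesgue_on unit_ball) \<le> (\<integral>x. (F x)\<^sup>2 \<partial>lborel)" .
qed

lemma L2_conv_cong_AE:
  assumes "L2_conv M F g" "f \<in> borel_measurable M" "AE x in M. f x = g x"
  shows "L2_conv M F f"
proof -
  note 1 = L2_convD[OF assms(1)]
  have "f \<in> L2 M" by (rule L2_cong_AE[OF 1(2) assms(2)]) (use assms(3) in eventually_elim, simp)
  moreover have "(\<integral>x. (F k x - f x)\<^sup>2 \<partial>M) = (\<integral>x. (F k x - g x)\<^sup>2 \<partial>M)" for k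
  proof (rule integral_cong_AE)
    show "AE x in M. (F k x - f x)\<^sup>2 = (F k x - g x)\<^sup>2" using assms(3) by eventually_elim simp
  qed (use assms(2) L2_measurable[OF 1(1)] L2_measurable[OF 1(2)] in simp_all)
  ultimately show ?thesis using 1 by (simp add: L2_conv_def)
qed

lemma L2_conv_lborel_imp_ball:
  fixes F :: "nat \<Rightarrow> 'a::euclidean_space \<Rightarrow> real"
  assumes "L2_conv lborel F g" "f \<in> borel_measurable (lebesgue_on unit_ball)"
    "AE x in lebesgue_on unit_ball. f x = g x"
  shows "L2_conv (lebesgue_on unit_ball) F f"
proof -
  note 1 = L2_convD[OF assms(1)]
  have "L2_conv (lebesgue_on unit_ball) F g"
    by (rule L2_conv_bound[OF _ _ _ 1(3)])
       (intro L2_lborel_imp_ball L2_diff 1)+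
  then show ?thesis by (rule L2_conv_cong_AE[OF _ assms(2,3)])
qed

lemma L2_conv_scale_seq:
  assumes F: "L2_conv M F f" and c: "c \<longlonglongrightarrow> 1"
  shows "L2_conv M (\<lambda>k x. c k * F k x) f"
proof (rule L2_conv_bound)
  note 1 = L2_convD[OF F]
  show "(\<lambda>x. c k * F k x) \<in> L2 M" for k by (intro L2_cmult 1)
  show "f \<in> L2 M" by (rule 1)
  show "(\<integral>x. (c k * F k x - f x)\<^sup>2 \<partial>M) \<le> 2 * ((c k)\<^sup>2 * (\<integral>x. (F k x - f x)\<^sup>2 \<partial>M)) + 2 * ((1 - c k)\<^sup>2 * (\<integral>x. (f x)\<^sup>2 \<partial>M))" for k
  proof -
    have "(\<integral>x. (c k * F k x - f x)\<^sup>2 \<partial>M) = (\<integral>x. (c k * (F k x - f x) - (1 - c k) * f x)\<^sup>2 \<partial>M)"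
      by (simp add: algebra_simps)
    also have "\<dots> \<le> 2 * (\<integral>x. (c k * (F k x - f x))\<^sup>2 \<partial>M) + 2 * (\<integral>x. ((1 - c k) * f x)\<^sup>2 \<partial>M)"
      by (intro L2_triangle_sq L2_cmult L2_diff 1)
    finally show ?thesis by (simp add: power_mult_distrib)
  qed
  have "(\<lambda>k. 2 * ((c k)\<^sup>2 * (\<integral>x. (F k x - f x)\<^sup>2 \<partial>M)) + 2 * ((1 - c k)\<^sup>2 * (\<integral>x. (f x)\<^sup>2 \<partial>M)))
      \<longlonglongrightarrow> 2 * (1\<^sup>2 * 0) + 2 * ((1 - 1)\<^sup>2 * (\<integral>x. (f x)\<^sup>2 \<partial>M))"
    by (intro tendsto_intros 1 c)
  then show "(\<lambda>k. 2 * ((c k)\<^sup>2 * (\<integral>x. (F k x - f x)\<^sup>2 \<partial>M)) + 2 * ((1 - c k)\<^sup>2 * (\<integral>x. (f x)\<^sup>2 \<partial>M))) \<longlonglongrightarrow> 0"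
    by simp
qed

lemma laplacian_affine:
  fixes f :: "'a::euclidean_space \<Rightarrow> real"
  assumes "smooth f"
  shows "laplacian (\<lambda>x. f (c *\<^sub>R x + d)) x = c\<^sup>2 * laplacian f (c *\<^sub>R x + d)"
proof -
  have "partial_deriv i (partial_deriv i (\<lambda>x. f (c *\<^sub>R x + d))) x
      = c\<^sup>2 * partial_deriv i (partial_deriv i f) (c *\<^sub>R x + d)" if i: "i \<in> Basis" for i
  proof -
    note s = smooth_partial_deriv[OF assms i]
    have "partial_deriv i (\<lambda>x. f (c *\<^sub>R x + d)) = (\<lambda>x. c * partial_deriv i f (c *\<^sub>R x + d))"
      by (rule ext) (rule partial_deriv_affine[OF smooth_C_k[OF assms]])
    then show ?thesis
      using partial_deriv_cmult[OF smooth_C_k[OF smooth_affine[OF s]], of i c c d x]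
        partial_deriv_affine[OF smooth_C_k[OF s], of i c d x] by (simp add: power2_eq_square)
  qed
  then show ?thesis by (simp add: laplacian_def sum_distrib_left)
qed

lemma test_function_smooth: "test_function f \<Longrightarrow> smooth f"
  by (simp add: test_function_def)

text \<open>As the Green identity is assumed for every smooth \<open>\<eta>\<close> and not only for test functions, the
  extension of \<open>\<phi>\<close> by zero has Laplacian \<open>f\<close> on the whole space.  Shrinking its support by a
  dilation leaves room for a mollification inside the ball.\<close>

theorem test_function_approximation:
  fixes \<phi> f :: "'a::euclidean_space \<Rightarrow> real"
  assumes \<phi>: "\<phi> \<in> L2 (lebesgue_on unit_ball)" and f: "f \<in> L2 (lebesgue_on unit_ball)"
    and green: "\<And>\<eta>. smooth \<eta> \<Longrightarrow>
      (\<integral>x. \<phi> x * laplacian \<eta> x \<partial>lebesgue_on unit_ball) = (\<integral>x. f x * \<eta> x \<partial>lebesgue_on unit_ball)"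
  obtains \<psi> where "\<And>k. test_function (\<psi> k)" "L2_conv (lebesgue_on unit_ball) \<psi> \<phi>"
    "L2_conv (lebesgue_on unit_ball) (\<lambda>k. laplacian (\<psi> k)) f"
    "(AE x in lebesgue_on unit_ball. \<phi> x \<ge> 0) \<Longrightarrow> (\<forall>k x. \<psi> k x \<ge> 0)"
proof -
  obtain g0 where g0: "g0 \<in> borel_measurable borel" "\<And>x. norm x \<ge> 1 \<Longrightarrow> g0 x = 0"
    "AE x in lebesgue_on unit_ball. \<phi> x = g0 x"
    using borel_version[OF L2_measurable[OF \<phi>]] by blast
  \<comment> \<open>When \<phi> is nonnegative almost everywhere, the representative is made
    nonnegative at every point, so that its mollifications are nonnegative at every point
    too.\<close>
  define g where "g = (if AE x in lebesgue_on unit_ball. \<phi> x \<ge> 0 then (\<lambda>x. max 0 (g0 x)) else g0)"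
  have g: "g \<in> borel_measurable borel" "\<And>x. norm x \<ge> 1 \<Longrightarrow> g x = 0"
    using g0(1,2) by (simp_all add: g_def)
  have gae: "AE x in lebesgue_on unit_ball. \<phi> x = g x"
  proof (cases "AE x in lebesgue_on unit_ball. \<phi> x \<ge> 0")
    case True
    with g0(3) have "AE x in lebesgue_on unit_ball. \<phi> x = max 0 (g0 x)" by eventually_elim simp
    then show ?thesis using True by (simp add: g_def)
  qed (use g0(3) in \<open>simp add: g_def\<close>)
  obtain h where h: "h \<in> borel_measurable borel" "\<And>x. norm x \<ge> 1 \<Longrightarrow> h x = 0"
    "AE x in lebesgue_on unit_ball. f x = h x"
    using borel_version[OF L2_measurable[OF f]] by blast
  have gL: "g \<in> L2 lborel" and hL: "h \<in> L2 lborel"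
    using L2_ball_imp_lborel[OF \<phi> g gae] L2_ball_imp_lborel[OF f h] by simp_all
  have gs: "supported 1 g" and hs: "supported 1 h"
    using g(2) h(2) by (simp_all add: supported_def)
  define c where "c k = 1 + 2 / real (Suc k)" for k
  have lap: "laplacian (mollify k g) = (\<lambda>x. (c k)\<^sup>2 * mollify k h x)" for k
  proof
    fix x :: 'a
    define K :: "'a \<Rightarrow> real" where "K = mollifier (1 / real (Suc k))"
    have K: "smooth K" "supported (1 / real (Suc k)) K"
      unfolding K_def by (rule mollifier_smooth, rule mollifier_supported) simp
    \<comment> \<open>The reflected kernel is centred at \<open>c k *\<^sub>R x\<close> and may
      reach across the boundary of the ball, so the Green identity is needed beyond test
      functions.\<close>
    define \<eta> where "\<eta> y = K ((-1) *\<^sub>R y + c k *\<^sub>R x)" for y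
    have \<eta>: "smooth \<eta>" unfolding \<eta>_def[abs_def] by (rule smooth_affine[OF K(1)])
    have "laplacian (mollify k g) x = (c k)\<^sup>2 * dilated_conv g (laplacian K) (c k) x"
      unfolding mollify_def c_def[symmetric] K_def[symmetric]
      by (rule laplacian_dilated_conv[OF L2_supported_integrable[OF gL gs] K])
    also have "dilated_conv g (laplacian K) (c k) x = (\<integral>y. g y * laplacian \<eta> y \<partial>lborel)"
      unfolding dilated_conv_def \<eta>_def[abs_def] laplacian_affine[OF K(1)] by (simp add: algebra_simps)
    also have "\<dots> = (\<integral>y. \<phi> y * laplacian \<eta> y \<partial>lebesgue_on unit_ball)"
      by (rule integral_ball_eq_lborel[OF L2_measurable[OF \<phi>] g gae, symmetric])
         (assumption, rule borel_measurable_continuous_onI[OF smooth_continuous[OF smooth_laplacian[OF \<eta>]]])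
    also have "\<dots> = (\<integral>y. f y * \<eta> y \<partial>lebesgue_on unit_ball)" by (rule green[OF \<eta>])
    also have "\<dots> = (\<integral>y. h y * \<eta> y \<partial>lborel)"
      by (rule integral_ball_eq_lborel[OF L2_measurable[OF f] h])
         (assumption, rule borel_measurable_continuous_onI[OF smooth_continuous[OF \<eta>]])
    also have "\<dots> = mollify k h x"
      unfolding mollify_def dilated_conv_def c_def[symmetric] K_def[symmetric] \<eta>_def by (simp add: algebra_simps)
    finally show "laplacian (mollify k g) x = (c k)\<^sup>2 * mollify k h x" .
  qed
  have c1: "(\<lambda>k. (c k)\<^sup>2) \<longlonglongrightarrow> 1"
  proof -
    have "(\<lambda>k. inverse (real (Suc k))) \<longlonglongrightarrow> 0" by (rule LIMSEQ_inverse_real_of_nat)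
    then have "(\<lambda>k. (1 + 2 * inverse (real (Suc k)))\<^sup>2) \<longlonglongrightarrow> (1 + 2 * 0)\<^sup>2" by (intro tendsto_intros)
    then show ?thesis by (simp add: c_def divide_inverse)
  qed
  show thesis
  proof (rule that[of "\<lambda>k. mollify k g"])
    show "test_function (mollify k g)" for k by (rule mollify_test_function[OF gL gs])
    show "L2_conv (lebesgue_on unit_ball) (\<lambda>k. mollify k g) \<phi>"
      by (rule L2_conv_lborel_imp_ball[OF mollify_L2_conv[OF gL gs] L2_measurable[OF \<phi>] gae])
    show "L2_conv (lebesgue_on unit_ball) (\<lambda>k. laplacian (mollify k g)) f"
      unfolding lap
      by (rule L2_conv_scale_seq[OF L2_conv_lborel_imp_ball[OF mollify_L2_conv[OF hL hs] L2_measurable[OF f] h(3)] c1])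
    show "\<forall>k x. mollify k g x \<ge> 0" if "AE x in lebesgue_on unit_ball. \<phi> x \<ge> 0"
    proof -
      have "g = (\<lambda>x. max 0 (g0 x))" unfolding g_def using that by (rule if_P)
      then show ?thesis using mollify_nonneg[OF g(1)] by simp
    qed
  qed
qed

text \<open>The test functions are mollifications of the sign of \<open>g\<close> on the smaller
  ball. They are bounded by 1 and converge to the sign almost everywhere along a subsequence, so the
  vanishing integrals tend to the integral of |g| over that ball.\<close>

lemma fundamental_lemma_cball:
  fixes g :: "'a::euclidean_space \<Rightarrow> real"
  assumes g: "integrable (lebesgue_on (cball 0 \<rho>)) g"
    and z: "\<And>\<psi>. test_function \<psi> \<Longrightarrow> (\<integral>x. g x * \<psi> x \<partial>lebesgue_on unit_ball) = 0"
    and \<rho>: "1 / 2 \<le> \<rho>" "\<rho> < 1"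
  shows "AE x in lborel. norm x \<le> \<rho> \<longrightarrow> g x = 0"
proof -
  define G where "G x = indicator (cball 0 \<rho>) x * g x" for x
  have G: "integrable lebesgue G"
    using g by (subst (asm) integrable_restrict_space) (simp_all add: G_def[abs_def])
  have "(\<lambda>x. sgn (G x)) \<in> borel_measurable lebesgue"
    by (rule measurable_compose[OF borel_measurable_integrable[OF G] borel_measurable_sgn])
  from completion_ex_borel_measurable_real[OF this] obtain s where s: "s \<in> borel_measurable lborel"
    "AE x in lborel. sgn (G x) = s x" by blast
  define \<sigma> where "\<sigma> x = indicator (cball 0 \<rho>) x * max (-1) (min 1 (s x))" for x
  have \<sigma>m: "\<sigma> \<in> borel_measurable borel" unfolding \<sigma>_def
    using s(1) by (intro borel_measurable_times borel_measurable_indicator borel_measurable_max borel_measurable_min) simp_all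
  have \<sigma>b: "\<bar>\<sigma> x\<bar> \<le> 1" for x by (auto simp: \<sigma>_def indicator_def max_def min_def)
  have \<sigma>s: "supported \<rho> \<sigma>" by (simp add: supported_def \<sigma>_def)
  then have \<sigma>s1: "supported 1 \<sigma>" using \<rho> by (simp add: supported_def)
  have \<sigma>G: "AE x in lborel. G x * \<sigma> x = \<bar>G x\<bar>"
    using s(2)
  proof eventually_elim
    case (elim x)
    have "max (-1) (min 1 (sgn t)) = sgn t" for t :: real by (simp add: sgn_if)
    from this[of "G x"] have "\<sigma> x = indicator (cball 0 \<rho>) x * sgn (G x)"
      unfolding \<sigma>_def elim by simp
    then show ?case by (simp add: G_def indicator_def abs_sgn)
  qed
  have \<sigma>L: "\<sigma> \<in> L2 lborel"
  proof -
    have "integrable lborel (\<lambda>x. (\<sigma> x)\<^sup>2)"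
    proof (rule Bochner_Integration.integrable_bound)
      show "integrable lborel (\<lambda>x::'a. 1 * indicator (cball 0 \<rho>) x :: real)"
        using emeasure_lborel_cball_finite[of "0::'a" \<rho>]
        by (intro integrable_mult_right integrable_real_indicator) auto
      have "\<bar>\<sigma> x\<bar> \<le> 1 * indicator (cball 0 \<rho>) x" for x by (auto simp: \<sigma>_def indicator_def max_def min_def)
      from power2_le_indicator[OF this]
      show "AE x in lborel. norm ((\<sigma> x)\<^sup>2) \<le> norm (1 * indicator (cball 0 \<rho>) x :: real)" by simp
    qed (use \<sigma>m in simp)
    then show ?thesis using \<sigma>m by (simp add: L2_def)
  qed
  define \<psi> where "\<psi> k = mollify k \<sigma>" for k
  have \<psi>t: "test_function (\<psi> k)" for k unfolding \<psi>_def by (rule mollify_test_function[OF \<sigma>L \<sigma>s1])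
  have \<psi>b: "\<bar>\<psi> k x\<bar> \<le> 1" for k x unfolding \<psi>_def by (rule mollify_bounded[OF \<sigma>m \<sigma>b])
  have \<psi>s: "\<psi> k x = 0" if "norm x > \<rho>" for k x
  proof -
    \<comment> \<open>The mollifications must not leave the ball on which \<open>g\<close> is
      integrable. With e = 1 / (k + 1) the condition (\<rho> + e) / (1 + 2 e) \<le> \<rho> amounts
      to 1 \<le> 2 \<rho>, whence the lower bound on \<rho>.\<close>
    have "\<rho> + 1 / real (Suc k) \<le> \<rho> * (1 + 2 / real (Suc k))"
      using mult_right_mono[of 1 "2 * \<rho>" "1 / real (Suc k)"] \<rho>(1) by (simp add: algebra_simps)
    then have "(\<rho> + 1 / real (Suc k)) / (1 + 2 / real (Suc k)) \<le> \<rho>"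
      by (subst pos_divide_le_eq) (simp_all add: add_pos_pos)
    then show ?thesis
      using mollify_supported[OF \<sigma>s, of k] \<rho>(1) that unfolding supported_def \<psi>_def by fastforce
  qed
  have \<psi>m: "\<psi> k \<in> borel_measurable borel" for k
    by (rule borel_measurable_continuous_onI[OF smooth_continuous[OF test_function_smooth[OF \<psi>t]]])
  then have \<psi>m': "\<psi> k \<in> borel_measurable lebesgue" for k by (simp add: measurable_completion)
  have "L2_conv lborel \<psi> \<sigma>" unfolding \<psi>_def[abs_def] by (rule mollify_L2_conv[OF \<sigma>L \<sigma>s1])
  then obtain r where r: "strict_mono r" "AE x in lborel. (\<lambda>k. \<psi> (r k) x) \<longlonglongrightarrow> \<sigma> x"
    by (rule L2_conv_AE_subseq)
  have "(\<integral>x. G x * \<psi> k x \<partial>lebesgue) = 0" for k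
  proof -
    have "(\<integral>x. g x * \<psi> k x \<partial>lebesgue_on unit_ball) = (\<integral>x. indicator unit_ball x * (g x * \<psi> k x) \<partial>lebesgue)"
      by (subst integral_restrict_space) simp_all
    also have "\<dots> = (\<integral>x. G x * \<psi> k x \<partial>lebesgue)"
    proof (rule Bochner_Integration.integral_cong[OF refl])
      fix x :: 'a
      show "indicator unit_ball x * (g x * \<psi> k x) = G x * \<psi> k x"
        using \<psi>s[of x k] \<rho>(2) by (cases "norm x \<le> \<rho>") (simp_all add: G_def)
    qed
    finally show ?thesis using z[OF \<psi>t] by simp
  qed
  moreover have "(\<lambda>k. \<integral>x. G x * \<psi> (r k) x \<partial>lebesgue) \<longlonglongrightarrow> (\<integral>x. \<bar>G x\<bar> \<partial>lebesgue)"
  proof (rule integral_dominated_convergence[OF _ _ integrable_abs[OF G]])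
    show "(\<lambda>x. \<bar>G x\<bar>) \<in> borel_measurable lebesgue"
      using borel_measurable_integrable[OF G] by simp
    show "(\<lambda>x. G x * \<psi> (r k) x) \<in> borel_measurable lebesgue" for k
      using borel_measurable_integrable[OF G] \<psi>m' by simp
    show "AE x in lebesgue. (\<lambda>k. G x * \<psi> (r k) x) \<longlonglongrightarrow> \<bar>G x\<bar>"
      unfolding AE_completion_iff using r(2) \<sigma>G
    proof eventually_elim
      case (elim x)
      from tendsto_mult_left[OF elim(1), of "G x"] elim(2) show ?case by simp
    qed
    show "AE x in lebesgue. norm (G x * \<psi> (r k) x) \<le> \<bar>G x\<bar>" for k
      using \<psi>b by (simp add: abs_mult mult_left_le)
  qed
  ultimately have "(\<integral>x. \<bar>G x\<bar> \<partial>lebesgue) = 0" by (simp add: LIMSEQ_const_iff)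
  then have "AE x in lebesgue. \<bar>G x\<bar> = 0"
    using integral_nonneg_eq_0_iff_AE[OF integrable_abs[OF G]] by simp
  then have "AE x in lborel. G x = 0" unfolding AE_completion_iff by simp
  then show ?thesis by eventually_elim (auto simp: G_def indicator_def split: if_splits)
qed

theorem fundamental_lemma:
  fixes g :: "'a::euclidean_space \<Rightarrow> real"
  assumes g: "locally_integrable g"
    and z: "\<And>\<psi>. test_function \<psi> \<Longrightarrow> (\<integral>x. g x * \<psi> x \<partial>lebesgue_on unit_ball) = 0"
  shows "AE x in lebesgue_on unit_ball. g x = 0"
proof -
  define \<rho> :: "nat \<Rightarrow> real" where "\<rho> j = 1 - 1 / real (j + 2)" for j
  have \<rho>: "1 / 2 \<le> \<rho> j" "\<rho> j < 1" for j by (simp_all add: \<rho>_def field_simps)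
  have "AE x in lborel. norm x \<le> \<rho> j \<longrightarrow> g x = 0" for j
  proof (rule fundamental_lemma_cball[OF _ z \<rho>])
    have "cball 0 (\<rho> j) \<subseteq> (unit_ball :: 'a set)" using \<rho>(2)[of j] by auto
    then show "integrable (lebesgue_on (cball 0 (\<rho> j))) g"
      using g by (auto simp: locally_integrable_def)
  qed
  then have "AE x in lborel. \<forall>j. norm x \<le> \<rho> j \<longrightarrow> g x = 0"
    unfolding AE_all_countable by (rule allI)
  then show ?thesis
    unfolding AE_lebesgue_on_iff[OF borel_open[OF open_ball]]
  proof eventually_elim
    case (elim x)
    show ?case
    proof
      assume "x \<in> unit_ball"
      then have "norm x < 1" by simp
      then obtain j where "inverse (real (Suc j)) < 1 - norm x"
        using reals_Archimedean[of "1 - norm x"] by auto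
      moreover have "1 / real (j + 2) \<le> inverse (real (Suc j))"
        by (simp add: inverse_eq_divide frac_le)
      ultimately have "norm x \<le> \<rho> j" by (simp add: \<rho>_def)
      with elim show "g x = 0" by blast
    qed
  qed
qed

section \<open>Integration by parts for test functions\<close>

lemma has_real_derivative_line:
  assumes "C_k (Suc 0) f" "i \<in> Basis"
  shows "((\<lambda>s. f (y + s *\<^sub>R i)) has_real_derivative partial_deriv i f (y + s *\<^sub>R i)) (at s)"
proof -
  have 1: "((\<lambda>s. y + s *\<^sub>R i) has_derivative (\<lambda>h. h *\<^sub>R i)) (at s)"
    by (auto intro!: derivative_eq_intros)
  have "(\<Sum>j\<in>Basis. (h *\<^sub>R i \<bullet> j) * partial_deriv j f z) = partial_deriv i f z * h" for h z
    using sum_Basis_inner_mult[OF assms(2), of "\<lambda>j. partial_deriv j f z"]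
    by (simp add: sum_distrib_left[symmetric] mult.assoc)
  with has_derivative_compose[OF 1 C_k_Suc_has_derivative[OF assms(1)]]
  show ?thesis by (simp add: has_field_derivative_def)
qed

text \<open>The left-hand side is symmetric in \<open>i\<close> and \<open>j\<close>; this is where the symmetry of second derivatives comes from.\<close>

lemma second_difference:
  assumes f: "C_k (Suc (Suc 0)) f" and ij: "i \<in> Basis" "j \<in> Basis" and h: "h > 0"
  shows "\<exists>p. norm (p - x) \<le> 2 * h \<and>
    f (x + h *\<^sub>R i + h *\<^sub>R j) - f (x + h *\<^sub>R i) - f (x + h *\<^sub>R j) + f x = h\<^sup>2 * partial_deriv j (partial_deriv i f) p"
proof -
  have f1: "C_k (Suc 0) f" by (rule C_k_Suc_imp[OF f])
  have fi: "C_k (Suc 0) (partial_deriv i f)" using f ij by simp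
  define G where "G s = f (x + h *\<^sub>R j + s *\<^sub>R i) - f (x + s *\<^sub>R i)" for s
  have "\<exists>z>0. z < h \<and> G h - G 0 = (h - 0) * (partial_deriv i f (x + h *\<^sub>R j + z *\<^sub>R i) - partial_deriv i f (x + z *\<^sub>R i))"
    unfolding G_def by (rule MVT2[OF h]) (intro DERIV_diff has_real_derivative_line f1 ij)
  then obtain z where z: "0 < z" "z < h"
    "G h - G 0 = h * (partial_deriv i f (x + h *\<^sub>R j + z *\<^sub>R i) - partial_deriv i f (x + z *\<^sub>R i))" by auto
  have "\<exists>w>0. w < h \<and> partial_deriv i f (x + z *\<^sub>R i + h *\<^sub>R j) - partial_deriv i f (x + z *\<^sub>R i + 0 *\<^sub>R j)
      = (h - 0) * partial_deriv j (partial_deriv i f) (x + z *\<^sub>R i + w *\<^sub>R j)"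
    by (rule MVT2[OF h]) (intro has_real_derivative_line fi ij)
  then obtain w where w: "0 < w" "w < h"
    "partial_deriv i f (x + z *\<^sub>R i + h *\<^sub>R j) - partial_deriv i f (x + z *\<^sub>R i)
      = h * partial_deriv j (partial_deriv i f) (x + z *\<^sub>R i + w *\<^sub>R j)" by auto
  show ?thesis
  proof (intro exI conjI)
    have "norm (z *\<^sub>R i + w *\<^sub>R j) \<le> norm (z *\<^sub>R i) + norm (w *\<^sub>R j)" by (rule norm_triangle_ineq)
    then show "norm (x + z *\<^sub>R i + w *\<^sub>R j - x) \<le> 2 * h" using z w ij by simp
    have "f (x + h *\<^sub>R i + h *\<^sub>R j) - f (x + h *\<^sub>R i) - f (x + h *\<^sub>R j) + f x = G h - G 0"
      unfolding G_def by (simp add: add_ac)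
    also have "\<dots> = h\<^sup>2 * partial_deriv j (partial_deriv i f) (x + z *\<^sub>R i + w *\<^sub>R j)"
      unfolding z(3) using w(3) by (simp add: add_ac power2_eq_square)
    finally show "f (x + h *\<^sub>R i + h *\<^sub>R j) - f (x + h *\<^sub>R i) - f (x + h *\<^sub>R j) + f x
        = h\<^sup>2 * partial_deriv j (partial_deriv i f) (x + z *\<^sub>R i + w *\<^sub>R j)" .
  qed
qed

lemma partial_deriv_commute:
  assumes f: "C_k (Suc (Suc 0)) f" and ij: "i \<in> Basis" "j \<in> Basis"
  shows "partial_deriv j (partial_deriv i f) x = partial_deriv i (partial_deriv j f) x"
proof -
  define h where "h n = inverse (real (Suc n))" for n
  have h: "h n > 0" for n by (simp add: h_def)
  have h0: "(\<lambda>n. 2 * h n) \<longlonglongrightarrow> 2 * 0" unfolding h_def by (intro tendsto_intros LIMSEQ_inverse_real_of_nat)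
  define Q where "Q n = (f (x + h n *\<^sub>R i + h n *\<^sub>R j) - f (x + h n *\<^sub>R i) - f (x + h n *\<^sub>R j) + f x) / (h n)\<^sup>2" for n
  have *: "Q \<longlonglongrightarrow> partial_deriv l (partial_deriv k f) x"
    if kl: "k \<in> Basis" "l \<in> Basis"
      and Q: "\<And>n. \<exists>p. norm (p - x) \<le> 2 * h n \<and> Q n = partial_deriv l (partial_deriv k f) p" for k l
  proof -
    obtain p where p: "\<And>n. norm (p n - x) \<le> 2 * h n" "\<And>n. Q n = partial_deriv l (partial_deriv k f) (p n)"
      using Q by metis
    have "(\<lambda>n. p n - x) \<longlonglongrightarrow> 0"
      by (rule Lim_null_comparison[OF always_eventually[OF allI[OF p(1)]]]) (use h0 in simp)
    then have px: "p \<longlonglongrightarrow> x" by (rule LIM_zero_cancel)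
    have "continuous_on UNIV (partial_deriv l (partial_deriv k f))" using f kl by simp
    from continuous_on_tendsto_compose[OF this px]
    have "(\<lambda>n. partial_deriv l (partial_deriv k f) (p n)) \<longlonglongrightarrow> partial_deriv l (partial_deriv k f) x" by simp
    moreover have "Q = (\<lambda>n. partial_deriv l (partial_deriv k f) (p n))" by (rule ext) (rule p(2))
    ultimately show ?thesis by simp
  qed
  have "Q \<longlonglongrightarrow> partial_deriv j (partial_deriv i f) x"
  proof (rule *[OF ij])
    fix n
    obtain p where p: "norm (p - x) \<le> 2 * h n" "f (x + h n *\<^sub>R i + h n *\<^sub>R j) - f (x + h n *\<^sub>R i) - f (x + h n *\<^sub>R j) + f x
        = (h n)\<^sup>2 * partial_deriv j (partial_deriv i f) p"
      using second_difference[OF f ij h, of x n] by blast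
    show "\<exists>p. norm (p - x) \<le> 2 * h n \<and> Q n = partial_deriv j (partial_deriv i f) p"
      using p h[of n] by (intro exI[of _ p]) (simp add: Q_def)
  qed
  moreover have "Q \<longlonglongrightarrow> partial_deriv i (partial_deriv j f) x"
  proof (rule *[OF ij(2,1)])
    fix n
    obtain p where p: "norm (p - x) \<le> 2 * h n" "f (x + h n *\<^sub>R j + h n *\<^sub>R i) - f (x + h n *\<^sub>R j) - f (x + h n *\<^sub>R i) + f x
        = (h n)\<^sup>2 * partial_deriv i (partial_deriv j f) p"
      using second_difference[OF f ij(2,1) h, of x n] by blast
    have "Q n = partial_deriv i (partial_deriv j f) p"
      using p(2) h[of n] unfolding Q_def by (simp add: field_simps)
    with p(1) show "\<exists>p. norm (p - x) \<le> 2 * h n \<and> Q n = partial_deriv i (partial_deriv j f) p" by blast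
  qed
  ultimately show ?thesis by (rule LIMSEQ_unique)
qed

section \<open>Integration by parts and L2 estimates for test functions\<close>

lemma continuous_L2_ball:
  fixes f :: "'a::euclidean_space \<Rightarrow> real"
  assumes "continuous_on UNIV f" shows "f \<in> L2 (lebesgue_on unit_ball)"
proof -
  have m: "f \<in> borel_measurable borel" by (rule borel_measurable_continuous_onI[OF assms])
  obtain B where B: "B \<ge> 0" "\<And>x. norm x \<le> 1 \<Longrightarrow> \<bar>f x\<bar> \<le> B"
    using continuous_bounded_cball[OF assms, of 1] by metis
  have "integrable lborel (\<lambda>x. indicator unit_ball x * (f x)\<^sup>2)"
  proof (rule integrable_bounded_ball)
    show "\<bar>(f x)\<^sup>2\<bar> \<le> B\<^sup>2" if "norm x < 1" for x
      using power_mono[OF B(2)[of x], of 2] that by simp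
  qed (use m in simp)
  then have "integrable (lebesgue_on unit_ball) (\<lambda>x. (f x)\<^sup>2)"
    using m by (subst integrable_lebesgue_on_borel) simp_all
  then show ?thesis using borel_measurable_lebesgue_on_ball[OF m] by (simp add: L2_def)
qed

lemma L2_ball_integrable:
  fixes f :: "'a::euclidean_space \<Rightarrow> real"
  assumes "f \<in> L2 (lebesgue_on unit_ball)" shows "integrable (lebesgue_on unit_ball) f"
  using L2_mult[OF assms continuous_L2_ball[OF continuous_on_const[of UNIV 1]]] by simp

lemma continuous_integrable_ball:
  fixes f :: "'a::euclidean_space \<Rightarrow> real"
  assumes "continuous_on UNIV f" shows "integrable (lebesgue_on unit_ball) f"
  by (rule L2_ball_integrable[OF continuous_L2_ball[OF assms]])

lemma C_1_partial_deriv_continuous: "C_k (Suc 0) f \<Longrightarrow> i \<in> Basis \<Longrightarrow> continuous_on UNIV (partial_deriv i f)"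
  by simp

lemma ibp_sphere:
  fixes f g :: "'a::euclidean_space \<Rightarrow> real"
  assumes f: "C_k (Suc 0) f" and g: "C_k (Suc 0) g" and i: "i \<in> Basis"
  shows "(\<integral>x. f x * partial_deriv i g x \<partial>lebesgue_on unit_ball) + (\<integral>x. partial_deriv i f x * g x \<partial>lebesgue_on unit_ball)
    = (\<integral>x. f x * g x * (x \<bullet> i) \<partial>sphere_measure)"
proof -
  note cf = C_k_continuous[OF f] C_1_partial_deriv_continuous[OF f i]
  note cg = C_k_continuous[OF g] C_1_partial_deriv_continuous[OF g i]
  have "(\<integral>x. f x * g x * (x \<bullet> i) \<partial>sphere_measure) = (\<integral>x. partial_deriv i (\<lambda>x. f x * g x) x \<partial>lebesgue_on unit_ball)"
    by (rule divergence_ball[OF C_k_mult[OF f g] i, symmetric])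
  also have "\<dots> = (\<integral>x. f x * partial_deriv i g x + partial_deriv i f x * g x \<partial>lebesgue_on unit_ball)"
    by (simp only: partial_deriv_mult[OF f g])
  also have "\<dots> = (\<integral>x. f x * partial_deriv i g x \<partial>lebesgue_on unit_ball) + (\<integral>x. partial_deriv i f x * g x \<partial>lebesgue_on unit_ball)"
    by (intro Bochner_Integration.integral_add continuous_integrable_ball continuous_on_mult cf cg)
  finally show ?thesis by simp
qed

lemma ibp_vanishing:
  fixes f g :: "'a::euclidean_space \<Rightarrow> real"
  assumes f: "C_k (Suc 0) f" and g: "C_k (Suc 0) g" and i: "i \<in> Basis"
    and z: "\<And>x. norm x = 1 \<Longrightarrow> f x * g x = 0"
  shows "(\<integral>x. f x * partial_deriv i g x \<partial>lebesgue_on unit_ball) = - (\<integral>x. partial_deriv i f x * g x \<partial>lebesgue_on unit_ball)"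
proof -
  have "(\<integral>x. f x * g x * (x \<bullet> i) \<partial>sphere_measure) = 0"
    by (rule integral_eq_zero_AE) (use AE_sphere_measure in eventually_elim, simp add: z)
  with ibp_sphere[OF f g i] show ?thesis by linarith
qed

text \<open>The norm attains its maximum on the compact support, which turns inclusion in the open
  ball into a radius strictly below 1.\<close>

lemma test_function_iff:
  fixes f :: "'a::euclidean_space \<Rightarrow> real"
  shows "test_function f \<longleftrightarrow> smooth f \<and> (\<exists>r<1. supported r f)"
proof
  assume t: "test_function f"
  define K where "K = closure {x. f x \<noteq> 0}"
  have K: "compact K" "K \<subseteq> ball 0 1" using t by (auto simp: test_function_def K_def)
  have "\<exists>r<1. supported r f"
  proof (cases "K = {}")
    case True
    then have "f x = 0" for x using closure_subset[of "{x. f x \<noteq> 0}"] by (auto simp: K_def)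
    then show ?thesis by (intro exI[of _ 0]) (simp add: supported_def)
  next
    case False
    obtain x0 where x0: "x0 \<in> K" "\<And>x. x \<in> K \<Longrightarrow> norm x \<le> norm x0"
      using continuous_attains_sup[OF K(1) False, of norm] continuous_on_norm_id by blast
    have "f x = 0" if "norm x > norm x0" for x
      using x0(2)[of x] that closure_subset[of "{x. f x \<noteq> 0}"] by (force simp: K_def)
    moreover have "norm x0 < 1" using x0(1) K(2) by auto
    ultimately show ?thesis by (auto simp: supported_def)
  qed
  with t show "smooth f \<and> (\<exists>r<1. supported r f)" by (simp add: test_function_def)
qed (use test_functionI in blast)

lemma test_function_vanish: "test_function f \<Longrightarrow> norm x \<ge> 1 \<Longrightarrow> f x = 0"
  unfolding test_function_iff supported_def by auto

lemma test_function_partial_deriv: "test_function f \<Longrightarrow> i \<in> Basis \<Longrightarrow> test_function (partial_deriv i f)"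
  unfolding test_function_iff by (auto intro: smooth_partial_deriv supported_partial_deriv)

lemma test_function_lincomb:
  assumes "test_function f" "test_function g" shows "test_function (\<lambda>x. a * f x + b * g x)"
proof -
  obtain r s where "r < 1" "supported r f" "s < 1" "supported s g"
    using assms unfolding test_function_iff by blast
  then have "max r s < 1" "supported (max r s) (\<lambda>x. a * f x + b * g x)"
    by (simp_all add: supported_def)
  moreover have "smooth (\<lambda>x. a * f x + b * g x)"
    by (intro smooth_add smooth_mult smooth_const test_function_smooth assms)
  ultimately show ?thesis unfolding test_function_iff by blast
qed

lemma laplacian_lincomb:
  assumes f: "smooth f" and g: "smooth g"
  shows "laplacian (\<lambda>x. a * f x + b * g x) = (\<lambda>x. a * laplacian f x + b * laplacian g x)"
proof
  fix x
  have pd: "partial_deriv i (\<lambda>x. a * u x + b * v x) = (\<lambda>x. a * partial_deriv i u x + b * partial_deriv i v x)"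
    if "smooth u" "smooth v" for u v :: "'a \<Rightarrow> real" and i
    by (rule ext)
       (simp add: partial_deriv_add[OF C_k_mult[OF C_k_const smooth_C_k[OF that(1)]] C_k_mult[OF C_k_const smooth_C_k[OF that(2)]]]
          partial_deriv_cmult[OF smooth_C_k[OF that(1)]] partial_deriv_cmult[OF smooth_C_k[OF that(2)]])
  show "laplacian (\<lambda>x. a * f x + b * g x) x = a * laplacian f x + b * laplacian g x"
    unfolding laplacian_def
    by (simp add: pd f g smooth_partial_deriv sum.distrib sum_distrib_left)
qed

lemma test_function_C_k: "test_function f \<Longrightarrow> C_k k f"
  by (rule smooth_C_k[OF test_function_smooth])

lemma test_function_continuous: "test_function f \<Longrightarrow> continuous_on S f"
  by (rule smooth_continuous[OF test_function_smooth])

lemma test_function_L2: "test_function f \<Longrightarrow> f \<in> L2 (lebesgue_on unit_ball)"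
  by (rule continuous_L2_ball[OF test_function_continuous])

lemma test_function_laplacian_L2: "test_function f \<Longrightarrow> laplacian f \<in> L2 (lebesgue_on unit_ball)"
  by (rule continuous_L2_ball[OF smooth_continuous[OF smooth_laplacian[OF test_function_smooth]]])

lemma poincare_partial_deriv:
  fixes \<psi> :: "'a::euclidean_space \<Rightarrow> real"
  assumes \<psi>: "test_function \<psi>" and i: "i \<in> Basis"
  shows "(\<integral>x. (\<psi> x)\<^sup>2 \<partial>lebesgue_on unit_ball) \<le> 4 * (\<integral>x. (partial_deriv i \<psi> x)\<^sup>2 \<partial>lebesgue_on unit_ball)"
proof -
  let ?M = "lebesgue_on (unit_ball :: 'a set)"
  define A where "A = (\<integral>x. (\<psi> x)\<^sup>2 \<partial>?M)"
  define D where "D = (\<integral>x. (partial_deriv i \<psi> x)\<^sup>2 \<partial>?M)"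
  have A0: "A \<ge> 0" and D0: "D \<ge> 0" by (simp_all add: A_def D_def)
  note c1 = test_function_C_k[OF \<psi>, of "Suc 0"]
  have c2: "C_k (Suc 0) (\<lambda>x. \<psi> x * \<psi> x)" by (intro C_k_mult c1)
  have pdx: "partial_deriv i (\<lambda>x. x \<bullet> i) x = 1" for x :: 'a
    using i by (subst partial_deriv_eqI[of _ "\<lambda>v. v \<bullet> i"]) (auto intro!: derivative_eq_intros)
  define X where "X x = (x \<bullet> i) * \<psi> x" for x
  have Xc: "continuous_on UNIV X" unfolding X_def by (intro continuous_intros test_function_continuous[OF \<psi>])
  have "(\<integral>x. (x \<bullet> i) * partial_deriv i (\<lambda>x. \<psi> x * \<psi> x) x \<partial>?M) = - (\<integral>x. partial_deriv i (\<lambda>x. x \<bullet> i) x * (\<psi> x * \<psi> x) \<partial>?M)"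
    by (rule ibp_vanishing[OF C_k_inner c2 i]) (simp add: test_function_vanish[OF \<psi>])
  moreover have "(x \<bullet> i) * partial_deriv i (\<lambda>x. \<psi> x * \<psi> x) x = 2 * (X x * partial_deriv i \<psi> x)" for x
    by (simp add: partial_deriv_mult[OF c1 c1] X_def algebra_simps)
  ultimately have "A = - 2 * (\<integral>x. X x * partial_deriv i \<psi> x \<partial>?M)"
    by (simp add: pdx A_def power2_eq_square)
  then have "A\<^sup>2 = 4 * (\<integral>x. X x * partial_deriv i \<psi> x \<partial>?M)\<^sup>2" by (simp add: power2_eq_square)
  also have "(\<integral>x. X x * partial_deriv i \<psi> x \<partial>?M)\<^sup>2 \<le> (\<integral>x. (X x)\<^sup>2 \<partial>?M) * D"
    unfolding D_def by (intro L2_cauchy_schwarz continuous_L2_ball Xc test_function_L2 test_function_partial_deriv \<psi> i)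
  also have "(\<integral>x. (X x)\<^sup>2 \<partial>?M) \<le> A"
    unfolding A_def
  proof (rule integral_mono)
    show "integrable ?M (\<lambda>x. (X x)\<^sup>2)" by (rule L2_integrable[OF continuous_L2_ball[OF Xc]])
    show "integrable ?M (\<lambda>x. (\<psi> x)\<^sup>2)" by (rule L2_integrable[OF test_function_L2[OF \<psi>]])
    fix x :: 'a assume "x \<in> space ?M"
    then have "norm x \<le> 1" by (simp add: space_restrict_space)
    then have "\<bar>x \<bullet> i\<bar> \<le> 1" using Basis_le_norm[OF i, of x] by linarith
    then have "(x \<bullet> i)\<^sup>2 * (\<psi> x)\<^sup>2 \<le> 1 * (\<psi> x)\<^sup>2" by (intro mult_right_mono) (simp_all add: abs_square_le_1)
    then show "(X x)\<^sup>2 \<le> (\<psi> x)\<^sup>2" by (simp add: X_def power_mult_distrib)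
  qed
  finally have "A * A \<le> A * (4 * D)" using D0 by (simp add: power2_eq_square mult_right_mono mult_ac)
  then have "A \<le> 4 * D" using A0 D0 by (cases "A = 0") simp_all
  then show ?thesis by (simp add: A_def D_def)
qed

lemma ibp_test:
  fixes f g :: "'a::euclidean_space \<Rightarrow> real"
  assumes "C_k (Suc 0) f" "test_function g" "i \<in> Basis"
  shows "(\<integral>x. f x * partial_deriv i g x \<partial>lebesgue_on unit_ball) = - (\<integral>x. partial_deriv i f x * g x \<partial>lebesgue_on unit_ball)"
  by (rule ibp_vanishing[OF assms(1) test_function_C_k[OF assms(2)] assms(3)])
     (simp add: test_function_vanish[OF assms(2)])

lemma green_test:
  fixes f \<psi> :: "'a::euclidean_space \<Rightarrow> real"
  assumes f: "C_k (Suc (Suc 0)) f" and \<psi>: "test_function \<psi>"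
  shows "(\<integral>x. laplacian f x * \<psi> x \<partial>lebesgue_on unit_ball) = (\<integral>x. f x * laplacian \<psi> x \<partial>lebesgue_on unit_ball)"
proof -
  let ?M = "lebesgue_on (unit_ball :: 'a set)"
  have c: "continuous_on UNIV (partial_deriv i (partial_deriv i f))" if "i \<in> Basis" for i using f that by simp
  have "(\<integral>x. laplacian f x * \<psi> x \<partial>?M) = (\<Sum>i\<in>Basis. \<integral>x. partial_deriv i (partial_deriv i f) x * \<psi> x \<partial>?M)"
    unfolding laplacian_def sum_distrib_right
    by (rule Bochner_Integration.integral_sum)
       (intro continuous_integrable_ball continuous_on_mult c test_function_continuous \<psi>)
  also have "\<dots> = (\<Sum>i\<in>Basis. \<integral>x. f x * partial_deriv i (partial_deriv i \<psi>) x \<partial>?M)"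
  proof (rule sum.cong[OF refl])
    fix i :: 'a assume i: "i \<in> Basis"
    have "C_k (Suc 0) (partial_deriv i f)" using f i by simp
    from ibp_test[OF this \<psi> i] ibp_test[OF C_k_Suc_imp[OF f] test_function_partial_deriv[OF \<psi> i] i]
    show "(\<integral>x. partial_deriv i (partial_deriv i f) x * \<psi> x \<partial>?M) = (\<integral>x. f x * partial_deriv i (partial_deriv i \<psi>) x \<partial>?M)"
      by linarith
  qed
  also have "\<dots> = (\<integral>x. f x * laplacian \<psi> x \<partial>?M)"
    unfolding laplacian_def sum_distrib_left
    by (rule Bochner_Integration.integral_sum[symmetric])
       (intro continuous_integrable_ball continuous_on_mult C_k_continuous[OF f] test_function_continuous test_function_partial_deriv \<psi>)
  finally show ?thesis .
qed

text \<open>Let A, S, L be the integrals of the squared function, gradient and Laplacian.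
  Integration by parts and Cauchy-Schwarz give S^2 \<le> A L, while the Poincare inequality in a
  single direction gives A \<le> 4 S; hence S \<le> 4 L and A \<le> 16 L.\<close>

lemma gradient_laplacian_bound:
  fixes \<psi> :: "'a::euclidean_space \<Rightarrow> real"
  assumes \<psi>: "test_function \<psi>"
  shows "(\<integral>x. (\<psi> x)\<^sup>2 \<partial>lebesgue_on unit_ball) \<le> 16 * (\<integral>x. (laplacian \<psi> x)\<^sup>2 \<partial>lebesgue_on unit_ball)"
    and "(\<Sum>i\<in>Basis. \<integral>x. (partial_deriv i \<psi> x)\<^sup>2 \<partial>lebesgue_on unit_ball) \<le> 4 * (\<integral>x. (laplacian \<psi> x)\<^sup>2 \<partial>lebesgue_on unit_ball)"
proof -
  let ?M = "lebesgue_on (unit_ball :: 'a set)"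
  define A where "A = (\<integral>x. (\<psi> x)\<^sup>2 \<partial>?M)"
  define L where "L = (\<integral>x. (laplacian \<psi> x)\<^sup>2 \<partial>?M)"
  define S where "S = (\<Sum>i\<in>Basis. \<integral>x. (partial_deriv i \<psi> x)\<^sup>2 \<partial>?M)"
  have 0: "A \<ge> 0" "L \<ge> 0" "S \<ge> 0" by (simp_all add: A_def L_def S_def sum_nonneg)
  have "S = (\<Sum>i\<in>Basis. - (\<integral>x. \<psi> x * partial_deriv i (partial_deriv i \<psi>) x \<partial>?M))"
    unfolding S_def
  proof (rule sum.cong[OF refl])
    fix i :: 'a assume i: "i \<in> Basis"
    show "(\<integral>x. (partial_deriv i \<psi> x)\<^sup>2 \<partial>?M) = - (\<integral>x. \<psi> x * partial_deriv i (partial_deriv i \<psi>) x \<partial>?M)"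
      using ibp_test[OF test_function_C_k[OF \<psi>] test_function_partial_deriv[OF \<psi> i] i]
      by (simp add: power2_eq_square)
  qed
  also have "\<dots> = - (\<integral>x. \<psi> x * laplacian \<psi> x \<partial>?M)"
    unfolding laplacian_def sum_distrib_left sum_negf
    by (subst Bochner_Integration.integral_sum)
       (intro continuous_integrable_ball continuous_on_mult test_function_continuous test_function_partial_deriv \<psi>, simp_all)
  finally have S: "S\<^sup>2 \<le> A * L"
    using L2_cauchy_schwarz[OF test_function_L2[OF \<psi>] test_function_laplacian_L2[OF \<psi>]] by (simp add: A_def L_def)
  obtain i :: 'a where i: "i \<in> Basis" by (meson nonempty_Basis all_not_in_conv)
  have "(\<integral>x. (partial_deriv i \<psi> x)\<^sup>2 \<partial>?M) \<le> S"
    unfolding S_def using i by (intro member_le_sum) simp_all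
  then have AS: "A \<le> 4 * S" using poincare_partial_deriv[OF \<psi> i] by (simp add: A_def)
  have "S * S \<le> (4 * L) * S" using S mult_right_mono[OF AS 0(2)] by (simp add: power2_eq_square mult_ac)
  then have SL: "S \<le> 4 * L" using 0 by (cases "S = 0") simp_all
  then show "(\<Sum>i\<in>Basis. \<integral>x. (partial_deriv i \<psi> x)\<^sup>2 \<partial>?M) \<le> 4 * (\<integral>x. (laplacian \<psi> x)\<^sup>2 \<partial>?M)"
    by (simp add: S_def L_def)
  show "(\<integral>x. (\<psi> x)\<^sup>2 \<partial>?M) \<le> 16 * (\<integral>x. (laplacian \<psi> x)\<^sup>2 \<partial>?M)"
    using AS SL by (simp add: A_def L_def)
qed

text \<open>Moving one derivative across twice turns the integral of D_ii D_jj into that of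
  (D_ij)^2. Summed over all i and j, the squared Laplacian therefore has the same integral as the
  full squared Hessian, of which one entry is kept.\<close>

lemma hessian_laplacian_bound:
  fixes \<psi> :: "'a::euclidean_space \<Rightarrow> real"
  assumes \<psi>: "test_function \<psi>" and k: "k \<in> Basis" "l \<in> Basis"
  shows "(\<integral>x. (partial_deriv l (partial_deriv k \<psi>) x)\<^sup>2 \<partial>lebesgue_on unit_ball) \<le> (\<integral>x. (laplacian \<psi> x)\<^sup>2 \<partial>lebesgue_on unit_ball)"
proof -
  let ?M = "lebesgue_on (unit_ball :: 'a set)"
  let ?D = "\<lambda>i j. partial_deriv i (partial_deriv j \<psi>)"
  note t1 = test_function_partial_deriv[OF \<psi>]
  have t2: "test_function (?D i j)" if "i \<in> Basis" "j \<in> Basis" for i j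
    using that by (intro test_function_partial_deriv \<psi>)
  have sq: "(\<integral>x. ?D i i x * ?D j j x \<partial>?M) = (\<integral>x. (?D i j x)\<^sup>2 \<partial>?M)" if ij: "i \<in> Basis" "j \<in> Basis" for i j
  proof -
    have com: "?D i j = ?D j i" by (rule ext) (rule partial_deriv_commute[OF test_function_C_k[OF \<psi>] ij(2,1)])
    have com3: "partial_deriv j (?D i i) = partial_deriv i (?D i j)"
    proof -
      have "partial_deriv j (?D i i) = partial_deriv i (?D j i)"
        by (rule ext) (rule partial_deriv_commute[OF test_function_C_k[OF t1[OF ij(1)]] ij])
      then show ?thesis by (simp add: com)
    qed
    have "(\<integral>x. ?D i i x * ?D j j x \<partial>?M) = - (\<integral>x. partial_deriv j (?D i i) x * partial_deriv j \<psi> x \<partial>?M)"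
      by (rule ibp_test[OF test_function_C_k[OF t2[OF ij(1,1)]] t1[OF ij(2)] ij(2)])
    also have "\<dots> = - (\<integral>x. partial_deriv i (?D i j) x * partial_deriv j \<psi> x \<partial>?M)" by (simp only: com3)
    also have "\<dots> = (\<integral>x. ?D i j x * ?D i j x \<partial>?M)"
      using ibp_test[OF test_function_C_k[OF t2[OF ij]] t1[OF ij(2)] ij(1)] by simp
    finally show ?thesis by (simp add: power2_eq_square)
  qed
  have "(\<integral>x. (laplacian \<psi> x)\<^sup>2 \<partial>?M) = (\<integral>x. (\<Sum>i\<in>Basis. \<Sum>j\<in>Basis. ?D i i x * ?D j j x) \<partial>?M)"
    by (simp add: laplacian_def power2_eq_square sum_product)
  also have "\<dots> = (\<Sum>i\<in>Basis. \<Sum>j\<in>Basis. (\<integral>x. ?D i i x * ?D j j x \<partial>?M))"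
  proof -
    have I: "integrable ?M (\<lambda>x. ?D i i x * ?D j j x)" if "i \<in> Basis" "j \<in> Basis" for i j
      using that by (intro L2_mult test_function_L2 t2)
    show ?thesis
      by (subst Bochner_Integration.integral_sum, intro Bochner_Integration.integrable_sum I, assumption+)
         (intro sum.cong refl Bochner_Integration.integral_sum I)
  qed
  also have "\<dots> = (\<Sum>i\<in>Basis. \<Sum>j\<in>Basis. (\<integral>x. (?D i j x)\<^sup>2 \<partial>?M))"
    by (intro sum.cong refl sq)
  also have "(\<integral>x. (?D l k x)\<^sup>2 \<partial>?M) \<le> \<dots>"
  proof -
    have "(\<integral>x. (?D l k x)\<^sup>2 \<partial>?M) \<le> (\<Sum>j\<in>Basis. (\<integral>x. (?D l j x)\<^sup>2 \<partial>?M))"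
      using k by (intro member_le_sum[of k Basis "\<lambda>j. \<integral>x. (?D l j x)\<^sup>2 \<partial>?M"]) simp_all
    also have "\<dots> \<le> (\<Sum>i\<in>Basis. \<Sum>j\<in>Basis. (\<integral>x. (?D i j x)\<^sup>2 \<partial>?M))"
      using k by (intro member_le_sum[of l Basis "\<lambda>i. \<Sum>j\<in>Basis. \<integral>x. (?D i j x)\<^sup>2 \<partial>?M"]) (simp_all add: sum_nonneg)
    finally show ?thesis .
  qed
  finally show ?thesis .
qed

section \<open>Sobolev functions and weak solutions\<close>

lemma integrable_lebesgue_on_iff:
  fixes f :: "'a::euclidean_space \<Rightarrow> real"
  assumes "S \<in> sets borel"
  shows "integrable (lebesgue_on S) f \<longleftrightarrow> integrable lebesgue (\<lambda>x. indicator S x * f x)"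
  using assms by (subst integrable_restrict_space) simp_all

lemma locally_integrable_test:
  fixes v :: "'a::euclidean_space \<Rightarrow> real"
  assumes v: "locally_integrable v" and \<psi>: "test_function \<psi>"
  shows "integrable (lebesgue_on unit_ball) (\<lambda>x. v x * \<psi> x)"
proof -
  obtain r where r: "r < 1" "supported r \<psi>" using \<psi> unfolding test_function_iff by blast
  obtain B where B: "B \<ge> 0" "\<And>x. \<bar>\<psi> x\<bar> \<le> B"
    using supported_bounded[OF test_function_continuous[OF \<psi>] r(2)] by blast
  have "cball 0 r \<subseteq> (unit_ball :: 'a set)" using r(1) by auto
  then have "integrable (lebesgue_on (cball 0 r)) v" using v by (simp add: locally_integrable_def)
  then have I: "integrable lebesgue (\<lambda>x. indicator (cball 0 r) x * v x)"
    by (subst (asm) integrable_lebesgue_on_iff) simp_all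
  have m: "\<psi> \<in> borel_measurable lebesgue"
    using borel_measurable_continuous_onI[OF test_function_continuous[OF \<psi>]] by (simp add: measurable_completion)
  have "integrable lebesgue (\<lambda>x. (indicator (cball 0 r) x * v x) * \<psi> x)"
  proof (rule Bochner_Integration.integrable_bound[OF integrable_mult_left[OF I, of B]])
    show "(\<lambda>x. (indicator (cball 0 r) x * v x) * \<psi> x) \<in> borel_measurable lebesgue"
      by (intro borel_measurable_times borel_measurable_integrable[OF I] m)
    have "norm (a * \<psi> x) \<le> norm (a * B)" for a x
      using B(2)[of x] unfolding real_norm_def abs_mult by (intro mult_left_mono) auto
    then show "AE x in lebesgue. norm ((indicator (cball 0 r) x * v x) * \<psi> x) \<le> norm (indicator (cball 0 r) x * v x * B)"
      by (intro AE_I2)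
  qed
  moreover have "(indicator (cball 0 r) x * v x) * \<psi> x = indicator unit_ball x * (v x * \<psi> x)" for x
    using r by (auto simp: indicator_def supported_def)
  ultimately show ?thesis by (subst integrable_lebesgue_on_iff) simp_all
qed

lemma L2_locally_integrable:
  fixes v :: "'a::euclidean_space \<Rightarrow> real"
  assumes "v \<in> L2 (lebesgue_on unit_ball)" shows "locally_integrable v"
  unfolding locally_integrable_def
proof (intro allI impI)
  fix K :: "'a set" assume K: "compact K \<and> K \<subseteq> unit_ball"
  then have Kb: "K \<in> sets borel" by (simp add: borel_compact)
  have "integrable lebesgue (\<lambda>x. indicator unit_ball x * v x)"
    using L2_ball_integrable[OF assms] by (subst (asm) integrable_lebesgue_on_iff) simp_all
  from integrable_mult_indicator[OF _ this, of K]
  have I: "integrable lebesgue (\<lambda>x. indicator K x *\<^sub>R (indicator unit_ball x * v x))" using Kb by simp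
  have eq: "indicator K x *\<^sub>R (indicator unit_ball x * v x) = indicator K x * v x" for x
    using K by (auto simp: indicator_def)
  show "integrable (lebesgue_on K) v" unfolding integrable_lebesgue_on_iff[OF Kb] using I unfolding eq .
qed

lemma locally_integrable_diff:
  "locally_integrable u \<Longrightarrow> locally_integrable v \<Longrightarrow> locally_integrable (\<lambda>x. u x - v x)"
  by (simp add: locally_integrable_def)

lemma has_weak_pderiv_unique:
  fixes u v w :: "'a::euclidean_space \<Rightarrow> real"
  assumes v: "has_weak_pderiv i u v" and w: "has_weak_pderiv i u w"
  shows "AE x in lebesgue_on unit_ball. v x = w x"
proof -
  have l: "locally_integrable v" "locally_integrable w" using v w by (simp_all add: has_weak_pderiv_def)
  have "AE x in lebesgue_on unit_ball. v x - w x = 0"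
  proof (rule fundamental_lemma[OF locally_integrable_diff[OF l]])
    fix \<psi> :: "'a \<Rightarrow> real" assume \<psi>: "test_function \<psi>"
    have "(\<integral>x. (v x - w x) * \<psi> x \<partial>lebesgue_on unit_ball) = (\<integral>x. v x * \<psi> x \<partial>lebesgue_on unit_ball) - (\<integral>x. w x * \<psi> x \<partial>lebesgue_on unit_ball)"
      unfolding left_diff_distrib by (intro Bochner_Integration.integral_diff locally_integrable_test l \<psi>)
    also have "\<dots> = 0" using v w \<psi> unfolding has_weak_pderiv_def by fastforce
    finally show "(\<integral>x. (v x - w x) * \<psi> x \<partial>lebesgue_on unit_ball) = 0" .
  qed
  then show ?thesis by eventually_elim simp
qed

text \<open>The representative selected by \<open>weak_pderiv\<close> agrees with a given derivative
  only almost everywhere; completeness of Lebesgue measure transfers measurability to it.\<close>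

lemma borel_measurable_AE_ball:
  fixes f g :: "'a::euclidean_space \<Rightarrow> real"
  assumes f: "f \<in> borel_measurable (lebesgue_on unit_ball)" and ae: "AE x in lebesgue_on unit_ball. f x = g x"
  shows "g \<in> borel_measurable (lebesgue_on unit_ball)"
proof -
  have "(\<lambda>x. indicator unit_ball x *\<^sub>R g x) \<in> borel_measurable lebesgue"
  proof (rule borel_measurable_AE)
    show "(\<lambda>x. indicator unit_ball x *\<^sub>R f x) \<in> borel_measurable lebesgue"
      using f by (subst (asm) borel_measurable_restrict_space_iff) auto
    have "AE x in lebesgue. x \<in> unit_ball \<longrightarrow> f x = g x" using ae by (subst (asm) AE_restrict_space_iff) auto
    then show "AE x in lebesgue. indicator unit_ball x *\<^sub>R f x = indicator unit_ball x *\<^sub>R g x"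
      by eventually_elim (auto simp: indicator_def)
  qed
  then show ?thesis by (subst borel_measurable_restrict_space_iff) auto
qed

lemma has_weak_pderiv_weak_pderiv: "has_weak_pderiv i u v \<Longrightarrow> has_weak_pderiv i u (weak_pderiv i u)"
  unfolding weak_pderiv_def by (rule someI[of "\<lambda>v. has_weak_pderiv i u v"])

lemma weak_pderiv_AE: "has_weak_pderiv i u v \<Longrightarrow> AE x in lebesgue_on unit_ball. v x = weak_pderiv i u x"
  by (rule has_weak_pderiv_unique[OF _ has_weak_pderiv_weak_pderiv])

lemma weak_pderiv_L2:
  assumes w: "has_weak_pderiv i u v" and v: "v \<in> L2 (lebesgue_on unit_ball)"
  shows "weak_pderiv i u \<in> L2 (lebesgue_on unit_ball)"
  by (rule L2_cong_AE[OF v borel_measurable_AE_ball[OF L2_measurable[OF v] weak_pderiv_AE[OF w]] weak_pderiv_AE[OF w]])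

lemma has_weak_pderivI:
  fixes u v :: "'a::euclidean_space \<Rightarrow> real"
  assumes "u \<in> L2 (lebesgue_on unit_ball)" "v \<in> L2 (lebesgue_on unit_ball)"
    "\<And>\<psi>. test_function \<psi> \<Longrightarrow> (\<integral>x. u x * partial_deriv i \<psi> x \<partial>lebesgue_on unit_ball) = - (\<integral>x. v x * \<psi> x \<partial>lebesgue_on unit_ball)"
  shows "has_weak_pderiv i u v"
  using assms by (simp add: has_weak_pderiv_def L2_locally_integrable)

lemma has_weak_pderivD:
  "has_weak_pderiv i u v \<Longrightarrow> test_function \<psi> \<Longrightarrow>
    (\<integral>x. u x * partial_deriv i \<psi> x \<partial>lebesgue_on unit_ball) = - (\<integral>x. v x * \<psi> x \<partial>lebesgue_on unit_ball)"
  by (simp add: has_weak_pderiv_def)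

lemma has_weak_pderiv_limit:
  fixes u v :: "'a::euclidean_space \<Rightarrow> real"
  assumes U: "L2_conv (lebesgue_on unit_ball) U u" and V: "L2_conv (lebesgue_on unit_ball) V v"
    and w: "\<And>k. has_weak_pderiv i (U k) (V k)" and i: "i \<in> Basis"
  shows "has_weak_pderiv i u v"
proof (rule has_weak_pderivI[OF L2_convD(2)[OF U] L2_convD(2)[OF V]])
  fix \<psi> :: "'a \<Rightarrow> real" assume \<psi>: "test_function \<psi>"
  have "(\<lambda>k. \<integral>x. U k x * partial_deriv i \<psi> x \<partial>lebesgue_on unit_ball) \<longlonglongrightarrow> (\<integral>x. u x * partial_deriv i \<psi> x \<partial>lebesgue_on unit_ball)"
    by (intro L2_conv_inner_const[OF U] test_function_L2 test_function_partial_deriv \<psi> i)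
  moreover have "(\<lambda>k. - (\<integral>x. V k x * \<psi> x \<partial>lebesgue_on unit_ball)) \<longlonglongrightarrow> - (\<integral>x. v x * \<psi> x \<partial>lebesgue_on unit_ball)"
    by (intro tendsto_minus L2_conv_inner_const[OF V] test_function_L2 \<psi>)
  ultimately show "(\<integral>x. u x * partial_deriv i \<psi> x \<partial>lebesgue_on unit_ball) = - (\<integral>x. v x * \<psi> x \<partial>lebesgue_on unit_ball)"
    unfolding has_weak_pderivD[OF w \<psi>] by (rule LIMSEQ_unique)
qed

lemma has_weak_pderiv_smooth:
  assumes V: "smooth V" and i: "i \<in> Basis" shows "has_weak_pderiv i V (partial_deriv i V)"
  by (intro has_weak_pderivI continuous_L2_ball smooth_continuous smooth_partial_deriv V i ibp_test smooth_C_k)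

lemma has_weak_pderiv_diff:
  fixes u1 u2 v1 v2 :: "'a::euclidean_space \<Rightarrow> real"
  assumes w: "has_weak_pderiv i u1 v1" "has_weak_pderiv i u2 v2" and i: "i \<in> Basis"
    and L: "u1 \<in> L2 (lebesgue_on unit_ball)" "u2 \<in> L2 (lebesgue_on unit_ball)"
      "v1 \<in> L2 (lebesgue_on unit_ball)" "v2 \<in> L2 (lebesgue_on unit_ball)"
  shows "has_weak_pderiv i (\<lambda>x. u1 x - u2 x) (\<lambda>x. v1 x - v2 x)"
proof (rule has_weak_pderivI)
  fix \<psi> :: "'a \<Rightarrow> real" assume \<psi>: "test_function \<psi>"
  note p = test_function_L2[OF test_function_partial_deriv[OF \<psi> i]] test_function_L2[OF \<psi>]
  show "(\<integral>x. (u1 x - u2 x) * partial_deriv i \<psi> x \<partial>lebesgue_on unit_ball) = - (\<integral>x. (v1 x - v2 x) * \<psi> x \<partial>lebesgue_on unit_ball)"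
    using has_weak_pderivD[OF w(1) \<psi>] has_weak_pderivD[OF w(2) \<psi>]
    by (simp add: left_diff_distrib L2_mult L p)
qed (intro L2_diff L)+

text \<open>Second derivatives are taken of the representative \<open>weak_pderiv i u\<close>, which
  agrees with an explicit derivative only almost everywhere; this exchanges one for the
  other.\<close>

lemma has_weak_pderiv_cong_AE:
  fixes u u' v :: "'a::euclidean_space \<Rightarrow> real"
  assumes w: "has_weak_pderiv i u v" and i: "i \<in> Basis" and u: "u \<in> L2 (lebesgue_on unit_ball)"
    and v: "v \<in> L2 (lebesgue_on unit_ball)" and ae: "AE x in lebesgue_on unit_ball. u x = u' x"
  shows "has_weak_pderiv i u' v"
proof (rule has_weak_pderivI)
  have m: "u' \<in> borel_measurable (lebesgue_on unit_ball)"
    by (rule borel_measurable_AE_ball[OF L2_measurable[OF u] ae])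
  then show "u' \<in> L2 (lebesgue_on unit_ball)" by (rule L2_cong_AE[OF u _ ae])
  fix \<psi> :: "'a \<Rightarrow> real" assume \<psi>: "test_function \<psi>"
  have "(\<integral>x. u' x * partial_deriv i \<psi> x \<partial>lebesgue_on unit_ball) = (\<integral>x. u x * partial_deriv i \<psi> x \<partial>lebesgue_on unit_ball)"
  proof (rule integral_cong_AE)
    show "AE x in lebesgue_on unit_ball. u' x * partial_deriv i \<psi> x = u x * partial_deriv i \<psi> x"
      using ae by eventually_elim simp
  qed (use m L2_measurable[OF u] L2_measurable[OF test_function_L2[OF test_function_partial_deriv[OF \<psi> i]]] in simp_all)
  then show "(\<integral>x. u' x * partial_deriv i \<psi> x \<partial>lebesgue_on unit_ball) = - (\<integral>x. v x * \<psi> x \<partial>lebesgue_on unit_ball)"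
    using has_weak_pderivD[OF w \<psi>] by simp
qed (rule v)

lemma H1I:
  assumes u: "u \<in> L2 (lebesgue_on unit_ball)"
    and w: "\<And>i. i \<in> Basis \<Longrightarrow> has_weak_pderiv i u (d i)"
    and d: "\<And>i. i \<in> Basis \<Longrightarrow> d i \<in> L2 (lebesgue_on unit_ball)"
  shows "u \<in> H1"
  unfolding H1_def
proof (intro CollectI conjI ballI u)
  fix i :: 'a assume i: "i \<in> Basis"
  show "\<exists>v. has_weak_pderiv i u v" by (rule exI[of _ "d i"]) (rule w[OF i])
  show "weak_pderiv i u \<in> L2 (lebesgue_on unit_ball)" by (rule weak_pderiv_L2[OF w[OF i] d[OF i]])
qed

lemma H1D:
  assumes "u \<in> H1"
  shows "u \<in> L2 (lebesgue_on unit_ball)" "i \<in> Basis \<Longrightarrow> has_weak_pderiv i u (weak_pderiv i u)"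
    "i \<in> Basis \<Longrightarrow> weak_pderiv i u \<in> L2 (lebesgue_on unit_ball)"
proof -
  show "u \<in> L2 (lebesgue_on unit_ball)" using assms by (simp add: H1_def)
  assume i: "i \<in> Basis"
  then obtain v where "has_weak_pderiv i u v" using assms unfolding H1_def by blast
  then show "has_weak_pderiv i u (weak_pderiv i u)" by (rule has_weak_pderiv_weak_pderiv)
  show "weak_pderiv i u \<in> L2 (lebesgue_on unit_ball)" using assms i by (simp add: H1_def)
qed

lemma H1_norm_eq:
  assumes "\<And>i. i \<in> Basis \<Longrightarrow> has_weak_pderiv i u (d i)" "\<And>i. i \<in> Basis \<Longrightarrow> d i \<in> L2 (lebesgue_on unit_ball)"
  shows "H1_norm u = sqrt ((\<integral>x. (u x)\<^sup>2 \<partial>lebesgue_on unit_ball) + (\<Sum>i\<in>Basis. \<integral>x. (d i x)\<^sup>2 \<partial>lebesgue_on unit_ball))"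
proof -
  have "(\<integral>x. (weak_pderiv i u x)\<^sup>2 \<partial>lebesgue_on unit_ball) = (\<integral>x. (d i x)\<^sup>2 \<partial>lebesgue_on unit_ball)" if i: "i \<in> Basis" for i
  proof (rule integral_cong_AE)
    show "AE x in lebesgue_on unit_ball. (weak_pderiv i u x)\<^sup>2 = (d i x)\<^sup>2"
      using weak_pderiv_AE[OF assms(1)[OF i]] by eventually_elim simp
  qed (use L2_measurable[OF weak_pderiv_L2[OF assms(1)[OF i] assms(2)[OF i]]] L2_measurable[OF assms(2)[OF i]] in simp_all)
  then show ?thesis by (simp add: H1_norm_def)
qed

text \<open>Translates the norm used for traces into L2 convergence of the function and of each
  derivative, the form in which limits are taken below. The derivatives \<open>d\<close> are free,
  so that the chosen representatives may be replaced by explicit ones.\<close>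

lemma H1_norm_tendsto_iff:
  fixes u :: "'a::euclidean_space \<Rightarrow> real"
  assumes V: "\<And>k. smooth (V k)" and u: "u \<in> L2 (lebesgue_on unit_ball)"
    and d: "\<And>i. i \<in> Basis \<Longrightarrow> has_weak_pderiv i u (d i)" "\<And>i. i \<in> Basis \<Longrightarrow> d i \<in> L2 (lebesgue_on unit_ball)"
  shows "(\<lambda>k. H1_norm (\<lambda>x. V k x - u x)) \<longlonglongrightarrow> 0 \<longleftrightarrow>
    L2_conv (lebesgue_on unit_ball) V u \<and> (\<forall>i\<in>Basis. L2_conv (lebesgue_on unit_ball) (\<lambda>k. partial_deriv i (V k)) (d i))"
proof -
  let ?M = "lebesgue_on (unit_ball :: 'a set)"
  have VL: "V k \<in> L2 ?M" for k by (intro continuous_L2_ball smooth_continuous V)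
  have dVL: "partial_deriv i (V k) \<in> L2 ?M" if "i \<in> Basis" for i k
    by (intro continuous_L2_ball smooth_continuous smooth_partial_deriv V that)
  define a where "a k = (\<integral>x. (V k x - u x)\<^sup>2 \<partial>?M)" for k
  define b where "b i k = (\<integral>x. (partial_deriv i (V k) x - d i x)\<^sup>2 \<partial>?M)" for i k
  have a0: "a k \<ge> 0" and b0: "b i k \<ge> 0" for i k by (simp_all add: a_def b_def)
  have N: "H1_norm (\<lambda>x. V k x - u x) = sqrt (a k + (\<Sum>i\<in>Basis. b i k))" for k
    unfolding a_def b_def
    by (rule H1_norm_eq) (intro has_weak_pderiv_diff has_weak_pderiv_smooth V d u VL dVL L2_diff | assumption)+
  have "(\<lambda>k. H1_norm (\<lambda>x. V k x - u x)) \<longlonglongrightarrow> 0 \<longleftrightarrow> a \<longlonglongrightarrow> 0 \<and> (\<forall>i\<in>Basis. b i \<longlonglongrightarrow> 0)"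
    unfolding N
  proof
    assume "(\<lambda>k. sqrt (a k + (\<Sum>i\<in>Basis. b i k))) \<longlonglongrightarrow> 0"
    from tendsto_power[OF this, of 2] have S: "(\<lambda>k. a k + (\<Sum>i\<in>Basis. b i k)) \<longlonglongrightarrow> 0"
      by (simp add: a0 b0 sum_nonneg)
    have "a \<longlonglongrightarrow> 0"
      by (rule tendsto_sandwich[OF always_eventually always_eventually tendsto_const S])
         (simp_all add: a0 b0 sum_nonneg)
    moreover have "b i \<longlonglongrightarrow> 0" if i: "i \<in> Basis" for i
    proof (rule tendsto_sandwich[OF always_eventually always_eventually tendsto_const S])
      show "\<forall>k. b i k \<le> a k + (\<Sum>i\<in>Basis. b i k)"
      proof
        fix k
        have "b i k \<le> (\<Sum>i\<in>Basis. b i k)" by (rule member_le_sum[of i Basis "\<lambda>i. b i k"]) (simp_all add: i b0)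
        then show "b i k \<le> a k + (\<Sum>i\<in>Basis. b i k)" using a0[of k] by linarith
      qed
    qed (simp add: b0)
    ultimately show "a \<longlonglongrightarrow> 0 \<and> (\<forall>i\<in>Basis. b i \<longlonglongrightarrow> 0)" by blast
  next
    assume "a \<longlonglongrightarrow> 0 \<and> (\<forall>i\<in>Basis. b i \<longlonglongrightarrow> 0)"
    then have "(\<lambda>k. sqrt (a k + (\<Sum>i\<in>Basis. b i k))) \<longlonglongrightarrow> sqrt (0 + (\<Sum>i\<in>(Basis :: 'a set). 0))"
      by (intro tendsto_real_sqrt tendsto_add tendsto_sum) auto
    then show "(\<lambda>k. sqrt (a k + (\<Sum>i\<in>Basis. b i k))) \<longlonglongrightarrow> 0" by simp
  qed
  also have "\<dots> \<longleftrightarrow> L2_conv ?M V u \<and> (\<forall>i\<in>Basis. L2_conv ?M (\<lambda>k. partial_deriv i (V k)) (d i))"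
    using VL u dVL d(2) by (simp add: L2_conv_def a_def[abs_def] b_def[abs_def])
  finally show ?thesis .
qed

section \<open>Traces and the boundary terms of Green's identity\<close>

lemma continuous_L2_sphere:
  fixes h :: "'a::euclidean_space \<Rightarrow> real"
  assumes "continuous_on UNIV h" shows "h \<in> L2 sphere_measure"
proof -
  have "h \<in> borel_measurable sphere_measure" using borel_measurable_continuous_onI[OF assms] by simp
  moreover have "integrable sphere_measure (\<lambda>x. (h x)\<^sup>2)"
    by (intro integrable_sphere_measure continuous_intros assms)
  ultimately show ?thesis by (simp add: L2_def)
qed

lemma has_traceD:
  fixes u :: "'a::euclidean_space \<Rightarrow> real"
  assumes "has_trace u h"
  obtains V where "\<And>k. smooth (V k)" "L2_conv (lebesgue_on unit_ball) V u"
    "\<And>i. i \<in> Basis \<Longrightarrow> L2_conv (lebesgue_on unit_ball) (\<lambda>k. partial_deriv i (V k)) (weak_pderiv i u)"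
    "L2_conv sphere_measure V h"
proof -
  from assms obtain V where V: "\<And>k. smooth (V k)" "(\<lambda>k. H1_norm (\<lambda>x. V k x - u x)) \<longlonglongrightarrow> 0"
    "(\<lambda>k. \<integral>x. (V k x - h x)\<^sup>2 \<partial>sphere_measure) \<longlonglongrightarrow> 0" and u: "u \<in> H1" and h: "h \<in> L2 sphere_measure"
    unfolding has_trace_def by blast
  have "L2_conv (lebesgue_on unit_ball) V u \<and>
      (\<forall>i\<in>Basis. L2_conv (lebesgue_on unit_ball) (\<lambda>k. partial_deriv i (V k)) (weak_pderiv i u))"
    using V(2) by (rule iffD1[OF H1_norm_tendsto_iff[where V = V], rotated -1])
      (simp_all add: V(1) H1D[OF u])
  moreover have "L2_conv sphere_measure V h"
    unfolding L2_conv_def by (intro conjI allI h V(3) continuous_L2_sphere smooth_continuous V(1))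
  ultimately show thesis by (intro that[of V]) (simp_all add: V(1))
qed

lemma has_traceI:
  fixes u :: "'a::euclidean_space \<Rightarrow> real"
  assumes d: "\<And>i. i \<in> Basis \<Longrightarrow> has_weak_pderiv i u (d i)"
    and V: "\<And>k. smooth (V k)" "L2_conv (lebesgue_on unit_ball) V u"
    "\<And>i. i \<in> Basis \<Longrightarrow> L2_conv (lebesgue_on unit_ball) (\<lambda>k. partial_deriv i (V k)) (d i)"
    "L2_conv sphere_measure V h"
  shows "has_trace u h"
proof -
  have dL: "d i \<in> L2 (lebesgue_on unit_ball)" if "i \<in> Basis" for i by (rule L2_convD(2)[OF V(3)[OF that]])
  have u: "u \<in> L2 (lebesgue_on unit_ball)" by (rule L2_convD(2)[OF V(2)])
  have "(\<lambda>k. H1_norm (\<lambda>x. V k x - u x)) \<longlonglongrightarrow> 0"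
    by (rule iffD2[OF H1_norm_tendsto_iff[where V = V and d = d]]) (simp_all add: V(1-3) u d dL)
  then show ?thesis
    unfolding has_trace_def using H1I[OF u d dL] V(1) L2_convD(2,3)[OF V(4)] by auto
qed

text \<open>Integration by parts holds for the smooth approximations of \<open>u\<close>, and all
  three integrals are continuous under the L2 convergences that define the trace.\<close>

lemma trace_green:
  fixes u :: "'a::euclidean_space \<Rightarrow> real"
  assumes t: "has_trace u h" and \<eta>: "smooth \<eta>" and i: "i \<in> Basis"
  shows "(\<integral>x. u x * partial_deriv i \<eta> x \<partial>lebesgue_on unit_ball) + (\<integral>x. weak_pderiv i u x * \<eta> x \<partial>lebesgue_on unit_ball)
    = (\<integral>x. h x * (\<eta> x * (x \<bullet> i)) \<partial>sphere_measure)"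
proof -
  let ?M = "lebesgue_on (unit_ball :: 'a set)"
  obtain V where V: "\<And>k. smooth (V k)" "L2_conv ?M V u"
    "\<And>i. i \<in> Basis \<Longrightarrow> L2_conv ?M (\<lambda>k. partial_deriv i (V k)) (weak_pderiv i u)" "L2_conv sphere_measure V h"
    using has_traceD[OF t] by blast
  have c: "continuous_on UNIV \<eta>" "continuous_on UNIV (partial_deriv i \<eta>)"
    by (intro smooth_continuous smooth_partial_deriv \<eta> i)+
  have "(\<lambda>k. (\<integral>x. V k x * partial_deriv i \<eta> x \<partial>?M) + (\<integral>x. partial_deriv i (V k) x * \<eta> x \<partial>?M))
      \<longlonglongrightarrow> (\<integral>x. u x * partial_deriv i \<eta> x \<partial>?M) + (\<integral>x. weak_pderiv i u x * \<eta> x \<partial>?M)"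
    by (intro tendsto_add L2_conv_inner_const V(2) V(3)[OF i] continuous_L2_ball c)
  moreover have "(\<lambda>k. \<integral>x. V k x * (\<eta> x * (x \<bullet> i)) \<partial>sphere_measure) \<longlonglongrightarrow> (\<integral>x. h x * (\<eta> x * (x \<bullet> i)) \<partial>sphere_measure)"
    by (intro L2_conv_inner_const V(4) continuous_L2_sphere continuous_intros c)
  ultimately show ?thesis
    unfolding ibp_sphere[OF smooth_C_k[OF V(1)] smooth_C_k[OF \<eta>] i] mult.assoc by (rule LIMSEQ_unique)
qed

lemma H2D:
  assumes "u \<in> H2"
  shows "u \<in> H1" "i \<in> Basis \<Longrightarrow> weak_pderiv i u \<in> H1"
    "u \<in> L2 (lebesgue_on unit_ball)" "i \<in> Basis \<Longrightarrow> weak_pderiv i u \<in> L2 (lebesgue_on unit_ball)"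
    "i \<in> Basis \<Longrightarrow> j \<in> Basis \<Longrightarrow> weak_pderiv j (weak_pderiv i u) \<in> L2 (lebesgue_on unit_ball)"
    "weak_laplacian u \<in> L2 (lebesgue_on unit_ball)"
proof -
  show 1: "u \<in> H1" and 2: "i \<in> Basis \<Longrightarrow> weak_pderiv i u \<in> H1" for i using assms by (simp_all add: H2_def)
  show "u \<in> L2 (lebesgue_on unit_ball)" by (rule H1D(1)[OF 1])
  show "i \<in> Basis \<Longrightarrow> weak_pderiv i u \<in> L2 (lebesgue_on unit_ball)" by (rule H1D(1)[OF 2])
  show 3: "i \<in> Basis \<Longrightarrow> j \<in> Basis \<Longrightarrow> weak_pderiv j (weak_pderiv i u) \<in> L2 (lebesgue_on unit_ball)" for i j
    by (rule H1D(3)[OF 2])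
  show "weak_laplacian u \<in> L2 (lebesgue_on unit_ball)"
    unfolding weak_laplacian_def[abs_def] by (intro L2_sum 3)
qed

text \<open>For each coordinate \<open>trace_green\<close> is used twice: for \<open>u\<close>
  against a derivative of \<eta>, and for the weak derivative of \<open>u\<close> against \<eta>.
  The right-hand side involves \<open>a\<close>, \<open>b\<close> and \<eta> but not
  \<open>u\<close>, which is what makes differences of solutions free of boundary terms.\<close>

lemma weak_green:
  fixes u :: "'a::euclidean_space \<Rightarrow> real"
  assumes u: "u \<in> H2" and a: "has_trace u (\<lambda>_. a)" and b: "has_normal_deriv_trace u (\<lambda>_. b)" and \<eta>: "smooth \<eta>"
  shows "(\<integral>x. u x * laplacian \<eta> x \<partial>lebesgue_on unit_ball) - (\<integral>x. weak_laplacian u x * \<eta> x \<partial>lebesgue_on unit_ball)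
    = (\<Sum>i\<in>Basis. \<integral>x. a * (partial_deriv i \<eta> x * (x \<bullet> i)) \<partial>sphere_measure) - (\<integral>x. b * \<eta> x \<partial>sphere_measure)"
proof -
  let ?M = "lebesgue_on (unit_ball :: 'a set)"
  obtain h where h: "\<And>i. i \<in> Basis \<Longrightarrow> has_trace (weak_pderiv i u) (h i)"
    "AE x in sphere_measure. (\<Sum>i\<in>Basis. h i x * (x \<bullet> i)) = b"
    using b unfolding has_normal_deriv_trace_def by blast
  have hL: "h i \<in> L2 sphere_measure" if "i \<in> Basis" for i using h(1)[OF that] by (simp add: has_trace_def)
  have c: "continuous_on UNIV \<eta>" "\<And>i. i \<in> Basis \<Longrightarrow> continuous_on UNIV (partial_deriv i \<eta>)"
    "\<And>i. i \<in> Basis \<Longrightarrow> continuous_on UNIV (partial_deriv i (partial_deriv i \<eta>))"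
    by (intro smooth_continuous smooth_partial_deriv \<eta> | assumption)+
  have 1: "(\<integral>x. u x * laplacian \<eta> x \<partial>?M) = (\<Sum>i\<in>Basis. \<integral>x. u x * partial_deriv i (partial_deriv i \<eta>) x \<partial>?M)"
    unfolding laplacian_def sum_distrib_left
    by (rule Bochner_Integration.integral_sum) (intro L2_mult H2D(3)[OF u] continuous_L2_ball c)
  have 2: "(\<integral>x. weak_laplacian u x * \<eta> x \<partial>?M) = (\<Sum>i\<in>Basis. \<integral>x. weak_pderiv i (weak_pderiv i u) x * \<eta> x \<partial>?M)"
    unfolding weak_laplacian_def sum_distrib_right
    by (rule Bochner_Integration.integral_sum) (intro L2_mult H2D(5)[OF u] continuous_L2_ball c)
  have "(\<integral>x. b * \<eta> x \<partial>sphere_measure) = (\<integral>x. (\<Sum>i\<in>Basis. h i x * (\<eta> x * (x \<bullet> i))) \<partial>sphere_measure)"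
  proof (rule integral_cong_AE)
    have [measurable]: "h i \<in> borel_measurable borel" if "i \<in> Basis" for i using L2_measurable[OF hL[OF that]] by simp
    have [measurable]: "\<eta> \<in> borel_measurable borel" by (rule borel_measurable_continuous_onI[OF c(1)])
    show "(\<lambda>x. b * \<eta> x) \<in> borel_measurable sphere_measure" by simp
    show "(\<lambda>x. \<Sum>i\<in>Basis. h i x * (\<eta> x * (x \<bullet> i))) \<in> borel_measurable sphere_measure"
      by (intro borel_measurable_sum borel_measurable_times) simp_all
    show "AE x in sphere_measure. b * \<eta> x = (\<Sum>i\<in>Basis. h i x * (\<eta> x * (x \<bullet> i)))"
      using h(2)
    proof eventually_elim
      case (elim x)
      then show ?case by (simp add: sum_distrib_right flip: elim) (simp add: mult_ac)
    qed
  qed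
  also have "\<dots> = (\<Sum>i\<in>Basis. \<integral>x. h i x * (\<eta> x * (x \<bullet> i)) \<partial>sphere_measure)"
    by (rule Bochner_Integration.integral_sum) (intro L2_mult hL continuous_L2_sphere continuous_intros c)
  finally have 3: "(\<integral>x. b * \<eta> x \<partial>sphere_measure) = (\<Sum>i\<in>Basis. \<integral>x. h i x * (\<eta> x * (x \<bullet> i)) \<partial>sphere_measure)" .
  show ?thesis
    unfolding 1 2 3 sum_subtractf[symmetric]
  proof (rule sum.cong[OF refl])
    fix i :: 'a assume i: "i \<in> Basis"
    from trace_green[OF a smooth_partial_deriv[OF \<eta> i] i] trace_green[OF h(1)[OF i] \<eta> i]
    show "(\<integral>x. u x * partial_deriv i (partial_deriv i \<eta>) x \<partial>?M) - (\<integral>x. weak_pderiv i (weak_pderiv i u) x * \<eta> x \<partial>?M)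
      = (\<integral>x. a * (partial_deriv i \<eta> x * (x \<bullet> i)) \<partial>sphere_measure) - (\<integral>x. h i x * (\<eta> x * (x \<bullet> i)) \<partial>sphere_measure)"
      by linarith
  qed
qed

text \<open>\<open>\<phi>\<close> belongs to the closure \<open>H\<^sub>0\<^sup>2\<close> of the test functions, with Laplacian \<open>f\<close>.\<close>

definition H20 :: "('a::euclidean_space \<Rightarrow> real) \<Rightarrow> ('a \<Rightarrow> real) \<Rightarrow> bool" where
  "H20 \<phi> f \<longleftrightarrow> (\<exists>\<psi>. (\<forall>k. test_function (\<psi> k)) \<and> L2_conv (lebesgue_on unit_ball) \<psi> \<phi> \<and>
     L2_conv (lebesgue_on unit_ball) (\<lambda>k. laplacian (\<psi> k)) f)"

lemma H20D:
  assumes "H20 \<phi> f"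
  shows "\<phi> \<in> L2 (lebesgue_on unit_ball)" "f \<in> L2 (lebesgue_on unit_ball)"
  using assms unfolding H20_def L2_conv_def by auto

lemma weak_solutionD:
  assumes "weak_solution a b lam u"
  shows "u \<in> H2" "integrable (lebesgue_on unit_ball) (\<lambda>x. exp (u x))" "has_trace u (\<lambda>_. a)"
    "has_normal_deriv_trace u (\<lambda>_. b)"
    "test_function \<psi> \<Longrightarrow> (\<integral>x. weak_laplacian u x * laplacian \<psi> x \<partial>lebesgue_on unit_ball) =
        lam * (\<integral>x. exp (u x) * \<psi> x \<partial>lebesgue_on unit_ball)"
  using assms by (simp_all add: weak_solution_def)

text \<open>The boundary terms of \<open>weak_green\<close> cancel, so the difference satisfies
  Green's identity against every smooth function, which is the hypothesis of
  \<open>test_function_approximation\<close>. The parameters \<open>lam\<close> and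
  \<open>mu\<close> may differ, as only the boundary data matter.\<close>

lemma H20_weak_solution_diff:
  assumes u: "weak_solution a b lam u" and v: "weak_solution a b mu v"
  shows "H20 (\<lambda>x. u x - v x) (\<lambda>x. weak_laplacian u x - weak_laplacian v x)"
proof -
  let ?M = "lebesgue_on (unit_ball :: 'a set)"
  note U = H2D[OF weak_solutionD(1)[OF u]] and V = H2D[OF weak_solutionD(1)[OF v]]
  have dL: "(\<lambda>x. u x - v x) \<in> L2 ?M" "(\<lambda>x. weak_laplacian u x - weak_laplacian v x) \<in> L2 ?M"
    by (intro L2_diff U V)+
  obtain \<psi> where "\<And>k. test_function (\<psi> k)" "L2_conv ?M \<psi> (\<lambda>x. u x - v x)"
    "L2_conv ?M (\<lambda>k. laplacian (\<psi> k)) (\<lambda>x. weak_laplacian u x - weak_laplacian v x)"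
  proof (rule test_function_approximation[OF dL])
    fix \<eta> :: "'a \<Rightarrow> real" assume \<eta>: "smooth \<eta>"
    have c: "\<eta> \<in> L2 ?M" "laplacian \<eta> \<in> L2 ?M" by (intro continuous_L2_ball smooth_continuous smooth_laplacian \<eta>)+
    show "(\<integral>x. (u x - v x) * laplacian \<eta> x \<partial>?M) = (\<integral>x. (weak_laplacian u x - weak_laplacian v x) * \<eta> x \<partial>?M)"
      using weak_green[OF weak_solutionD(1)[OF u] weak_solutionD(3,4)[OF u] \<eta>]
        weak_green[OF weak_solutionD(1)[OF v] weak_solutionD(3,4)[OF v] \<eta>]
      by (simp add: left_diff_distrib L2_mult U V c)
  qed blast
  then show ?thesis unfolding H20_def by blast
qed

text \<open>Only mutual distances are compared, so completeness supplies some limit; where necessary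
  it is identified separately through almost everywhere convergence.\<close>

lemma L2_conv_dominated:
  assumes G: "L2_conv M G g" and F: "\<And>k. F k \<in> L2 N"
    and le: "\<And>m n. (\<integral>x. (F m x - F n x)\<^sup>2 \<partial>N) \<le> C * (\<integral>x. (G m x - G n x)\<^sup>2 \<partial>M)"
  shows "\<exists>f. L2_conv N F f"
proof (rule L2_complete[OF F])
  fix e :: real assume e: "e > 0"
  note 1 = L2_convD[OF G]
  \<comment> \<open>A constant at least 1 allows division by it whatever the sign of
    \<open>C\<close>.\<close>
  define C' where "C' = max C 1"
  have C': "C' \<ge> 1" "C \<le> C'" by (simp_all add: C'_def)
  have "e / (4 * C') > 0" using e C' by simp
  then have "\<forall>\<^sub>F k in sequentially. (\<integral>x. (G k x - g x)\<^sup>2 \<partial>M) < e / (4 * C')"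
    by (rule order_tendstoD(2)[OF 1(3)])
  then obtain K where K: "\<And>k. k \<ge> K \<Longrightarrow> (\<integral>x. (G k x - g x)\<^sup>2 \<partial>M) < e / (4 * C')"
    by (auto simp: eventually_sequentially)
  have "(\<integral>x. (F m x - F n x)\<^sup>2 \<partial>N) < e" if mn: "m \<ge> K" "n \<ge> K" for m n
  proof -
    have "(\<integral>x. (G m x - G n x)\<^sup>2 \<partial>M) = (\<integral>x. ((G m x - g x) - (G n x - g x))\<^sup>2 \<partial>M)" by simp
    also have "\<dots> \<le> 2 * (\<integral>x. (G m x - g x)\<^sup>2 \<partial>M) + 2 * (\<integral>x. (G n x - g x)\<^sup>2 \<partial>M)"
      by (intro L2_triangle_sq L2_diff 1)
    also have "\<dots> < e / C'" using K[OF mn(1)] K[OF mn(2)] C' by (simp add: field_simps)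
    finally have "C' * (\<integral>x. (G m x - G n x)\<^sup>2 \<partial>M) < e" using C' by (simp add: pos_less_divide_eq mult.commute)
    moreover have "C * (\<integral>x. (G m x - G n x)\<^sup>2 \<partial>M) \<le> C' * (\<integral>x. (G m x - G n x)\<^sup>2 \<partial>M)"
      by (rule mult_right_mono[OF C'(2)]) simp
    ultimately show ?thesis using le[of m n] by linarith
  qed
  then show "\<exists>K. \<forall>m\<ge>K. \<forall>n\<ge>K. (\<integral>x. (F m x - F n x)\<^sup>2 \<partial>N) < e" by blast
qed

lemma test_function_diff: "test_function f \<Longrightarrow> test_function g \<Longrightarrow> test_function (\<lambda>x. f x - g x)"
  using test_function_lincomb[of f g 1 "-1"] by simp

lemma laplacian_diff: "smooth f \<Longrightarrow> smooth g \<Longrightarrow> laplacian (\<lambda>x. f x - g x) = (\<lambda>x. laplacian f x - laplacian g x)"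
  using laplacian_lincomb[of f g 1 "-1"] by simp

lemma L2_conv_sum:
  "(\<And>i. i \<in> I \<Longrightarrow> L2_conv M (F i) (f i)) \<Longrightarrow> L2_conv M (\<lambda>k x. \<Sum>i\<in>I. F i k x) (\<lambda>x. \<Sum>i\<in>I. f i x)"
proof (induction I rule: infinite_finite_induct)
  case (insert j I)
  then have "L2_conv M (\<lambda>k x. 1 * F j k x + 1 * (\<Sum>i\<in>I. F i k x)) (\<lambda>x. 1 * f j x + 1 * (\<Sum>i\<in>I. f i x))"
    by (intro L2_conv_lincomb) simp_all
  with insert.hyps show ?case by simp
qed (simp_all add: L2_conv_const L2_zero)

text \<open>Applied to differences of test functions, the gradient and Hessian bounds make all
  derivatives of order one and two Cauchy as soon as the Laplacians converge.\<close>

lemma test_limit_derivatives: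
  fixes \<psi> :: "nat \<Rightarrow> 'a::euclidean_space \<Rightarrow> real"
  assumes \<psi>: "\<And>k. test_function (\<psi> k)" and f: "L2_conv (lebesgue_on unit_ball) (\<lambda>k. laplacian (\<psi> k)) f"
  obtains d dd where "\<And>i. i \<in> Basis \<Longrightarrow> L2_conv (lebesgue_on unit_ball) (\<lambda>k. partial_deriv i (\<psi> k)) (d i)"
    "\<And>i j. i \<in> Basis \<Longrightarrow> j \<in> Basis \<Longrightarrow>
      L2_conv (lebesgue_on unit_ball) (\<lambda>k. partial_deriv j (partial_deriv i (\<psi> k))) (dd i j)"
    "AE x in lebesgue_on unit_ball. f x = (\<Sum>i\<in>Basis. dd i i x)"
proof -
  let ?M = "lebesgue_on (unit_ball :: 'a set)"
  note lap = laplacian_diff[OF test_function_smooth[OF \<psi>] test_function_smooth[OF \<psi>]]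
  note sm = smooth_C_k[OF test_function_smooth[OF \<psi>]]
  have pd: "partial_deriv i (\<lambda>x. \<psi> m x - \<psi> n x) = (\<lambda>x. partial_deriv i (\<psi> m) x - partial_deriv i (\<psi> n) x)" for i m n
    by (rule ext) (rule partial_deriv_diff[OF sm sm])
  have pdd: "partial_deriv j (partial_deriv i (\<lambda>x. \<psi> m x - \<psi> n x))
      = (\<lambda>x. partial_deriv j (partial_deriv i (\<psi> m)) x - partial_deriv j (partial_deriv i (\<psi> n)) x)"
    if "i \<in> Basis" for i j m n
    unfolding pd
    by (rule ext) (intro partial_deriv_diff smooth_C_k smooth_partial_deriv test_function_smooth \<psi> that)
  have "\<exists>g. L2_conv ?M (\<lambda>k. partial_deriv i (\<psi> k)) g" if i: "i \<in> Basis" for i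
  proof (rule L2_conv_dominated[OF f])
    show "partial_deriv i (\<psi> k) \<in> L2 ?M" for k by (intro test_function_L2 test_function_partial_deriv \<psi> i)
    fix m n
    have "(\<integral>x. (partial_deriv i (\<lambda>x. \<psi> m x - \<psi> n x) x)\<^sup>2 \<partial>?M)
        \<le> (\<Sum>i\<in>Basis. \<integral>x. (partial_deriv i (\<lambda>x. \<psi> m x - \<psi> n x) x)\<^sup>2 \<partial>?M)"
      using i by (intro member_le_sum[of i Basis "\<lambda>i. \<integral>x. (partial_deriv i (\<lambda>x. \<psi> m x - \<psi> n x) x)\<^sup>2 \<partial>?M"]) simp_all
    also have "\<dots> \<le> 4 * (\<integral>x. (laplacian (\<lambda>x. \<psi> m x - \<psi> n x) x)\<^sup>2 \<partial>?M)"
      by (rule gradient_laplacian_bound(2)[OF test_function_diff[OF \<psi> \<psi>]])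
    finally show "(\<integral>x. (partial_deriv i (\<psi> m) x - partial_deriv i (\<psi> n) x)\<^sup>2 \<partial>?M)
        \<le> 4 * (\<integral>x. (laplacian (\<psi> m) x - laplacian (\<psi> n) x)\<^sup>2 \<partial>?M)"
      unfolding pd lap .
  qed
  then obtain d where d: "\<And>i. i \<in> Basis \<Longrightarrow> L2_conv ?M (\<lambda>k. partial_deriv i (\<psi> k)) (d i)" by metis
  have "\<exists>g. L2_conv ?M (\<lambda>k. partial_deriv j (partial_deriv i (\<psi> k))) g" if i: "i \<in> Basis" and j: "j \<in> Basis" for i j
  proof (rule L2_conv_dominated[OF f])
    show "partial_deriv j (partial_deriv i (\<psi> k)) \<in> L2 ?M" for k
      by (intro test_function_L2 test_function_partial_deriv \<psi> i j)
    fix m n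
    show "(\<integral>x. (partial_deriv j (partial_deriv i (\<psi> m)) x - partial_deriv j (partial_deriv i (\<psi> n)) x)\<^sup>2 \<partial>?M)
        \<le> 1 * (\<integral>x. (laplacian (\<psi> m) x - laplacian (\<psi> n) x)\<^sup>2 \<partial>?M)"
      using hessian_laplacian_bound[OF test_function_diff[OF \<psi> \<psi>] i j, of m n] unfolding pdd[OF i] lap by simp
  qed
  then obtain dd where dd: "\<And>i j. i \<in> Basis \<Longrightarrow> j \<in> Basis \<Longrightarrow> L2_conv ?M (\<lambda>k. partial_deriv j (partial_deriv i (\<psi> k))) (dd i j)"
    by metis
  have "L2_conv ?M (\<lambda>k x. \<Sum>i\<in>Basis. partial_deriv i (partial_deriv i (\<psi> k)) x) (\<lambda>x. \<Sum>i\<in>Basis. dd i i x)"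
    by (intro L2_conv_sum dd)
  then have "L2_conv ?M (\<lambda>k. laplacian (\<psi> k)) (\<lambda>x. \<Sum>i\<in>Basis. dd i i x)"
    by (simp add: laplacian_def[abs_def])
  from L2_conv_unique[OF f this] show thesis using that d dd by blast
qed

lemma L2_conv_sphere_test:
  fixes V :: "nat \<Rightarrow> 'a::euclidean_space \<Rightarrow> real"
  assumes V: "L2_conv sphere_measure V h" and Vs: "\<And>k. smooth (V k)" and \<psi>: "\<And>k. test_function (\<psi> k)"
  shows "L2_conv sphere_measure (\<lambda>k x. V k x - \<psi> k x) h"
proof (rule L2_conv_bound[OF _ L2_convD(2)[OF V] _ L2_convD(3)[OF V]])
  note c = smooth_continuous[OF Vs] test_function_continuous[OF \<psi>]
  show "(\<lambda>x. V k x - \<psi> k x) \<in> L2 sphere_measure" for k by (intro continuous_L2_sphere continuous_intros c)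
  have [measurable]: "V k \<in> borel_measurable borel" "\<psi> k \<in> borel_measurable borel" for k
    by (intro borel_measurable_continuous_onI c)+
  have [measurable]: "h \<in> borel_measurable borel" using L2_measurable[OF L2_convD(2)[OF V]] by simp
  show "(\<integral>x. (V k x - \<psi> k x - h x)\<^sup>2 \<partial>sphere_measure) \<le> (\<integral>x. (V k x - h x)\<^sup>2 \<partial>sphere_measure)" for k
  proof (rule eq_refl, rule integral_cong_AE)
    show "AE x in sphere_measure. (V k x - \<psi> k x - h x)\<^sup>2 = (V k x - h x)\<^sup>2"
      using AE_sphere_measure by eventually_elim (simp add: test_function_vanish[OF \<psi>])
  qed simp_all
qed

text \<open>Subtracting the test functions that approximate \<phi>, or their derivatives, from the
  smooth approximations of \<open>u\<close>, or of its derivatives, leaves the values on the sphere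
  unchanged. The new sequences therefore exhibit the same traces for u - \<phi>, and only the
  equation has to be supplied.\<close>

lemma weak_solution_perturb:
  fixes u :: "'a::euclidean_space \<Rightarrow> real"
  assumes u: "weak_solution a b lam u" and \<phi>: "H20 \<phi> f"
    and int: "integrable (lebesgue_on unit_ball) (\<lambda>x. exp (u x - \<phi> x))"
    and eq: "\<And>\<psi>. test_function \<psi> \<Longrightarrow> (\<integral>x. (weak_laplacian u x - f x) * laplacian \<psi> x \<partial>lebesgue_on unit_ball)
      = mu * (\<integral>x. exp (u x - \<phi> x) * \<psi> x \<partial>lebesgue_on unit_ball)"
  shows "weak_solution a b mu (\<lambda>x. u x - \<phi> x)"
proof -
  let ?M = "lebesgue_on (unit_ball :: 'a set)"
  define v where "v x = u x - \<phi> x" for x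
  note U = weak_solutionD[OF u] and U2 = H2D[OF weak_solutionD(1)[OF u]]
  obtain \<psi> where \<psi>: "\<And>k. test_function (\<psi> k)" "L2_conv ?M \<psi> \<phi>" "L2_conv ?M (\<lambda>k. laplacian (\<psi> k)) f"
    using \<phi> unfolding H20_def by blast
  obtain d dd where d: "\<And>i. i \<in> Basis \<Longrightarrow> L2_conv ?M (\<lambda>k. partial_deriv i (\<psi> k)) (d i)"
    and dd: "\<And>i j. i \<in> Basis \<Longrightarrow> j \<in> Basis \<Longrightarrow> L2_conv ?M (\<lambda>k. partial_deriv j (partial_deriv i (\<psi> k))) (dd i j)"
    and fd: "AE x in ?M. f x = (\<Sum>i\<in>Basis. dd i i x)"
    using test_limit_derivatives[OF \<psi>(1) \<psi>(3)] by blast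
  note s = test_function_smooth[OF \<psi>(1)]
  have w1: "has_weak_pderiv i \<phi> (d i)" if "i \<in> Basis" for i
    by (rule has_weak_pderiv_limit[OF \<psi>(2) d[OF that] has_weak_pderiv_smooth[OF s that] that])
  have w2: "has_weak_pderiv j (d i) (dd i j)" if "i \<in> Basis" "j \<in> Basis" for i j
    by (rule has_weak_pderiv_limit[OF d[OF that(1)] dd[OF that] has_weak_pderiv_smooth[OF smooth_partial_deriv[OF s that(1)] that(2)] that(2)])
  note dL = L2_convD(2)[OF d] and ddL = L2_convD(2)[OF dd] and \<phi>L = L2_convD(2)[OF \<psi>(2)]
  have vL: "v \<in> L2 ?M" unfolding v_def by (intro L2_diff U2 \<phi>L)
  have v1: "has_weak_pderiv i v (\<lambda>x. weak_pderiv i u x - d i x)" if i: "i \<in> Basis" for i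
    unfolding v_def by (intro has_weak_pderiv_diff H1D(2)[OF U2(1)] w1 i U2 \<phi>L dL)
  have v1L: "(\<lambda>x. weak_pderiv i u x - d i x) \<in> L2 ?M" if i: "i \<in> Basis" for i
    by (intro L2_diff U2 dL i)
  have v2L: "(\<lambda>x. weak_pderiv j (weak_pderiv i u) x - dd i j x) \<in> L2 ?M" if "i \<in> Basis" "j \<in> Basis" for i j
    by (intro L2_diff U2 ddL that)
  have v2: "has_weak_pderiv j (weak_pderiv i v) (\<lambda>x. weak_pderiv j (weak_pderiv i u) x - dd i j x)"
    if ij: "i \<in> Basis" "j \<in> Basis" for i j
  proof (rule has_weak_pderiv_cong_AE[OF _ ij(2) v1L[OF ij(1)] v2L[OF ij] weak_pderiv_AE[OF v1[OF ij(1)]]])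
    show "has_weak_pderiv j (\<lambda>x. weak_pderiv i u x - d i x) (\<lambda>x. weak_pderiv j (weak_pderiv i u) x - dd i j x)"
      by (intro has_weak_pderiv_diff H1D(2)[OF U2(2)] w2 ij U2 dL ddL)
  qed
  have wv1L: "weak_pderiv i v \<in> L2 ?M" if "i \<in> Basis" for i by (rule weak_pderiv_L2[OF v1 v1L]) fact+
  have vH2: "v \<in> H2"
    unfolding H2_def using H1I[OF vL v1 v1L] H1I[OF wv1L v2 v2L] by blast
  have lap: "AE x in ?M. weak_laplacian v x = weak_laplacian u x - f x"
  proof -
    have "AE x in ?M. \<forall>i\<in>Basis. weak_pderiv i (weak_pderiv i u) x - dd i i x = weak_pderiv i (weak_pderiv i v) x"
      by (rule AE_finite_allI) (simp, rule weak_pderiv_AE[OF v2])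
    with fd show ?thesis
      by eventually_elim (simp add: weak_laplacian_def sum_subtractf[symmetric])
  qed
  have pd: "partial_deriv i (\<lambda>x. V x - W x) = (\<lambda>x. partial_deriv i V x - partial_deriv i W x)"
    if "smooth V" "smooth W" for i and V W :: "'a \<Rightarrow> real"
    by (rule ext) (rule partial_deriv_diff[OF smooth_C_k[OF that(1)] smooth_C_k[OF that(2)]])
  have ta: "has_trace v (\<lambda>_. a)"
  proof -
    obtain V where V: "\<And>k. smooth (V k)" "L2_conv ?M V u"
      "\<And>i. i \<in> Basis \<Longrightarrow> L2_conv ?M (\<lambda>k. partial_deriv i (V k)) (weak_pderiv i u)" "L2_conv sphere_measure V (\<lambda>_. a)"
      using has_traceD[OF U(3)] by blast
    show ?thesis
    proof (rule has_traceI[OF v1])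
      show "smooth (\<lambda>x. V k x - \<psi> k x)" for k by (rule smooth_diff[OF V(1) s])
      show "L2_conv ?M (\<lambda>k x. V k x - \<psi> k x) v" unfolding v_def by (rule L2_conv_diff[OF V(2) \<psi>(2)])
      show "L2_conv ?M (\<lambda>k. partial_deriv i (\<lambda>x. V k x - \<psi> k x)) (\<lambda>x. weak_pderiv i u x - d i x)" if "i \<in> Basis" for i
        unfolding pd[OF V(1) s] by (rule L2_conv_diff[OF V(3)[OF that] d[OF that]])
      show "L2_conv sphere_measure (\<lambda>k x. V k x - \<psi> k x) (\<lambda>_. a)" by (rule L2_conv_sphere_test[OF V(4) V(1) \<psi>(1)])
    qed
  qed
  have tb: "has_normal_deriv_trace v (\<lambda>_. b)"
  proof -
    obtain h where h: "\<And>i. i \<in> Basis \<Longrightarrow> has_trace (weak_pderiv i u) (h i)"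
      "AE x in sphere_measure. (\<Sum>i\<in>Basis. h i x * (x \<bullet> i)) = b"
      using U(4) unfolding has_normal_deriv_trace_def by blast
    have "has_trace (weak_pderiv i v) (h i)" if i: "i \<in> Basis" for i
    proof -
      obtain V where V: "\<And>k. smooth (V k)" "L2_conv ?M V (weak_pderiv i u)"
        "\<And>j. j \<in> Basis \<Longrightarrow> L2_conv ?M (\<lambda>k. partial_deriv j (V k)) (weak_pderiv j (weak_pderiv i u))"
        "L2_conv sphere_measure V (h i)"
        using has_traceD[OF h(1)[OF i]] by blast
      note si = smooth_partial_deriv[OF s i]
      show ?thesis
      proof (rule has_traceI[OF v2[OF i]])
        show "smooth (\<lambda>x. V k x - partial_deriv i (\<psi> k) x)" for k by (rule smooth_diff[OF V(1) si])
        show "L2_conv ?M (\<lambda>k x. V k x - partial_deriv i (\<psi> k) x) (weak_pderiv i v)"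
        proof (rule L2_conv_cong_AE[OF L2_conv_diff[OF V(2) d[OF i]] L2_measurable[OF wv1L[OF i]]])
          show "AE x in ?M. weak_pderiv i v x = weak_pderiv i u x - d i x"
            using weak_pderiv_AE[OF v1[OF i]] by eventually_elim simp
        qed
        show "L2_conv ?M (\<lambda>k. partial_deriv j (\<lambda>x. V k x - partial_deriv i (\<psi> k) x))
            (\<lambda>x. weak_pderiv j (weak_pderiv i u) x - dd i j x)" if j: "j \<in> Basis" for j
          unfolding pd[OF V(1) si] by (rule L2_conv_diff[OF V(3)[OF j] dd[OF i j]])
        show "L2_conv sphere_measure (\<lambda>k x. V k x - partial_deriv i (\<psi> k) x) (h i)"
          by (rule L2_conv_sphere_test[OF V(4) V(1) test_function_partial_deriv[OF \<psi>(1) i]])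
      qed
    qed
    then show ?thesis using h(2) unfolding has_normal_deriv_trace_def by blast
  qed
  have "(\<integral>x. weak_laplacian v x * laplacian \<eta> x \<partial>?M) = mu * (\<integral>x. exp (v x) * \<eta> x \<partial>?M)" if \<eta>: "test_function \<eta>" for \<eta>
  proof -
    have "(\<integral>x. weak_laplacian v x * laplacian \<eta> x \<partial>?M) = (\<integral>x. (weak_laplacian u x - f x) * laplacian \<eta> x \<partial>?M)"
    proof (rule integral_cong_AE)
      show "AE x in ?M. weak_laplacian v x * laplacian \<eta> x = (weak_laplacian u x - f x) * laplacian \<eta> x"
        using lap by eventually_elim simp
    qed (intro borel_measurable_times borel_measurable_diff L2_measurable H2D(6)[OF vH2] U2 H20D[OF \<phi>] test_function_laplacian_L2 \<eta>)+
    then show ?thesis using eq[OF \<eta>] by (simp add: v_def)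
  qed
  then have "weak_solution a b mu v"
    using vH2 int ta tb unfolding weak_solution_def by (simp add: v_def)
  then show ?thesis by (simp add: v_def[abs_def])
qed

section \<open>Boggio's principle\<close>

text \<open>An antiderivative of \<open>t powr (- p)\<close> on the positive axis. It is used with p
  = n and p = n - 1 for n half the dimension, so the logarithm occurs in dimensions 2 and 4.\<close>

definition powr_prim :: "real \<Rightarrow> real \<Rightarrow> real" where
  "powr_prim p t = (if p = 1 then ln t else t powr (1 - p) / (1 - p))"

lemma powr_prim_deriv:
  assumes "t > 0" shows "(powr_prim p has_real_derivative t powr (- p)) (at t)"
proof (cases "p = 1")
  case True
  have "(ln has_real_derivative inverse t) (at t)" by (rule DERIV_ln[OF assms])
  moreover have "powr_prim p = ln" using True by (simp add: powr_prim_def fun_eq_iff)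
  moreover have "t powr (- p) = inverse t" using True assms by (simp add: powr_minus)
  ultimately show ?thesis by simp
next
  case False
  have "((\<lambda>t. t powr (1 - p)) has_real_derivative (1 - p) * t powr (1 - p - 1)) (at t)"
    by (rule has_real_derivative_powr[OF assms])
  from DERIV_cdivide[OF this, of "1 - p"]
  have "((\<lambda>t. t powr (1 - p) / (1 - p)) has_real_derivative t powr (- p)) (at t)"
    using False by simp
  moreover have "powr_prim p = (\<lambda>t. t powr (1 - p) / (1 - p))" using False by (simp add: powr_prim_def fun_eq_iff)
  ultimately show ?thesis by simp
qed

text \<open>The Green function of the biharmonic Dirichlet problem on the unit ball is, up to a constant,
  \<open>\<integral>\<^sub>0\<^sup>q m (\<bar>x - y\<bar>\<^sup>2 + m) powr (- N / 2) dm\<close> with \<open>q = (1 - \<bar>x\<bar>\<^sup>2) (1 - \<bar>y\<bar>\<^sup>2)\<close>.  It is made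
  smooth by replacing \<open>\<bar>x - y\<bar>\<^sup>2\<close> by \<open>\<rho> = \<bar>x - y\<bar>\<^sup>2 + \<delta>\<close>; the upper end of the range of
  \<open>\<rho> + m\<close> is then \<open>\<alpha> = \<rho> + q\<close>.\<close>

locale regularised_green =
  fixes x :: "'a::euclidean_space" and \<delta> :: real
  assumes x: "norm x < 1" and \<delta>: "\<delta> > 0"
begin

definition \<beta> :: real where "\<beta> = x \<bullet> x"
definition n :: real where "n = real DIM('a) / 2"
definition \<rho> :: "'a \<Rightarrow> real" where "\<rho> y = y \<bullet> y - 2 * (x \<bullet> y) + \<beta> + \<delta>"
text \<open>Apart from \<open>\<delta>\<close>, and for x \<noteq> 0, this is |x|^2 times the
  squared distance from y to x / |x|^2, the pole reflected in the unit sphere.\<close>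

definition \<alpha> :: "'a \<Rightarrow> real" where "\<alpha> y = \<beta> * (y \<bullet> y) - 2 * (x \<bullet> y) + 1 + \<delta>"

lemma \<beta>: "0 \<le> \<beta>" "\<beta> < 1" "\<beta> = (norm x)\<^sup>2"
  using x by (simp_all add: \<beta>_def power2_norm_eq_inner[symmetric] power_less_one_iff)

lemma n_pos: "n > 0"
  by (simp add: n_def)

lemma \<rho>_eq: "\<rho> y = (norm (y - x))\<^sup>2 + \<delta>"
  unfolding power2_norm_eq_inner by (simp add: \<rho>_def \<beta>_def algebra_simps inner_commute)

lemma \<rho>_pos: "\<rho> y > 0"
  unfolding \<rho>_eq using \<delta> by (simp add: add_nonneg_pos)

text \<open>Cauchy-Schwarz. For y in the ball the square is at least (1 - |x|)^2, so negative powers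
  of \<open>\<alpha>\<close> stay bounded as \<open>\<delta>\<close> tends to 0, unlike those of
  \<open>\<rho>\<close>.\<close>

lemma \<alpha>_ge: "\<alpha> y \<ge> (1 - norm x * norm y)\<^sup>2 + \<delta>"
proof -
  have "x \<bullet> y \<le> norm x * norm y" by (rule norm_cauchy_schwarz)
  moreover have "\<beta> * (y \<bullet> y) = (norm x * norm y)\<^sup>2"
    by (simp add: \<beta>(3) power_mult_distrib power2_norm_eq_inner)
  ultimately show ?thesis by (simp add: \<alpha>_def power2_diff)
qed

lemma \<alpha>_pos: "\<alpha> y > 0"
  using \<alpha>_ge[of y] \<delta> zero_le_power2[of "1 - norm x * norm y"] by linarith

lemma \<alpha>_minus_\<rho>: "\<alpha> y - \<rho> y = (1 - \<beta>) * (1 - (norm y)\<^sup>2)"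
  by (simp add: \<alpha>_def \<rho>_def power2_norm_eq_inner algebra_simps)

lemma \<alpha>_deriv: "(\<alpha> has_derivative (\<lambda>v. 2 * \<beta> * (y \<bullet> v) - 2 * (x \<bullet> v))) (at y)"
  unfolding \<alpha>_def by (auto intro!: derivative_eq_intros simp: inner_commute algebra_simps)

lemma \<rho>_deriv: "(\<rho> has_derivative (\<lambda>v. 2 * (y \<bullet> v) - 2 * (x \<bullet> v))) (at y)"
  unfolding \<rho>_def by (auto intro!: derivative_eq_intros simp: inner_commute algebra_simps)

lemma \<alpha>_continuous: "continuous_on UNIV \<alpha>" and \<rho>_continuous: "continuous_on UNIV \<rho>"
  unfolding \<alpha>_def \<rho>_def by (intro continuous_intros)+

lemma compose_deriv:
  assumes "(g has_real_derivative g') (at (h y))" "(h has_derivative h') (at y)"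
  shows "((\<lambda>y. g (h y)) has_derivative (\<lambda>v. g' * h' v)) (at y)"
  using has_derivative_compose[OF assms(2) assms(1)[unfolded has_field_derivative_def]] .

text \<open>One formula serves for both Laplacians, since \<open>G\<close> and \<open>W\<close> have
  this shape. The gradients of \<open>\<alpha>\<close> and \<open>\<rho>\<close> are 2 (\<beta> y -
  x) and 2 (y - x); their inner products are affine in \<open>\<alpha>\<close> and
  \<open>\<rho>\<close>, so the point y enters the result only through these two functions.\<close>

lemma laplacian_combination:
  assumes a: "\<And>t. t > 0 \<Longrightarrow> (a has_real_derivative a1 t) (at t)" "\<And>t. t > 0 \<Longrightarrow> (a1 has_real_derivative a2 t) (at t)"
    and b: "\<And>t. t > 0 \<Longrightarrow> (b has_real_derivative b1 t) (at t)" "\<And>t. t > 0 \<Longrightarrow> (b1 has_real_derivative b2 t) (at t)"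
    and c: "\<And>t. t > 0 \<Longrightarrow> (c has_real_derivative c1 t) (at t)" "\<And>t. t > 0 \<Longrightarrow> (c1 has_real_derivative c2 t) (at t)"
    and cont: "continuous_on {0<..} a2" "continuous_on {0<..} b2" "continuous_on {0<..} c2"
  defines "F \<equiv> \<lambda>y. a (\<alpha> y) + \<rho> y * b (\<alpha> y) + c (\<rho> y)"
  shows "C_k (Suc (Suc 0)) F"
    and "partial_deriv v F y = (a1 (\<alpha> y) + \<rho> y * b1 (\<alpha> y)) * (2 * \<beta> * (y \<bullet> v) - 2 * (x \<bullet> v))
      + (b (\<alpha> y) + c1 (\<rho> y)) * (2 * (y \<bullet> v) - 2 * (x \<bullet> v))"
    and "laplacian F y = 4 * \<beta> * (\<alpha> y - \<delta>) * (a2 (\<alpha> y) + \<rho> y * b2 (\<alpha> y)) + 4 * n * \<beta> * (a1 (\<alpha> y) + \<rho> y * b1 (\<alpha> y))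
      + 2 * (2 * \<alpha> y + 2 * \<beta> * \<rho> y - (2 + 2 * \<beta>) * \<delta> - 2 * (1 - \<beta>)\<^sup>2) * b1 (\<alpha> y) + 4 * n * b (\<alpha> y)
      + 4 * (\<rho> y - \<delta>) * c2 (\<rho> y) + 4 * n * c1 (\<rho> y)"
proof -
  define dA where "dA y v = 2 * \<beta> * (y \<bullet> v) - 2 * (x \<bullet> v)" for y v :: 'a
  define dr where "dr y v = 2 * (y \<bullet> v) - 2 * (x \<bullet> v)" for y v :: 'a
  have A: "(\<alpha> has_derivative dA y) (at y)" and R: "(\<rho> has_derivative dr y) (at y)" for y
    unfolding dA_def dr_def by (rule \<alpha>_deriv \<rho>_deriv)+
  define F1 where "F1 y v = (a1 (\<alpha> y) + \<rho> y * b1 (\<alpha> y)) * dA y v + (b (\<alpha> y) + c1 (\<rho> y)) * dr y v" for y v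
  have D1: "(F has_derivative F1 y) (at y)" for y
  proof -
    have "(F has_derivative (\<lambda>v. (a1 (\<alpha> y) * dA y v + (\<rho> y * (b1 (\<alpha> y) * dA y v) + dr y v * b (\<alpha> y))) + c1 (\<rho> y) * dr y v)) (at y)"
      unfolding F_def
      by (intro has_derivative_add has_derivative_mult compose_deriv A R a b c \<alpha>_pos \<rho>_pos)
    then show ?thesis by (simp add: F1_def[abs_def] algebra_simps)
  qed
  have pd: "partial_deriv v F = (\<lambda>y. F1 y v)" for v
    by (rule ext) (rule partial_deriv_eqI[OF D1])
  show "partial_deriv v F y = (a1 (\<alpha> y) + \<rho> y * b1 (\<alpha> y)) * (2 * \<beta> * (y \<bullet> v) - 2 * (x \<bullet> v))
      + (b (\<alpha> y) + c1 (\<rho> y)) * (2 * (y \<bullet> v) - 2 * (x \<bullet> v))"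
    unfolding pd F1_def dA_def dr_def ..
  define F2 where "F2 v y w = (a1 (\<alpha> y) + \<rho> y * b1 (\<alpha> y)) * (2 * \<beta> * (w \<bullet> v))
    + (a2 (\<alpha> y) * dA y w + (\<rho> y * (b2 (\<alpha> y) * dA y w) + dr y w * b1 (\<alpha> y))) * dA y v
    + ((b (\<alpha> y) + c1 (\<rho> y)) * (2 * (w \<bullet> v)) + (b1 (\<alpha> y) * dA y w + c2 (\<rho> y) * dr y w) * dr y v)" for v y w
  have dAd: "((\<lambda>y. dA y v) has_derivative (\<lambda>w. 2 * \<beta> * (w \<bullet> v))) (at y)"
    and drd: "((\<lambda>y. dr y v) has_derivative (\<lambda>w. 2 * (w \<bullet> v))) (at y)" for y v
    unfolding dA_def dr_def by (auto intro!: derivative_eq_intros)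
  have D2: "((\<lambda>y. F1 y v) has_derivative F2 v y) (at y)" for v y
    unfolding F1_def F2_def
    by (intro has_derivative_add has_derivative_mult compose_deriv A R a b c dAd drd \<alpha>_pos \<rho>_pos)
  have comp: "continuous_on UNIV (\<lambda>y. g (\<alpha> y))" "continuous_on UNIV (\<lambda>y. g (\<rho> y))"
    if "continuous_on {0<..} g" for g :: "real \<Rightarrow> real"
    by (rule continuous_on_compose2[OF that \<alpha>_continuous]; use \<alpha>_pos in auto)
       (rule continuous_on_compose2[OF that \<rho>_continuous]; use \<rho>_pos in auto)
  have cd: "continuous_on {0<..} g" if "\<And>t. t > 0 \<Longrightarrow> (g has_real_derivative g' t) (at t)" for g g'
    by (rule DERIV_continuous_on[of _ _ g']) (rule DERIV_subset[OF that], auto)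
  note cc = comp[OF cont(1)] comp[OF cont(2)] comp[OF cont(3)]
    comp[OF cd[OF a(2)]] comp[OF cd[OF b(1)]] comp[OF cd[OF b(2)]] comp[OF cd[OF c(2)]]
  have "C_k (Suc 0) (partial_deriv i F)" for i
    unfolding pd
  proof (rule C_k_SucI[OF D2])
    fix j :: 'a
    show "C_k 0 (\<lambda>y. F2 i y j)"
      unfolding F2_def dA_def dr_def C_k.simps by (intro continuous_intros cc \<rho>_continuous)
  qed
  moreover have "F differentiable_on UNIV"
    using D1 unfolding differentiable_on_def differentiable_def by blast
  ultimately show "C_k (Suc (Suc 0)) F" unfolding C_k.simps(2)[of "Suc 0" F] by blast
  have sums: "(\<Sum>i\<in>Basis. (u \<bullet> i) * (w \<bullet> i)) = u \<bullet> w" for u w :: 'a by (rule euclidean_inner[symmetric])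
  have dAi: "dA y v = (2 *\<^sub>R (\<beta> *\<^sub>R y - x)) \<bullet> v" and dri: "dr y v = (2 *\<^sub>R (y - x)) \<bullet> v" for v
    by (simp_all add: dA_def dr_def inner_simps algebra_simps)
  have "laplacian F y = (\<Sum>i\<in>Basis. F2 i y i)"
    unfolding laplacian_def pd by (intro sum.cong refl partial_deriv_eqI[OF D2])
  also have "\<dots> = (\<Sum>i\<in>Basis. (2 * \<beta> * (a1 (\<alpha> y) + \<rho> y * b1 (\<alpha> y)) + 2 * (b (\<alpha> y) + c1 (\<rho> y)))
      + (a2 (\<alpha> y) + \<rho> y * b2 (\<alpha> y)) * (dA y i * dA y i) + 2 * b1 (\<alpha> y) * (dA y i * dr y i)
      + c2 (\<rho> y) * (dr y i * dr y i))"
    by (intro sum.cong refl) (simp add: F2_def algebra_simps inner_same_Basis)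
  also have "\<dots> = real DIM('a) * (2 * \<beta> * (a1 (\<alpha> y) + \<rho> y * b1 (\<alpha> y)) + 2 * (b (\<alpha> y) + c1 (\<rho> y)))
      + (a2 (\<alpha> y) + \<rho> y * b2 (\<alpha> y)) * ((2 *\<^sub>R (\<beta> *\<^sub>R y - x)) \<bullet> (2 *\<^sub>R (\<beta> *\<^sub>R y - x)))
      + 2 * b1 (\<alpha> y) * ((2 *\<^sub>R (\<beta> *\<^sub>R y - x)) \<bullet> (2 *\<^sub>R (y - x)))
      + c2 (\<rho> y) * ((2 *\<^sub>R (y - x)) \<bullet> (2 *\<^sub>R (y - x)))"
    unfolding sum.distrib sum_distrib_left[symmetric] dAi dri sums by (simp add: distrib_left mult.left_commute)
  also have "(2 *\<^sub>R (\<beta> *\<^sub>R y - x)) \<bullet> (2 *\<^sub>R (\<beta> *\<^sub>R y - x)) = 4 * \<beta> * (\<alpha> y - \<delta>)"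
    by (simp add: \<alpha>_def inner_simps inner_commute[of y x] algebra_simps) (simp add: \<beta>_def[symmetric] algebra_simps)
  also have "(2 *\<^sub>R (\<beta> *\<^sub>R y - x)) \<bullet> (2 *\<^sub>R (y - x)) = 2 * \<alpha> y + 2 * \<beta> * \<rho> y - (2 + 2 * \<beta>) * \<delta> - 2 * (1 - \<beta>)\<^sup>2"
    by (simp add: \<alpha>_def \<rho>_def inner_simps inner_commute[of y x] power2_diff algebra_simps)
       (simp add: \<beta>_def[symmetric] power2_eq_square algebra_simps)
  also have "(2 *\<^sub>R (y - x)) \<bullet> (2 *\<^sub>R (y - x)) = 4 * (\<rho> y - \<delta>)"
    by (simp add: \<rho>_def inner_simps inner_commute[of y x] \<beta>_def algebra_simps)
  finally show "laplacian F y = 4 * \<beta> * (\<alpha> y - \<delta>) * (a2 (\<alpha> y) + \<rho> y * b2 (\<alpha> y)) + 4 * n * \<beta> * (a1 (\<alpha> y) + \<rho> y * b1 (\<alpha> y))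
      + 2 * (2 * \<alpha> y + 2 * \<beta> * \<rho> y - (2 + 2 * \<beta>) * \<delta> - 2 * (1 - \<beta>)\<^sup>2) * b1 (\<alpha> y) + 4 * n * b (\<alpha> y)
      + 4 * (\<rho> y - \<delta>) * c2 (\<rho> y) + 4 * n * c1 (\<rho> y)"
    by (simp add: n_def algebra_simps)
qed

text \<open>The integral of (t - \<rho>) t^(-n) over t from \<rho> to \<alpha>, evaluated: the
  integrand has the antiderivative
  \<open>powr_prim (n - 1) t - \<rho> y * powr_prim n t\<close>.\<close>

definition G :: "'a \<Rightarrow> real" where
  "G y = powr_prim (n - 1) (\<alpha> y) + \<rho> y * (- powr_prim n (\<alpha> y)) + (\<rho> y * powr_prim n (\<rho> y) - powr_prim (n - 1) (\<rho> y))"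

definition E :: real where "E = (1 - \<beta>)\<^sup>2 + \<delta> * (1 + n * \<beta>)"

text \<open>The Laplacian of \<open>G\<close> in closed form, again arranged as a(\<alpha>) + \<rho>
  b(\<alpha>) + c(\<rho>) so that \<open>laplacian_combination\<close> applies a second time. Up to
  the factor 4, \<open>E\<close> is the coefficient of \<alpha>^(-n) in a.\<close>

definition W :: "'a \<Rightarrow> real" where
  "W y = (4 * (E * \<alpha> y powr (- n) - (1 - \<beta>) * \<alpha> y powr (1 - n) - n * powr_prim n (\<alpha> y)))
    + \<rho> y * (4 * (- \<beta> * \<alpha> y powr (- n) - n * \<beta> * \<delta> * \<alpha> y powr (- n - 1)))
    + 4 * (\<rho> y powr (1 - n) - \<delta> * \<rho> y powr (- n) + n * powr_prim n (\<rho> y))"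

lemma powr_deriv: "t > 0 \<Longrightarrow> ((\<lambda>t. t powr p) has_real_derivative p * t powr (p - 1)) (at t)" for t p :: real
  by (rule has_real_derivative_powr)

lemma powr_shift: "t > 0 \<Longrightarrow> t powr (p + 1) = t * t powr p" for t p :: real
  by (simp add: powr_add)

lemma powr_shift': "t > 0 \<Longrightarrow> p = q + 1 \<Longrightarrow> t powr p = t * t powr q" for t p q :: real
  by (simp add: powr_add)

lemma G_facts:
  shows G_C2: "C_k (Suc (Suc 0)) G"
    and G_deriv: "partial_deriv v G y = ((\<alpha> y - \<rho> y) * \<alpha> y powr (- n)) * (2 * \<beta> * (y \<bullet> v) - 2 * (x \<bullet> v))
      + (powr_prim n (\<rho> y) - powr_prim n (\<alpha> y)) * (2 * (y \<bullet> v) - 2 * (x \<bullet> v))"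
    and G_laplacian: "laplacian G y = W y"
proof -
  have a: "(powr_prim (n - 1) has_real_derivative t powr (1 - n)) (at t)"
    "((\<lambda>t. t powr (1 - n)) has_real_derivative (1 - n) * t powr (- n)) (at t)" if "t > 0" for t
    using powr_prim_deriv[OF that, of "n - 1"] powr_deriv[OF that, of "1 - n"] by simp_all
  have b: "((\<lambda>t. - powr_prim n t) has_real_derivative - (t powr (- n))) (at t)"
    "((\<lambda>t. - (t powr (- n))) has_real_derivative n * t powr (- n - 1)) (at t)" if "t > 0" for t
    using DERIV_minus[OF powr_prim_deriv[OF that, of n]] DERIV_minus[OF powr_deriv[OF that, of "- n"]] by simp_all
  \<comment> \<open>The product rule contributes t * t^(-n), which cancels the derivative of the
    second term.\<close>
  have c: "((\<lambda>t. t * powr_prim n t - powr_prim (n - 1) t) has_real_derivative powr_prim n t) (at t)" if "t > 0" for t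
  proof -
    have "((\<lambda>t. t * powr_prim n t - powr_prim (n - 1) t) has_real_derivative
        (1 * powr_prim n t + t powr (- n) * t) - t powr (1 - n)) (at t)"
      by (intro DERIV_diff DERIV_mult DERIV_ident powr_prim_deriv[OF that] a(1)[OF that])
    moreover have "t powr (1 - n) = t powr (- n) * t" using powr_shift[OF that, of "- n"] by (simp add: algebra_simps)
    ultimately show ?thesis by simp
  qed
  have cont: "continuous_on {0<..} (\<lambda>t. (1 - n) * t powr (- n))" "continuous_on {0<..} (\<lambda>t. n * t powr (- n - 1))"
    "continuous_on {0<..} (\<lambda>t. t powr (- n))"
    by (auto intro!: continuous_intros)
  note L = laplacian_combination[OF a b c powr_prim_deriv cont, folded G_def]
  have Geq: "(\<lambda>y. powr_prim (n - 1) (\<alpha> y) + \<rho> y * (- powr_prim n (\<alpha> y)) + (\<rho> y * powr_prim n (\<rho> y) - powr_prim (n - 1) (\<rho> y))) = G"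
    by (simp add: G_def[abs_def])
  show "C_k (Suc (Suc 0)) G" using L(1) unfolding Geq by simp
  \<comment> \<open>All powers of \<open>A\<close> are written as multiples of the lowest one, and
    likewise for \<open>r\<close>; what remains is a polynomial identity.\<close>
  define A where "A = \<alpha> y"
  define P where "P = A powr (- n - 1)"
  define r where "r = \<rho> y"
  define Q where "Q = r powr (- n)"
  have A0: "A > 0" and r0: "r > 0" by (simp_all add: A_def r_def \<alpha>_pos \<rho>_pos)
  have An: "A powr (- n) = A * P" using powr_shift[OF A0, of "- n - 1"] by (simp add: P_def)
  have A1: "A powr (1 - n) = A * (A * P)" using powr_shift[OF A0, of "- n"] An by (simp add: add.commute)
  have r1: "r powr (1 - n) = r * Q" using powr_shift[OF r0, of "- n"] by (simp add: add.commute Q_def)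
  show "partial_deriv v G y = ((\<alpha> y - \<rho> y) * \<alpha> y powr (- n)) * (2 * \<beta> * (y \<bullet> v) - 2 * (x \<bullet> v))
      + (powr_prim n (\<rho> y) - powr_prim n (\<alpha> y)) * (2 * (y \<bullet> v) - 2 * (x \<bullet> v))"
  proof -
    have "\<alpha> y powr (1 - n) + \<rho> y * - (\<alpha> y powr (- n)) = (\<alpha> y - \<rho> y) * \<alpha> y powr (- n)"
      using A1 An unfolding A_def by (simp add: left_diff_distrib)
    moreover have "- powr_prim n (\<alpha> y) + powr_prim n (\<rho> y) = powr_prim n (\<rho> y) - powr_prim n (\<alpha> y)" by simp
    ultimately show ?thesis using L(2)[of v y] unfolding Geq by simp
  qed
  have "laplacian G y = 4 * \<beta> * (A - \<delta>) * ((1 - n) * A powr (- n) + r * (n * A powr (- n - 1)))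
      + 4 * n * \<beta> * (A powr (1 - n) + r * - (A powr (- n)))
      + 2 * (2 * A + 2 * \<beta> * r - (2 + 2 * \<beta>) * \<delta> - 2 * (1 - \<beta>)\<^sup>2) * - (A powr (- n)) + 4 * n * - powr_prim n A
      + 4 * (r - \<delta>) * r powr (- n) + 4 * n * powr_prim n r"
    using L(3)[of y] unfolding Geq A_def r_def by simp
  also have "\<dots> = W y"
    unfolding W_def E_def A_def[symmetric] r_def[symmetric] A1 An r1 P_def[symmetric] Q_def[symmetric]
    by (simp add: power2_eq_square algebra_simps)
  finally show "laplacian G y = W y" .
qed

text \<open>Every surviving term carries a factor \<open>\<delta>\<close>, as the unregularised
  function is biharmonic away from the pole. The term in \<open>\<rho>\<close> alone is a rescaled
  \<open>bubble\<close> and keeps its mass as \<open>\<delta>\<close> tends to 0; the other one is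
  of order \<open>\<delta>\<close>.\<close>

lemma W_facts:
  shows W_C2: "C_k (Suc (Suc 0)) W"
    and W_laplacian: "laplacian W y = 16 * n * (n + 1) * (\<delta>\<^sup>2 * \<rho> y powr (- n - 2))
      + 16 * n * (n + 1) * \<beta> * \<delta> * ((n + 2) * \<beta> * \<delta> * \<rho> y * \<alpha> y powr (- n - 3)
        - (2 * (1 - \<beta>)\<^sup>2 + \<delta> * (2 + \<beta> + n * \<beta>)) * \<alpha> y powr (- n - 2))"
proof -
  have e: "- n - 1 - 1 = - n - 2" "- n - 2 - 1 = - n - 3" "1 - n - 1 = - n" by simp_all
  have p: "((\<lambda>t. t powr (- n)) has_real_derivative - n * t powr (- n - 1)) (at t)"
    "((\<lambda>t. t powr (1 - n)) has_real_derivative (1 - n) * t powr (- n)) (at t)"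
    "((\<lambda>t. t powr (- n - 1)) has_real_derivative (- n - 1) * t powr (- n - 2)) (at t)"
    "((\<lambda>t. t powr (- n - 2)) has_real_derivative (- n - 2) * t powr (- n - 3)) (at t)" if "t > 0" for t
    using powr_deriv[OF that, of "- n"] powr_deriv[OF that, of "1 - n"] powr_deriv[OF that, of "- n - 1"]
      powr_deriv[OF that, of "- n - 2"] unfolding e by blast+
  have a: "((\<lambda>t. 4 * (E * t powr (- n) - (1 - \<beta>) * t powr (1 - n) - n * powr_prim n t)) has_real_derivative
      4 * (E * (- n * t powr (- n - 1)) - (1 - \<beta>) * ((1 - n) * t powr (- n)) - n * t powr (- n))) (at t)"
    "((\<lambda>t. 4 * (E * (- n * t powr (- n - 1)) - (1 - \<beta>) * ((1 - n) * t powr (- n)) - n * t powr (- n))) has_real_derivative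
      4 * (E * (- n * ((- n - 1) * t powr (- n - 2))) - (1 - \<beta>) * ((1 - n) * (- n * t powr (- n - 1))) - n * (- n * t powr (- n - 1)))) (at t)"
    if "t > 0" for t
    by (intro DERIV_cmult DERIV_diff powr_prim_deriv p that)+
  have b: "((\<lambda>t. 4 * (- \<beta> * t powr (- n) - n * \<beta> * \<delta> * t powr (- n - 1))) has_real_derivative
      4 * (- \<beta> * (- n * t powr (- n - 1)) - n * \<beta> * \<delta> * ((- n - 1) * t powr (- n - 2)))) (at t)"
    "((\<lambda>t. 4 * (- \<beta> * (- n * t powr (- n - 1)) - n * \<beta> * \<delta> * ((- n - 1) * t powr (- n - 2)))) has_real_derivative
      4 * (- \<beta> * (- n * ((- n - 1) * t powr (- n - 2))) - n * \<beta> * \<delta> * ((- n - 1) * ((- n - 2) * t powr (- n - 3))))) (at t)"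
    if "t > 0" for t
    by (intro DERIV_cmult DERIV_diff p that)+
  have c: "((\<lambda>t. 4 * (t powr (1 - n) - \<delta> * t powr (- n) + n * powr_prim n t)) has_real_derivative
      4 * ((1 - n) * t powr (- n) - \<delta> * (- n * t powr (- n - 1)) + n * t powr (- n))) (at t)"
    "((\<lambda>t. 4 * ((1 - n) * t powr (- n) - \<delta> * (- n * t powr (- n - 1)) + n * t powr (- n))) has_real_derivative
      4 * ((1 - n) * (- n * t powr (- n - 1)) - \<delta> * (- n * ((- n - 1) * t powr (- n - 2))) + n * (- n * t powr (- n - 1)))) (at t)"
    if "t > 0" for t
    by (intro DERIV_cmult DERIV_diff DERIV_add powr_prim_deriv p that)+
  have cont: "continuous_on {0<..} (\<lambda>t. 4 * (E * (- n * ((- n - 1) * t powr (- n - 2))) - (1 - \<beta>) * ((1 - n) * (- n * t powr (- n - 1))) - n * (- n * t powr (- n - 1))))"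
    "continuous_on {0<..} (\<lambda>t. 4 * (- \<beta> * (- n * ((- n - 1) * t powr (- n - 2))) - n * \<beta> * \<delta> * ((- n - 1) * ((- n - 2) * t powr (- n - 3)))))"
    "continuous_on {0<..} (\<lambda>t. 4 * ((1 - n) * (- n * t powr (- n - 1)) - \<delta> * (- n * ((- n - 1) * t powr (- n - 2))) + n * (- n * t powr (- n - 1))))"
    by (auto intro!: continuous_intros)
  note L = laplacian_combination[OF a b c cont]
  have Weq: "(\<lambda>y. 4 * (E * \<alpha> y powr (- n) - (1 - \<beta>) * \<alpha> y powr (1 - n) - n * powr_prim n (\<alpha> y))
    + \<rho> y * (4 * (- \<beta> * \<alpha> y powr (- n) - n * \<beta> * \<delta> * \<alpha> y powr (- n - 1)))
    + 4 * (\<rho> y powr (1 - n) - \<delta> * \<rho> y powr (- n) + n * powr_prim n (\<rho> y))) = W"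
    by (simp add: W_def[abs_def])
  show "C_k (Suc (Suc 0)) W" using L(1) unfolding Weq by simp
  define A where "A = \<alpha> y"
  define P where "P = A powr (- n - 3)"
  define r where "r = \<rho> y"
  define Q where "Q = r powr (- n - 2)"
  have A0: "A > 0" and r0: "r > 0" by (simp_all add: A_def r_def \<alpha>_pos \<rho>_pos)
  have A2: "A powr (- n - 2) = A * P" unfolding P_def by (rule powr_shift'[OF A0]) simp
  have A1: "A powr (- n - 1) = A * (A * P)" unfolding A2[symmetric] by (rule powr_shift'[OF A0]) simp
  have An: "A powr (- n) = A * (A * (A * P))" unfolding A1[symmetric] by (rule powr_shift'[OF A0]) simp
  have r1: "r powr (- n - 1) = r * Q" unfolding Q_def by (rule powr_shift'[OF r0]) simp
  have rn: "r powr (- n) = r * (r * Q)" unfolding r1[symmetric] by (rule powr_shift'[OF r0]) simp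
  \<comment> \<open>The terms in \<open>r\<close> alone and those with powers of \<open>A\<close>
    form two separate identities. In the first everything cancels except the multiple of
    \<open>\<delta>\<^sup>2 * Q\<close>.\<close>
  have rpart: "4 * (r - \<delta>) * (4 * ((1 - n) * (- n * (r * Q)) - \<delta> * (- n * ((- n - 1) * Q)) + n * (- n * (r * Q))))
      + 4 * n * (4 * ((1 - n) * (r * (r * Q)) - \<delta> * (- n * (r * Q)) + n * (r * (r * Q)))) = 16 * n * (n + 1) * (\<delta>\<^sup>2 * Q)"
    by (simp add: power2_eq_square algebra_simps)
  have Apart: "4 * \<beta> * (A - \<delta>) * (4 * (E * (- n * ((- n - 1) * (A * P))) - (1 - \<beta>) * ((1 - n) * (- n * (A * (A * P)))) - n * (- n * (A * (A * P))))
       + r * (4 * (- \<beta> * (- n * ((- n - 1) * (A * P))) - n * \<beta> * \<delta> * ((- n - 1) * ((- n - 2) * P)))))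
      + 4 * n * \<beta> * (4 * (E * (- n * (A * (A * P))) - (1 - \<beta>) * ((1 - n) * (A * (A * (A * P)))) - n * (A * (A * (A * P))))
       + r * (4 * (- \<beta> * (- n * (A * (A * P))) - n * \<beta> * \<delta> * ((- n - 1) * (A * P)))))
      + 2 * (2 * A + 2 * \<beta> * r - (2 + 2 * \<beta>) * \<delta> - 2 * (1 - \<beta>)\<^sup>2) * (4 * (- \<beta> * (- n * (A * (A * P))) - n * \<beta> * \<delta> * ((- n - 1) * (A * P))))
      + 4 * n * (4 * (- \<beta> * (A * (A * (A * P))) - n * \<beta> * \<delta> * (A * (A * P))))
      = 16 * n * (n + 1) * \<beta> * \<delta> * ((n + 2) * \<beta> * \<delta> * r * P - (2 * (1 - \<beta>)\<^sup>2 + \<delta> * (2 + \<beta> + n * \<beta>)) * (A * P))"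
    unfolding E_def by (simp add: power2_eq_square algebra_simps)
  show "laplacian W y = 16 * n * (n + 1) * (\<delta>\<^sup>2 * \<rho> y powr (- n - 2))
      + 16 * n * (n + 1) * \<beta> * \<delta> * ((n + 2) * \<beta> * \<delta> * \<rho> y * \<alpha> y powr (- n - 3)
        - (2 * (1 - \<beta>)\<^sup>2 + \<delta> * (2 + \<beta> + n * \<beta>)) * \<alpha> y powr (- n - 2))"
    using L(3)[of y] rpart Apart
    unfolding Weq A_def[symmetric] r_def[symmetric] A2 A1 An r1 rn P_def[symmetric] Q_def[symmetric] by linarith
qed

text \<open>\<open>G y\<close> is the increment from \<rho> to \<alpha> of a function with
  derivative (t - \<rho>) t^(-n), and \<rho> \<le> \<alpha> follows from |y| \<le> 1 by
  \<open>\<alpha>_minus_\<rho>\<close>.\<close>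

lemma G_nonneg:
  assumes "norm y \<le> 1" shows "G y \<ge> 0"
proof -
  define h where "h t = powr_prim (n - 1) t - \<rho> y * powr_prim n t" for t
  have "h (\<rho> y) \<le> h (\<alpha> y)"
  proof (rule DERIV_nonneg_imp_nondecreasing[where f = h])
    have "0 \<le> (1 - \<beta>) * (1 - (norm y)\<^sup>2)"
      using \<beta>(2) assms by (intro mult_nonneg_nonneg) (simp_all add: abs_square_le_1)
    then show "\<rho> y \<le> \<alpha> y" using \<alpha>_minus_\<rho>[of y] by linarith
    fix t assume t: "\<rho> y \<le> t" "t \<le> \<alpha> y"
    have t0: "t > 0" using t(1) \<rho>_pos[of y] by linarith
    have "(h has_real_derivative t powr (- (n - 1)) - \<rho> y * t powr (- n)) (at t)"
      unfolding h_def by (intro DERIV_diff DERIV_cmult powr_prim_deriv t0)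
    moreover have "t powr (- (n - 1)) = t * t powr (- n)" using powr_shift[OF t0, of "- n"] by (simp add: algebra_simps)
    then have "t powr (- (n - 1)) - \<rho> y * t powr (- n) = (t - \<rho> y) * t powr (- n)" by (simp add: left_diff_distrib)
    moreover have "(t - \<rho> y) * t powr (- n) \<ge> 0" using t by simp
    ultimately show "\<exists>z. (h has_real_derivative z) (at t) \<and> 0 \<le> z" by metis
  qed
  then show ?thesis by (simp add: G_def h_def)
qed

text \<open>On the sphere \<alpha> = \<rho>, which annihilates both coefficients in
  \<open>G_deriv\<close> as well. These are the Dirichlet conditions that allow \<open>G\<close> to
  be approximated by test functions.\<close>

lemma G_boundary:
  assumes "norm y = 1" shows "G y = 0" "partial_deriv v G y = 0"
proof -
  have "\<alpha> y = \<rho> y" using \<alpha>_minus_\<rho>[of y] assms by simp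
  then show "G y = 0" "partial_deriv v G y = 0" by (simp_all add: G_def G_deriv)
qed

end

section \<open>Testing with the regularised Green function\<close>

lemma green_vanishing:
  fixes g \<eta> :: "'a::euclidean_space \<Rightarrow> real"
  assumes g: "C_k (Suc (Suc 0)) g" and z: "\<And>y. norm y = 1 \<Longrightarrow> g y = 0"
    "\<And>y i. norm y = 1 \<Longrightarrow> partial_deriv i g y = 0" and \<eta>: "smooth \<eta>"
  shows "(\<integral>y. g y * laplacian \<eta> y \<partial>lebesgue_on unit_ball) = (\<integral>y. laplacian g y * \<eta> y \<partial>lebesgue_on unit_ball)"
proof -
  let ?M = "lebesgue_on (unit_ball :: 'a set)"
  have g1: "C_k (Suc 0) (partial_deriv i g)" if "i \<in> Basis" for i using g that by simp
  have g2: "continuous_on UNIV (partial_deriv i (partial_deriv i g))" if "i \<in> Basis" for i using g that by simp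
  note s = smooth_partial_deriv[OF \<eta>]
  have "(\<integral>y. g y * laplacian \<eta> y \<partial>?M) = (\<Sum>i\<in>Basis. \<integral>y. g y * partial_deriv i (partial_deriv i \<eta>) y \<partial>?M)"
    unfolding laplacian_def sum_distrib_left
    by (rule Bochner_Integration.integral_sum)
       (intro continuous_integrable_ball continuous_on_mult C_k_continuous[OF g] smooth_continuous smooth_partial_deriv \<eta>)
  also have "\<dots> = (\<Sum>i\<in>Basis. \<integral>y. partial_deriv i (partial_deriv i g) y * \<eta> y \<partial>?M)"
  proof (rule sum.cong[OF refl])
    fix i :: 'a assume i: "i \<in> Basis"
    have "(\<integral>y. g y * partial_deriv i (partial_deriv i \<eta>) y \<partial>?M) = - (\<integral>y. partial_deriv i g y * partial_deriv i \<eta> y \<partial>?M)"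
      by (rule ibp_vanishing[OF C_k_Suc_imp[OF g] smooth_C_k[OF s[OF i]] i]) (simp add: z)
    also have "\<dots> = (\<integral>y. partial_deriv i (partial_deriv i g) y * \<eta> y \<partial>?M)"
      using ibp_vanishing[OF g1[OF i] smooth_C_k[OF \<eta>] i] by (simp add: z)
    finally show "(\<integral>y. g y * partial_deriv i (partial_deriv i \<eta>) y \<partial>?M) = (\<integral>y. partial_deriv i (partial_deriv i g) y * \<eta> y \<partial>?M)" .
  qed
  also have "\<dots> = (\<integral>y. laplacian g y * \<eta> y \<partial>?M)"
    unfolding laplacian_def sum_distrib_right
    by (rule Bochner_Integration.integral_sum[symmetric])
       (intro continuous_integrable_ball continuous_on_mult g2 smooth_continuous \<eta>)
  finally show ?thesis .
qed

lemma C_2_laplacian_continuous: "C_k (Suc (Suc 0)) g \<Longrightarrow> continuous_on UNIV (laplacian g)"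
  unfolding laplacian_def[abs_def] by (intro continuous_on_sum) simp

text \<open>In use \<open>f\<close> is the Laplacian of \<phi>, so this says that the bilaplacian of
  \<phi> is nonnegative in the sense of distributions.\<close>

definition nonneg_biharmonic :: "('a::euclidean_space \<Rightarrow> real) \<Rightarrow> bool" where
  "nonneg_biharmonic f \<longleftrightarrow> (\<forall>\<psi>. test_function \<psi> \<and> (\<forall>x. 0 \<le> \<psi> x) \<longrightarrow>
     0 \<le> (\<integral>x. f x * laplacian \<psi> x \<partial>lebesgue_on unit_ball))"

context regularised_green
begin

text \<open>\<open>G\<close> is nonnegative and vanishes to second order on the sphere, so it is a
  limit of nonnegative test functions whose Laplacians tend to \<open>W\<close>; hence the integral
  of f W is nonnegative. Approximating \<phi> by test functions and moving the Laplacian over to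
  \<open>W\<close> gives the claim.\<close>

lemma pairing_nonneg:
  assumes \<phi>: "H20 \<phi> f" and f: "nonneg_biharmonic f"
  shows "0 \<le> (\<integral>y. \<phi> y * laplacian W y \<partial>lebesgue_on unit_ball)"
proof -
  let ?M = "lebesgue_on (unit_ball :: 'a set)"
  have lapG: "laplacian G = W" by (rule ext) (rule G_laplacian)
  have GL: "G \<in> L2 ?M" by (intro continuous_L2_ball C_k_continuous[OF G_C2])
  have WL: "W \<in> L2 ?M" by (intro continuous_L2_ball C_k_continuous[OF W_C2])
  have lWL: "laplacian W \<in> L2 ?M" by (intro continuous_L2_ball C_2_laplacian_continuous W_C2)
  obtain \<psi> where \<psi>: "\<And>k. test_function (\<psi> k)" "L2_conv ?M (\<lambda>k. laplacian (\<psi> k)) W"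
    "(AE y in ?M. G y \<ge> 0) \<Longrightarrow> (\<forall>k y. \<psi> k y \<ge> 0)"
  proof (rule test_function_approximation[OF GL WL])
    show "(\<integral>y. G y * laplacian \<eta> y \<partial>?M) = (\<integral>y. W y * \<eta> y \<partial>?M)" if "smooth \<eta>" for \<eta>
      using green_vanishing[OF G_C2 G_boundary that] unfolding lapG .
  qed blast
  have "AE y in ?M. G y \<ge> 0"
    unfolding AE_lebesgue_on_iff[OF borel_open[OF open_ball]] by (intro AE_I2 impI G_nonneg) simp
  then have nn: "\<psi> k y \<ge> 0" for k y using \<psi>(3) by blast
  have "(\<lambda>k. \<integral>y. f y * laplacian (\<psi> k) y \<partial>?M) \<longlonglongrightarrow> (\<integral>y. f y * W y \<partial>?M)"
    using L2_conv_inner_const[OF \<psi>(2) H20D(2)[OF \<phi>]] by (simp add: mult.commute)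
  moreover have "0 \<le> (\<integral>y. f y * laplacian (\<psi> k) y \<partial>?M)" for k
    using f \<psi>(1) nn unfolding nonneg_biharmonic_def by blast
  ultimately have fW: "0 \<le> (\<integral>y. f y * W y \<partial>?M)"
    by (intro LIMSEQ_le_const) auto
  obtain \<xi> where \<xi>: "\<And>k. test_function (\<xi> k)" "L2_conv ?M \<xi> \<phi>" "L2_conv ?M (\<lambda>k. laplacian (\<xi> k)) f"
    using \<phi> unfolding H20_def by blast
  have "(\<lambda>k. \<integral>y. laplacian (\<xi> k) y * W y \<partial>?M) \<longlonglongrightarrow> (\<integral>y. f y * W y \<partial>?M)"
    by (rule L2_conv_inner_const[OF \<xi>(3) WL])
  then have "(\<lambda>k. \<integral>y. \<xi> k y * laplacian W y \<partial>?M) \<longlonglongrightarrow> (\<integral>y. f y * W y \<partial>?M)"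
    using green_test[OF W_C2 \<xi>(1)] by (simp add: mult.commute)
  moreover have "(\<lambda>k. \<integral>y. \<xi> k y * laplacian W y \<partial>?M) \<longlonglongrightarrow> (\<integral>y. \<phi> y * laplacian W y \<partial>?M)"
    by (rule L2_conv_inner_const[OF \<xi>(2) lWL])
  ultimately have "(\<integral>y. f y * W y \<partial>?M) = (\<integral>y. \<phi> y * laplacian W y \<partial>?M)" by (rule LIMSEQ_unique)
  with fW show ?thesis by simp
qed

text \<open>The part of the bilaplacian of \<open>G\<close> that does not concentrate at \<open>x\<close> as \<open>\<delta> \<rightarrow> 0\<close>, divided by
  \<open>16 n (n + 1) \<beta> \<delta>\<close>.\<close>

definition remainder :: "'a \<Rightarrow> real" where
  "remainder y = (n + 2) * \<beta> * \<delta> * \<rho> y * \<alpha> y powr (- n - 3)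
        - (2 * (1 - \<beta>)\<^sup>2 + \<delta> * (2 + \<beta> + n * \<beta>)) * \<alpha> y powr (- n - 2)"

text \<open>The bound is independent of \<open>\<delta>\<close> and of y: \<alpha> \<ge> (1 -
  |x|)^2, while \<rho> \<le> 2^2 + \<delta> \<le> 5. The factor 5 + n is 2 * 1 + (3 + n), from
  \<beta> < 1 and \<delta> \<le> 1.\<close>

lemma remainder_bound:
  assumes y: "norm y < 1" and d1: "\<delta> \<le> 1"
  shows "\<bar>remainder y\<bar> \<le> (n + 2) * 5 * ((1 - norm x)\<^sup>2) powr (- n - 3) + (5 + n) * ((1 - norm x)\<^sup>2) powr (- n - 2)"
proof -
  define k where "k = (1 - norm x)\<^sup>2"
  have k0: "k > 0" using x by (simp add: k_def)
  have "norm x * norm y \<le> norm x" using y by (simp add: mult_left_le)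
  then have "k \<le> (1 - norm x * norm y)\<^sup>2" unfolding k_def using x by (intro power_mono) auto
  then have k: "k \<le> \<alpha> y" using \<alpha>_ge[of y] \<delta> by linarith
  have p: "\<alpha> y powr q \<le> k powr q" if "q \<le> 0" for q by (rule powr_mono2'[OF that k0 k])
  have r: "\<rho> y \<le> 5"
  proof -
    have "norm (y - x) \<le> 2" using norm_triangle_ineq4[of y x] x y by linarith
    then have "(norm (y - x))\<^sup>2 \<le> 2\<^sup>2" by (intro power_mono) auto
    then show ?thesis unfolding \<rho>_eq using d1 by simp
  qed
  have "\<beta> * \<delta> \<le> 1 * 1" using \<beta> \<delta> d1 by (intro mult_mono) auto
  then have "(\<beta> * \<delta>) * \<rho> y \<le> 1 * 5" using r \<rho>_pos[of y] by (intro mult_mono) auto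
  then have "(n + 2) * ((\<beta> * \<delta>) * \<rho> y) \<le> (n + 2) * 5" using n_pos by (intro mult_left_mono) auto
  then have "(n + 2) * ((\<beta> * \<delta>) * \<rho> y) * \<alpha> y powr (- n - 3) \<le> (n + 2) * 5 * k powr (- n - 3)"
    by (rule mult_mono) (use n_pos p[of "- n - 3"] in auto)
  moreover have "0 \<le> (n + 2) * ((\<beta> * \<delta>) * \<rho> y) * \<alpha> y powr (- n - 3)"
    using n_pos \<beta>(1) \<delta> \<rho>_pos[of y] by (intro mult_nonneg_nonneg) auto
  moreover have "(2 * (1 - \<beta>)\<^sup>2 + \<delta> * (2 + \<beta> + n * \<beta>)) * \<alpha> y powr (- n - 2) \<le> (5 + n) * k powr (- n - 2)"
  proof (rule mult_mono)
    have "(1 - \<beta>)\<^sup>2 \<le> 1" using power_mono[of "1 - \<beta>" 1 2] \<beta>(1,2) by simp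
    moreover have nb: "n * \<beta> \<le> n * 1" "0 \<le> n * \<beta>"
      using n_pos \<beta>(1,2) by (intro mult_left_mono mult_nonneg_nonneg; simp)+
    have "2 + \<beta> + n * \<beta> \<le> 3 + n" using nb(1) \<beta>(2) by linarith
    then have "\<delta> * (2 + \<beta> + n * \<beta>) \<le> 1 * (3 + n)"
      using nb(2) \<beta>(1) \<delta> d1 n_pos by (intro mult_mono) simp_all
    ultimately have "2 * (1 - \<beta>)\<^sup>2 + \<delta> * (2 + \<beta> + n * \<beta>) \<le> 2 * 1 + 1 * (3 + n)"
      by (intro add_mono mult_left_mono) simp_all
    then show "2 * (1 - \<beta>)\<^sup>2 + \<delta> * (2 + \<beta> + n * \<beta>) \<le> 5 + n" by simp
    show "\<alpha> y powr (- n - 2) \<le> k powr (- n - 2)" using n_pos p[of "- n - 2"] by simp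
  qed (use n_pos in auto)
  moreover have "0 \<le> (2 * (1 - \<beta>)\<^sup>2 + \<delta> * (2 + \<beta> + n * \<beta>)) * \<alpha> y powr (- n - 2)"
    using n_pos \<beta>(1) \<delta> by (intro mult_nonneg_nonneg add_nonneg_nonneg) auto
  ultimately show ?thesis unfolding remainder_def k_def[symmetric] by (simp only: mult.assoc)
qed

text \<open>\<open>pairing_nonneg\<close> after division by 16 n (n + 1), with the remainder moved
  to the other side; what is lost is of order \<open>\<delta>\<close> for fixed x.\<close>

lemma kernel_lower_bound:
  assumes \<phi>: "H20 \<phi> f" and f: "nonneg_biharmonic f" and d1: "\<delta> \<le> 1"
  shows "- \<delta> * (((n + 2) * 5 * ((1 - norm x)\<^sup>2) powr (- n - 3) + (5 + n) * ((1 - norm x)\<^sup>2) powr (- n - 2))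
        * (\<integral>y. \<bar>\<phi> y\<bar> \<partial>lebesgue_on unit_ball))
    \<le> (\<integral>y. \<phi> y * (\<delta>\<^sup>2 * \<rho> y powr (- n - 2)) \<partial>lebesgue_on unit_ball)" (is "- \<delta> * (?C * ?I) \<le> ?J")
proof -
  let ?M = "lebesgue_on (unit_ball :: 'a set)"
  have C0: "?C \<ge> 0" using n_pos by (intro add_nonneg_nonneg mult_nonneg_nonneg) auto
  have \<phi>L: "\<phi> \<in> L2 ?M" by (rule H20D(1)[OF \<phi>])
  have rc: "continuous_on UNIV remainder"
    unfolding remainder_def using \<alpha>_pos by (intro continuous_intros \<alpha>_continuous \<rho>_continuous) (auto simp: less_imp_neq[symmetric])
  have kc: "continuous_on UNIV (\<lambda>y. \<delta>\<^sup>2 * \<rho> y powr (- n - 2))"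
    using \<rho>_pos by (intro continuous_intros \<rho>_continuous) (auto simp: less_imp_neq[symmetric])
  have i1: "integrable ?M (\<lambda>y. \<phi> y * (\<delta>\<^sup>2 * \<rho> y powr (- n - 2)))" by (intro L2_mult \<phi>L continuous_L2_ball kc)
  have i2: "integrable ?M (\<lambda>y. \<phi> y * remainder y)" by (intro L2_mult \<phi>L continuous_L2_ball rc)
  have i3: "integrable ?M (\<lambda>y. \<bar>\<phi> y\<bar>)" by (intro integrable_abs L2_ball_integrable \<phi>L)
  have "\<phi> y * laplacian W y = 16 * n * (n + 1) * (\<phi> y * (\<delta>\<^sup>2 * \<rho> y powr (- n - 2)) + \<beta> * \<delta> * (\<phi> y * remainder y))" for y
    by (simp add: W_laplacian remainder_def algebra_simps)
  then have "0 \<le> 16 * n * (n + 1) * (?J + \<beta> * \<delta> * (\<integral>y. \<phi> y * remainder y \<partial>?M))"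
    using pairing_nonneg[OF \<phi> f] i1 i2 by simp
  then have pos: "0 \<le> ?J + \<beta> * \<delta> * (\<integral>y. \<phi> y * remainder y \<partial>?M)"
  proof -
    have K: "0 < 16 * n * (n + 1)" using n_pos by simp
    assume "0 \<le> 16 * n * (n + 1) * (?J + \<beta> * \<delta> * (\<integral>y. \<phi> y * remainder y \<partial>?M))"
    with K show ?thesis by (meson mult_pos_neg not_le)
  qed
  have "\<bar>\<integral>y. \<phi> y * remainder y \<partial>?M\<bar> \<le> (\<integral>y. ?C * \<bar>\<phi> y\<bar> \<partial>?M)"
  proof (rule integral_abs_bound_integral[OF i2 integrable_mult_right[OF i3]])
    fix y :: 'a assume "y \<in> space ?M"
    then have "norm y < 1" by (simp add: space_restrict_space)
    from remainder_bound[OF this d1] show "\<bar>\<phi> y * remainder y\<bar> \<le> ?C * \<bar>\<phi> y\<bar>"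
      unfolding abs_mult by (subst mult.commute) (intro mult_right_mono, simp_all)
  qed
  then have "\<bar>\<integral>y. \<phi> y * remainder y \<partial>?M\<bar> \<le> ?C * ?I" by simp
  then have "\<delta> * \<bar>\<integral>y. \<phi> y * remainder y \<partial>?M\<bar> \<le> \<delta> * (?C * ?I)" using \<delta> by (intro mult_left_mono) auto
  moreover have "\<beta> * (\<delta> * \<bar>\<integral>y. \<phi> y * remainder y \<partial>?M\<bar>) \<le> 1 * (\<delta> * \<bar>\<integral>y. \<phi> y * remainder y \<partial>?M\<bar>)"
    using \<beta> \<delta> by (intro mult_right_mono) auto
  moreover have "\<beta> * \<delta> * (\<integral>y. \<phi> y * remainder y \<partial>?M) \<le> \<beta> * (\<delta> * \<bar>\<integral>y. \<phi> y * remainder y \<partial>?M\<bar>)"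
    unfolding mult.assoc using \<beta> \<delta> by (intro mult_left_mono) auto
  ultimately show ?thesis using pos by linarith
qed

end

text \<open>The profile whose rescalings are the main part \<open>\<delta>\<^sup>2 \<rho> powr (- n - 2)\<close> of the bilaplacian of \<open>G\<close>.\<close>

definition bubble :: "'a::euclidean_space \<Rightarrow> real" where
  "bubble z = ((norm z)\<^sup>2 + 1) powr (- (real DIM('a) / 2) - 2)"

lemma bubble_pos: "bubble z > 0"
proof -
  have "(norm z)\<^sup>2 + 1 > 0" by (simp add: add_nonneg_pos)
  then show ?thesis by (simp add: bubble_def)
qed

lemma bubble_borel [measurable]: "bubble \<in> borel_measurable borel"
  unfolding bubble_def[abs_def] by measurable

text \<open>For k \<le> |z| < k + 1 the value is at most g(k) = (k^2 + 1)^p, and the shell is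
  enlarged to the ball of radius k + 1. Since k^2 + 1 \<ge> (k + 1)^2 / 2 and 2 p + N = -4, the
  series is dominated by a multiple of the sum of (k + 1)^(-2).\<close>

lemma bubble_integrable: "integrable lborel (bubble :: 'a::euclidean_space \<Rightarrow> real)"
proof (rule integrableI_bounded)
  define N where "N = DIM('a)"
  define p where "p = - (real N / 2) - 2"
  define g where "g k = ((real k)\<^sup>2 + 1) powr p" for k
  define V where "V = measure lborel (ball (0::'a) 1)"
  have em: "emeasure lborel (ball (0::'a) (real (Suc k))) = ennreal (V * real (Suc k) ^ N)" for k
  proof -
    have "emeasure lborel (ball (0::'a) (real (Suc k))) = ennreal (measure lborel (ball (0::'a) (real (Suc k))))"
      using less_imp_neq[OF emeasure_lborel_ball_finite[of "0::'a" "real (Suc k)"]]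
      by (intro emeasure_eq_ennreal_measure) (simp only: infinity_ennreal_def not_False_eq_True)
    then show ?thesis by (simp add: content_ball V_def N_def)
  qed
  have gk: "g k * real (Suc k) ^ N \<le> 2 powr (- p) * inverse (real (Suc k) ^ 2)" for k
  proof -
    have s: "(real (Suc k))\<^sup>2 / 2 \<le> (real k)\<^sup>2 + 1"
    proof -
      have "0 \<le> (real k - 1)\<^sup>2" by simp
      then show ?thesis by (simp add: power2_eq_square algebra_simps)
    qed
    have "g k \<le> ((real (Suc k))\<^sup>2 / 2) powr p"
      unfolding g_def by (rule powr_mono2'[OF _ _ s]) (simp_all add: p_def)
    also have "\<dots> = ((real (Suc k))\<^sup>2) powr p / 2 powr p" by (rule powr_divide)
    also have "((real (Suc k))\<^sup>2) powr p = real (Suc k) powr (2 * p)"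
      by (simp add: powr_powr[symmetric] powr_numeral del: of_nat_Suc)
    finally have "g k * real (Suc k) ^ N \<le> real (Suc k) powr (2 * p) / 2 powr p * real (Suc k) ^ N"
      by (rule mult_right_mono) simp
    also have "real (Suc k) ^ N = real (Suc k) powr real N" by (rule powr_realpow[symmetric]) simp
    also have "real (Suc k) powr (2 * p) / 2 powr p * real (Suc k) powr real N
        = 2 powr (- p) * (real (Suc k) powr (2 * p) * real (Suc k) powr real N)" by (simp add: powr_minus divide_inverse)
    finally have 1: "g k * real (Suc k) powr real N
        \<le> 2 powr (- p) * (real (Suc k) powr (2 * p) * real (Suc k) powr real N)" .
    have "real (Suc k) powr (2 * p) * real (Suc k) powr real N = real (Suc k) powr (- 4)"
      by (simp only: powr_add[symmetric]) (simp add: p_def)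
    also have "\<dots> \<le> real (Suc k) powr (- 2)" by (rule powr_mono) simp_all
    also have "\<dots> = inverse (real (Suc k) ^ 2)" by (simp add: powr_minus powr_numeral del: of_nat_Suc)
    finally have "2 powr (- p) * (real (Suc k) powr (2 * p) * real (Suc k) powr real N)
        \<le> 2 powr (- p) * inverse (real (Suc k) ^ 2)"
      by (rule mult_left_mono) simp
    from order_trans[OF 1 this] show ?thesis by (simp only: powr_realpow of_nat_0_less_iff zero_less_Suc)
  qed
  have le: "ennreal (norm (bubble z)) \<le> (\<Sum>k. ennreal (g k) * indicator (ball 0 (real (Suc k))) z)" for z :: 'a
  proof -
    define k where "k = nat \<lfloor>norm z\<rfloor>"
    have k: "real k \<le> norm z" "norm z < real (Suc k)"
      by (simp_all add: k_def) linarith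
    have "(real k)\<^sup>2 + 1 \<le> (norm z)\<^sup>2 + 1" using k(1) by (simp add: power_mono)
    then have "bubble z \<le> g k"
      unfolding bubble_def g_def p_def N_def by (intro powr_mono2') (auto intro: add_nonneg_pos)
    then have "ennreal (norm (bubble z)) \<le> ennreal (g k) * indicator (ball 0 (real (Suc k))) z"
      using k(2) bubble_pos[of z] by (simp add: ennreal_leI)
    also have "\<dots> = (\<Sum>i\<in>{k}. ennreal (g i) * indicator (ball 0 (real (Suc i))) z)"
      by (simp only: sum.insert_remove sum.empty finite.emptyI Diff_empty empty_Diff add_0_right)
    also have "\<dots> \<le> (\<Sum>i. ennreal (g i) * indicator (ball 0 (real (Suc i))) z)"
      by (rule sum_le_suminf) (rule summableI, rule finite.insertI, rule finite.emptyI, rule zero_le)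
    finally show ?thesis .
  qed
  have "(\<integral>\<^sup>+z. ennreal (norm (bubble (z::'a))) \<partial>lborel) \<le> (\<integral>\<^sup>+z. (\<Sum>k. ennreal (g k) * indicator (ball (0::'a) (real (Suc k))) z) \<partial>lborel)"
    by (rule nn_integral_mono) (rule le)
  also have "\<dots> = (\<Sum>k. \<integral>\<^sup>+z. ennreal (g k) * indicator (ball (0::'a) (real (Suc k))) z \<partial>lborel)"
    by (rule nn_integral_suminf)
      (intro borel_measurable_times_ennreal borel_measurable_const borel_measurable_indicator, simp)
  also have "\<dots> = (\<Sum>k. ennreal (g k) * ennreal (V * real (Suc k) ^ N))"
    by (simp add: nn_integral_cmult_indicator em del: of_nat_Suc)
  also have "\<dots> \<le> (\<Sum>k. ennreal (V * 2 powr (- p) * inverse (real (Suc k) ^ 2)))"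
  proof (rule suminf_le)
    fix k
    have "g k * (V * real (Suc k) ^ N) \<le> V * 2 powr (- p) * inverse (real (Suc k) ^ 2)"
      using mult_left_mono[OF gk[of k], of V] by (simp add: V_def mult_ac)
    then show "ennreal (g k) * ennreal (V * real (Suc k) ^ N) \<le> ennreal (V * 2 powr (- p) * inverse (real (Suc k) ^ 2))"
      by (subst ennreal_mult'[symmetric]) (auto simp: g_def intro!: ennreal_leI)
  qed auto
  also have "\<dots> < \<infinity>"
  proof -
    have "summable (\<lambda>k. inverse (real (Suc k) ^ 2))"
      using inverse_power_summable[of 2, where 'a = real] by (subst summable_Suc_iff) simp
    then have "summable (\<lambda>k. V * 2 powr (- p) * inverse (real (Suc k) ^ 2))" by (rule summable_mult)
    then have "(\<lambda>k. V * 2 powr (- p) * inverse (real (Suc k) ^ 2)) sums (\<Sum>k. V * 2 powr (- p) * inverse (real (Suc k) ^ 2))"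
      by (rule summable_sums)
    then have "(\<Sum>k. ennreal (V * 2 powr (- p) * inverse (real (Suc k) ^ 2))) = ennreal (\<Sum>k. V * 2 powr (- p) * inverse (real (Suc k) ^ 2))"
      by (rule suminf_ennreal_eq[rotated]) (simp add: V_def)
    then show ?thesis by simp
  qed
  finally show "(\<integral>\<^sup>+z. ennreal (norm (bubble (z::'a))) \<partial>lborel) < \<infinity>" .
qed simp

lemma bubble_mass_pos: "(\<integral>z. bubble (z::'a::euclidean_space) \<partial>lborel) > 0"
proof -
  have nn: "AE z in lborel. 0 \<le> bubble (z::'a)" by (intro AE_I2 less_imp_le bubble_pos)
  have "(\<integral>z. bubble (z::'a) \<partial>lborel) \<noteq> 0"
  proof
    assume "(\<integral>z. bubble (z::'a) \<partial>lborel) = 0"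
    then have "AE z in lborel. bubble (z::'a) = 0" using integral_nonneg_eq_0_iff_AE[OF bubble_integrable nn] by simp
    then have "AE z in lborel. (z::'a) \<notin> UNIV"
    proof eventually_elim
      case (elim z)
      then show ?case using bubble_pos[of z] by simp
    qed
    then have "(UNIV :: 'a set) \<in> null_sets lborel" using AE_iff_null_sets[of "UNIV :: 'a set" lborel] by simp
    then show False by (simp add: null_sets_def)
  qed
  moreover have "(\<integral>z. bubble (z::'a) \<partial>lborel) \<ge> 0" using nn by (rule integral_nonneg_AE)
  ultimately show ?thesis by simp
qed

text \<open>The substitution y = x - e z with regularisation \<open>\<delta> = e\<^sup>2\<close>.
  The Jacobian e^N, the factor \<delta>^2 = e^4 and the power e^(2 p) cancel, because p = - N/2 -
  2.\<close>

lemma bubble_rescale: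
  fixes g :: "'a::euclidean_space \<Rightarrow> real"
  assumes g: "g \<in> borel_measurable borel" and e: "e > 0"
  shows "(\<integral>z. bubble z * g (x - e *\<^sub>R z) \<partial>lborel)
    = (\<integral>y. g y * ((e\<^sup>2)\<^sup>2 * ((norm (y - x))\<^sup>2 + e\<^sup>2) powr (- (real DIM('a) / 2) - 2)) \<partial>lborel)"
proof -
  define p where "p = - (real DIM('a) / 2) - 2"
  have m: "(\<lambda>y. g y * ((e\<^sup>2)\<^sup>2 * ((norm (y - x))\<^sup>2 + e\<^sup>2) powr p)) \<in> borel_measurable borel"
    using g by measurable
  have "(\<integral>y. g y * ((e\<^sup>2)\<^sup>2 * ((norm (y - x))\<^sup>2 + e\<^sup>2) powr p) \<partial>lborel)
      = \<bar>- e\<bar> ^ DIM('a) * (\<integral>z. g (x + (- e) *\<^sub>R z) * ((e\<^sup>2)\<^sup>2 * ((norm (x + (- e) *\<^sub>R z - x))\<^sup>2 + e\<^sup>2) powr p) \<partial>lborel)"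
    by (rule lborel_integral_affine[OF m]) (use e in simp)
  also have "\<dots> = (\<integral>z. e ^ DIM('a) * (g (x + (- e) *\<^sub>R z) * ((e\<^sup>2)\<^sup>2 * ((norm (x + (- e) *\<^sub>R z - x))\<^sup>2 + e\<^sup>2) powr p)) \<partial>lborel)"
    using e by simp
  also have "\<dots> = (\<integral>z. bubble z * g (x - e *\<^sub>R z) \<partial>lborel)"
  proof (rule Bochner_Integration.integral_cong[OF refl])
    fix z :: 'a
    have "(norm (x + (- e) *\<^sub>R z - x))\<^sup>2 + e\<^sup>2 = e\<^sup>2 * ((norm z)\<^sup>2 + 1)"
      by (simp add: power_mult_distrib distrib_left)
    then have "((norm (x + (- e) *\<^sub>R z - x))\<^sup>2 + e\<^sup>2) powr p = (e\<^sup>2) powr p * ((norm z)\<^sup>2 + 1) powr p"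
      by (simp add: powr_mult)
    also have "(e\<^sup>2) powr p = e powr (2 * p)" using e by (simp add: powr_powr[symmetric] powr_numeral)
    finally have 1: "((norm (x + (- e) *\<^sub>R z - x))\<^sup>2 + e\<^sup>2) powr p = e powr (2 * p) * bubble z"
      by (simp add: bubble_def p_def)
    have "e ^ DIM('a) * (e\<^sup>2)\<^sup>2 = e powr (real DIM('a)) * e powr 4"
      using e by (simp add: powr_realpow powr_numeral)
    then have "e ^ DIM('a) * (e\<^sup>2)\<^sup>2 * e powr (2 * p) = e powr (real DIM('a) + 4 + 2 * p)"
      by (simp add: powr_add)
    also have "real DIM('a) + 4 + 2 * p = 0" by (simp add: p_def)
    finally have 2: "e ^ DIM('a) * (e\<^sup>2)\<^sup>2 * e powr (2 * p) = 1" using e by simp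
    have "e ^ DIM('a) * (g (x + (- e) *\<^sub>R z) * ((e\<^sup>2)\<^sup>2 * ((norm (x + (- e) *\<^sub>R z - x))\<^sup>2 + e\<^sup>2) powr p))
        = (e ^ DIM('a) * (e\<^sup>2)\<^sup>2 * e powr (2 * p)) * (bubble z * g (x + (- e) *\<^sub>R z))"
      unfolding 1 by (simp only: mult_ac)
    then show "e ^ DIM('a) * (g (x + (- e) *\<^sub>R z) * ((e\<^sup>2)\<^sup>2 * ((norm (x + (- e) *\<^sub>R z - x))\<^sup>2 + e\<^sup>2) powr p)) = bubble z * g (x - e *\<^sub>R z)"
      unfolding 2 by simp
  qed
  finally show ?thesis by (simp add: p_def)
qed

text \<open>For \<delta> = e^2 the main part of the pairing is the approximate identity
  \<open>T k x\<close>, and \<open>kernel_lower_bound\<close> says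
  \<open>T k x \<ge> - (e k)\<^sup>2 * C\<close>. The constant \<open>C\<close> may blow up as x
  approaches the boundary, which does no harm: the limit is taken at each fixed x, along a
  subsequence on which \<open>T\<close> converges almost everywhere to a positive multiple of
  \<phi>.\<close>

theorem boggio:
  fixes \<phi> f :: "'a::euclidean_space \<Rightarrow> real"
  assumes \<phi>: "H20 \<phi> f" and f: "nonneg_biharmonic f"
  shows "AE x in lebesgue_on unit_ball. \<phi> x \<ge> 0"
proof -
  let ?M = "lebesgue_on (unit_ball :: 'a set)"
  define N2 where "N2 = real DIM('a) / 2"
  have \<phi>L: "\<phi> \<in> L2 ?M" by (rule H20D(1)[OF \<phi>])
  obtain g where g: "g \<in> borel_measurable borel" "\<And>x. norm x \<ge> 1 \<Longrightarrow> g x = 0" "AE x in ?M. \<phi> x = g x"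
    using borel_version[OF L2_measurable[OF \<phi>L]] by blast
  have gL: "g \<in> L2 lborel" by (rule L2_ball_imp_lborel[OF \<phi>L g])
  define e where "e k = 1 / real (Suc k)" for k
  have e: "e k > 0" "e k \<le> 1" for k by (simp_all add: e_def)
  have e0: "e \<longlonglongrightarrow> 0" using LIMSEQ_inverse_real_of_nat by (simp add: e_def[abs_def] inverse_eq_divide)
  define m where "m = (\<integral>z. bubble (z::'a) \<partial>lborel)"
  have m: "m > 0" unfolding m_def by (rule bubble_mass_pos)
  define T where "T k x = (\<integral>z. bubble z * g (1 *\<^sub>R x - e k *\<^sub>R z) \<partial>lborel)" for k x
  have "L2_conv lborel T (\<lambda>x. m * g x)"
    unfolding T_def m_def
    by (rule approximate_identity_L2[OF gL _ bubble_integrable _ _ _ e0])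
       (simp_all add: g(2) less_imp_le[OF bubble_pos])
  then obtain r where r: "strict_mono r" "AE x in lborel. (\<lambda>k. T (r k) x) \<longlonglongrightarrow> m * g x"
    by (rule L2_conv_AE_subseq)
  have lower: "\<exists>C. \<forall>k. - ((e k)\<^sup>2 * C) \<le> T k x" if x: "norm x < 1" for x
  proof (intro exI allI)
    fix k
    interpret regularised_green x "(e k)\<^sup>2" by standard (use x e[of k] in auto)
    have d1: "(e k)\<^sup>2 \<le> 1" using e[of k] by (simp add: abs_square_le_1)
    have neq: "n = N2" by (simp add: n_def N2_def)
    have kc: "continuous_on UNIV (\<lambda>y. ((e k)\<^sup>2)\<^sup>2 * \<rho> y powr (- n - 2))"
      using \<rho>_pos by (intro continuous_intros \<rho>_continuous) (auto simp: less_imp_neq[symmetric])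
    have "T k x = (\<integral>y. g y * (((e k)\<^sup>2)\<^sup>2 * \<rho> y powr (- n - 2)) \<partial>lborel)"
      unfolding T_def scaleR_one bubble_rescale[OF g(1) e(1)] \<rho>_eq n_def ..
    also have "\<dots> = (\<integral>y. \<phi> y * (((e k)\<^sup>2)\<^sup>2 * \<rho> y powr (- n - 2)) \<partial>?M)"
      by (rule integral_ball_eq_lborel[OF L2_measurable[OF \<phi>L] g, symmetric])
         (assumption, rule borel_measurable_continuous_onI[OF kc])
    finally show "- ((e k)\<^sup>2 * (((N2 + 2) * 5 * ((1 - norm x)\<^sup>2) powr (- N2 - 3) + (5 + N2) * ((1 - norm x)\<^sup>2) powr (- N2 - 2))
        * (\<integral>y. \<bar>\<phi> y\<bar> \<partial>?M))) \<le> T k x"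
      using kernel_lower_bound[OF \<phi> f d1] unfolding neq by simp
  qed
  have "AE x in lborel. x \<in> unit_ball \<longrightarrow> g x \<ge> 0"
    using r(2)
  proof eventually_elim
    case (elim x)
    show ?case
    proof
      assume "x \<in> unit_ball"
      then have "norm x < 1" by simp
      then obtain C where C: "\<And>k. - ((e k)\<^sup>2 * C) \<le> T k x" using lower by blast
      have "(\<lambda>k. - ((e (r k))\<^sup>2 * C)) \<longlonglongrightarrow> - (0\<^sup>2 * C)"
        by (intro tendsto_intros LIMSEQ_subseq_LIMSEQ[OF e0 r(1), unfolded o_def])
      then have "- (0\<^sup>2 * C) \<le> m * g x"
        by (rule LIMSEQ_le[OF _ elim]) (use C in blast)
      then show "g x \<ge> 0" using m by (simp add: zero_le_mult_iff)
    qed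
  qed
  then have "AE x in ?M. g x \<ge> 0" unfolding AE_lebesgue_on_iff[OF borel_open[OF open_ball]] .
  with g(3) show ?thesis by eventually_elim simp
qed

section \<open>The truncated problem\<close>

lemma H20_poincare:
  assumes "H20 \<phi> f"
  shows "(\<integral>x. (\<phi> x)\<^sup>2 \<partial>lebesgue_on unit_ball) \<le> 16 * (\<integral>x. (f x)\<^sup>2 \<partial>lebesgue_on unit_ball)"
proof -
  obtain \<psi> where \<psi>: "\<And>k. test_function (\<psi> k)" "L2_conv (lebesgue_on unit_ball) \<psi> \<phi>"
    "L2_conv (lebesgue_on unit_ball) (\<lambda>k. laplacian (\<psi> k)) f"
    using assms unfolding H20_def by blast
  show ?thesis
    by (rule LIMSEQ_le[OF L2_conv_sq[OF \<psi>(2)] tendsto_mult_left[OF L2_conv_sq[OF \<psi>(3)]]])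
       (intro exI allI impI gradient_laplacian_bound(1) \<psi>(1))
qed

lemma one_minus_exp_minus_bounds:
  fixes h :: real assumes "0 \<le> h"
  shows "1 - exp (- h) \<le> h" "h - h\<^sup>2 \<le> 1 - exp (- h)"
proof -
  show "1 - exp (- h) \<le> h" using exp_ge_add_one_self[of "- h"] by linarith
  have "1 + h \<le> exp h" by (rule exp_ge_add_one_self)
  then have "exp (- h) \<le> inverse (1 + h)" using assms by (simp add: exp_minus le_imp_inverse_le)
  also have "inverse (1 + h) \<le> 1 - h + h\<^sup>2"
  proof -
    have "1 \<le> (1 - h + h\<^sup>2) * (1 + h)"
      using assms by (simp add: algebra_simps power2_eq_square)
    then show ?thesis using assms by (simp add: inverse_eq_divide pos_divide_le_eq)
  qed
  finally show "h - h\<^sup>2 \<le> 1 - exp (- h)" by linarith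
qed

text \<open>The nonlinearity \<open>e\<^sup>u\<^sup>-\<^sup>s\<close> is truncated to \<open>e\<^sup>u exp (- max 0 s)\<close>, whose derivative in \<open>s\<close>
  is at most \<open>e\<^sup>u\<close> in absolute value; the stability of \<open>u\<close> then makes the energy functional strongly convex.\<close>

definition trunc_prim :: "real \<Rightarrow> real" where
  "trunc_prim s = (if s \<le> 0 then s else 1 - exp (- s))"

lemma trunc_prim_deriv: "(trunc_prim has_real_derivative exp (- max 0 s)) (at s)"
proof -
  consider "s < 0" | "s > 0" | "s = 0" by linarith
  then show ?thesis
  proof cases
    case 1
    have "((\<lambda>s. s) has_real_derivative 1) (at s)" by simp
    then have "(trunc_prim has_real_derivative 1) (at s)"
      by (rule has_field_derivative_transform_within_open[where S = "{..<0}"])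
         (use 1 in \<open>simp_all add: trunc_prim_def\<close>)
    then show ?thesis using 1 by simp
  next
    case 2
    have "((\<lambda>s. 1 - exp (- s)) has_real_derivative exp (- s)) (at s)"
      by (auto intro!: derivative_eq_intros)
    then have "(trunc_prim has_real_derivative exp (- s)) (at s)"
      by (rule has_field_derivative_transform_within_open[where S = "{0<..}"])
         (use 2 in \<open>simp_all add: trunc_prim_def\<close>)
    then show ?thesis using 2 by simp
  next
    case 3
    have "(trunc_prim has_derivative (\<lambda>h. h)) (at 0)"
    proof (rule has_derivative_quadratic_bound[where C = 1])
      fix h :: real
      show "\<bar>trunc_prim (0 + h) - trunc_prim 0 - h\<bar> \<le> 1 * (norm h)\<^sup>2"
      proof (cases "h \<le> 0")
        case False
        then show ?thesis
          using one_minus_exp_minus_bounds[of h] by (simp add: trunc_prim_def abs_le_iff)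
      qed (simp add: trunc_prim_def)
    qed (rule bounded_linear_ident)
    moreover have "(*) 1 = (\<lambda>h::real. h)" by auto
    ultimately show ?thesis using 3 by (simp add: has_field_derivative_def)
  qed
qed

text \<open>The constant 1 is decisive: it makes \<open>trunc_prim s + s\<^sup>2 / 2\<close> convex,
  and it carries L2 convergence over to the nonlinearity.\<close>

lemma exp_minus_max_lipschitz: "\<bar>exp (- max 0 s) - exp (- max 0 t)\<bar> \<le> \<bar>s - t\<bar>" for s t :: real
proof -
  have *: "exp (- a) - exp (- b) \<le> b - a" "0 \<le> exp (- a) - exp (- b)" if "0 \<le> a" "a \<le> b" for a b :: real
  proof -
    have "exp (- a) - exp (- b) = exp (- a) * (1 - exp (- (b - a)))"
      by (simp add: right_diff_distrib exp_add[symmetric])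
    also have "\<dots> \<le> 1 * (b - a)"
      using one_minus_exp_minus_bounds(1)[of "b - a"] that by (intro mult_mono) simp_all
    finally show "exp (- a) - exp (- b) \<le> b - a" by simp
    show "0 \<le> exp (- a) - exp (- b)" using that by simp
  qed
  show ?thesis
  proof (cases "s \<le> t")
    case True
    then show ?thesis using *[of "max 0 s" "max 0 t"] by (auto simp: max_def split: if_splits)
  next
    case False
    then show ?thesis using *[of "max 0 t" "max 0 s"] by (auto simp: max_def split: if_splits)
  qed
qed

text \<open>\<open>trunc_prim\<close> is concave, its derivative being nonincreasing. This tangent
  inequality later replaces differentiation of the energy under the integral.\<close>

lemma trunc_prim_above: "trunc_prim (s + h) \<le> trunc_prim s + exp (- max 0 s) * h"
proof -
  have "convex_on UNIV (\<lambda>s. - trunc_prim s)"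
    by (rule convex_on_realI[where f' = "\<lambda>s. - exp (- max 0 s)"])
       (auto intro!: DERIV_minus trunc_prim_deriv)
  from convex_on_imp_above_tangent[OF this, of s "s + h" "- exp (- max 0 s)"]
  show ?thesis
    using DERIV_minus[OF trunc_prim_deriv[of s]] by (simp add: algebra_simps)
qed

text \<open>Midpoint convexity of \<open>trunc_prim s + s\<^sup>2 / 2\<close>. The loss (s - t)^2 /
  4 matches the gain of the parallelogram law for the Laplacians, so stability can absorb
  it.\<close>

lemma trunc_prim_midpoint:
  "trunc_prim s + trunc_prim t - 2 * trunc_prim ((s + t) / 2) \<ge> - (s - t)\<^sup>2 / 4"
proof -
  define g where "g s = trunc_prim s + s\<^sup>2 / 2" for s
  have gd: "(g has_real_derivative exp (- max 0 s) + s) (at s)" for s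
    unfolding g_def by (rule DERIV_add[OF trunc_prim_deriv]) (auto intro!: derivative_eq_intros)
  have "convex_on UNIV g"
  proof (rule convex_on_realI[OF _ gd])
    fix s t :: real assume "s \<le> t"
    then show "exp (- max 0 s) + s \<le> exp (- max 0 t) + t" using exp_minus_max_lipschitz[of s t] by linarith
  qed simp
  from convex_onD[OF this, of "1/2" s t]
  have "g ((s + t) / 2) \<le> g s / 2 + g t / 2" by (simp add: add_divide_distrib)
  then have "2 * g ((s + t) / 2) \<le> g s + g t" by simp
  moreover have "s\<^sup>2 / 2 + t\<^sup>2 / 2 - ((s + t) / 2)\<^sup>2 = (s - t)\<^sup>2 / 4"
    by (simp add: power2_eq_square field_simps)
  ultimately show ?thesis unfolding g_def by simp
qed

lemma trunc_prim_abs: "\<bar>trunc_prim s\<bar> \<le> \<bar>s\<bar>"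
  using one_minus_exp_minus_bounds(1)[of s] by (simp add: trunc_prim_def)

lemma trunc_prim_borel [measurable]: "trunc_prim \<in> borel_measurable borel"
  by (rule borel_measurable_continuous_onI)
     (rule continuous_at_imp_continuous_on, rule ballI, rule DERIV_isCont[OF trunc_prim_deriv])

section \<open>Minimisation of the energy with a stable weight\<close>

locale stable_weight =
  fixes w :: "'a::euclidean_space \<Rightarrow> real" and \<Lambda> :: real
  assumes w_integrable: "integrable (lebesgue_on unit_ball) w" and w_pos: "\<And>x. w x > 0" and \<Lambda>: "\<Lambda> > 0"
    and stable: "\<And>\<psi>. test_function \<psi> \<Longrightarrow>
      \<Lambda> * (\<integral>x. w x * (\<psi> x)\<^sup>2 \<partial>lebesgue_on unit_ball) \<le> (\<integral>x. (laplacian \<psi> x)\<^sup>2 \<partial>lebesgue_on unit_ball)"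
begin

abbreviation B where "B \<equiv> lebesgue_on (unit_ball :: 'a set)"

text \<open>The weight is absorbed into the measure, so that the general L2 results apply to
  weighted integrals.\<close>

definition \<nu> :: "'a measure" where "\<nu> = density B (\<lambda>x. ennreal (w x))"

lemma w_measurable: "w \<in> borel_measurable B"
  by (rule borel_measurable_integrable[OF w_integrable])

lemma measurable_\<nu>: "f \<in> borel_measurable \<nu> \<longleftrightarrow> f \<in> borel_measurable B" for f :: "'a \<Rightarrow> real"
  by (simp add: \<nu>_def)

lemma integral_\<nu>: "f \<in> borel_measurable B \<Longrightarrow> (\<integral>x. f x \<partial>\<nu>) = (\<integral>x. w x * f x \<partial>B)" for f :: "'a \<Rightarrow> real"
  unfolding \<nu>_def using w_measurable w_pos by (subst integral_density) (simp_all add: less_imp_le)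

lemma AE_\<nu>: "(AE x in \<nu>. P x) \<longleftrightarrow> (AE x in B. P x)"
  unfolding \<nu>_def using w_measurable w_pos by (subst AE_density) simp_all

lemma finite_\<nu>: "finite_measure \<nu>"
proof
  have "emeasure \<nu> (space \<nu>) = (\<integral>\<^sup>+x. ennreal (w x) \<partial>B)"
    unfolding \<nu>_def using w_measurable
    by (subst emeasure_density) (auto intro!: nn_integral_cong simp: indicator_def)
  also have "\<dots> = ennreal (\<integral>x. w x \<partial>B)"
    using w_integrable w_pos by (intro nn_integral_eq_integral) (simp_all add: less_imp_le)
  finally show "emeasure \<nu> (space \<nu>) \<noteq> \<infinity>" by simp
qed

lemma bounded_L2_\<nu>:
  assumes "f \<in> borel_measurable B" "\<And>x. \<bar>f x\<bar> \<le> C" shows "f \<in> L2 \<nu>"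
proof -
  interpret finite_measure \<nu> by (rule finite_\<nu>)
  have "norm ((f x)\<^sup>2) \<le> C\<^sup>2" for x
    using power_mono[OF assms(2)[of x], where n = 2] by simp
  then have "AE x in \<nu>. norm ((f x)\<^sup>2) \<le> C\<^sup>2" by (intro AE_I2)
  then have "integrable \<nu> (\<lambda>x. (f x)\<^sup>2)"
    using assms(1) by (intro integrable_const_bound) (simp_all add: measurable_\<nu>)
  then show ?thesis using assms(1) by (simp add: L2_def measurable_\<nu>)
qed

lemma test_L2_\<nu>: assumes "test_function \<psi>" shows "\<psi> \<in> L2 \<nu>"
proof -
  obtain C where "\<And>x. \<bar>\<psi> x\<bar> \<le> C"
    using assms supported_bounded[OF test_function_continuous[OF assms]] unfolding test_function_iff by metis
  then show ?thesis by (intro bounded_L2_\<nu>[OF L2_measurable[OF test_function_L2[OF assms]]])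
qed

lemma stable_\<nu>:
  assumes "test_function \<psi>" shows "\<Lambda> * (\<integral>x. (\<psi> x)\<^sup>2 \<partial>\<nu>) \<le> (\<integral>x. (laplacian \<psi> x)\<^sup>2 \<partial>B)"
  using stable[OF assms] L2_measurable[OF test_function_L2[OF assms]] by (simp add: integral_\<nu>)

text \<open>Stability bounds distances in L2 of \<open>\<nu>\<close> by distances of the Laplacians,
  so the sequence has a limit there as well. Since the weight is positive, \<open>\<nu>\<close> and
  \<open>B\<close> have the same null sets, and a common subsequence identifies this limit with
  \<phi>.\<close>

lemma L2_conv_\<nu>:
  assumes \<psi>: "\<And>k. test_function (\<psi> k)" "L2_conv B \<psi> \<phi>" "L2_conv B (\<lambda>k. laplacian (\<psi> k)) f"
  shows "L2_conv \<nu> \<psi> \<phi>"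
proof -
  have "\<exists>g. L2_conv \<nu> \<psi> g"
  proof (rule L2_conv_dominated[OF \<psi>(3)])
    show "\<psi> k \<in> L2 \<nu>" for k by (rule test_L2_\<nu>[OF \<psi>(1)])
    fix m n
    have "\<Lambda> * (\<integral>x. (\<psi> m x - \<psi> n x)\<^sup>2 \<partial>\<nu>) \<le> (\<integral>x. (laplacian (\<psi> m) x - laplacian (\<psi> n) x)\<^sup>2 \<partial>B)"
      using stable_\<nu>[OF test_function_diff[OF \<psi>(1) \<psi>(1)], of m n]
      unfolding laplacian_diff[OF test_function_smooth[OF \<psi>(1)] test_function_smooth[OF \<psi>(1)]] .
    then show "(\<integral>x. (\<psi> m x - \<psi> n x)\<^sup>2 \<partial>\<nu>) \<le> (1 / \<Lambda>) * (\<integral>x. (laplacian (\<psi> m) x - laplacian (\<psi> n) x)\<^sup>2 \<partial>B)"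
      using \<Lambda> by (simp add: pos_le_divide_eq mult.commute)
  qed
  then obtain g where g: "L2_conv \<nu> \<psi> g" ..
  obtain r where r: "strict_mono r" "AE x in \<nu>. (\<lambda>k. \<psi> (r k) x) \<longlonglongrightarrow> g x" by (rule L2_conv_AE_subseq[OF g])
  obtain q where q: "strict_mono q" "AE x in B. (\<lambda>k. \<psi> (r (q k)) x) \<longlonglongrightarrow> \<phi> x"
    by (rule L2_conv_AE_subseq[OF L2_conv_subseq[OF \<psi>(2) r(1)]])
  have "AE x in \<nu>. \<phi> x = g x"
    using r(2) q(2)[folded AE_\<nu>]
  proof eventually_elim
    case (elim x)
    from LIMSEQ_subseq_LIMSEQ[OF elim(1) q(1)] elim(2) show ?case by (simp add: o_def LIMSEQ_unique)
  qed
  moreover have "\<phi> \<in> borel_measurable \<nu>" using L2_measurable[OF L2_convD(2)[OF \<psi>(2)]] by (simp add: measurable_\<nu>)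
  ultimately show ?thesis by (intro L2_conv_cong_AE[OF g])
qed

lemma H20_stable:
  assumes "H20 \<phi> f"
  shows "\<phi> \<in> L2 \<nu>" "\<Lambda> * (\<integral>x. (\<phi> x)\<^sup>2 \<partial>\<nu>) \<le> (\<integral>x. (f x)\<^sup>2 \<partial>B)"
proof -
  obtain \<psi> where \<psi>: "\<And>k. test_function (\<psi> k)" "L2_conv B \<psi> \<phi>" "L2_conv B (\<lambda>k. laplacian (\<psi> k)) f"
    using assms unfolding H20_def by blast
  note c = L2_conv_\<nu>[OF \<psi>]
  show "\<phi> \<in> L2 \<nu>" by (rule L2_convD(2)[OF c])
  show "\<Lambda> * (\<integral>x. (\<phi> x)\<^sup>2 \<partial>\<nu>) \<le> (\<integral>x. (f x)\<^sup>2 \<partial>B)"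
    by (rule LIMSEQ_le[OF tendsto_mult_left[OF L2_conv_sq[OF c]] L2_conv_sq[OF \<psi>(3)]])
       (intro exI allI impI stable_\<nu> \<psi>(1))
qed

text \<open>Extends an equation for test functions to \<phi> by density, so that \<phi> itself may
  be inserted.\<close>

lemma H20_weak_equation:
  assumes \<phi>: "H20 \<phi> f" and g: "g \<in> L2 B" and H: "H \<in> L2 \<nu>"
    and eq: "\<And>\<psi>. test_function \<psi> \<Longrightarrow> (\<integral>x. g x * laplacian \<psi> x \<partial>B) = (\<integral>x. H x * \<psi> x \<partial>\<nu>)"
  shows "(\<integral>x. g x * f x \<partial>B) = (\<integral>x. H x * \<phi> x \<partial>\<nu>)"
proof -
  obtain \<psi> where \<psi>: "\<And>k. test_function (\<psi> k)" "L2_conv B \<psi> \<phi>" "L2_conv B (\<lambda>k. laplacian (\<psi> k)) f"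
    using \<phi> unfolding H20_def by blast
  have "(\<lambda>k. \<integral>x. g x * laplacian (\<psi> k) x \<partial>B) \<longlonglongrightarrow> (\<integral>x. g x * f x \<partial>B)"
    using L2_conv_inner_const[OF \<psi>(3) g] by (simp add: mult.commute)
  moreover have "(\<lambda>k. \<integral>x. H x * \<psi> k x \<partial>\<nu>) \<longlonglongrightarrow> (\<integral>x. H x * \<phi> x \<partial>\<nu>)"
    using L2_conv_inner_const[OF L2_conv_\<nu>[OF \<psi>] H] by (simp add: mult.commute)
  ultimately show ?thesis unfolding eq[OF \<psi>(1)] by (rule LIMSEQ_unique)
qed

text \<open>Its Euler equation is the truncated problem, because \<open>trunc_prim\<close> has
  derivative \<open>exp (- max 0 s)\<close>. The functional is used on test functions only.\<close>

definition energy :: "real \<Rightarrow> ('a \<Rightarrow> real) \<Rightarrow> real" where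
  "energy l \<psi> = (\<integral>x. (laplacian \<psi> x)\<^sup>2 \<partial>B) / 2 - \<Lambda> * (\<integral>x. \<psi> x \<partial>\<nu>) + l * (\<integral>x. trunc_prim (\<psi> x) \<partial>\<nu>)"

lemma test_integrable_\<nu>:
  assumes "test_function \<psi>"
  shows "integrable \<nu> \<psi>" "integrable \<nu> (\<lambda>x. trunc_prim (\<psi> x))"
    "(\<lambda>x. exp (- max 0 (\<psi> x))) \<in> L2 \<nu>"
proof -
  have one: "(\<lambda>x. 1) \<in> L2 \<nu>" by (rule bounded_L2_\<nu>[where C = 1]) simp_all
  note m = L2_measurable[OF test_function_L2[OF assms]]
  show i: "integrable \<nu> \<psi>" using L2_mult[OF test_L2_\<nu>[OF assms] one] by simp
  show "integrable \<nu> (\<lambda>x. trunc_prim (\<psi> x))"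
    by (rule Bochner_Integration.integrable_bound[OF i])
       (use m trunc_prim_abs in \<open>simp_all add: measurable_\<nu>\<close>)
  show "(\<lambda>x. exp (- max 0 (\<psi> x))) \<in> L2 \<nu>"
    by (rule bounded_L2_\<nu>[where C = 1]) (use m in simp_all)
qed

text \<open>The lower-order integrand is at least -2 \<Lambda> |\<psi>| \<ge> - \<Lambda> (\<psi>^2
  / 2 + 2), and by stability half of the Laplacian integral absorbs the quadratic part.\<close>

lemma energy_lower_bound:
  assumes \<psi>: "test_function \<psi>" and l: "0 \<le> l" "l \<le> \<Lambda>"
  shows "energy l \<psi> \<ge> - 2 * \<Lambda> * measure \<nu> (space \<nu>)"
proof -
  interpret finite_measure \<nu> by (rule finite_\<nu>)
  note i = test_integrable_\<nu>[OF \<psi>]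
  have "(\<integral>x. - (\<Lambda> / 2) * (\<psi> x)\<^sup>2 - 2 * \<Lambda> \<partial>\<nu>) \<le> (\<integral>x. - \<Lambda> * \<psi> x + l * trunc_prim (\<psi> x) \<partial>\<nu>)"
  proof (rule integral_mono)
    show "integrable \<nu> (\<lambda>x. - (\<Lambda> / 2) * (\<psi> x)\<^sup>2 - 2 * \<Lambda>)"
      using L2_integrable[OF test_L2_\<nu>[OF \<psi>]] by simp
    show "integrable \<nu> (\<lambda>x. - \<Lambda> * \<psi> x + l * trunc_prim (\<psi> x))" using i by simp
    fix x
    have "l * \<bar>trunc_prim (\<psi> x)\<bar> \<le> \<Lambda> * \<bar>\<psi> x\<bar>"
      using trunc_prim_abs[of "\<psi> x"] l by (intro mult_mono) simp_all
    then have "l * trunc_prim (\<psi> x) \<ge> - (\<Lambda> * \<bar>\<psi> x\<bar>)"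
      using l(1) abs_ge_minus_self[of "l * trunc_prim (\<psi> x)"] by (simp add: abs_mult)
    moreover have "\<Lambda> * \<psi> x \<le> \<Lambda> * \<bar>\<psi> x\<bar>" using \<Lambda> by simp
    moreover have "\<Lambda> * (2 * \<bar>\<psi> x\<bar>) \<le> \<Lambda> * ((\<psi> x)\<^sup>2 / 2 + 2)"
    proof (rule mult_left_mono)
      have "0 \<le> (\<bar>\<psi> x\<bar> - 2)\<^sup>2" by simp
      then show "2 * \<bar>\<psi> x\<bar> \<le> (\<psi> x)\<^sup>2 / 2 + 2" by (simp add: power2_diff)
    qed (use \<Lambda> in simp)
    ultimately show "- (\<Lambda> / 2) * (\<psi> x)\<^sup>2 - 2 * \<Lambda> \<le> - \<Lambda> * \<psi> x + l * trunc_prim (\<psi> x)"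
      by (simp add: algebra_simps)
  qed
  also have "(\<integral>x. - \<Lambda> * \<psi> x + l * trunc_prim (\<psi> x) \<partial>\<nu>) = - \<Lambda> * (\<integral>x. \<psi> x \<partial>\<nu>) + l * (\<integral>x. trunc_prim (\<psi> x) \<partial>\<nu>)"
    using i by simp
  also have "(\<integral>x. - (\<Lambda> / 2) * (\<psi> x)\<^sup>2 - 2 * \<Lambda> \<partial>\<nu>) = - (\<Lambda> / 2) * (\<integral>x. (\<psi> x)\<^sup>2 \<partial>\<nu>) - 2 * \<Lambda> * measure \<nu> (space \<nu>)"
    using L2_integrable[OF test_L2_\<nu>[OF \<psi>]] by simp
  finally show ?thesis using stable_\<nu>[OF \<psi>] unfolding energy_def by simp
qed

text \<open>With D the squared distance of the Laplacians, the parallelogram law gains D / 4, while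
  the concave term loses at most l / 4 times the weighted squared distance of the functions, hence
  at most l D / (4 \<Lambda>) by stability.\<close>

lemma energy_midpoint:
  assumes \<psi>: "test_function \<psi>" and \<xi>: "test_function \<xi>" and l: "0 \<le> l"
  shows "energy l \<psi> + energy l \<xi> - 2 * energy l (\<lambda>x. (1/2) * \<psi> x + (1/2) * \<xi> x)
    \<ge> (1 - l / \<Lambda>) / 4 * (\<integral>x. (laplacian \<psi> x - laplacian \<xi> x)\<^sup>2 \<partial>B)"
proof -
  define \<zeta> where "\<zeta> x = (1/2) * \<psi> x + (1/2) * \<xi> x" for x
  have \<zeta>: "test_function \<zeta>" unfolding \<zeta>_def[abs_def] by (rule test_function_lincomb[OF \<psi> \<xi>])
  note s = test_function_smooth[OF \<psi>] test_function_smooth[OF \<xi>]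
  note L = test_function_laplacian_L2[OF \<psi>] test_function_laplacian_L2[OF \<xi>]
  note i = test_integrable_\<nu>[OF \<psi>] test_integrable_\<nu>[OF \<xi>] test_integrable_\<nu>[OF \<zeta>]
  define D where "D = (\<integral>x. (laplacian \<psi> x - laplacian \<xi> x)\<^sup>2 \<partial>B)"
  have lap: "laplacian \<zeta> = (\<lambda>x. (1/2) * laplacian \<psi> x + (1/2) * laplacian \<xi> x)"
    unfolding \<zeta>_def[abs_def] by (rule laplacian_lincomb[OF s])
  have par: "(\<integral>x. (laplacian \<psi> x)\<^sup>2 \<partial>B) / 2 + (\<integral>x. (laplacian \<xi> x)\<^sup>2 \<partial>B) / 2 - (\<integral>x. (laplacian \<zeta> x)\<^sup>2 \<partial>B) = D / 4"
  proof -
    have "(\<integral>x. (laplacian \<zeta> x)\<^sup>2 \<partial>B) = (\<integral>x. (laplacian \<psi> x + 1 * laplacian \<xi> x)\<^sup>2 / 4 \<partial>B)"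
      unfolding lap by (intro Bochner_Integration.integral_cong refl) (simp add: power2_eq_square field_simps)
    also have "\<dots> = (\<integral>x. (laplacian \<psi> x + 1 * laplacian \<xi> x)\<^sup>2 \<partial>B) / 4" by simp
    finally show ?thesis
      using L2_sq_add[OF L, of 1] L2_sq_add[OF L, of "-1"] by (simp add: D_def)
  qed
  have lin: "\<Lambda> * (\<integral>x. \<zeta> x \<partial>\<nu>) = (\<Lambda> * (\<integral>x. \<psi> x \<partial>\<nu>) + \<Lambda> * (\<integral>x. \<xi> x \<partial>\<nu>)) / 2"
    unfolding \<zeta>_def using i by (simp add: distrib_left)
  have "(\<integral>x. - (1/4) * (\<psi> x - \<xi> x)\<^sup>2 \<partial>\<nu>) \<le> (\<integral>x. trunc_prim (\<psi> x) + trunc_prim (\<xi> x) - 2 * trunc_prim (\<zeta> x) \<partial>\<nu>)"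
  proof (rule integral_mono)
    show "integrable \<nu> (\<lambda>x. - (1/4) * (\<psi> x - \<xi> x)\<^sup>2)"
      by (intro integrable_mult_right L2_integrable L2_diff test_L2_\<nu> \<psi> \<xi>)
    show "integrable \<nu> (\<lambda>x. trunc_prim (\<psi> x) + trunc_prim (\<xi> x) - 2 * trunc_prim (\<zeta> x))" using i by simp
    show "- (1/4) * (\<psi> x - \<xi> x)\<^sup>2 \<le> trunc_prim (\<psi> x) + trunc_prim (\<xi> x) - 2 * trunc_prim (\<zeta> x)" for x
      using trunc_prim_midpoint[of "\<psi> x" "\<xi> x"] by (simp add: \<zeta>_def add_divide_distrib)
  qed
  then have "- (1/4) * (\<integral>x. (\<psi> x - \<xi> x)\<^sup>2 \<partial>\<nu>)
      \<le> (\<integral>x. trunc_prim (\<psi> x) \<partial>\<nu>) + (\<integral>x. trunc_prim (\<xi> x) \<partial>\<nu>) - 2 * (\<integral>x. trunc_prim (\<zeta> x) \<partial>\<nu>)"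
    using i by simp
  moreover have "(\<integral>x. (\<psi> x - \<xi> x)\<^sup>2 \<partial>\<nu>) \<le> D / \<Lambda>"
    using stable_\<nu>[OF test_function_diff[OF \<psi> \<xi>]] \<Lambda>
    unfolding laplacian_diff[OF s] D_def[symmetric] by (simp add: pos_le_divide_eq mult.commute)
  ultimately have "- (D / \<Lambda>) / 4
      \<le> (\<integral>x. trunc_prim (\<psi> x) \<partial>\<nu>) + (\<integral>x. trunc_prim (\<xi> x) \<partial>\<nu>) - 2 * (\<integral>x. trunc_prim (\<zeta> x) \<partial>\<nu>)"
    by (auto intro: order_trans[rotated])
  from mult_left_mono[OF this l]
  have "- (l / \<Lambda> * D) / 4
      \<le> l * (\<integral>x. trunc_prim (\<psi> x) \<partial>\<nu>) + l * (\<integral>x. trunc_prim (\<xi> x) \<partial>\<nu>) - 2 * (l * (\<integral>x. trunc_prim (\<zeta> x) \<partial>\<nu>))"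
    by (simp add: algebra_simps)
  moreover have "x1 / 2 - p1 + s1 + (x2 / 2 - p2 + s2) - 2 * (x3 / 2 - (p1 + p2) / 2 + s3) \<ge> D / 4 - y / 4"
    if "- y / 4 \<le> s1 + s2 - 2 * s3" "x1 / 2 + x2 / 2 - x3 = D / 4" for x1 x2 x3 p1 p2 s1 s2 s3 y :: real
    using that by (simp add: field_simps)
  ultimately have "energy l \<psi> + energy l \<xi> - 2 * energy l \<zeta> \<ge> D / 4 - (l / \<Lambda> * D) / 4"
    using par unfolding energy_def lin by blast
  also have "D / 4 - (l / \<Lambda> * D) / 4 = (1 - l / \<Lambda>) / 4 * D" by (simp add: left_diff_distrib diff_divide_distrib)
  finally show ?thesis by (simp add: D_def \<zeta>_def[abs_def])
qed

text \<open>An upper bound for every real \<open>t\<close> suffices: against the infimum of the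
  energy it confines the linear coefficient through \<open>quadratic_nonneg_imp\<close>.\<close>

lemma energy_variation:
  assumes \<psi>: "test_function \<psi>" and \<eta>: "test_function \<eta>" and l: "0 \<le> l"
  shows "energy l (\<lambda>x. 1 * \<psi> x + t * \<eta> x) \<le> energy l \<psi>
    + t * ((\<integral>x. laplacian \<psi> x * laplacian \<eta> x \<partial>B) - (\<integral>x. (\<Lambda> - l * exp (- max 0 (\<psi> x))) * \<eta> x \<partial>\<nu>))
    + t\<^sup>2 * ((\<integral>x. (laplacian \<eta> x)\<^sup>2 \<partial>B) / 2)"
proof -
  define \<zeta> where "\<zeta> x = 1 * \<psi> x + t * \<eta> x" for x
  have \<zeta>: "test_function \<zeta>" unfolding \<zeta>_def[abs_def] by (rule test_function_lincomb[OF \<psi> \<eta>])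
  note s = test_function_smooth[OF \<psi>] test_function_smooth[OF \<eta>]
  note L = test_function_laplacian_L2[OF \<psi>] test_function_laplacian_L2[OF \<eta>]
  note i = test_integrable_\<nu>[OF \<psi>] test_integrable_\<nu>[OF \<eta>] test_integrable_\<nu>[OF \<zeta>]
  have lap: "laplacian \<zeta> = (\<lambda>x. 1 * laplacian \<psi> x + t * laplacian \<eta> x)"
    unfolding \<zeta>_def[abs_def] by (rule laplacian_lincomb[OF s])
  have quad: "(\<integral>x. (laplacian \<zeta> x)\<^sup>2 \<partial>B) = (\<integral>x. (laplacian \<psi> x)\<^sup>2 \<partial>B)
      + 2 * t * (\<integral>x. laplacian \<psi> x * laplacian \<eta> x \<partial>B) + t\<^sup>2 * (\<integral>x. (laplacian \<eta> x)\<^sup>2 \<partial>B)"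
    unfolding lap using L2_sq_add[OF L, of t] by simp
  have lin: "(\<integral>x. \<zeta> x \<partial>\<nu>) = (\<integral>x. \<psi> x \<partial>\<nu>) + t * (\<integral>x. \<eta> x \<partial>\<nu>)"
    unfolding \<zeta>_def using i by simp
  have e: "integrable \<nu> (\<lambda>x. exp (- max 0 (\<psi> x)) * \<eta> x)" by (intro L2_mult i test_L2_\<nu> \<eta>)
  have "(\<integral>x. trunc_prim (\<zeta> x) \<partial>\<nu>) \<le> (\<integral>x. trunc_prim (\<psi> x) + t * (exp (- max 0 (\<psi> x)) * \<eta> x) \<partial>\<nu>)"
  proof (rule integral_mono)
    show "integrable \<nu> (\<lambda>x. trunc_prim (\<psi> x) + t * (exp (- max 0 (\<psi> x)) * \<eta> x))" using i e by simp
    show "trunc_prim (\<zeta> x) \<le> trunc_prim (\<psi> x) + t * (exp (- max 0 (\<psi> x)) * \<eta> x)" for x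
      using trunc_prim_above[of "\<psi> x" "t * \<eta> x"] by (simp add: \<zeta>_def mult_ac)
  qed (use i in simp)
  also have "\<dots> = (\<integral>x. trunc_prim (\<psi> x) \<partial>\<nu>) + t * (\<integral>x. exp (- max 0 (\<psi> x)) * \<eta> x \<partial>\<nu>)" using i e by simp
  finally have con: "l * (\<integral>x. trunc_prim (\<zeta> x) \<partial>\<nu>)
      \<le> l * ((\<integral>x. trunc_prim (\<psi> x) \<partial>\<nu>) + t * (\<integral>x. exp (- max 0 (\<psi> x)) * \<eta> x \<partial>\<nu>))"
    by (rule mult_left_mono[OF _ l])
  have split: "(\<integral>x. (\<Lambda> - l * exp (- max 0 (\<psi> x))) * \<eta> x \<partial>\<nu>) = \<Lambda> * (\<integral>x. \<eta> x \<partial>\<nu>) - l * (\<integral>x. exp (- max 0 (\<psi> x)) * \<eta> x \<partial>\<nu>)"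
    using i e by (simp add: left_diff_distrib mult.assoc)
  have "energy l \<zeta> \<le> energy l \<psi>
    + t * ((\<integral>x. laplacian \<psi> x * laplacian \<eta> x \<partial>B) - (\<integral>x. (\<Lambda> - l * exp (- max 0 (\<psi> x))) * \<eta> x \<partial>\<nu>))
    + t\<^sup>2 * ((\<integral>x. (laplacian \<eta> x)\<^sup>2 \<partial>B) / 2)"
    using con unfolding energy_def quad lin split by (simp add: algebra_simps add_divide_distrib)
  then show ?thesis unfolding \<zeta>_def[abs_def] .
qed

lemma zero_test_function: "test_function (\<lambda>x::'a. 0)"
  by (rule test_functionI[where r = 0]) (simp_all add: smooth_const supported_def)

text \<open>The midpoint estimate makes the Laplacians of a minimising sequence Cauchy. The Euler
  equation is not derived at the limit: it holds for the members of the sequence up to an error that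
  vanishes, and each of its terms converges.\<close>

theorem truncated_problem:
  assumes l: "0 \<le> l" "l < \<Lambda>"
  obtains \<phi> f where "H20 \<phi> f"
    "\<And>\<eta>. test_function \<eta> \<Longrightarrow> (\<integral>x. f x * laplacian \<eta> x \<partial>B) = (\<integral>x. (\<Lambda> - l * exp (- max 0 (\<phi> x))) * \<eta> x \<partial>\<nu>)"
proof -
  define J where "J = energy l ` {\<psi>. test_function \<psi>}"
  have bdd: "bdd_below J"
    unfolding J_def using energy_lower_bound l by (intro bdd_belowI2[where m = "- 2 * \<Lambda> * measure \<nu> (space \<nu>)"]) simp
  have ne: "J \<noteq> {}" unfolding J_def using zero_test_function by blast
  define I where "I = Inf J"
  have I: "I \<le> energy l \<psi>" if "test_function \<psi>" for \<psi>
    unfolding I_def J_def by (rule cInf_lower[OF _ bdd[unfolded J_def]]) (use that in blast)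
  have "\<exists>\<psi>. test_function \<psi> \<and> energy l \<psi> < I + inverse (real (Suc k))" for k
  proof -
    have "\<exists>y\<in>J. y < I + inverse (real (Suc k))"
      using cInf_lessD[OF ne, of "I + inverse (real (Suc k))"] by (simp add: I_def)
    then show ?thesis unfolding J_def by blast
  qed
  then obtain \<psi> where \<psi>: "\<And>k. test_function (\<psi> k)" "\<And>k. energy l (\<psi> k) < I + inverse (real (Suc k))" by metis
  define e where "e k = inverse (real (Suc k))" for k
  have e0: "e \<longlonglongrightarrow> 0" unfolding e_def[abs_def] by (rule LIMSEQ_inverse_real_of_nat)
  have epos: "e k > 0" for k by (simp add: e_def)
  define c where "c = (1 - l / \<Lambda>) / 4"
  have c: "c > 0" using l \<Lambda> by (simp add: c_def)
  \<comment> \<open>The midpoint competitor has energy at least \<open>I\<close>, the two given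
    functions less than \<open>I + e m\<close> and \<open>I + e n\<close>.\<close>
  have D: "c * (\<integral>x. (laplacian (\<psi> m) x - laplacian (\<psi> n) x)\<^sup>2 \<partial>B) \<le> e m + e n" for m n
    using energy_midpoint[OF \<psi>(1)[of m] \<psi>(1)[of n] l(1)] I[OF test_function_lincomb[OF \<psi>(1)[of m] \<psi>(1)[of n], of "1/2" "1/2"]]
      \<psi>(2)[of m] \<psi>(2)[of n] unfolding c_def[symmetric] e_def by linarith
  have "\<exists>f. L2_conv B (\<lambda>k. laplacian (\<psi> k)) f"
  proof (rule L2_complete)
    show "laplacian (\<psi> k) \<in> L2 B" for k by (rule test_function_laplacian_L2[OF \<psi>(1)])
    fix d :: real assume d: "d > 0"
    have "\<forall>\<^sub>F k in sequentially. e k < c * d / 2" using c d by (intro order_tendstoD(2)[OF e0]) simp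
    then obtain K where K: "\<And>k. k \<ge> K \<Longrightarrow> e k < c * d / 2" by (auto simp: eventually_sequentially)
    have "(\<integral>x. (laplacian (\<psi> m) x - laplacian (\<psi> n) x)\<^sup>2 \<partial>B) < d" if "m \<ge> K" "n \<ge> K" for m n
    proof -
      have "c * (\<integral>x. (laplacian (\<psi> m) x - laplacian (\<psi> n) x)\<^sup>2 \<partial>B) < c * d"
        using D[of m n] K[OF that(1)] K[OF that(2)] by linarith
      then show ?thesis using c by simp
    qed
    then show "\<exists>N. \<forall>m\<ge>N. \<forall>n\<ge>N. (\<integral>x. (laplacian (\<psi> m) x - laplacian (\<psi> n) x)\<^sup>2 \<partial>B) < d" by blast
  qed
  then obtain f where f: "L2_conv B (\<lambda>k. laplacian (\<psi> k)) f" ..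
  have "\<exists>\<phi>. L2_conv B \<psi> \<phi>"
  proof (rule L2_conv_dominated[OF f])
    show "\<psi> k \<in> L2 B" for k by (rule test_function_L2[OF \<psi>(1)])
    show "(\<integral>x. (\<psi> m x - \<psi> n x)\<^sup>2 \<partial>B) \<le> 16 * (\<integral>x. (laplacian (\<psi> m) x - laplacian (\<psi> n) x)\<^sup>2 \<partial>B)" for m n
      using gradient_laplacian_bound(1)[OF test_function_diff[OF \<psi>(1)[of m] \<psi>(1)[of n]]]
      unfolding laplacian_diff[OF test_function_smooth[OF \<psi>(1)] test_function_smooth[OF \<psi>(1)]] .
  qed
  then obtain \<phi> where \<phi>: "L2_conv B \<psi> \<phi>" ..
  have H: "H20 \<phi> f" unfolding H20_def using \<psi>(1) \<phi> f by blast
  note \<nu>c = L2_conv_\<nu>[OF \<psi>(1) \<phi> f]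
  have E: "L2_conv \<nu> (\<lambda>k x. exp (- max 0 (\<psi> k x))) (\<lambda>x. exp (- max 0 (\<phi> x)))"
  proof (rule L2_conv_bound[OF _ _ _ L2_convD(3)[OF \<nu>c]])
    show 1: "(\<lambda>x. exp (- max 0 (\<psi> k x))) \<in> L2 \<nu>" for k by (rule test_integrable_\<nu>(3)[OF \<psi>(1)])
    show 2: "(\<lambda>x. exp (- max 0 (\<phi> x))) \<in> L2 \<nu>"
      by (rule bounded_L2_\<nu>[where C = 1]) (use L2_measurable[OF L2_convD(2)[OF \<phi>]] in simp_all)
    show "(\<integral>x. (exp (- max 0 (\<psi> k x)) - exp (- max 0 (\<phi> x)))\<^sup>2 \<partial>\<nu>) \<le> (\<integral>x. (\<psi> k x - \<phi> x)\<^sup>2 \<partial>\<nu>)" for k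
    proof (rule integral_mono)
      show "integrable \<nu> (\<lambda>x. (exp (- max 0 (\<psi> k x)) - exp (- max 0 (\<phi> x)))\<^sup>2)"
        by (rule L2_integrable[OF L2_diff[OF 1 2]])
      show "integrable \<nu> (\<lambda>x. (\<psi> k x - \<phi> x)\<^sup>2)"
        by (rule L2_integrable[OF L2_diff[OF L2_convD(1)[OF \<nu>c] L2_convD(2)[OF \<nu>c]]])
      show "(exp (- max 0 (\<psi> k x)) - exp (- max 0 (\<phi> x)))\<^sup>2 \<le> (\<psi> k x - \<phi> x)\<^sup>2" for x
        using exp_minus_max_lipschitz[of "\<psi> k x" "\<phi> x"] by (simp add: abs_le_square_iff)
    qed
  qed
  have one: "L2_conv \<nu> (\<lambda>k x. 1) (\<lambda>x. 1)"
    by (rule L2_conv_const) (rule bounded_L2_\<nu>[where C = 1], simp_all)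
  have "(\<integral>x. f x * laplacian \<eta> x \<partial>B) = (\<integral>x. (\<Lambda> - l * exp (- max 0 (\<phi> x))) * \<eta> x \<partial>\<nu>)" if \<eta>: "test_function \<eta>" for \<eta>
  proof -
    define d where "d k = (\<integral>x. laplacian (\<psi> k) x * laplacian \<eta> x \<partial>B) - (\<integral>x. (\<Lambda> - l * exp (- max 0 (\<psi> k x))) * \<eta> x \<partial>\<nu>)" for k
    define Q where "Q = (\<integral>x. (laplacian \<eta> x)\<^sup>2 \<partial>B) / 2"
    have Q: "Q \<ge> 0" by (simp add: Q_def)
    \<comment> \<open>Perturbing by \<open>t * \<eta>\<close> cannot lower the energy by more than
      the gap \<open>e k\<close>, so a quadratic polynomial in \<open>t\<close> is nonnegative; its
      discriminant bounds the first variation \<open>d k\<close>.\<close>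
    have le: "(d k / 2)\<^sup>2 \<le> e k * Q" for k
    proof (rule quadratic_nonneg_imp[OF _ Q])
      fix t :: real
      have "I \<le> energy l (\<lambda>x. 1 * \<psi> k x + t * \<eta> x)" by (rule I[OF test_function_lincomb[OF \<psi>(1) \<eta>]])
      also have "\<dots> \<le> energy l (\<psi> k) + t * d k + t\<^sup>2 * Q"
        unfolding d_def Q_def by (rule energy_variation[OF \<psi>(1) \<eta> l(1)])
      finally show "0 \<le> e k + 2 * t * (d k / 2) + t\<^sup>2 * Q" using \<psi>(2)[of k] by (simp add: e_def)
    qed
    have lim: "(\<lambda>k. e k * Q) \<longlonglongrightarrow> 0" using tendsto_mult_right[OF e0, of Q] by simp
    have "(\<lambda>k. (d k / 2)\<^sup>2) \<longlonglongrightarrow> 0"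
    proof (rule tendsto_sandwich[OF _ _ tendsto_const lim])
      show "\<forall>\<^sub>F k in sequentially. 0 \<le> (d k / 2)\<^sup>2" by (rule always_eventually) simp
      show "\<forall>\<^sub>F k in sequentially. (d k / 2)\<^sup>2 \<le> e k * Q" by (intro always_eventually allI le)
    qed
    from tendsto_real_sqrt[OF this] have "(\<lambda>k. \<bar>d k\<bar> / 2) \<longlonglongrightarrow> 0" by simp
    from tendsto_mult_left[OF this, of 2] have d0: "d \<longlonglongrightarrow> 0" by (simp add: tendsto_rabs_zero_iff)
    have "L2_conv \<nu> (\<lambda>k x. \<Lambda> * 1 + (- l) * exp (- max 0 (\<psi> k x))) (\<lambda>x. \<Lambda> * 1 + (- l) * exp (- max 0 (\<phi> x)))"
      by (rule L2_conv_lincomb[OF one E])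
    then have "L2_conv \<nu> (\<lambda>k x. \<Lambda> - l * exp (- max 0 (\<psi> k x))) (\<lambda>x. \<Lambda> - l * exp (- max 0 (\<phi> x)))" by simp
    then have "d \<longlonglongrightarrow> (\<integral>x. f x * laplacian \<eta> x \<partial>B) - (\<integral>x. (\<Lambda> - l * exp (- max 0 (\<phi> x))) * \<eta> x \<partial>\<nu>)"
      unfolding d_def by (intro tendsto_diff L2_conv_inner_const f test_function_laplacian_L2 test_L2_\<nu> \<eta>)
    with d0 have "(\<integral>x. f x * laplacian \<eta> x \<partial>B) - (\<integral>x. (\<Lambda> - l * exp (- max 0 (\<phi> x))) * \<eta> x \<partial>\<nu>) = 0"
      using LIMSEQ_unique by blast
    then show ?thesis by simp
  qed
  with H show thesis by (rule that)
qed

end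

section \<open>Comparison of weak solutions\<close>

lemma stable_weight_exp:
  fixes u :: "'a::euclidean_space \<Rightarrow> real"
  assumes "weak_solution a b lam u" "stable_solution lam u" "lam > 0"
  shows "stable_weight (\<lambda>x. exp (u x)) lam"
proof
  show "integrable (lebesgue_on unit_ball) (\<lambda>x. exp (u x))" by (rule weak_solutionD(2)[OF assms(1)])
qed (use assms in \<open>simp_all add: stable_solution_def\<close>)

text \<open>The solution at the smaller parameter is \<open>u - \<phi>\<close>, where \<open>\<phi>\<close> solves the truncated problem;
  Boggio's principle gives \<open>\<phi> \<ge> 0\<close>, so that the truncation is not felt.\<close>

lemma weak_solution_below:
  fixes u :: "'a::euclidean_space \<Rightarrow> real"
  assumes u: "weak_solution a b lam u" and st: "stable_solution lam u" and l: "0 \<le> l" "l < lam"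
  obtains v where "weak_solution a b l v" "AE x in lebesgue_on unit_ball. v x \<le> u x"
proof -
  let ?M = "lebesgue_on (unit_ball :: 'a set)"
  have lam: "lam > 0" using l by simp
  interpret stable_weight "\<lambda>x. exp (u x)" lam by (rule stable_weight_exp[OF u st lam])
  obtain \<phi> f where \<phi>: "H20 \<phi> f"
    and eq: "\<And>\<eta>. test_function \<eta> \<Longrightarrow> (\<integral>x. f x * laplacian \<eta> x \<partial>?M) = (\<integral>x. (lam - l * exp (- max 0 (\<phi> x))) * \<eta> x \<partial>\<nu>)"
    using truncated_problem[OF l] by blast
  have \<phi>m: "\<phi> \<in> borel_measurable ?M" by (rule L2_measurable[OF H20D(1)[OF \<phi>]])
  \<comment> \<open>This holds for every real \<open>s\<close>, so the sign of \<phi> is not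
    presupposed when Boggio's principle is applied.\<close>
  have pos: "0 \<le> lam - l * exp (- max 0 s)" for s
    using mult_left_le[of "exp (- max 0 s)" l] l by simp
  have "nonneg_biharmonic f"
    unfolding nonneg_biharmonic_def
  proof (intro allI impI)
    fix \<psi> :: "'a \<Rightarrow> real" assume \<psi>: "test_function \<psi> \<and> (\<forall>x. 0 \<le> \<psi> x)"
    show "0 \<le> (\<integral>x. f x * laplacian \<psi> x \<partial>?M)"
      unfolding eq[OF conjunct1[OF \<psi>]] using \<psi> pos by (intro integral_nonneg_AE AE_I2) simp
  qed
  then have \<phi>0: "AE x in ?M. \<phi> x \<ge> 0" by (rule boggio[OF \<phi>])
  have um: "u \<in> borel_measurable ?M" by (rule L2_measurable[OF H2D(3)[OF weak_solutionD(1)[OF u]]])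
  have int: "integrable ?M (\<lambda>x. exp (u x - \<phi> x))"
    by (rule Bochner_Integration.integrable_bound[OF weak_solutionD(2)[OF u]])
       (use \<phi>0 um \<phi>m in \<open>simp_all\<close>)
  have "weak_solution a b l (\<lambda>x. u x - \<phi> x)"
  proof (rule weak_solution_perturb[OF u \<phi> int])
    fix \<psi> :: "'a \<Rightarrow> real" assume \<psi>: "test_function \<psi>"
    note \<psi>m = L2_measurable[OF test_function_L2[OF \<psi>]]
    have lap: "laplacian \<psi> \<in> L2 ?M" by (rule test_function_laplacian_L2[OF \<psi>])
    have i1: "integrable \<nu> \<psi>" by (rule test_integrable_\<nu>(1)[OF \<psi>])
    have "(\<lambda>x. exp (- max 0 (\<phi> x))) \<in> L2 \<nu>" by (rule bounded_L2_\<nu>[where C = 1]) (use \<phi>m in simp_all)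
    then have i2: "integrable \<nu> (\<lambda>x. exp (- max 0 (\<phi> x)) * \<psi> x)" by (rule L2_mult[OF _ test_L2_\<nu>[OF \<psi>]])
    have "(\<integral>x. (weak_laplacian u x - f x) * laplacian \<psi> x \<partial>?M)
      = (\<integral>x. weak_laplacian u x * laplacian \<psi> x \<partial>?M) - (\<integral>x. f x * laplacian \<psi> x \<partial>?M)"
      using L2_mult[OF H2D(6)[OF weak_solutionD(1)[OF u]] lap] L2_mult[OF H20D(2)[OF \<phi>] lap]
      by (simp add: left_diff_distrib)
    also have "(\<integral>x. weak_laplacian u x * laplacian \<psi> x \<partial>?M) = lam * (\<integral>x. \<psi> x \<partial>\<nu>)"
      unfolding weak_solutionD(5)[OF u \<psi>] integral_\<nu>[OF \<psi>m] ..
    also have "(\<integral>x. f x * laplacian \<psi> x \<partial>?M) = lam * (\<integral>x. \<psi> x \<partial>\<nu>) - l * (\<integral>x. exp (- max 0 (\<phi> x)) * \<psi> x \<partial>\<nu>)"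
      unfolding eq[OF \<psi>] using i1 i2 by (simp add: left_diff_distrib mult.assoc)
    also have "(\<integral>x. exp (- max 0 (\<phi> x)) * \<psi> x \<partial>\<nu>) = (\<integral>x. exp (u x) * (exp (- max 0 (\<phi> x)) * \<psi> x) \<partial>?M)"
      by (rule integral_\<nu>) (use \<phi>m \<psi>m in simp)
    also have "\<dots> = (\<integral>x. exp (u x - \<phi> x) * \<psi> x \<partial>?M)"
    proof (rule integral_cong_AE)
      show "AE x in ?M. exp (u x) * (exp (- max 0 (\<phi> x)) * \<psi> x) = exp (u x - \<phi> x) * \<psi> x"
        using \<phi>0 by eventually_elim (simp add: exp_diff exp_minus divide_inverse max_def)
    qed (use um \<phi>m \<psi>m in simp_all)
    finally show "(\<integral>x. (weak_laplacian u x - f x) * laplacian \<psi> x \<partial>?M) = l * (\<integral>x. exp (u x - \<phi> x) * \<psi> x \<partial>?M)" by simp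
  qed
  moreover have "AE x in ?M. u x - \<phi> x \<le> u x" using \<phi>0 by eventually_elim simp
  ultimately show thesis by (rule that)
qed

text \<open>With \<open>\<phi> = u - s \<ge> 0\<close> the difference of the equations tested with \<open>\<phi>\<close> and the stability
  inequality leave \<open>\<integral> e\<^sup>u \<phi> (\<phi> - 1 + e\<^sup>-\<^sup>\<phi>) \<le> 0\<close>, whose integrand vanishes only at \<open>\<phi> = 0\<close>.\<close>

lemma stable_solution_unique:
  fixes u s :: "'a::euclidean_space \<Rightarrow> real"
  assumes u: "weak_solution a b lam u" and st: "stable_solution lam u" and lam: "lam > 0"
    and s: "weak_solution a b lam s" and le: "AE x in lebesgue_on unit_ball. s x \<le> u x"
  shows "AE x in lebesgue_on unit_ball. u x = s x"
proof -
  let ?M = "lebesgue_on (unit_ball :: 'a set)"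
  interpret stable_weight "\<lambda>x. exp (u x)" lam by (rule stable_weight_exp[OF u st lam])
  define \<phi> where "\<phi> x = u x - s x" for x
  define f where "f x = weak_laplacian u x - weak_laplacian s x" for x
  \<comment> \<open>The maximum keeps \<open>H\<close> bounded at every point, hence in L2 of
    \<open>\<nu>\<close>, although \<phi> \<ge> 0 is known only almost everywhere.\<close>
  define H where "H x = lam * (1 - exp (- max 0 (\<phi> x)))" for x
  have \<phi>: "H20 \<phi> f" unfolding \<phi>_def[abs_def] f_def[abs_def] by (rule H20_weak_solution_diff[OF u s])
  have \<phi>m: "\<phi> \<in> borel_measurable ?M" by (rule L2_measurable[OF H20D(1)[OF \<phi>]])
  have \<phi>0: "AE x in ?M. \<phi> x \<ge> 0" using le unfolding \<phi>_def by eventually_elim simp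
  have um: "u \<in> borel_measurable ?M" by (rule L2_measurable[OF H2D(3)[OF weak_solutionD(1)[OF u]]])
  have sm: "s \<in> borel_measurable ?M" by (rule L2_measurable[OF H2D(3)[OF weak_solutionD(1)[OF s]]])
  have EL: "(\<lambda>x. exp (- max 0 (\<phi> x))) \<in> L2 \<nu>" by (rule bounded_L2_\<nu>[where C = 1]) (use \<phi>m in simp_all)
  have HL: "H \<in> L2 \<nu>"
  proof (rule bounded_L2_\<nu>)
    show "H \<in> borel_measurable ?M" unfolding H_def[abs_def] using \<phi>m by simp
    show "\<bar>H x\<bar> \<le> lam" for x unfolding H_def using lam by (simp add: abs_mult)
  qed
  have eq: "(\<integral>x. f x * laplacian \<psi> x \<partial>?M) = (\<integral>x. H x * \<psi> x \<partial>\<nu>)" if \<psi>: "test_function \<psi>" for \<psi>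
  proof -
    note \<psi>m = L2_measurable[OF test_function_L2[OF \<psi>]]
    have lap: "laplacian \<psi> \<in> L2 ?M" by (rule test_function_laplacian_L2[OF \<psi>])
    have i1: "integrable \<nu> \<psi>" by (rule test_integrable_\<nu>(1)[OF \<psi>])
    have i2: "integrable \<nu> (\<lambda>x. exp (- max 0 (\<phi> x)) * \<psi> x)" by (rule L2_mult[OF EL test_L2_\<nu>[OF \<psi>]])
    have "(\<integral>x. exp (s x) * \<psi> x \<partial>?M) = (\<integral>x. exp (u x) * (exp (- max 0 (\<phi> x)) * \<psi> x) \<partial>?M)"
    proof (rule integral_cong_AE)
      show "AE x in ?M. exp (s x) * \<psi> x = exp (u x) * (exp (- max 0 (\<phi> x)) * \<psi> x)"
        using \<phi>0 by eventually_elim (simp add: \<phi>_def max_def exp_diff exp_minus)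
    qed (use um sm \<phi>m \<psi>m in simp_all)
    also have "\<dots> = (\<integral>x. exp (- max 0 (\<phi> x)) * \<psi> x \<partial>\<nu>)"
      by (rule integral_\<nu>[symmetric]) (use \<phi>m \<psi>m in simp)
    finally have "(\<integral>x. weak_laplacian s x * laplacian \<psi> x \<partial>?M) = lam * (\<integral>x. exp (- max 0 (\<phi> x)) * \<psi> x \<partial>\<nu>)"
      unfolding weak_solutionD(5)[OF s \<psi>] by simp
    moreover have "(\<integral>x. weak_laplacian u x * laplacian \<psi> x \<partial>?M) = lam * (\<integral>x. \<psi> x \<partial>\<nu>)"
      unfolding weak_solutionD(5)[OF u \<psi>] integral_\<nu>[OF \<psi>m] ..
    moreover have "(\<integral>x. f x * laplacian \<psi> x \<partial>?M)
      = (\<integral>x. weak_laplacian u x * laplacian \<psi> x \<partial>?M) - (\<integral>x. weak_laplacian s x * laplacian \<psi> x \<partial>?M)"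
      using L2_mult[OF H2D(6)[OF weak_solutionD(1)[OF u]] lap] L2_mult[OF H2D(6)[OF weak_solutionD(1)[OF s]] lap]
      by (simp add: f_def left_diff_distrib)
    moreover have "(\<integral>x. H x * \<psi> x \<partial>\<nu>) = lam * (\<integral>x. \<psi> x \<partial>\<nu>) - lam * (\<integral>x. exp (- max 0 (\<phi> x)) * \<psi> x \<partial>\<nu>)"
      unfolding H_def using i1 i2 by (simp add: left_diff_distrib right_diff_distrib mult.assoc)
    ultimately show ?thesis by simp
  qed
  have \<phi>\<nu>: "\<phi> \<in> L2 \<nu>" by (rule H20_stable(1)[OF \<phi>])
  have "(\<integral>x. (f x)\<^sup>2 \<partial>?M) = (\<integral>x. H x * \<phi> x \<partial>\<nu>)"
    using H20_weak_equation[OF \<phi> H20D(2)[OF \<phi>] HL eq] by (simp add: power2_eq_square)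
  with H20_stable(2)[OF \<phi>] have "lam * (\<integral>x. (\<phi> x)\<^sup>2 \<partial>\<nu>) \<le> (\<integral>x. H x * \<phi> x \<partial>\<nu>)" by simp
  then have int_le: "(\<integral>x. lam * (\<phi> x)\<^sup>2 - H x * \<phi> x \<partial>\<nu>) \<le> 0"
    using L2_integrable[OF \<phi>\<nu>] L2_mult[OF HL \<phi>\<nu>] by simp
  have nn: "0 \<le> t * t - (1 - exp (- t)) * t" if "t \<ge> 0" for t :: real
    using mult_right_mono[OF one_minus_exp_minus_bounds(1)[OF that] that] by simp
  have zero: "t = 0" if "t \<ge> 0" "t * t - (1 - exp (- t)) * t = 0" for t :: real
  proof (rule ccontr)
    assume "t \<noteq> 0"
    moreover have "t * (t - (1 - exp (- t))) = 0" using that(2) by (simp add: algebra_simps)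
    \<comment> \<open>With y = exp (-t) this reads ln y = y - 1, whose only solution is y =
      1.\<close>
    ultimately have "1 + (- t) = exp (- t)" by simp
    then show False using ln_eq_minus_one[of "exp (- t)"] \<open>t \<noteq> 0\<close> by simp
  qed
  have split: "lam * (\<phi> x)\<^sup>2 - H x * \<phi> x = lam * (\<phi> x * \<phi> x - (1 - exp (- \<phi> x)) * \<phi> x)" if "\<phi> x \<ge> 0" for x
    using that by (simp add: H_def max_def power2_eq_square right_diff_distrib mult.assoc)
  have AE0: "AE x in \<nu>. 0 \<le> lam * (\<phi> x)\<^sup>2 - H x * \<phi> x"
    unfolding AE_\<nu> using \<phi>0 by eventually_elim (use lam nn split in simp)
  moreover have "(\<integral>x. lam * (\<phi> x)\<^sup>2 - H x * \<phi> x \<partial>\<nu>) = 0"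
    using int_le integral_nonneg_AE[OF AE0] by simp
  moreover have "integrable \<nu> (\<lambda>x. lam * (\<phi> x)\<^sup>2 - H x * \<phi> x)"
    using L2_integrable[OF \<phi>\<nu>] L2_mult[OF HL \<phi>\<nu>] by simp
  ultimately have "AE x in \<nu>. lam * (\<phi> x)\<^sup>2 - H x * \<phi> x = 0"
    using integral_nonneg_eq_0_iff_AE[of \<nu> "\<lambda>x. lam * (\<phi> x)\<^sup>2 - H x * \<phi> x"] by simp
  then have "AE x in ?M. lam * (\<phi> x)\<^sup>2 - H x * \<phi> x = 0" unfolding AE_\<nu> .
  with \<phi>0 show ?thesis
  proof eventually_elim
    case (elim x)
    then have "\<phi> x = 0" using zero[of "\<phi> x"] lam split[of x] by simp
    then show ?case by (simp add: \<phi>_def)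
  qed
qed

text \<open>Without nonlinearity the Laplacian \<open>f\<close> of the difference is orthogonal to
  the Laplacians of all test functions. Some of these converge to \<open>f\<close>, so
  \<open>f\<close> vanishes almost everywhere, and the Poincare inequality concludes.\<close>

lemma weak_solution_0_unique:
  fixes u s :: "'a::euclidean_space \<Rightarrow> real"
  assumes u: "weak_solution a b 0 u" and s: "weak_solution a b 0 s"
  shows "AE x in lebesgue_on unit_ball. u x = s x"
proof -
  let ?M = "lebesgue_on (unit_ball :: 'a set)"
  define f where "f x = weak_laplacian u x - weak_laplacian s x" for x
  have \<phi>: "H20 (\<lambda>x. u x - s x) f" unfolding f_def[abs_def] by (rule H20_weak_solution_diff[OF u s])
  obtain \<psi> where \<psi>: "\<And>k. test_function (\<psi> k)" "L2_conv ?M (\<lambda>k. laplacian (\<psi> k)) f"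
    using \<phi> unfolding H20_def by blast
  have "(\<integral>x. laplacian (\<psi> k) x * f x \<partial>?M) = 0" for k
  proof -
    note L = L2_mult[OF test_function_laplacian_L2[OF \<psi>(1)[of k]]]
    have "(\<integral>x. laplacian (\<psi> k) x * f x \<partial>?M)
      = (\<integral>x. laplacian (\<psi> k) x * weak_laplacian u x \<partial>?M) - (\<integral>x. laplacian (\<psi> k) x * weak_laplacian s x \<partial>?M)"
      using L[OF H2D(6)[OF weak_solutionD(1)[OF u]]] L[OF H2D(6)[OF weak_solutionD(1)[OF s]]]
      by (simp add: f_def right_diff_distrib)
    then show ?thesis
      using weak_solutionD(5)[OF u \<psi>(1)[of k]] weak_solutionD(5)[OF s \<psi>(1)[of k]] by (simp add: mult.commute)
  qed
  with L2_conv_inner_const[OF \<psi>(2) H20D(2)[OF \<phi>]] have "(\<lambda>k. 0) \<longlonglongrightarrow> (\<integral>x. f x * f x \<partial>?M)" by simp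
  then have "(\<integral>x. (f x)\<^sup>2 \<partial>?M) = 0" by (simp add: power2_eq_square LIMSEQ_const_iff)
  with H20_poincare[OF \<phi>] have "(\<integral>x. (u x - s x)\<^sup>2 \<partial>?M) \<le> 0" by simp
  moreover have "0 \<le> (\<integral>x. (u x - s x)\<^sup>2 \<partial>?M)" by simp
  ultimately have "(\<integral>x. (u x - s x)\<^sup>2 \<partial>?M) = 0" by linarith
  then have "AE x in ?M. (u x - s x)\<^sup>2 = 0"
    using integral_nonneg_eq_0_iff_AE[OF L2_integrable[OF H20D(1)[OF \<phi>]]] by simp
  then show ?thesis by eventually_elim simp
qed

lemma smooth_up_to_boundary_bounded:
  fixes s :: "'a::euclidean_space \<Rightarrow> real"
  assumes "smooth_up_to_boundary s" "AE x in lebesgue_on unit_ball. u x = s x"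
  shows "essentially_bounded u"
proof -
  obtain g where g: "smooth g" "\<And>x. x \<in> closure unit_ball \<Longrightarrow> s x = g x"
    using assms(1) unfolding smooth_up_to_boundary_def by blast
  obtain C where C: "\<And>x. x \<in> cball 0 1 \<Longrightarrow> \<bar>g x\<bar> \<le> C"
    using continuous_bounded_cball[OF smooth_continuous[OF g(1)], of 1] by (metis mem_cball_0)
  have "AE x in lebesgue_on unit_ball. \<bar>u x\<bar> \<le> C"
    using assms(2) AE_space
  proof eventually_elim
    case (elim x)
    then have "x \<in> cball 0 1" "x \<in> closure unit_ball" using closure_subset[of "unit_ball :: 'a set"] by auto
    then show ?case using elim(1) g(2) C by simp
  qed
  then show ?thesis unfolding essentially_bounded_def by blast
qed

theorem proposition1p7:
  fixes a b lam lamstar :: real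
    and u us :: "'a::euclidean_space \<Rightarrow> real"
  assumes "0 \<le> lam"
    and "extremal_parameter TYPE('a) a b lamstar"
    and "extremal_solution a b lamstar us"
    and "weak_solution a b lam u"
    and "\<not> essentially_bounded u"
    and "stable_solution lam u"
  shows "lam = lamstar \<and> (AE x in lebesgue_on unit_ball. u x = us x)"
proof -
  let ?M = "lebesgue_on (unit_ball :: 'a set)"
  obtain U where U: "\<And>l. 0 \<le> l \<Longrightarrow> l < lamstar \<Longrightarrow> smooth_minimal_solution a b l (U l)"
    and lim: "AE x in ?M. ((\<lambda>l. U l x) \<longlongrightarrow> us x) (at_left lamstar)"
    and us: "weak_solution a b lamstar us"
    using assms(3) unfolding extremal_solution_def by blast
  have pos: "lamstar > 0" and "lam \<le> lamstar"
    using assms(2,4) unfolding extremal_parameter_def by (auto simp: not_less[symmetric])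
  have "\<not> lam < lamstar"
  proof
    assume "lam < lamstar"
    then have m: "smooth_minimal_solution a b lam (U lam)" using U assms(1) by blast
    then have s: "weak_solution a b lam (U lam)" "smooth_up_to_boundary (U lam)"
      and le: "AE x in ?M. U lam x \<le> u x"
      using assms(4) unfolding smooth_minimal_solution_def by blast+
    have "AE x in ?M. u x = U lam x"
    proof (cases "lam = 0")
      case True
      then show ?thesis using weak_solution_0_unique assms(4) s(1) by blast
    next
      case False
      then show ?thesis using stable_solution_unique[OF assms(4,6) _ s(1) le] assms(1) by simp
    qed
    then show False using smooth_up_to_boundary_bounded[OF s(2)] assms(5) by blast
  qed
  with \<open>lam \<le> lamstar\<close> have eq: "lam = lamstar" by simp
  \<comment> \<open>Countably many parameters, so that the exceptional null sets of the comparisons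
    unite to a null set; they lie between \<open>lamstar / 2\<close> and
    \<open>lamstar\<close>.\<close>
  define l where "l k = lamstar - lamstar * inverse (real (Suc (Suc k)))" for k
  have inv: "0 < inverse (real (Suc (Suc k)))" "inverse (real (Suc (Suc k))) \<le> 1" for k
    by (simp_all add: field_simps)
  have l: "0 \<le> l k" "l k < lamstar" for k
    using pos inv[of k] mult_left_le[of "inverse (real (Suc (Suc k)))" lamstar] unfolding l_def by simp_all
  have "(\<lambda>k. lamstar - lamstar * inverse (real (Suc (Suc k)))) \<longlonglongrightarrow> lamstar - lamstar * 0"
    by (intro tendsto_intros LIMSEQ_Suc[OF LIMSEQ_inverse_real_of_nat])
  then have l_lim: "filterlim l (at_left lamstar) sequentially"
    unfolding filterlim_at l_def[abs_def, symmetric] using l by (auto simp: less_imp_neq)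
  have "AE x in ?M. U (l k) x \<le> u x" for k
  proof -
    obtain v where v: "weak_solution a b (l k) v" "AE x in ?M. v x \<le> u x"
      using weak_solution_below[OF assms(4,6) l(1)[of k]] l(2)[of k] unfolding eq by blast
    have "AE x in ?M. U (l k) x \<le> v x"
      using U[OF l] v(1) unfolding smooth_minimal_solution_def by blast
    with v(2) show ?thesis by eventually_elim simp
  qed
  then have "AE x in ?M. \<forall>k. U (l k) x \<le> u x" by (simp add: AE_all_countable)
  with lim have "AE x in ?M. us x \<le> u x"
  proof eventually_elim
    case (elim x)
    from filterlim_compose[OF elim(1) l_lim] show ?case
      by (rule LIMSEQ_le_const2) (use elim(2) in blast)
  qed
  then have "AE x in ?M. u x = us x"
    using stable_solution_unique[OF assms(4,6)] us pos unfolding eq by blast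
  with eq show ?thesis by blast
qed

end
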